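(* Let $\mathcal E$ be an exact Courant algebroid on a manifold $X$, and let $f\colon Y\to X$ be the inclusion of a closed submanifold. The set of generalized tangent bundles for $Y\subset X$ is in bijection with the set of Courant trivializations of $f^!\mathcal E$. These sets are torsors for the space $\mathrm H^0(Y,\Omega^2_{\mathrm{cl}})$ of global closed two-forms on $Y$.
   Context: A manifold is a real $C^\infty$ manifold, a complex manifold, or a smooth algebraic variety over a field of characteristic zero. $\mathcal T$ denotes tangent bundles and $\mathcal N_Y^\vee$ the conormal bundle of $Y$ in $X$. A Courant algebroid on $X$ is a vector bundle $\mathcal E$ with a nondegenerate symmetric pairing $\langle-,-\rangle$, an anchor $a\colon\mathcal E\to\mathcal T_X$, and a bilinear bracket on its sheaf of sections with $[\![x,fy]\!]=f[\![x,y]\!]+(\mathscr L_{ax}f)y$; $[\![x,x]\!]=\tfrac12a^*\mathrm d\langle x,x\rangle$; $\mathscr L_{ax}\langle y,z\rangle=\langle[\![x,y]\!],z\rangle+\langle y,[\![x,z]\!]\rangle$; $[\![x,[\![y,z]\!]]\!]=[\![[\![x,y]\!],z]\!]+[\![y,[\![x,z]\!]]\!]$, where $a^*\colon\Omega^1_X\to\mathcal E$ is the transpose of $a$ with respect to the pairing. Isomorphisms (over the identity of the base) preserve pairing, anchor and bracket. It is exact if $0\to\mathcal T_X^\vee\xrightarrow{a^*}\mathcal E\xrightarrow{a}\mathcal T_X\to0$ is exact. The standard Courant algebroid on $Y$ is $\mathcal T_Y\oplus\mathcal T_Y^\vee$ with canonical pairing, projection anchor and bracket $[\![x+\alpha,y+\beta]\!]=[x,y]+\mathscr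 L_x\beta-\iota_y\mathrm d\alpha$. For $\mathcal E$ exact on $X$, $f^!\mathcal E=a^{-1}(\mathcal T_Y)/\mathcal N_Y^\vee$, where $a^{-1}(\mathcal T_Y)\subset f^*\mathcal E$ and $\mathcal N_Y^\vee\subset f^*\mathcal T_X^\vee$ is embedded via $a^*$; it is an exact Courant algebroid on $Y$. A Courant trivialization of $f^!\mathcal E$ is an isomorphism of Courant algebroids $f^!\mathcal E\cong\mathcal T_Y\oplus\mathcal T_Y^\vee$ with the standard Courant algebroid. The generalized tangent bundle of a Courant trivialization is the Dirac structure with support $\mathcal F\subset f^*\mathcal E$ (Lagrangian subbundle with $a(\mathcal F)\subset\mathcal T_Y$, closed under the bracket of $\mathcal E$) given by the preimage of $\mathcal T_Y$ under $a^{-1}(\mathcal T_Y)\to f^!\mathcal E\cong\mathcal T_Y\oplus\mathcal T_Y^\vee$; it sits in an exact sequence $0\to\mathcal N_Y^\vee\to\mathcal F\to\mathcal T_Y\to0$.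
   Formalization: "Torsor" here means a free and transitive action on a possibly empty set: Courant trivializations need not exist (e.g. Y = X = S^3 with Courant algebroid twisted by a volume form), so non-emptiness is not claimed. *)

theory Defs
  imports
    "HOL-Analysis.Analysis"
    "HOL-Algebra.Ideal"
    "HOL-Combinatorics.Permutations"
    "HOL-Library.Function_Algebras"
    "HOL-Library.Poly_Mapping"
begin

section \<open>Sheaves\<close>

text \<open>
  A sheaf of abelian groups: \<open>sec F U\<close> is the set of sections over an open set \<open>U\<close> and
  \<open>res F U V\<close> is the restriction from \<open>U\<close> to \<open>V\<close>.  The section groups are subgroups of one
  ambient abelian group, whose addition they inherit.  This is no restriction: any family of groups
  embeds into its direct sum.  Values of \<open>sec\<close> at non-open sets, and of \<open>res\<close> outside its natural
  domain, are irrelevant.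
\<close>

record ('x, 'a) sheaf =
  sec :: "'x set \<Rightarrow> 'a set"
  res :: "'x set \<Rightarrow> 'x set \<Rightarrow> 'a \<Rightarrow> 'a"

definition sheaf_on :: "'x topology \<Rightarrow> ('x, 'a::ab_group_add, 'z) sheaf_scheme \<Rightarrow> bool" where
  "sheaf_on T F \<longleftrightarrow>
     (\<forall>U. openin T U \<longrightarrow>
        0 \<in> sec F U \<and> (\<forall>s\<in>sec F U. \<forall>t\<in>sec F U. s + t \<in> sec F U \<and> - s \<in> sec F U) \<and>
        (\<forall>s\<in>sec F U. res F U U s = s)) \<and>
     (\<forall>U V. openin T U \<and> openin T V \<and> V \<subseteq> U \<longrightarrow>
        (\<forall>s\<in>sec F U. res F U V s \<in> sec F V) \<and>
        (\<forall>s\<in>sec F U. \<forall>t\<in>sec F U. res F U V (s + t) = res F U V s + res F U V t)) \<and>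
     (\<forall>U V W. openin T U \<and> openin T V \<and> openin T W \<and> W \<subseteq> V \<and> V \<subseteq> U \<longrightarrow>
        (\<forall>s\<in>sec F U. res F V W (res F U V s) = res F U W s)) \<and>
     (\<forall>\<U>. (\<forall>U\<in>\<U>. openin T U) \<longrightarrow>
        (\<forall>s\<in>sec F (\<Union>\<U>). \<forall>t\<in>sec F (\<Union>\<U>).
           (\<forall>U\<in>\<U>. res F (\<Union>\<U>) U s = res F (\<Union>\<U>) U t) \<longrightarrow> s = t) \<and>
        (\<forall>c. (\<forall>U\<in>\<U>. c U \<in> sec F U) \<and>
             (\<forall>U\<in>\<U>. \<forall>V\<in>\<U>. res F U (U \<inter> V) (c U) = res F V (U \<inter> V) (c V)) \<longrightarrow>
           (\<exists>s\<in>sec F (\<Union>\<U>). \<forall>U\<in>\<U>. res F (\<Union>\<U>) U s = c U)))"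

text \<open>
  A space with a sheaf of commutative \<open>k\<close>-algebras.  All section rings are subrings of an ambient
  commutative ring without unit (for instance the direct sum of all of them); the unit of the ring
  of sections over \<open>U\<close> is \<open>const X U 1\<close>, where \<open>const X U\<close> is the structure map from \<open>k\<close>.
\<close>

record ('x, 'r, 'k) ringed_space = "('x, 'r) sheaf" +
  topo :: "'x topology"
  const :: "'x set \<Rightarrow> 'k \<Rightarrow> 'r"

abbreviation pts :: "('x, 'r, 'k) ringed_space \<Rightarrow> 'x set" where
  "pts X \<equiv> topspace (topo X)"

abbreviation opn :: "('x, 'r, 'k) ringed_space \<Rightarrow> 'x set \<Rightarrow> bool" where
  "opn X U \<equiv> openin (topo X) U"

definition k_ringed_space :: "('x, 'r::comm_ring, 'k::field_char_0) ringed_space \<Rightarrow> bool" where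
  "k_ringed_space X \<longleftrightarrow>
     sheaf_on (topo X) X \<and>
     (\<forall>U. opn X U \<longrightarrow>
        (\<forall>s\<in>sec X U. \<forall>t\<in>sec X U. s * t \<in> sec X U) \<and>
        (\<forall>a. const X U a \<in> sec X U) \<and>
        (\<forall>a b. const X U (a + b) = const X U a + const X U b \<and>
               const X U (a * b) = const X U a * const X U b) \<and>
        (\<forall>s\<in>sec X U. const X U 1 * s = s)) \<and>
     (\<forall>U V. opn X U \<and> opn X V \<and> V \<subseteq> U \<longrightarrow>
        (\<forall>s\<in>sec X U. \<forall>t\<in>sec X U. res X U V (s * t) = res X U V s * res X U V t) \<and>
        (\<forall>a. res X U V (const X U a) = const X V a))"


section \<open>Manifolds\<close>

subsection \<open>Smooth and complex manifolds\<close>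

text \<open>
  The coordinate space \<open>K\<^sup>n\<close>, as the sequences vanishing from position \<open>n\<close> on; for \<open>K = \<real>\<close> this
  is \<^const>\<open>Euclidean_space\<close>.
\<close>

definition coord_space :: "nat \<Rightarrow> (nat \<Rightarrow> 'a::real_normed_field) topology" where
  "coord_space n = subtopology (product_topology (\<lambda>_. euclidean) UNIV) {x. \<forall>i\<ge>n. x i = 0}"

text \<open>
  A function on an open subset \<open>W\<close> of \<open>K\<^sup>n\<close> is smooth if all its iterated partial derivatives
  (with respect to the variables in \<open>K\<close>) exist and are continuous; \<open>g I\<close> is the iterated derivative
  along the list of indices \<open>I\<close>.  For \<open>K = \<real>\<close> this is smoothness in the usual sense, for
  \<open>K = \<complex>\<close> it is holomorphy.
\<close>

definition smooth_fun :: "nat \<Rightarrow> (nat \<Rightarrow> 'a::real_normed_field) set \<Rightarrow> ((nat \<Rightarrow> 'a) \<Rightarrow> 'a) \<Rightarrow> bool" where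
  "smooth_fun n W f \<longleftrightarrow>
     (\<exists>g :: nat list \<Rightarrow> (nat \<Rightarrow> 'a) \<Rightarrow> 'a.
        (\<forall>x\<in>W. g [] x = f x) \<and>
        (\<forall>I. set I \<subseteq> {..<n} \<longrightarrow>
           continuous_map (subtopology (coord_space n) W) euclidean (g I) \<and>
           (\<forall>i<n. \<forall>x\<in>W. ((\<lambda>t. g I (x(i := t))) has_field_derivative g (i # I) x) (at (x i)))))"

definition field_iso :: "('k::field \<Rightarrow> 'a::field) \<Rightarrow> bool" where
  "field_iso \<phi> \<longleftrightarrow> bij \<phi> \<and> (\<forall>a b. \<phi> (a + b) = \<phi> a + \<phi> b \<and> \<phi> (a * b) = \<phi> a * \<phi> b)"

text \<open>
  Manifolds modelled on \<open>K\<^sup>n\<close> (\<open>K = \<real>\<close> or \<open>K = \<complex>\<close>), in ringed-space form: locally the space with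
  its sheaf of \<open>k\<close>-algebras is isomorphic, via a homeomorphism \<open>h\<close> and ring isomorphisms \<open>\<theta> V\<close>, to
  an open subset of \<open>K\<^sup>n\<close> with its sheaf of smooth functions (functions on \<open>h ` V\<close> are extended by
  zero).  The abstract ground field \<open>k\<close> is identified with \<open>K\<close> through \<open>\<phi>\<close>.  The dimension may
  vary between components.
\<close>

definition chart_manifold ::
    "('k::field_char_0 \<Rightarrow> 'a::real_normed_field) \<Rightarrow> ('x, 'r::comm_ring, 'k) ringed_space \<Rightarrow> bool" where
  "chart_manifold \<phi> X \<longleftrightarrow>
     k_ringed_space X \<and> Hausdorff_space (topo X) \<and> second_countable (topo X) \<and>
     (\<forall>x\<in>pts X. \<exists>U n W h \<theta>.
        opn X U \<and> x \<in> U \<and> openin (coord_space n) W \<and>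
        homeomorphic_map (subtopology (topo X) U) (subtopology (coord_space n) W) h \<and>
        (\<forall>V. opn X V \<and> V \<subseteq> U \<longrightarrow>
           bij_betw (\<theta> V) (sec X V) {f. smooth_fun n (h ` V) f \<and> (\<forall>p. p \<notin> h ` V \<longrightarrow> f p = 0)} \<and>
           (\<forall>s\<in>sec X V. \<forall>t\<in>sec X V. \<forall>p\<in>h ` V.
              \<theta> V (s + t) p = \<theta> V s p + \<theta> V t p \<and> \<theta> V (s * t) p = \<theta> V s p * \<theta> V t p) \<and>
           (\<forall>a. \<forall>p\<in>h ` V. \<theta> V (const X V a) p = \<phi> a) \<and>
           (\<forall>V'. opn X V' \<and> V' \<subseteq> V \<longrightarrow>
              (\<forall>s\<in>sec X V. \<forall>p\<in>h ` V'. \<theta> V' (res X V V' s) p = \<theta> V s p))))"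

subsection \<open>Smooth varieties\<close>

definition section_ring :: "('x, 'r::comm_ring, 'k::field_char_0) ringed_space \<Rightarrow> 'x set \<Rightarrow> 'r ring" where
  "section_ring X U =
     \<lparr>carrier = sec X U, mult = (*), one = const X U 1, zero = 0, add = (+)\<rparr>"

text \<open>The locus where the germ of a section is invertible.\<close>

definition unit_locus ::
    "('x, 'r::comm_ring, 'k::field_char_0) ringed_space \<Rightarrow> 'x set \<Rightarrow> 'r \<Rightarrow> 'x set" where
  "unit_locus X U s =
     {x \<in> U. \<exists>V. opn X V \<and> x \<in> V \<and> V \<subseteq> U \<and> (\<exists>t\<in>sec X V. res X U V s * t = const X V 1)}"

text \<open>
  An open set \<open>U\<close> is affine if it is the spectrum of its ring of sections \<open>A\<close>: the points of \<open>U\<close>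
  correspond to the primes of \<open>A\<close>, the loci \<open>D(s)\<close> form a basis of the topology of \<open>U\<close>, and the
  sections over \<open>D(s)\<close> are the localization of \<open>A\<close> at \<open>s\<close> (that \<open>s\<close> becomes a unit there is
  automatic).  Here \<open>((*) s ^^ n) b\<close> is \<open>s\<close> to the power \<open>n\<close> times \<open>b\<close>.
\<close>

definition affine_open :: "('x, 'r::comm_ring, 'k::field_char_0) ringed_space \<Rightarrow> 'x set \<Rightarrow> bool" where
  "affine_open X U \<longleftrightarrow>
     opn X U \<and>
     bij_betw (\<lambda>x. {s \<in> sec X U. x \<notin> unit_locus X U s}) U {P. primeideal P (section_ring X U)} \<and>
     (\<forall>V x. opn X V \<and> V \<subseteq> U \<and> x \<in> V \<longrightarrow>
        (\<exists>s\<in>sec X U. x \<in> unit_locus X U s \<and> unit_locus X U s \<subseteq> V)) \<and>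
     (\<forall>s\<in>sec X U.
        (\<forall>t\<in>sec X (unit_locus X U s). \<exists>n. \<exists>b\<in>sec X U.
           ((*) (res X U (unit_locus X U s) s) ^^ n) t = res X U (unit_locus X U s) b) \<and>
        (\<forall>b\<in>sec X U. res X U (unit_locus X U s) b = 0 \<longrightarrow> (\<exists>n. ((*) s ^^ n) b = 0)))"

text \<open>Polynomials over \<open>k\<close> in the variables with index less than \<open>n\<close>.\<close>

type_synonym 'k mpoly = "(nat \<Rightarrow>\<^sub>0 nat) \<Rightarrow>\<^sub>0 'k"

definition mpolys :: "nat \<Rightarrow> 'k::field_char_0 mpoly set" where
  "mpolys n = {p. \<forall>m\<in>Poly_Mapping.keys p. Poly_Mapping.keys m \<subseteq> {..<n}}"

definition mpoly_pderiv :: "nat \<Rightarrow> 'k::field_char_0 mpoly \<Rightarrow> 'k mpoly" where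
  "mpoly_pderiv i p =
     (\<Sum>m\<in>Poly_Mapping.keys p.
        Poly_Mapping.single (m - Poly_Mapping.single i 1)
          (of_nat (Poly_Mapping.lookup m i) * Poly_Mapping.lookup p m))"

definition mpoly_eval ::
    "('x, 'r::comm_ring, 'k::field_char_0) ringed_space \<Rightarrow> 'x set \<Rightarrow> nat \<Rightarrow> (nat \<Rightarrow> 'r) \<Rightarrow> 'k mpoly \<Rightarrow> 'r" where
  "mpoly_eval X U n y p =
     (\<Sum>m\<in>Poly_Mapping.keys p.
        const X U (Poly_Mapping.lookup p m) *
        finprod (section_ring X U)
          (\<lambda>i. y i [^]\<^bsub>section_ring X U\<^esub> Poly_Mapping.lookup m i) {..<n})"

text \<open>
  The ring of sections over \<open>U\<close> is a standard smooth \<open>k\<close>-algebra: a quotient of a polynomial ring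
  in \<open>n\<close> variables by \<open>c\<close> relations \<open>f 0, \<dots>, f (c - 1)\<close> such that the minor of the Jacobian matrix in
  the first \<open>c\<close> variables becomes invertible.
\<close>

definition standard_smooth :: "('x, 'r::comm_ring, 'k::field_char_0) ringed_space \<Rightarrow> 'x set \<Rightarrow> bool" where
  "standard_smooth X U \<longleftrightarrow>
     (\<exists>n c (y :: nat \<Rightarrow> 'r) (f :: nat \<Rightarrow> 'k mpoly).
        c \<le> n \<and> (\<forall>i<n. y i \<in> sec X U) \<and> (\<forall>j<c. f j \<in> mpolys n) \<and>
        mpoly_eval X U n y ` mpolys n = sec X U \<and>
        (\<forall>p\<in>mpolys n. mpoly_eval X U n y p = 0 \<longleftrightarrow>
           (\<exists>g. (\<forall>j<c. g j \<in> mpolys n) \<and> p = (\<Sum>j<c. g j * f j))) \<and>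
        mpoly_eval X U n y
          (\<Sum>\<pi> | \<pi> permutes {..<c}. of_int (sign \<pi>) * (\<Prod>j<c. mpoly_pderiv (\<pi> j) (f j)))
          \<in> Units (section_ring X U))"

text \<open>
  Smooth separated schemes of finite type over \<open>k\<close>, not necessarily connected.  Separatedness is
  stated by the usual criterion: for affine opens \<open>U\<close>, \<open>V\<close>, the intersection \<open>U \<inter> V\<close> is affine and
  its ring of sections is generated by the restrictions from \<open>U\<close> and \<open>V\<close>.
\<close>

definition smooth_variety :: "('x, 'r::comm_ring, 'k::field_char_0) ringed_space \<Rightarrow> bool" where
  "smooth_variety X \<longleftrightarrow>
     k_ringed_space X \<and> compact_space (topo X) \<and>
     (\<forall>x\<in>pts X. \<exists>U. affine_open X U \<and> x \<in> U \<and> standard_smooth X U) \<and>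
     (\<forall>U V. affine_open X U \<and> affine_open X V \<longrightarrow>
        affine_open X (U \<inter> V) \<and>
        (\<forall>s\<in>sec X (U \<inter> V). \<exists>(n::nat) a b.
           (\<forall>i<n. a i \<in> sec X U \<and> b i \<in> sec X V) \<and>
           s = (\<Sum>i<n. res X U (U \<inter> V) (a i) * res X V (U \<inter> V) (b i))))"

subsection \<open>Manifolds and closed submanifolds\<close>

definition manifold :: "('x, 'r::comm_ring, 'k::field_char_0) ringed_space \<Rightarrow> bool" where
  "manifold X \<longleftrightarrow>
     (\<exists>\<phi> :: 'k \<Rightarrow> real. field_iso \<phi> \<and> chart_manifold \<phi> X) \<or>
     (\<exists>\<phi> :: 'k \<Rightarrow> complex. field_iso \<phi> \<and> chart_manifold \<phi> X) \<or>
     smooth_variety X"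

text \<open>
  A closed immersion of \<open>k\<close>-ringed spaces, given by the inclusion of the closed set \<open>pts Y\<close> with the
  subspace topology and the comorphism \<open>\<rho> U : O\<^sub>X(U) \<rightarrow> O\<^sub>Y(U \<inter> Y)\<close>, which is surjective as a map
  of sheaves (functions on \<open>Y\<close> extend locally to \<open>X\<close>).
\<close>

definition closed_immersion ::
    "('x, 'r::comm_ring, 'k::field_char_0) ringed_space \<Rightarrow> ('x, 's::comm_ring, 'k) ringed_space \<Rightarrow>
     ('x set \<Rightarrow> 'r \<Rightarrow> 's) \<Rightarrow> bool" where
  "closed_immersion X Y \<rho> \<longleftrightarrow>
     closedin (topo X) (pts Y) \<and> topo Y = subtopology (topo X) (pts Y) \<and>
     (\<forall>U. opn X U \<longrightarrow>
        (\<forall>s\<in>sec X U. \<rho> U s \<in> sec Y (U \<inter> pts Y)) \<and>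
        (\<forall>s\<in>sec X U. \<forall>t\<in>sec X U. \<rho> U (s + t) = \<rho> U s + \<rho> U t \<and> \<rho> U (s * t) = \<rho> U s * \<rho> U t) \<and>
        (\<forall>a. \<rho> U (const X U a) = const Y (U \<inter> pts Y) a)) \<and>
     (\<forall>U V. opn X U \<and> opn X V \<and> V \<subseteq> U \<longrightarrow>
        (\<forall>s\<in>sec X U. \<rho> V (res X U V s) = res Y (U \<inter> pts Y) (V \<inter> pts Y) (\<rho> U s))) \<and>
     (\<forall>V. opn Y V \<longrightarrow> (\<forall>g\<in>sec Y V. \<forall>y\<in>V. \<exists>U. opn X U \<and> y \<in> U \<and> U \<inter> pts Y \<subseteq> V \<and>
        (\<exists>s\<in>sec X U. \<rho> U s = res Y V (U \<inter> pts Y) g)))"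

text \<open>\<open>X\<close> and \<open>Y\<close> are manifolds of the same kind and \<open>Y\<close> is closed and embedded in \<open>X\<close>.\<close>

definition closed_submanifold ::
    "('x, 'r::comm_ring, 'k::field_char_0) ringed_space \<Rightarrow> ('x, 's::comm_ring, 'k) ringed_space \<Rightarrow>
     ('x set \<Rightarrow> 'r \<Rightarrow> 's) \<Rightarrow> bool" where
  "closed_submanifold X Y \<rho> \<longleftrightarrow>
     closed_immersion X Y \<rho> \<and>
     ((\<exists>\<phi> :: 'k \<Rightarrow> real. field_iso \<phi> \<and> chart_manifold \<phi> X \<and> chart_manifold \<phi> Y) \<or>
      (\<exists>\<phi> :: 'k \<Rightarrow> complex. field_iso \<phi> \<and> chart_manifold \<phi> X \<and> chart_manifold \<phi> Y) \<or>
      (smooth_variety X \<and> smooth_variety Y))"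


section \<open>Vector bundles, vector fields and forms\<close>

text \<open>
  Sheaves of modules over the structure sheaf.  Scalar multiplication depends on the open set because
  sections of the tangent sheaf are families indexed by smaller open sets, see below.
\<close>

record ('x, 'r, 'm) msheaf = "('x, 'm) sheaf" +
  smul :: "'x set \<Rightarrow> 'r \<Rightarrow> 'm \<Rightarrow> 'm"

definition module_sheaf ::
    "('x, 'r::comm_ring, 'k::field_char_0) ringed_space \<Rightarrow>
     ('x, 'r, 'm::ab_group_add, 'z) msheaf_scheme \<Rightarrow> bool" where
  "module_sheaf X M \<longleftrightarrow>
     sheaf_on (topo X) M \<and>
     (\<forall>U. opn X U \<longrightarrow>
        (\<forall>a\<in>sec X U. \<forall>b\<in>sec X U. \<forall>s\<in>sec M U. \<forall>t\<in>sec M U.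
           smul M U a s \<in> sec M U \<and>
           smul M U a (s + t) = smul M U a s + smul M U a t \<and>
           smul M U (a + b) s = smul M U a s + smul M U b s \<and>
           smul M U (a * b) s = smul M U a (smul M U b s) \<and>
           smul M U (const X U 1) s = s)) \<and>
     (\<forall>U V. opn X U \<and> opn X V \<and> V \<subseteq> U \<longrightarrow>
        (\<forall>a\<in>sec X U. \<forall>s\<in>sec M U. res M U V (smul M U a s) = smul M V (res X U V a) (res M U V s)))"

text \<open>Vector bundles are locally free sheaves of finite rank.\<close>

definition vector_bundle ::
    "('x, 'r::comm_ring, 'k::field_char_0) ringed_space \<Rightarrow>
     ('x, 'r, 'm::ab_group_add, 'z) msheaf_scheme \<Rightarrow> bool" where
  "vector_bundle X M \<longleftrightarrow>
     module_sheaf X M \<and>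
     (\<forall>x\<in>pts X. \<exists>U (n::nat) b. opn X U \<and> x \<in> U \<and> (\<forall>i<n. b i \<in> sec M U) \<and>
        (\<forall>V. opn X V \<and> V \<subseteq> U \<longrightarrow>
           (\<forall>s\<in>sec M V. \<exists>!c. (\<forall>i<n. c i \<in> sec X V) \<and> (\<forall>i\<ge>n. c i = 0) \<and>
              s = (\<Sum>i<n. smul M V (c i) (res M U V (b i))))))"

text \<open>
  Homomorphisms of module sheaves over an open set \<open>U\<close>.  To make such families of maps unique as
  set-theoretic functions, \<open>null_outside\<close> normalizes their irrelevant values to zero.
\<close>

definition hom_on ::
    "('x, 'r::comm_ring, 'k::field_char_0) ringed_space \<Rightarrow> 'x set \<Rightarrow>
     ('x, 'r, 'm::ab_group_add, 'z) msheaf_scheme \<Rightarrow> ('x, 'r, 'n::ab_group_add, 'w) msheaf_scheme \<Rightarrow>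
     ('x set \<Rightarrow> 'm \<Rightarrow> 'n) \<Rightarrow> bool" where
  "hom_on X U M N \<phi> \<longleftrightarrow>
     (\<forall>V. opn X V \<and> V \<subseteq> U \<longrightarrow>
        (\<forall>s\<in>sec M V. \<phi> V s \<in> sec N V) \<and>
        (\<forall>s\<in>sec M V. \<forall>t\<in>sec M V. \<phi> V (s + t) = \<phi> V s + \<phi> V t) \<and>
        (\<forall>a\<in>sec X V. \<forall>s\<in>sec M V. \<phi> V (smul M V a s) = smul N V a (\<phi> V s)) \<and>
        (\<forall>W. opn X W \<and> W \<subseteq> V \<longrightarrow> (\<forall>s\<in>sec M V. \<phi> W (res M V W s) = res N V W (\<phi> V s))))"

definition null_outside ::
    "('x, 'r, 'k) ringed_space \<Rightarrow> 'x set \<Rightarrow> ('x, 'a, 'z) sheaf_scheme \<Rightarrow>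
     ('x set \<Rightarrow> 'a \<Rightarrow> 'b::zero) \<Rightarrow> bool" where
  "null_outside X U M \<phi> \<longleftrightarrow> (\<forall>V s. \<not> (opn X V \<and> V \<subseteq> U \<and> s \<in> sec M V) \<longrightarrow> \<phi> V s = 0)"

definition locally_onto ::
    "'x topology \<Rightarrow> ('x set \<Rightarrow> 'a set) \<Rightarrow> ('x, 'b, 'z) sheaf_scheme \<Rightarrow> ('x set \<Rightarrow> 'a \<Rightarrow> 'b) \<Rightarrow> bool" where
  "locally_onto T S N \<phi> \<longleftrightarrow>
     (\<forall>U. openin T U \<longrightarrow> (\<forall>t\<in>sec N U. \<forall>x\<in>U. \<exists>V. openin T V \<and> x \<in> V \<and> V \<subseteq> U \<and>
        (\<exists>s\<in>S V. \<phi> V s = res N U V t)))"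

definition structure_module ::
    "('x, 'r::comm_ring, 'k::field_char_0) ringed_space \<Rightarrow> ('x, 'r, 'r) msheaf" where
  "structure_module X = \<lparr>sec = sec X, res = res X, smul = (\<lambda>U. (*))\<rparr>"

text \<open>The dual sheaf: sections over \<open>U\<close> are the homomorphisms over \<open>U\<close> to the structure sheaf.\<close>

definition dual ::
    "('x, 'r::comm_ring, 'k::field_char_0) ringed_space \<Rightarrow>
     ('x, 'r, 'm::ab_group_add, 'z) msheaf_scheme \<Rightarrow> ('x, 'r, 'x set \<Rightarrow> 'm \<Rightarrow> 'r) msheaf" where
  "dual X M =
     \<lparr>sec = (\<lambda>U. {\<alpha>. hom_on X U M (structure_module X) \<alpha> \<and> null_outside X U M \<alpha>}),
      res = (\<lambda>U V \<alpha> W t. if W \<subseteq> V then \<alpha> W t else 0),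
      smul = (\<lambda>U a \<alpha> W t. res X U W a * \<alpha> W t)\<rparr>"

text \<open>
  The tangent sheaf: sections over \<open>U\<close> are the \<open>k\<close>-linear derivations of the structure sheaf of
  \<open>U\<close>, i.e. families of derivations \<open>D W\<close> of the section rings over the open \<open>W \<subseteq> U\<close> compatible
  with restriction.
\<close>

type_synonym ('x, 'r) vfield = "'x set \<Rightarrow> 'r \<Rightarrow> 'r"
type_synonym ('x, 'r) form1 = "'x set \<Rightarrow> ('x, 'r) vfield \<Rightarrow> 'r"
type_synonym ('x, 'r) form2 = "'x set \<Rightarrow> ('x, 'r) vfield \<Rightarrow> ('x, 'r) vfield \<Rightarrow> 'r"

definition derivation_on ::
    "('x, 'r::comm_ring, 'k::field_char_0) ringed_space \<Rightarrow> 'x set \<Rightarrow> ('x, 'r) vfield \<Rightarrow> bool" where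
  "derivation_on X U D \<longleftrightarrow>
     (\<forall>V. opn X V \<and> V \<subseteq> U \<longrightarrow>
        (\<forall>s\<in>sec X V. D V s \<in> sec X V) \<and>
        (\<forall>s\<in>sec X V. \<forall>t\<in>sec X V.
           D V (s + t) = D V s + D V t \<and> D V (s * t) = D V s * t + s * D V t) \<and>
        (\<forall>a. D V (const X V a) = 0) \<and>
        (\<forall>W. opn X W \<and> W \<subseteq> V \<longrightarrow> (\<forall>s\<in>sec X V. D W (res X V W s) = res X V W (D V s))))"

definition tangent ::
    "('x, 'r::comm_ring, 'k::field_char_0) ringed_space \<Rightarrow> ('x, 'r, ('x, 'r) vfield) msheaf" where
  "tangent X =
     \<lparr>sec = (\<lambda>U. {D. derivation_on X U D \<and> null_outside X U X D}),
      res = (\<lambda>U V D W s. if W \<subseteq> V then D W s else 0),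
      smul = (\<lambda>U a D W s. res X U W a * D W s)\<rparr>"

abbreviation cotangent ::
    "('x, 'r::comm_ring, 'k::field_char_0) ringed_space \<Rightarrow> ('x, 'r, ('x, 'r) form1) msheaf" where
  "cotangent X \<equiv> dual X (tangent X)"

definition lie_bracket :: "('x, 'r::comm_ring) vfield \<Rightarrow> ('x, 'r) vfield \<Rightarrow> ('x, 'r) vfield" where
  "lie_bracket D E = (\<lambda>W s. D W (E W s) - E W (D W s))"

text \<open>The differential of a function on \<open>U\<close>, as a one-form on \<open>U\<close>.\<close>

definition differential ::
    "('x, 'r::comm_ring, 'k::field_char_0) ringed_space \<Rightarrow> 'x set \<Rightarrow> 'r \<Rightarrow> ('x, 'r) form1" where
  "differential X U g =
     (\<lambda>W v. if opn X W \<and> W \<subseteq> U \<and> v \<in> sec (tangent X) W then v W (res X U W g) else 0)"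

text \<open>The Lie derivative of a one-form \<open>\<beta>\<close> along a vector field \<open>x\<close>, both on \<open>U\<close>.\<close>

definition lie_derivative ::
    "('x, 'r::comm_ring, 'k::field_char_0) ringed_space \<Rightarrow> 'x set \<Rightarrow>
     ('x, 'r) vfield \<Rightarrow> ('x, 'r) form1 \<Rightarrow> ('x, 'r) form1" where
  "lie_derivative X U x \<beta> =
     (\<lambda>W z. if opn X W \<and> W \<subseteq> U \<and> z \<in> sec (tangent X) W
             then x W (\<beta> W z) - \<beta> W (lie_bracket (res (tangent X) U W x) z) else 0)"

text \<open>The contraction of the exterior derivative of a one-form \<open>\<alpha>\<close> with \<open>y\<close>, both on \<open>U\<close>.\<close>

definition contract_d ::
    "('x, 'r::comm_ring, 'k::field_char_0) ringed_space \<Rightarrow> 'x set \<Rightarrow>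
     ('x, 'r) vfield \<Rightarrow> ('x, 'r) form1 \<Rightarrow> ('x, 'r) form1" where
  "contract_d X U y \<alpha> =
     (\<lambda>W z. if opn X W \<and> W \<subseteq> U \<and> z \<in> sec (tangent X) W
             then y W (\<alpha> W z) - z W (\<alpha> W (res (tangent X) U W y))
                  - \<alpha> W (lie_bracket (res (tangent X) U W y) z) else 0)"

text \<open>
  Global closed two-forms: alternating bilinear sheaf maps on the tangent sheaf whose exterior
  derivative, given by the Cartan formula, vanishes.
\<close>

definition two_forms :: "('x, 'r::comm_ring, 'k::field_char_0) ringed_space \<Rightarrow> ('x, 'r) form2 set" where
  "two_forms X = {B.
     (\<forall>U. opn X U \<longrightarrow>
        (\<forall>y\<in>sec (tangent X) U.
           B U y y = 0 \<and>
           (\<forall>z\<in>sec (tangent X) U.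
              B U y z \<in> sec X U \<and>
              (\<forall>x\<in>sec (tangent X) U. B U (x + y) z = B U x z + B U y z \<and> B U z (x + y) = B U z x + B U z y) \<and>
              (\<forall>a\<in>sec X U. B U (smul (tangent X) U a y) z = a * B U y z \<and>
                            B U z (smul (tangent X) U a y) = a * B U z y) \<and>
              (\<forall>V. opn X V \<and> V \<subseteq> U \<longrightarrow>
                 B V (res (tangent X) U V y) (res (tangent X) U V z) = res X U V (B U y z))))) \<and>
     (\<forall>U y z. \<not> (opn X U \<and> y \<in> sec (tangent X) U \<and> z \<in> sec (tangent X) U) \<longrightarrow> B U y z = 0)}"

definition closed_two_forms ::
    "('x, 'r::comm_ring, 'k::field_char_0) ringed_space \<Rightarrow> ('x, 'r) form2 set" where
  "closed_two_forms X = {B \<in> two_forms X.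
     \<forall>U. opn X U \<longrightarrow>
       (\<forall>x\<in>sec (tangent X) U. \<forall>y\<in>sec (tangent X) U. \<forall>z\<in>sec (tangent X) U.
          x U (B U y z) - y U (B U x z) + z U (B U x y)
          - B U (lie_bracket x y) z + B U (lie_bracket x z) y - B U (lie_bracket y z) x = 0)}"

text \<open>The contraction of a two-form \<open>B\<close> with a vector field \<open>x\<close> on \<open>U\<close>.\<close>

definition contract ::
    "('x, 'r::comm_ring, 'k::field_char_0) ringed_space \<Rightarrow> ('x, 'r) form2 \<Rightarrow> 'x set \<Rightarrow>
     ('x, 'r) vfield \<Rightarrow> ('x, 'r) form1" where
  "contract X B U x = (\<lambda>W z. if W \<subseteq> U then B W (res (tangent X) U W x) z else 0)"


section \<open>Courant algebroids\<close>

record ('x, 'r, 'e) courant = "('x, 'r, 'e) msheaf" +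
  pairing :: "'x set \<Rightarrow> 'e \<Rightarrow> 'e \<Rightarrow> 'r"
  anchor :: "'x set \<Rightarrow> 'e \<Rightarrow> ('x, 'r) vfield"
  bracket :: "'x set \<Rightarrow> 'e \<Rightarrow> 'e \<Rightarrow> 'e"

text \<open>A sheaf of modules with a pairing, an anchor and a bracket that are maps of sheaves.\<close>

definition courant_data ::
    "('x, 'r::comm_ring, 'k::field_char_0) ringed_space \<Rightarrow> ('x, 'r, 'e::ab_group_add) courant \<Rightarrow> bool" where
  "courant_data X E \<longleftrightarrow>
     module_sheaf X E \<and>
     (\<forall>U. opn X U \<longrightarrow> (\<forall>x\<in>sec E U. \<forall>y\<in>sec E U.
        pairing E U x y \<in> sec X U \<and> anchor E U x \<in> sec (tangent X) U \<and> bracket E U x y \<in> sec E U \<and>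
        (\<forall>V. opn X V \<and> V \<subseteq> U \<longrightarrow>
           pairing E V (res E U V x) (res E U V y) = res X U V (pairing E U x y) \<and>
           anchor E V (res E U V x) = res (tangent X) U V (anchor E U x) \<and>
           bracket E V (res E U V x) (res E U V y) = res E U V (bracket E U x y))))"

text \<open>The transpose of the anchor, from one-forms to sections of \<open>E\<close>.\<close>

definition coanchor ::
    "('x, 'r::comm_ring, 'k::field_char_0) ringed_space \<Rightarrow> ('x, 'r, 'e::ab_group_add) courant \<Rightarrow>
     'x set \<Rightarrow> ('x, 'r) form1 \<Rightarrow> 'e" where
  "coanchor X E U \<omega> =
     (THE e. e \<in> sec E U \<and>
        (\<forall>W. opn X W \<and> W \<subseteq> U \<longrightarrow>
           (\<forall>t\<in>sec E W. pairing E W (res E U W e) t = \<omega> W (anchor E W t))))"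

text \<open>Nondegeneracy: the map to the dual sheaf induced by the pairing is bijective.\<close>

definition nondegenerate ::
    "('x, 'r::comm_ring, 'k::field_char_0) ringed_space \<Rightarrow> ('x, 'r, 'e::ab_group_add) courant \<Rightarrow> bool" where
  "nondegenerate X E \<longleftrightarrow>
     (\<forall>U. opn X U \<longrightarrow> (\<forall>\<alpha>\<in>sec (dual X E) U. \<exists>!e. e \<in> sec E U \<and>
        (\<forall>W. opn X W \<and> W \<subseteq> U \<longrightarrow> (\<forall>t\<in>sec E W. pairing E W (res E U W e) t = \<alpha> W t))))"

definition courant_algebroid ::
    "('x, 'r::comm_ring, 'k::field_char_0) ringed_space \<Rightarrow> ('x, 'r, 'e::ab_group_add) courant \<Rightarrow> bool" where
  "courant_algebroid X E \<longleftrightarrow>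
     vector_bundle X E \<and> courant_data X E \<and> nondegenerate X E \<and>
     hom_on X (pts X) E (tangent X) (anchor E) \<and>
     (\<forall>U. opn X U \<longrightarrow>
        (\<forall>x\<in>sec E U. \<forall>y\<in>sec E U. \<forall>z\<in>sec E U. \<forall>g\<in>sec X U. \<forall>a.
           pairing E U x y = pairing E U y x \<and>
           pairing E U (x + y) z = pairing E U x z + pairing E U y z \<and>
           pairing E U (smul E U g x) y = g * pairing E U x y \<and>
           bracket E U (x + y) z = bracket E U x z + bracket E U y z \<and>
           bracket E U x (y + z) = bracket E U x y + bracket E U x z \<and>
           bracket E U (smul E U (const X U a) x) y = smul E U (const X U a) (bracket E U x y) \<and>
           bracket E U x (smul E U (const X U a) y) = smul E U (const X U a) (bracket E U x y) \<and>
           bracket E U x (smul E U g y) = smul E U g (bracket E U x y) + smul E U (anchor E U x U g) y \<and>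
           bracket E U x x =
             smul E U (const X U (1 / 2)) (coanchor X E U (differential X U (pairing E U x x))) \<and>
           anchor E U x U (pairing E U y z) =
             pairing E U (bracket E U x y) z + pairing E U y (bracket E U x z) \<and>
           bracket E U x (bracket E U y z) =
             bracket E U (bracket E U x y) z + bracket E U y (bracket E U x z)))"

definition exact_courant ::
    "('x, 'r::comm_ring, 'k::field_char_0) ringed_space \<Rightarrow> ('x, 'r, 'e::ab_group_add) courant \<Rightarrow> bool" where
  "exact_courant X E \<longleftrightarrow>
     courant_algebroid X E \<and>
     (\<forall>U. opn X U \<longrightarrow>
        inj_on (coanchor X E U) (sec (cotangent X) U) \<and>
        coanchor X E U ` sec (cotangent X) U = {e \<in> sec E U. anchor E U e = 0}) \<and>
     locally_onto (topo X) (sec E) (tangent X) (anchor E)"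

definition courant_iso ::
    "('x, 'r::comm_ring, 'k::field_char_0) ringed_space \<Rightarrow> ('x, 'r, 'e::ab_group_add) courant \<Rightarrow>
     ('x, 'r, 'f::ab_group_add) courant \<Rightarrow> ('x set \<Rightarrow> 'e \<Rightarrow> 'f) \<Rightarrow> bool" where
  "courant_iso X E F \<Phi> \<longleftrightarrow>
     hom_on X (pts X) E F \<Phi> \<and> null_outside X (pts X) E \<Phi> \<and>
     (\<forall>U. opn X U \<longrightarrow> bij_betw (\<Phi> U) (sec E U) (sec F U) \<and>
        (\<forall>x\<in>sec E U. \<forall>y\<in>sec E U.
           pairing F U (\<Phi> U x) (\<Phi> U y) = pairing E U x y \<and>
           anchor F U (\<Phi> U x) = anchor E U x \<and>
           bracket F U (\<Phi> U x) (\<Phi> U y) = \<Phi> U (bracket E U x y)))"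

definition standard_courant ::
    "('x, 'r::comm_ring, 'k::field_char_0) ringed_space \<Rightarrow>
     ('x, 'r, ('x, 'r) vfield \<times> ('x, 'r) form1) courant" where
  "standard_courant Y =
     \<lparr>sec = (\<lambda>U. sec (tangent Y) U \<times> sec (cotangent Y) U),
      res = (\<lambda>U V (x, \<alpha>). (res (tangent Y) U V x, res (cotangent Y) U V \<alpha>)),
      smul = (\<lambda>U a (x, \<alpha>). (smul (tangent Y) U a x, smul (cotangent Y) U a \<alpha>)),
      pairing = (\<lambda>U (x, \<alpha>) (y, \<beta>). \<alpha> U y + \<beta> U x),
      anchor = (\<lambda>U (x, \<alpha>). x),
      bracket = (\<lambda>U (x, \<alpha>) (y, \<beta>).
        (lie_bracket x y, lie_derivative Y U x \<beta> - contract_d Y U y \<alpha>))\<rparr>"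


section \<open>Restriction to a closed submanifold\<close>

text \<open>
  The pullback \<open>f\<^sup>*M\<close> of a module sheaf along a closed immersion is \<open>f\<^sup>-\<^sup>1(M / I M)\<close>, where \<open>I\<close> is
  the ideal sheaf of \<open>Y\<close>.  The predicate says that \<open>P\<close>, together with the maps
  \<open>p U : M(U) \<rightarrow> P(U \<inter> Y)\<close>, is such a pullback; this determines \<open>(P, p)\<close> up to unique isomorphism.
\<close>

definition vanishing_submodule ::
    "('x, 'r::comm_ring, 'k::field_char_0) ringed_space \<Rightarrow> ('x set \<Rightarrow> 'r \<Rightarrow> 's::comm_ring) \<Rightarrow>
     ('x, 'r, 'm::ab_group_add, 'z) msheaf_scheme \<Rightarrow> 'x set \<Rightarrow> 'm set" where
  "vanishing_submodule X \<rho> M U =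
     {s. \<exists>(n::nat) a b. (\<forall>i<n. a i \<in> sec X U \<and> \<rho> U (a i) = 0 \<and> b i \<in> sec M U) \<and>
        s = (\<Sum>i<n. smul M U (a i) (b i))}"

definition is_pullback ::
    "('x, 'r::comm_ring, 'k::field_char_0) ringed_space \<Rightarrow> ('x, 's::comm_ring, 'k) ringed_space \<Rightarrow>
     ('x set \<Rightarrow> 'r \<Rightarrow> 's) \<Rightarrow> ('x, 'r, 'm::ab_group_add, 'z) msheaf_scheme \<Rightarrow>
     ('x, 's, 'p::ab_group_add) msheaf \<Rightarrow> ('x set \<Rightarrow> 'm \<Rightarrow> 'p) \<Rightarrow> bool" where
  "is_pullback X Y \<rho> M P p \<longleftrightarrow>
     module_sheaf Y P \<and>
     (\<forall>U. opn X U \<longrightarrow>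
        (\<forall>s\<in>sec M U. p U s \<in> sec P (U \<inter> pts Y)) \<and>
        (\<forall>s\<in>sec M U. \<forall>t\<in>sec M U. p U (s + t) = p U s + p U t) \<and>
        (\<forall>a\<in>sec X U. \<forall>s\<in>sec M U. p U (smul M U a s) = smul P (U \<inter> pts Y) (\<rho> U a) (p U s)) \<and>
        (\<forall>V. opn X V \<and> V \<subseteq> U \<longrightarrow>
           (\<forall>s\<in>sec M U. p V (res M U V s) = res P (U \<inter> pts Y) (V \<inter> pts Y) (p U s))) \<and>
        (\<forall>s\<in>sec M U. p U s = 0 \<longleftrightarrow>
           (\<forall>y\<in>U \<inter> pts Y. \<exists>V. opn X V \<and> y \<in> V \<and> V \<subseteq> U \<and>
              res M U V s \<in> vanishing_submodule X \<rho> M V))) \<and>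
     (\<forall>V. opn Y V \<longrightarrow> (\<forall>\<sigma>\<in>sec P V. \<forall>y\<in>V. \<exists>U. opn X U \<and> y \<in> U \<and> U \<inter> pts Y \<subseteq> V \<and>
        (\<exists>s\<in>sec M U. p U s = res P V (U \<inter> pts Y) \<sigma>)))"

text \<open>
  A vector field \<open>v\<close> on the open subset \<open>U\<close> of \<open>X\<close> restricts along \<open>Y\<close> to the vector field \<open>D\<close> on
  \<open>U \<inter> Y\<close>: its restriction, as a derivation from functions on \<open>X\<close> to functions on \<open>Y\<close>, is the image
  of \<open>D\<close> under the inclusion of \<open>T\<^sub>Y\<close> into \<open>f\<^sup>*T\<^sub>X\<close>.
\<close>

definition vfield_restricts ::
    "('x, 'r::comm_ring, 'k::field_char_0) ringed_space \<Rightarrow> ('x, 's::comm_ring, 'k) ringed_space \<Rightarrow>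
     ('x set \<Rightarrow> 'r \<Rightarrow> 's) \<Rightarrow> 'x set \<Rightarrow> ('x, 'r) vfield \<Rightarrow> ('x, 's) vfield \<Rightarrow> bool" where
  "vfield_restricts X Y \<rho> U v D \<longleftrightarrow>
     (\<forall>W. opn X W \<and> W \<subseteq> U \<longrightarrow> (\<forall>g\<in>sec X W. \<rho> W (v W g) = D (W \<inter> pts Y) (\<rho> W g)))"

text \<open>The one-form \<open>\<omega>\<close> on \<open>U\<close> pulls back to the one-form \<open>\<eta>\<close> on \<open>U \<inter> Y\<close>.\<close>

definition form_restricts ::
    "('x, 'r::comm_ring, 'k::field_char_0) ringed_space \<Rightarrow> ('x, 's::comm_ring, 'k) ringed_space \<Rightarrow>
     ('x set \<Rightarrow> 'r \<Rightarrow> 's) \<Rightarrow> 'x set \<Rightarrow> ('x, 'r) form1 \<Rightarrow> ('x, 's) form1 \<Rightarrow> bool" where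
  "form_restricts X Y \<rho> U \<omega> \<eta> \<longleftrightarrow>
     (\<forall>W v D. opn X W \<and> W \<subseteq> U \<and> v \<in> sec (tangent X) W \<and> D \<in> sec (tangent Y) (W \<inter> pts Y) \<and>
        vfield_restricts X Y \<rho> W v D \<longrightarrow> \<rho> W (\<omega> W v) = \<eta> (W \<inter> pts Y) D)"

text \<open>
  From here on \<open>(P, p)\<close> is a pullback of \<open>E\<close> to \<open>Y\<close>.  The first two definitions are the pairing and
  anchor that \<open>P\<close> inherits from \<open>E\<close>; \<open>anchored V \<sigma> D\<close> says that the anchor of the section \<open>\<sigma>\<close> of
  \<open>f\<^sup>*E\<close>, a section of \<open>f\<^sup>*T\<^sub>X\<close>, is the vector field \<open>D\<close> on \<open>V \<subseteq> Y\<close>.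
\<close>

definition pull_pairing ::
    "('x, 'r::comm_ring, 'k::field_char_0) ringed_space \<Rightarrow> ('x, 's::comm_ring, 'k) ringed_space \<Rightarrow>
     ('x set \<Rightarrow> 'r \<Rightarrow> 's) \<Rightarrow> ('x, 'r, 'e::ab_group_add) courant \<Rightarrow>
     ('x, 's, 'p::ab_group_add) msheaf \<Rightarrow> ('x set \<Rightarrow> 'e \<Rightarrow> 'p) \<Rightarrow> 'x set \<Rightarrow> 'p \<Rightarrow> 'p \<Rightarrow> 's" where
  "pull_pairing X Y \<rho> E P p V \<sigma> \<tau> =
     (THE g. g \<in> sec Y V \<and>
        (\<forall>U. opn X U \<and> U \<inter> pts Y \<subseteq> V \<longrightarrow>
           (\<forall>e\<in>sec E U. \<forall>e'\<in>sec E U.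
              p U e = res P V (U \<inter> pts Y) \<sigma> \<and> p U e' = res P V (U \<inter> pts Y) \<tau> \<longrightarrow>
              \<rho> U (pairing E U e e') = res Y V (U \<inter> pts Y) g)))"

definition anchored ::
    "('x, 'r::comm_ring, 'k::field_char_0) ringed_space \<Rightarrow> ('x, 's::comm_ring, 'k) ringed_space \<Rightarrow>
     ('x set \<Rightarrow> 'r \<Rightarrow> 's) \<Rightarrow> ('x, 'r, 'e::ab_group_add) courant \<Rightarrow>
     ('x, 's, 'p::ab_group_add) msheaf \<Rightarrow> ('x set \<Rightarrow> 'e \<Rightarrow> 'p) \<Rightarrow>
     'x set \<Rightarrow> 'p \<Rightarrow> ('x, 's) vfield \<Rightarrow> bool" where
  "anchored X Y \<rho> E P p V \<sigma> D \<longleftrightarrow>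
     D \<in> sec (tangent Y) V \<and>
     (\<forall>U. opn X U \<and> U \<inter> pts Y \<subseteq> V \<longrightarrow>
        (\<forall>e\<in>sec E U. p U e = res P V (U \<inter> pts Y) \<sigma> \<longrightarrow>
           vfield_restricts X Y \<rho> U (anchor E U e) (res (tangent Y) V (U \<inter> pts Y) D)))"

definition pull_anchor ::
    "('x, 'r::comm_ring, 'k::field_char_0) ringed_space \<Rightarrow> ('x, 's::comm_ring, 'k) ringed_space \<Rightarrow>
     ('x set \<Rightarrow> 'r \<Rightarrow> 's) \<Rightarrow> ('x, 'r, 'e::ab_group_add) courant \<Rightarrow>
     ('x, 's, 'p::ab_group_add) msheaf \<Rightarrow> ('x set \<Rightarrow> 'e \<Rightarrow> 'p) \<Rightarrow>
     'x set \<Rightarrow> 'p \<Rightarrow> ('x, 's) vfield" where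
  "pull_anchor X Y \<rho> E P p V \<sigma> = (THE D. anchored X Y \<rho> E P p V \<sigma> D)"

text \<open>The subsheaf \<open>a\<^sup>-\<^sup>1(T\<^sub>Y)\<close> of \<open>f\<^sup>*E\<close>.\<close>

definition anchor_preimage ::
    "('x, 'r::comm_ring, 'k::field_char_0) ringed_space \<Rightarrow> ('x, 's::comm_ring, 'k) ringed_space \<Rightarrow>
     ('x set \<Rightarrow> 'r \<Rightarrow> 's) \<Rightarrow> ('x, 'r, 'e::ab_group_add) courant \<Rightarrow>
     ('x, 's, 'p::ab_group_add) msheaf \<Rightarrow> ('x set \<Rightarrow> 'e \<Rightarrow> 'p) \<Rightarrow> 'x set \<Rightarrow> 'p set" where
  "anchor_preimage X Y \<rho> E P p V = {\<sigma> \<in> sec P V. \<exists>D. anchored X Y \<rho> E P p V \<sigma> D}"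

text \<open>
  The conormal bundle, embedded into \<open>f\<^sup>*E\<close> by the transpose of the anchor: its sections are locally
  the restrictions to \<open>Y\<close> of \<open>a\<^sup>*\<omega>\<close>, where \<open>\<omega>\<close> is a one-form on \<open>X\<close> that annihilates \<open>T\<^sub>Y\<close>.
\<close>

definition conormal ::
    "('x, 'r::comm_ring, 'k::field_char_0) ringed_space \<Rightarrow> ('x, 's::comm_ring, 'k) ringed_space \<Rightarrow>
     ('x set \<Rightarrow> 'r \<Rightarrow> 's) \<Rightarrow> ('x, 'r, 'e::ab_group_add) courant \<Rightarrow>
     ('x, 's, 'p::ab_group_add) msheaf \<Rightarrow> ('x set \<Rightarrow> 'e \<Rightarrow> 'p) \<Rightarrow> 'x set \<Rightarrow> 'p set" where
  "conormal X Y \<rho> E P p V = {\<sigma> \<in> sec P V.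
     \<forall>y\<in>V. \<exists>U. opn X U \<and> y \<in> U \<and> U \<inter> pts Y \<subseteq> V \<and>
       (\<exists>\<omega>\<in>sec (cotangent X) U. form_restricts X Y \<rho> U \<omega> 0 \<and>
          res P V (U \<inter> pts Y) \<sigma> = p U (coanchor X E U \<omega>))}"

text \<open>
  \<open>Q\<close>, with the projection \<open>q V : a\<^sup>-\<^sup>1(T\<^sub>Y)(V) \<rightarrow> Q(V)\<close>, is the quotient sheaf \<open>f\<^sup>!E\<close> of
  \<open>a\<^sup>-\<^sup>1(T\<^sub>Y)\<close> by the conormal bundle, with the pairing, anchor and bracket induced from \<open>E\<close>.  Brackets
  are computed by lifting to sections of \<open>E\<close>.  As \<open>q\<close> is locally onto and all operations are maps of
  sheaves, they are determined by these conditions.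
\<close>

definition is_courant_pullback ::
    "('x, 'r::comm_ring, 'k::field_char_0) ringed_space \<Rightarrow> ('x, 's::comm_ring, 'k) ringed_space \<Rightarrow>
     ('x set \<Rightarrow> 'r \<Rightarrow> 's) \<Rightarrow> ('x, 'r, 'e::ab_group_add) courant \<Rightarrow>
     ('x, 's, 'p::ab_group_add) msheaf \<Rightarrow> ('x set \<Rightarrow> 'e \<Rightarrow> 'p) \<Rightarrow>
     ('x, 's, 'q::ab_group_add) courant \<Rightarrow> ('x set \<Rightarrow> 'p \<Rightarrow> 'q) \<Rightarrow> bool" where
  "is_courant_pullback X Y \<rho> E P p Q q \<longleftrightarrow>
     courant_data Y Q \<and>
     hom_on Y (pts Y) (P\<lparr>sec := anchor_preimage X Y \<rho> E P p\<rparr>) Q q \<and>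
     locally_onto (topo Y) (anchor_preimage X Y \<rho> E P p) Q q \<and>
     (\<forall>V. opn Y V \<longrightarrow>
        {\<sigma> \<in> anchor_preimage X Y \<rho> E P p V. q V \<sigma> = 0} = conormal X Y \<rho> E P p V \<and>
        (\<forall>\<sigma>\<in>anchor_preimage X Y \<rho> E P p V. \<forall>\<tau>\<in>anchor_preimage X Y \<rho> E P p V.
           pairing Q V (q V \<sigma>) (q V \<tau>) = pull_pairing X Y \<rho> E P p V \<sigma> \<tau> \<and>
           anchor Q V (q V \<sigma>) = pull_anchor X Y \<rho> E P p V \<sigma>)) \<and>
     (\<forall>U. opn X U \<longrightarrow>
        (\<forall>e\<in>sec E U. \<forall>e'\<in>sec E U.
           p U e \<in> anchor_preimage X Y \<rho> E P p (U \<inter> pts Y) \<and>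
           p U e' \<in> anchor_preimage X Y \<rho> E P p (U \<inter> pts Y) \<longrightarrow>
           bracket Q (U \<inter> pts Y) (q (U \<inter> pts Y) (p U e)) (q (U \<inter> pts Y) (p U e')) =
             q (U \<inter> pts Y) (p U (bracket E U e e'))))"

definition courant_trivializations ::
    "('x, 's::comm_ring, 'k::field_char_0) ringed_space \<Rightarrow> ('x, 's, 'q::ab_group_add) courant \<Rightarrow>
     ('x set \<Rightarrow> 'q \<Rightarrow> ('x, 's) vfield \<times> ('x, 's) form1) set" where
  "courant_trivializations Y Q = {\<Phi>. courant_iso Y Q (standard_courant Y) \<Phi>}"


section \<open>Generalized tangent bundles\<close>

text \<open>
  Subbundles: subsheaves of modules that are locally direct summands, i.e. locally the image of an
  idempotent endomorphism.
\<close>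

definition subbundle ::
    "('x, 's::comm_ring, 'k::field_char_0) ringed_space \<Rightarrow> ('x, 's, 'p::ab_group_add) msheaf \<Rightarrow>
     ('x set \<Rightarrow> 'p set) \<Rightarrow> bool" where
  "subbundle Y P F \<longleftrightarrow>
     (\<forall>V. opn Y V \<longrightarrow> F V \<subseteq> sec P V) \<and>
     module_sheaf Y (P\<lparr>sec := F\<rparr>) \<and>
     (\<forall>y\<in>pts Y. \<exists>V \<pi>. opn Y V \<and> y \<in> V \<and> hom_on Y V P P \<pi> \<and>
        (\<forall>W. opn Y W \<and> W \<subseteq> V \<longrightarrow>
           \<pi> W ` sec P W = F W \<and> (\<forall>\<sigma>\<in>sec P W. \<pi> W (\<pi> W \<sigma>) = \<pi> W \<sigma>)))"

text \<open>
  Dirac structures with support on \<open>Y\<close>.  Values at non-open sets are normalized to the empty set.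
\<close>

definition dirac_with_support ::
    "('x, 'r::comm_ring, 'k::field_char_0) ringed_space \<Rightarrow> ('x, 's::comm_ring, 'k) ringed_space \<Rightarrow>
     ('x set \<Rightarrow> 'r \<Rightarrow> 's) \<Rightarrow> ('x, 'r, 'e::ab_group_add) courant \<Rightarrow>
     ('x, 's, 'p::ab_group_add) msheaf \<Rightarrow> ('x set \<Rightarrow> 'e \<Rightarrow> 'p) \<Rightarrow> ('x set \<Rightarrow> 'p set) \<Rightarrow> bool" where
  "dirac_with_support X Y \<rho> E P p F \<longleftrightarrow>
     subbundle Y P F \<and> (\<forall>V. \<not> opn Y V \<longrightarrow> F V = {}) \<and>
     (\<forall>V. opn Y V \<longrightarrow>
        F V = {\<sigma> \<in> sec P V. \<forall>W. opn Y W \<and> W \<subseteq> V \<longrightarrow>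
                 (\<forall>\<tau>\<in>F W. pull_pairing X Y \<rho> E P p W (res P V W \<sigma>) \<tau> = 0)} \<and>
        F V \<subseteq> anchor_preimage X Y \<rho> E P p V) \<and>
     (\<forall>U. opn X U \<longrightarrow>
        (\<forall>e\<in>sec E U. \<forall>e'\<in>sec E U.
           p U e \<in> F (U \<inter> pts Y) \<and> p U e' \<in> F (U \<inter> pts Y) \<longrightarrow>
           p U (bracket E U e e') \<in> F (U \<inter> pts Y)))"

text \<open>
  Generalized tangent bundles are the Dirac structures with support on \<open>Y\<close> that, via the anchor, are
  extensions of \<open>T\<^sub>Y\<close> by the conormal bundle.
\<close>

definition generalized_tangent_bundles ::
    "('x, 'r::comm_ring, 'k::field_char_0) ringed_space \<Rightarrow> ('x, 's::comm_ring, 'k) ringed_space \<Rightarrow>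
     ('x set \<Rightarrow> 'r \<Rightarrow> 's) \<Rightarrow> ('x, 'r, 'e::ab_group_add) courant \<Rightarrow>
     ('x, 's, 'p::ab_group_add) msheaf \<Rightarrow> ('x set \<Rightarrow> 'e \<Rightarrow> 'p) \<Rightarrow> ('x set \<Rightarrow> 'p set) set" where
  "generalized_tangent_bundles X Y \<rho> E P p = {F. dirac_with_support X Y \<rho> E P p F \<and>
     (\<forall>V. opn Y V \<longrightarrow>
        {\<sigma> \<in> F V. pull_anchor X Y \<rho> E P p V \<sigma> = 0} = conormal X Y \<rho> E P p V) \<and>
     locally_onto (topo Y) F (tangent Y) (pull_anchor X Y \<rho> E P p)}"

text \<open>
  The generalized tangent bundle of a trivialization \<open>\<Phi>\<close>: the preimage of \<open>T\<^sub>Y\<close> under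
  \<open>\<Phi> \<circ> q\<close>.
\<close>

definition gtb_of_trivialization ::
    "('x, 'r::comm_ring, 'k::field_char_0) ringed_space \<Rightarrow> ('x, 's::comm_ring, 'k) ringed_space \<Rightarrow>
     ('x set \<Rightarrow> 'r \<Rightarrow> 's) \<Rightarrow> ('x, 'r, 'e::ab_group_add) courant \<Rightarrow>
     ('x, 's, 'p::ab_group_add) msheaf \<Rightarrow> ('x set \<Rightarrow> 'e \<Rightarrow> 'p) \<Rightarrow> ('x set \<Rightarrow> 'p \<Rightarrow> 'q::ab_group_add) \<Rightarrow>
     ('x set \<Rightarrow> 'q \<Rightarrow> ('x, 's) vfield \<times> ('x, 's) form1) \<Rightarrow> 'x set \<Rightarrow> 'p set" where
  "gtb_of_trivialization X Y \<rho> E P p q \<Phi> V =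
     (if opn Y V then {\<sigma> \<in> anchor_preimage X Y \<rho> E P p V. snd (\<Phi> V (q V \<sigma>)) = 0} else {})"


section \<open>The actions of closed two-forms\<close>

text \<open>
  \<open>B\<close> acts on trivializations by composition with the automorphism
  \<open>x + \<alpha> \<mapsto> x + \<alpha> + \<iota>\<^sub>x B\<close> of the standard Courant algebroid.
\<close>

definition gauge_action ::
    "('x, 's::comm_ring, 'k::field_char_0) ringed_space \<Rightarrow> ('x, 's) form2 \<Rightarrow>
     ('x set \<Rightarrow> 'q \<Rightarrow> ('x, 's) vfield \<times> ('x, 's) form1) \<Rightarrow>
     'x set \<Rightarrow> 'q \<Rightarrow> ('x, 's) vfield \<times> ('x, 's) form1" where
  "gauge_action Y B \<Phi> V \<kappa> = (let (x, \<alpha>) = \<Phi> V \<kappa> in (x, \<alpha> + contract Y B V x))"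

text \<open>
  \<open>B\<close> acts on generalized tangent bundles by shearing: \<open>\<tau>\<close> in \<open>F\<close> is replaced by the sections
  \<open>\<tau> - a\<^sup>*\<omega>\<close>, where the one-form \<open>\<omega>\<close> along \<open>Y\<close> pulls back to \<open>\<iota>\<^bsub>a \<tau>\<^esub> B\<close> on \<open>Y\<close>.  Given the sign in
  \<open>gauge_action\<close>, the minus sign is what makes the correspondence with trivializations equivariant: \<open>T\<^sub>Y\<close>
  pulls back under \<open>e\<^sup>B\<close> to the graph of \<open>-B\<close>.
\<close>

definition shear ::
    "('x, 'r::comm_ring, 'k::field_char_0) ringed_space \<Rightarrow> ('x, 's::comm_ring, 'k) ringed_space \<Rightarrow>
     ('x set \<Rightarrow> 'r \<Rightarrow> 's) \<Rightarrow> ('x, 'r, 'e::ab_group_add) courant \<Rightarrow>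
     ('x, 's, 'p::ab_group_add) msheaf \<Rightarrow> ('x set \<Rightarrow> 'e \<Rightarrow> 'p) \<Rightarrow>
     ('x, 's) form2 \<Rightarrow> ('x set \<Rightarrow> 'p set) \<Rightarrow> 'x set \<Rightarrow> 'p set" where
  "shear X Y \<rho> E P p B F V =
     (if opn Y V then {\<sigma> \<in> sec P V.
        \<forall>y\<in>V. \<exists>U. opn X U \<and> y \<in> U \<and> U \<inter> pts Y \<subseteq> V \<and>
          (\<exists>\<tau>\<in>F (U \<inter> pts Y). \<exists>\<omega>\<in>sec (cotangent X) U.
             form_restricts X Y \<rho> U \<omega>
               (contract Y B (U \<inter> pts Y) (pull_anchor X Y \<rho> E P p (U \<inter> pts Y) \<tau>)) \<and>
             res P V (U \<inter> pts Y) \<sigma> = \<tau> - p U (coanchor X E U \<omega>))} else {})"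

text \<open>
  Torsors under an additive group \<open>G\<close>: a free and transitive action.  The empty set counts as a
  torsor, since a given exact Courant algebroid may have no trivialization at all.
\<close>

definition is_torsor :: "'g::ab_group_add set \<Rightarrow> 's set \<Rightarrow> ('g \<Rightarrow> 's \<Rightarrow> 's) \<Rightarrow> bool" where
  "is_torsor G S act \<longleftrightarrow>
     0 \<in> G \<and> (\<forall>g\<in>G. \<forall>h\<in>G. g + h \<in> G \<and> - g \<in> G) \<and>
     (\<forall>g\<in>G. \<forall>s\<in>S. act g s \<in> S) \<and>
     (\<forall>s\<in>S. act 0 s = s) \<and>
     (\<forall>g\<in>G. \<forall>h\<in>G. \<forall>s\<in>S. act (g + h) s = act g (act h s)) \<and>
     (\<forall>s\<in>S. \<forall>t\<in>S. \<exists>!g. g \<in> G \<and> act g s = t)"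

end

theory Submission
  imports Defs "Jordan_Normal_Form.Determinant"
begin

text \<open>
  The only geometric input is that functions \<open>f\<^sub>i\<close> and vector fields \<open>d\<^sub>i\<close> with \<open>v = \<Sum>\<^sub>i v(f\<^sub>i) d\<^sub>i\<close> for all
  \<open>v\<close> exist locally. On a chart this is Hadamard's lemma; on a standard smooth affine open set the \<open>d\<^sub>i\<close>
  come from the inverse of a Jacobian minor and extend to all open subsets by localization.

  A trivialization \<open>\<Phi>\<close> gives the Lagrangian of all \<open>\<sigma>\<close> such that the form part of \<open>\<Phi>(q \<sigma>)\<close> vanishes.
  Conversely, a generalized tangent bundle \<open>F\<close> gives \<open>\<kappa> \<mapsto> (a \<kappa>, D \<mapsto> \<langle>\<kappa>, q \<tau>\<^sub>D\<rangle>)\<close>, where \<open>\<tau>\<^sub>D\<close> is a local lift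
  of \<open>D\<close> to \<open>F\<close>; involutivity of \<open>F\<close> makes this compatible with the brackets. Two trivializations
  differ by an automorphism of the standard Courant algebroid preserving anchor and pairing, that is
  by a two-form, which is closed because the brackets agree.
\<close>

section \<open>Sheaves\<close>

locale ab_sheaf =
  fixes T :: "'x topology" and F :: "('x, 'a::ab_group_add, 'z) sheaf_scheme"
  assumes sheaf: "sheaf_on T F"
begin

lemmas sheaf_group = sheaf[unfolded sheaf_on_def, THEN conjunct1, rule_format]

lemmas sheaf_res = sheaf[unfolded sheaf_on_def, THEN conjunct2, THEN conjunct1, rule_format]
lemmas sheaf_res_res =
  sheaf[unfolded sheaf_on_def, THEN conjunct2, THEN conjunct2, THEN conjunct1, rule_format]
lemmas sheaf_glue =
  sheaf[unfolded sheaf_on_def, THEN conjunct2, THEN conjunct2, THEN conjunct2, rule_format]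

lemma zero_in [simp]: "openin T U \<Longrightarrow> 0 \<in> sec F U" using sheaf_group[of U] by blast

lemma add_in [simp]: "\<lbrakk>openin T U; s \<in> sec F U; t \<in> sec F U\<rbrakk> \<Longrightarrow> s + t \<in> sec F U"
  using sheaf_group[of U] by blast

lemma uminus_in [simp]: "openin T U \<Longrightarrow> s \<in> sec F U \<Longrightarrow> - s \<in> sec F U" using sheaf_group[of U] by blast

lemma diff_in [simp]: "\<lbrakk>openin T U; s \<in> sec F U; t \<in> sec F U\<rbrakk> \<Longrightarrow> s - t \<in> sec F U"
  using add_in[of U s "- t"] by simp

lemma sum_in [simp]: "openin T U \<Longrightarrow> (\<And>i. i \<in> I \<Longrightarrow> s i \<in> sec F U) \<Longrightarrow> sum s I \<in> sec F U"
  by (induction I rule: infinite_finite_induct) auto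

lemma res_id [simp]: "openin T U \<Longrightarrow> s \<in> sec F U \<Longrightarrow> res F U U s = s" using sheaf_group[of U] by blast

lemma res_in [simp]: "\<lbrakk>openin T U; openin T V; V \<subseteq> U; s \<in> sec F U\<rbrakk> \<Longrightarrow> res F U V s \<in> sec F V"
  using sheaf_res[of U V] by blast

lemma res_add: "\<lbrakk>openin T U; openin T V; V \<subseteq> U; s \<in> sec F U; t \<in> sec F U\<rbrakk> \<Longrightarrow>
    res F U V (s + t) = res F U V s + res F U V t" using sheaf_res[of U V] by blast

lemma res_res [simp]: "\<lbrakk>openin T U; openin T V; openin T W; W \<subseteq> V; V \<subseteq> U; s \<in> sec F U\<rbrakk> \<Longrightarrow>
    res F V W (res F U V s) = res F U W s" using sheaf_res_res[of U V W] by blast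

lemma res_zero [simp]:
  assumes "openin T U" "openin T V" "V \<subseteq> U" shows "res F U V 0 = 0"
  using res_add[OF assms, of 0 0] assms by simp

lemma res_uminus:
  assumes "openin T U" "openin T V" "V \<subseteq> U" "s \<in> sec F U" shows "res F U V (- s) = - res F U V s"
  using res_add[OF assms(1-4), of "- s"] assms by (simp add: eq_neg_iff_add_eq_0 add.commute)

lemma res_diff: "\<lbrakk>openin T U; openin T V; V \<subseteq> U; s \<in> sec F U; t \<in> sec F U\<rbrakk> \<Longrightarrow>
    res F U V (s - t) = res F U V s - res F U V t"
  using res_add[of U V s "- t"] by (simp add: res_uminus)

lemma res_sum:
  assumes "openin T U" "openin T V" "V \<subseteq> U" "\<And>i. i \<in> I \<Longrightarrow> s i \<in> sec F U"
  shows "res F U V (sum s I) = (\<Sum>i\<in>I. res F U V (s i))"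
  using assms by (induction I rule: infinite_finite_induct) (auto simp: res_add)

lemma eqI_local:
  assumes U: "openin T U" and s: "s \<in> sec F U" and t: "t \<in> sec F U"
    and loc: "\<And>x. x \<in> U \<Longrightarrow> \<exists>V. openin T V \<and> x \<in> V \<and> V \<subseteq> U \<and> res F U V s = res F U V t"
  shows "s = t"
proof -
  let ?\<U> = "{V. openin T V \<and> V \<subseteq> U \<and> res F U V s = res F U V t}"
  have un: "\<Union>?\<U> = U" using loc by blast
  from sheaf_glue[of ?\<U>] show ?thesis unfolding un using s t by blast
qed

lemma glue_rel:
  assumes U: "openin T U"
    and loc: "\<And>x. x \<in> U \<Longrightarrow> \<exists>V s. openin T V \<and> x \<in> V \<and> V \<subseteq> U \<and> s \<in> sec F V \<and> R V s"
    and compat: "\<And>V s V' s'. \<lbrakk>openin T V; V \<subseteq> U; s \<in> sec F V; R V s;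
      openin T V'; V' \<subseteq> U; s' \<in> sec F V'; R V' s'\<rbrakk> \<Longrightarrow>
      res F V (V \<inter> V') s = res F V' (V \<inter> V') s'"
  shows "\<exists>!s. s \<in> sec F U \<and> (\<forall>V s'. openin T V \<and> V \<subseteq> U \<and> s' \<in> sec F V \<and> R V s' \<longrightarrow> res F U V s = s')"
proof -
  let ?\<U> = "{V. openin T V \<and> V \<subseteq> U \<and> (\<exists>s\<in>sec F V. R V s)}"
  define c where "c V = (SOME s. s \<in> sec F V \<and> R V s)" for V
  have un: "\<Union>?\<U> = U" using loc by blast
  have c: "c V \<in> sec F V \<and> R V (c V)" if V: "V \<in> ?\<U>" for V
  proof -
    obtain s where "s \<in> sec F V \<and> R V s" using V by blast
    then show ?thesis unfolding c_def by (rule someI)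
  qed
  have "\<exists>s\<in>sec F U. \<forall>V\<in>?\<U>. res F U V s = c V"
  proof -
    have "openin T V" if "V \<in> ?\<U>" for V using that by blast
    moreover have "(\<forall>V\<in>?\<U>. c V \<in> sec F V) \<and>
        (\<forall>V\<in>?\<U>. \<forall>V'\<in>?\<U>. res F V (V \<inter> V') (c V) = res F V' (V \<inter> V') (c V'))"
      using c by (auto intro!: compat)
    ultimately have "\<exists>s\<in>sec F (\<Union>?\<U>). \<forall>V\<in>?\<U>. res F (\<Union>?\<U>) V s = c V"
      by (rule sheaf_glue[THEN conjunct2, THEN spec, THEN mp])
    then show ?thesis unfolding un .
  qed
  then obtain s where s: "s \<in> sec F U" "\<And>V. V \<in> ?\<U> \<Longrightarrow> res F U V s = c V" by blast
  have R: "res F U V s = s'" if "openin T V" "V \<subseteq> U" "s' \<in> sec F V" "R V s'" for V s'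
  proof -
    have V: "V \<in> ?\<U>" using that by blast
    have "res F V (V \<inter> V) (c V) = res F V (V \<inter> V) s'" using that c[OF V] by (intro compat) auto
    then show ?thesis using that c[OF V] s(2)[OF V] by simp
  qed
  have uniq: "t = s" if "t \<in> sec F U"
      and t: "\<forall>V s'. openin T V \<and> V \<subseteq> U \<and> s' \<in> sec F V \<and> R V s' \<longrightarrow> res F U V t = s'" for t
  proof (rule eqI_local[OF U that(1) s(1)], goal_cases)
    case (1 x)
    then obtain V s' where "openin T V" "x \<in> V" "V \<subseteq> U" "s' \<in> sec F V" "R V s'" using loc by blast
    then show ?case using R t by auto
  qed
  show ?thesis
  proof (rule ex1I)
    show "s \<in> sec F U \<and>
        (\<forall>V s'. openin T V \<and> V \<subseteq> U \<and> s' \<in> sec F V \<and> R V s' \<longrightarrow> res F U V s = s')" using s(1) R by simp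
  qed (elim conjE, rule uniq)
qed

end

section \<open>Vector fields and forms on a ringed space\<close>

locale krs =
  fixes X :: "('x, 'r::comm_ring, 'k::field_char_0) ringed_space"
  assumes krs: "k_ringed_space X"
begin

abbreviation vfs where "vfs \<equiv> sec (tangent X)"
abbreviation vres where "vres \<equiv> res (tangent X)"
abbreviation vsmul where "vsmul \<equiv> smul (tangent X)"
abbreviation forms where "forms \<equiv> sec (cotangent X)"
abbreviation fres where "fres \<equiv> res (cotangent X)"

sublocale O: ab_sheaf "topo X" X
  by (rule ab_sheaf.intro) (rule krs[unfolded k_ringed_space_def, THEN conjunct1])

lemmas krs_ring = krs[unfolded k_ringed_space_def, THEN conjunct2, THEN conjunct1, rule_format]
lemmas krs_res = krs[unfolded k_ringed_space_def, THEN conjunct2, THEN conjunct2, rule_format]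

lemma mult_in [simp]: "\<lbrakk>opn X U; s \<in> sec X U; t \<in> sec X U\<rbrakk> \<Longrightarrow> s * t \<in> sec X U"
  using krs_ring[of U] by blast

lemma const_in [simp]: "opn X U \<Longrightarrow> const X U a \<in> sec X U" using krs_ring[of U] by blast

lemma const_add: "opn X U \<Longrightarrow> const X U (a + b) = const X U a + const X U b"
  using krs_ring[of U] by blast

lemma const_mult: "opn X U \<Longrightarrow> const X U (a * b) = const X U a * const X U b"
  using krs_ring[of U] by blast

lemma const_1 [simp]: "opn X U \<Longrightarrow> s \<in> sec X U \<Longrightarrow> const X U 1 * s = s" using krs_ring[of U] by blast

lemma res_mult: "\<lbrakk>opn X U; opn X V; V \<subseteq> U; s \<in> sec X U; t \<in> sec X U\<rbrakk> \<Longrightarrow>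
    res X U V (s * t) = res X U V s * res X U V t" using krs_res[of U V] by blast

lemma res_const [simp]:
  "\<lbrakk>opn X U; opn X V; V \<subseteq> U\<rbrakk> \<Longrightarrow> res X U V (const X U a) = const X V a" using krs_res[of U V] by blast

lemma const_0 [simp]: "opn X U \<Longrightarrow> const X U 0 = 0" using const_add[of U 0 0] by simp

lemma const_half: "opn X U \<Longrightarrow> s \<in> sec X U \<Longrightarrow> const X U (1/2) * (s + s) = s"
  using const_add[of U "1/2" "1/2"] const_1[of U s] by (simp add: distrib_right distrib_left)

lemma double_eq_0: "\<lbrakk>opn X U; s \<in> sec X U; s + s = 0\<rbrakk> \<Longrightarrow> s = 0" using const_half[of U s] by simp

lemma openin_Int2 [simp]: "opn X U \<Longrightarrow> opn X V \<Longrightarrow> opn X (U \<inter> V)" by (rule openin_Int)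

subsection \<open>Vector fields\<close>

lemma vf_in [simp]: "\<lbrakk>v \<in> vfs U; opn X W; W \<subseteq> U; s \<in> sec X W\<rbrakk> \<Longrightarrow> v W s \<in> sec X W"
  unfolding tangent_def derivation_on_def by auto

lemma vf_add: "\<lbrakk>v \<in> vfs U; opn X W; W \<subseteq> U; s \<in> sec X W; t \<in> sec X W\<rbrakk> \<Longrightarrow>
    v W (s + t) = v W s + v W t" unfolding tangent_def derivation_on_def by auto

lemma vf_mult: "\<lbrakk>v \<in> vfs U; opn X W; W \<subseteq> U; s \<in> sec X W; t \<in> sec X W\<rbrakk> \<Longrightarrow>
    v W (s * t) = v W s * t + s * v W t" unfolding tangent_def derivation_on_def by auto

lemma vf_const [simp]: "\<lbrakk>v \<in> vfs U; opn X W; W \<subseteq> U\<rbrakk> \<Longrightarrow> v W (const X W a) = 0"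
  unfolding tangent_def derivation_on_def by auto

lemma vf_res: "\<lbrakk>v \<in> vfs U; opn X W; W \<subseteq> U; opn X W'; W' \<subseteq> W; s \<in> sec X W\<rbrakk> \<Longrightarrow>
    v W' (res X W W' s) = res X W W' (v W s)" unfolding tangent_def derivation_on_def by auto

lemma vf_null: "v \<in> vfs U \<Longrightarrow> \<not> (opn X W \<and> W \<subseteq> U \<and> s \<in> sec X W) \<Longrightarrow> v W s = 0"
  unfolding tangent_def null_outside_def by simp

lemma vf_zero [simp]: "v \<in> vfs U \<Longrightarrow> v W 0 = 0" using vf_add[of v U W 0 0] vf_null[of v U W 0] by auto

lemma vf_uminus: "\<lbrakk>v \<in> vfs U; opn X W; W \<subseteq> U; s \<in> sec X W\<rbrakk> \<Longrightarrow> v W (- s) = - v W s"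
  using vf_add[of v U W s "- s"] by (simp add: eq_neg_iff_add_eq_0 add.commute)

lemma vf_diff: "\<lbrakk>v \<in> vfs U; opn X W; W \<subseteq> U; s \<in> sec X W; t \<in> sec X W\<rbrakk> \<Longrightarrow>
    v W (s - t) = v W s - v W t" using vf_add[of v U W s "- t"] by (simp add: vf_uminus)

lemma vf_sum:
  assumes "v \<in> vfs U" "opn X W" "W \<subseteq> U" "\<And>i. i \<in> I \<Longrightarrow> s i \<in> sec X W"
  shows "v W (sum s I) = (\<Sum>i\<in>I. v W (s i))"
  using assms by (induction I rule: infinite_finite_induct) (auto simp: vf_add)

lemma tangentI:
  assumes "\<And>W s. \<lbrakk>opn X W; W \<subseteq> U; s \<in> sec X W\<rbrakk> \<Longrightarrow> v W s \<in> sec X W"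
    and "\<And>W s t. \<lbrakk>opn X W; W \<subseteq> U; s \<in> sec X W; t \<in> sec X W\<rbrakk> \<Longrightarrow> v W (s + t) = v W s + v W t"
    and "\<And>W s t. \<lbrakk>opn X W; W \<subseteq> U; s \<in> sec X W; t \<in> sec X W\<rbrakk> \<Longrightarrow> v W (s * t) = v W s * t + s * v W t"
    and "\<And>W a. opn X W \<Longrightarrow> W \<subseteq> U \<Longrightarrow> v W (const X W a) = 0"
    and "\<And>W W' s. \<lbrakk>opn X W; W \<subseteq> U; opn X W'; W' \<subseteq> W; s \<in> sec X W\<rbrakk> \<Longrightarrow>
      v W' (res X W W' s) = res X W W' (v W s)"
    and "\<And>W s. \<not> (opn X W \<and> W \<subseteq> U \<and> s \<in> sec X W) \<Longrightarrow> v W s = 0"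
  shows "v \<in> vfs U" using assms unfolding tangent_def derivation_on_def null_outside_def by simp

lemma vf_eqI:
  assumes "v \<in> vfs U" "w \<in> vfs U" and "\<And>W s. \<lbrakk>opn X W; W \<subseteq> U; s \<in> sec X W\<rbrakk> \<Longrightarrow> v W s = w W s"
  shows "v = w"
proof (intro ext)
  fix W s show "v W s = w W s"
    using assms(3)[of W s] vf_null[OF assms(1), of W s] vf_null[OF assms(2), of W s]
    by (cases "opn X W \<and> W \<subseteq> U \<and> s \<in> sec X W") auto
qed

lemma res_vf_app: "vres U V v W s = (if W \<subseteq> V then v W s else 0)" unfolding tangent_def by simp

lemma res_vf_app' [simp]: "W \<subseteq> V \<Longrightarrow> vres U V v W s = v W s" by (simp add: res_vf_app)

lemma smul_vf_app [simp]: "vsmul U a v W s = res X U W a * v W s" unfolding tangent_def by simp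

lemma res_vf_in [simp]: "v \<in> vfs U \<Longrightarrow> V \<subseteq> U \<Longrightarrow> vres U V v \<in> vfs V"
  by (rule tangentI) (auto simp: res_vf_app vf_add vf_mult vf_res vf_null)

lemma res_vf_id [simp]: "v \<in> vfs U \<Longrightarrow> vres U U v = v" by (intro ext) (auto simp: res_vf_app vf_null)

lemma res_vf_res [simp]: "W \<subseteq> V \<Longrightarrow> vres V W (vres U V v) = vres U W v"
  by (intro ext) (auto simp: res_vf_app)

lemma zero_vf_in [simp]: "opn X U \<Longrightarrow> 0 \<in> vfs U" by (rule tangentI) auto

lemma add_vf_in [simp]: "v \<in> vfs U \<Longrightarrow> w \<in> vfs U \<Longrightarrow> v + w \<in> vfs U"
  by (rule tangentI) (auto simp: vf_add vf_mult vf_res vf_null O.res_add algebra_simps)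

lemma uminus_vf_in [simp]: "v \<in> vfs U \<Longrightarrow> - v \<in> vfs U"
  by (rule tangentI) (auto simp: vf_add vf_mult vf_res vf_null O.res_uminus algebra_simps)

lemma smul_vf_in [simp]: "\<lbrakk>opn X U; a \<in> sec X U; v \<in> vfs U\<rbrakk> \<Longrightarrow> vsmul U a v \<in> vfs U"
  by (rule tangentI) (auto simp: vf_add vf_mult vf_res vf_null res_mult algebra_simps)

lemma res_vf_add [simp]:
  "vres U V (v + w) = vres U V v + vres U V w" by (intro ext) (auto simp: res_vf_app)

lemma res_vf_zero [simp]: "vres U V 0 = 0" by (intro ext) (auto simp: res_vf_app)

lemma res_vf_smul: "\<lbrakk>opn X U; opn X V; V \<subseteq> U; a \<in> sec X U; v \<in> vfs U\<rbrakk> \<Longrightarrow> vres U V (vsmul U a v) =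
      vsmul V (res X U V a) (vres U V v)" by (rule vf_eqI[of _ V]) auto

lemma lie_bracket_in [simp]:
  assumes v: "v \<in> vfs U" and w: "w \<in> vfs U"
  shows "lie_bracket v w \<in> vfs U" using v w by (intro tangentI)
    (auto simp: lie_bracket_def vf_add[OF v] vf_mult[OF v] vf_res[OF v] vf_add[OF w] vf_mult[OF w]
      vf_res[OF w] vf_null[OF v] vf_null[OF w] O.res_diff algebra_simps)

lemma lie_bracket_app: "lie_bracket v w W s = v W (w W s) - w W (v W s)"
  by (simp add: lie_bracket_def)

lemma res_lie_bracket: "vres U V (lie_bracket v w) = lie_bracket (vres U V v) (vres U V w)"
  if "v \<in> vfs U" "w \<in> vfs U" "V \<subseteq> U"
  using that by (intro ext) (auto simp: res_vf_app lie_bracket_def)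

lemma vf_eqI_local:
  assumes "opn X U" and v: "v \<in> vfs U" and w: "w \<in> vfs U"
    and loc: "\<And>x. x \<in> U \<Longrightarrow> \<exists>V. opn X V \<and> x \<in> V \<and> V \<subseteq> U \<and>  vres U V v = vres U V w"
  shows "v = w"
proof (rule vf_eqI[OF v w], goal_cases)
  case W: (1 W s)
  show ?case
  proof (rule O.eqI_local[OF W(1)], goal_cases)
    case (3 x)
    then obtain V where V: "opn X V" "x \<in> V" "V \<subseteq> U" "vres U V v = vres U V w" using loc W by blast
    have "v (W \<inter> V) (res X W (W \<inter> V) s) = w (W \<inter> V) (res X W (W \<inter> V) s)"
      using fun_cong[OF fun_cong[OF V(4), of "W \<inter> V"], of "res X W (W \<inter> V) s"] by simp
    then have "res X W (W \<inter> V) (v W s) = res X W (W \<inter> V) (w W s)"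
      using W V v w by (simp add: vf_res)
    then show ?case using W V \<open>x \<in> W\<close> by (intro exI[of _ "W \<inter> V"]) auto
  qed (use W v w in auto)
qed

subsection \<open>One-forms\<close>

lemma cot_in [simp]: "\<lbrakk>\<omega> \<in> forms U; opn X W; W \<subseteq> U; v \<in> vfs W\<rbrakk> \<Longrightarrow> \<omega> W v \<in> sec X W"
  unfolding dual_def hom_on_def structure_module_def by auto

lemma cot_add: "\<lbrakk>\<omega> \<in> forms U; opn X W; W \<subseteq> U; v \<in> vfs W; w \<in> vfs W\<rbrakk> \<Longrightarrow> \<omega> W (v + w) = \<omega> W v + \<omega> W w"
  unfolding dual_def hom_on_def structure_module_def by auto

lemma cot_smul: "\<lbrakk>\<omega> \<in> forms U; opn X W; W \<subseteq> U; a \<in> sec X W; v \<in> vfs W\<rbrakk> \<Longrightarrow>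
    \<omega> W (vsmul W a v) = a * \<omega> W v" unfolding dual_def hom_on_def structure_module_def by auto

lemma cot_res: "\<lbrakk>\<omega> \<in> forms U; opn X W; W \<subseteq> U; opn X W'; W' \<subseteq> W;
    v \<in> vfs W\<rbrakk> \<Longrightarrow> \<omega> W' (vres W W' v) = res X W W' (\<omega> W v)"
  unfolding dual_def hom_on_def structure_module_def by auto

lemma cot_null: "\<omega> \<in> forms U \<Longrightarrow> \<not> (opn X W \<and> W \<subseteq> U \<and> v \<in> vfs W) \<Longrightarrow> \<omega> W v = 0"
  unfolding dual_def null_outside_def by simp

lemma cot_zero [simp]: "\<omega> \<in> forms U \<Longrightarrow> \<omega> W 0 = 0"
  using cot_add[of \<omega> U W 0 0] cot_null[of \<omega> U W 0] by auto

lemma cot_sum: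
  assumes "\<omega> \<in> forms U" "opn X W" "W \<subseteq> U" "\<And>i. i \<in> I \<Longrightarrow> v i \<in> vfs W"
  shows "\<omega> W (sum v I) = (\<Sum>i\<in>I. \<omega> W (v i))"
proof -
  have "sum v I \<in> vfs W \<and> \<omega> W (sum v I) = (\<Sum>i\<in>I. \<omega> W (v i))"
    using assms by (induction I rule: infinite_finite_induct) (auto simp: cot_add)
  then show ?thesis by simp
qed

lemma sum_vf_in [simp]:  "opn X W \<Longrightarrow> (\<And>i. i \<in> I \<Longrightarrow> v i \<in> vfs W) \<Longrightarrow> sum v I \<in> vfs W"
  by (induction I rule: infinite_finite_induct) auto

lemma cotangentI:
  assumes "\<And>W v. \<lbrakk>opn X W; W \<subseteq> U; v \<in> vfs W\<rbrakk> \<Longrightarrow> \<omega> W v \<in> sec X W"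
    and "\<And>W v w. \<lbrakk>opn X W; W \<subseteq> U; v \<in> vfs W; w \<in> vfs W\<rbrakk> \<Longrightarrow> \<omega> W (v + w) = \<omega> W v + \<omega> W w"
    and "\<And>W a v. \<lbrakk>opn X W; W \<subseteq> U; a \<in> sec X W; v \<in> vfs W\<rbrakk> \<Longrightarrow> \<omega> W (vsmul W a v) = a * \<omega> W v"
    and "\<And>W W' v. \<lbrakk>opn X W; W \<subseteq> U; opn X W'; W' \<subseteq> W; v \<in> vfs W\<rbrakk> \<Longrightarrow>
      \<omega> W' (vres W W' v) = res X W W' (\<omega> W v)"
    and "\<And>W v. \<not> (opn X W \<and> W \<subseteq> U \<and> v \<in> vfs W) \<Longrightarrow> \<omega> W v = 0"
  shows "\<omega> \<in> forms U"
  using assms unfolding dual_def hom_on_def null_outside_def structure_module_def by simp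

lemma cot_eqI:
  assumes "\<omega> \<in> forms U" "\<omega>' \<in> forms U" and "\<And>W v. \<lbrakk>opn X W; W \<subseteq> U; v \<in> vfs W\<rbrakk> \<Longrightarrow> \<omega> W v = \<omega>' W v"
  shows "\<omega> = \<omega>'"
proof (intro ext)
  fix W s show "\<omega> W s = \<omega>' W s"
    using assms(3)[of W s] cot_null[OF assms(1), of W s] cot_null[OF assms(2), of W s]
    by (cases "opn X W \<and> W \<subseteq> U \<and> s \<in> vfs W") auto
qed

lemma res_cot_app: "fres U V \<omega> W s = (if W \<subseteq> V then \<omega> W s else 0)" unfolding dual_def by simp

lemma res_cot_app' [simp]: "W \<subseteq> V \<Longrightarrow> fres U V \<omega> W s = \<omega> W s" unfolding dual_def by simp

lemma smul_cot_app [simp]: "smul (cotangent X) U a \<omega> W v = res X U W a * \<omega> W v"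
  unfolding dual_def by simp

lemma res_cot_in [simp]: "\<omega> \<in> forms U \<Longrightarrow> V \<subseteq> U \<Longrightarrow> fres U V \<omega> \<in> forms V"
  by (rule cotangentI) (auto simp: res_cot_app cot_add cot_smul cot_res cot_null)

lemma res_cot_zero [simp]: "fres U V 0 = 0" by (intro ext) (auto simp: res_cot_app)

lemma zero_cot_in [simp]: "opn X U \<Longrightarrow> 0 \<in> forms U" by (rule cotangentI) auto

lemma add_cot_in [simp]: "v \<in> forms U \<Longrightarrow> w \<in> forms U \<Longrightarrow> v + w \<in> forms U"
  by (rule cotangentI) (auto simp: cot_add cot_smul cot_res cot_null O.res_add algebra_simps)

lemma uminus_cot_in [simp]: "v \<in> forms U \<Longrightarrow> - v \<in> forms U"
  by (rule cotangentI) (auto simp: cot_add cot_smul cot_res cot_null O.res_uminus algebra_simps)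

lemma diff_cot_in [simp]:
  "v \<in> forms U \<Longrightarrow> w \<in> forms U \<Longrightarrow> v - w \<in> forms U" using add_cot_in[of v U "- w"] by simp

lemma differential_in [simp]: "opn X U \<Longrightarrow> g \<in> sec X U \<Longrightarrow> differential X U g \<in> forms U"
  by (rule cotangentI) (auto simp: differential_def vf_res[symmetric])

lemma differential_app: "\<lbrakk>opn X W; W \<subseteq> U; v \<in> vfs W\<rbrakk> \<Longrightarrow> differential X U g W v = v W (res X U W g)"
  by (simp add: differential_def)

end

section \<open>Exact Courant algebroids\<close>

lemma ex1_unique: "\<lbrakk>\<exists>!x. P x; P a; P b\<rbrakk> \<Longrightarrow> a = b" by blast

locale kmod = krs X for X :: "('x, 'r::comm_ring, 'k::field_char_0) ringed_space" +
  fixes M :: "('x, 'r, 'm::ab_group_add, 'z) msheaf_scheme"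
  assumes module: "module_sheaf X M"
begin

sublocale M: ab_sheaf "topo X" M
  by (rule ab_sheaf.intro) (rule module[unfolded module_sheaf_def, THEN conjunct1])

lemmas module_ring = module[unfolded module_sheaf_def, THEN conjunct2, THEN conjunct1, rule_format]
lemmas module_res = module[unfolded module_sheaf_def, THEN conjunct2, THEN conjunct2, rule_format]

lemma smul_in [simp]: "\<lbrakk>opn X U; a \<in> sec X U; s \<in> sec M U\<rbrakk> \<Longrightarrow> smul M U a s \<in> sec M U"
  using module_ring[of U a a s s] by blast

lemma smul_add_right: "\<lbrakk>opn X U; a \<in> sec X U; s \<in> sec M U; t \<in> sec M U\<rbrakk> \<Longrightarrow>
    smul M U a (s + t) = smul M U a s + smul M U a t" using module_ring[of U a a s t] by blast

lemma smul_add_left: "\<lbrakk>opn X U; a \<in> sec X U; b \<in> sec X U; s \<in> sec M U\<rbrakk> \<Longrightarrow>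
    smul M U (a + b) s = smul M U a s + smul M U b s" using module_ring[of U a b s s] by blast

lemma smul_mult: "\<lbrakk>opn X U; a \<in> sec X U; b \<in> sec X U; s \<in> sec M U\<rbrakk> \<Longrightarrow>
    smul M U (a * b) s = smul M U a (smul M U b s)" using module_ring[of U a b s s] by blast

lemma smul_1 [simp]: "opn X U \<Longrightarrow> s \<in> sec M U \<Longrightarrow> smul M U (const X U 1) s = s"
  using module_ring[of U 0 0 s s] by simp

lemma res_smul: "\<lbrakk>opn X U; opn X V; V \<subseteq> U; a \<in> sec X U; s \<in> sec M U\<rbrakk> \<Longrightarrow>
    res M U V (smul M U a s) = smul M V (res X U V a) (res M U V s)"
  using module_res[of U V a s] by blast

lemma smul_0_left [simp]: "opn X U \<Longrightarrow> s \<in> sec M U \<Longrightarrow> smul M U 0 s = 0"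
  using smul_add_left[of U 0 0 s] by simp

lemma smul_0_right [simp]: "opn X U \<Longrightarrow> a \<in> sec X U \<Longrightarrow> smul M U a 0 = 0"
  using smul_add_right[of U a 0 0] by simp

lemma smul_minus_left: "\<lbrakk>opn X U; a \<in> sec X U; s \<in> sec M U\<rbrakk> \<Longrightarrow> smul M U (- a) s = - smul M U a s"
  using smul_add_left[of U a "- a" s] by (simp add: eq_neg_iff_add_eq_0 add.commute)

lemma smul_diff_left: "\<lbrakk>opn X U; a \<in> sec X U; b \<in> sec X U; s \<in> sec M U\<rbrakk> \<Longrightarrow>
    smul M U (a - b) s = smul M U a s - smul M U b s"
  using smul_add_left[of U a "- b" s] by (simp add: smul_minus_left)

end

locale exact_ca = krs X for X :: "('x, 'r::comm_ring, 'k::field_char_0) ringed_space" +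
  fixes E :: "('x, 'r, 'e::ab_group_add) courant"
  assumes exact: "exact_courant X E"
begin

lemmas courant = exact[unfolded exact_courant_def, THEN conjunct1]
lemmas exact_mid = exact[unfolded exact_courant_def, THEN conjunct2, THEN conjunct1, rule_format]
lemmas exact_onto = exact[unfolded exact_courant_def, THEN conjunct2, THEN conjunct2]
lemmas vbundle = courant[unfolded courant_algebroid_def, THEN conjunct1]
lemmas data = courant[unfolded courant_algebroid_def, THEN conjunct2, THEN conjunct1]
lemmas nondeg =
  courant[unfolded courant_algebroid_def, THEN conjunct2, THEN conjunct2, THEN conjunct1]
lemmas anchor_hom = courant[unfolded courant_algebroid_def, THEN conjunct2, THEN conjunct2,
    THEN conjunct2, THEN conjunct1, unfolded hom_on_def, rule_format]
lemmas ca_axioms = courant[unfolded courant_algebroid_def, THEN conjunct2, THEN conjunct2,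
    THEN conjunct2, THEN conjunct2, rule_format]

sublocale E: kmod X E by (rule kmod.intro, rule krs_axioms, rule kmod_axioms.intro)
    (rule vbundle[unfolded vector_bundle_def, THEN conjunct1])

lemmas frame = vbundle[unfolded vector_bundle_def, THEN conjunct2, rule_format]
lemmas data_at = data[unfolded courant_data_def, THEN conjunct2, rule_format]

lemma pair_in [simp]:
  "\<lbrakk>opn X U; x \<in> sec E U; y \<in> sec E U\<rbrakk> \<Longrightarrow> pairing E U x y \<in> sec X U" using data_at[of U x y] by blast

lemma anch_in [simp]: "opn X U \<Longrightarrow> x \<in> sec E U \<Longrightarrow> anchor E U x \<in> vfs U"
  using data_at[of U x x] by blast

lemma brk_in [simp]:
  "\<lbrakk>opn X U; x \<in> sec E U; y \<in> sec E U\<rbrakk> \<Longrightarrow> bracket E U x y \<in> sec E U" using data_at[of U x y] by blast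

lemmas anch_vf_in [simp] = vf_in[OF anch_in]
lemmas anch_vf_add = vf_add[OF anch_in]
lemmas anch_vf_res = vf_res[OF anch_in]

lemmas lie_anch_in [simp] = vf_in[OF lie_bracket_in[OF anch_in anch_in]]

lemma res_pair: "\<lbrakk>opn X U; opn X V; V \<subseteq> U; x \<in> sec E U; y \<in> sec E U\<rbrakk> \<Longrightarrow>
    pairing E V (res E U V x) (res E U V y) = res X U V (pairing E U x y)"
  using data_at[of U x y] by blast

lemma anch_res: "\<lbrakk>opn X U; opn X V; V \<subseteq> U; x \<in> sec E U\<rbrakk> \<Longrightarrow>
    anchor E V (res E U V x) = vres U V (anchor E U x)" using data_at[of U x x] by blast

lemma brk_res: "\<lbrakk>opn X U; opn X V; V \<subseteq> U; x \<in> sec E U; y \<in> sec E U\<rbrakk> \<Longrightarrow>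
    bracket E V (res E U V x) (res E U V y) = res E U V (bracket E U x y)"
  using data_at[of U x y] by blast

lemma pair_sym: "\<lbrakk>opn X U; x \<in> sec E U; y \<in> sec E U\<rbrakk> \<Longrightarrow> pairing E U x y = pairing E U y x"
  using ca_axioms[of U x y x "const X U 1"] by simp

lemma pair_add_left: "\<lbrakk>opn X U; x \<in> sec E U; y \<in> sec E U; z \<in> sec E U\<rbrakk> \<Longrightarrow>
    pairing E U (x + y) z = pairing E U x z + pairing E U y z"
  using ca_axioms[of U x y z "const X U 1"] by simp

lemma pair_add_right: "\<lbrakk>opn X U; x \<in> sec E U; y \<in> sec E U; z \<in> sec E U\<rbrakk> \<Longrightarrow>
    pairing E U z (x + y) = pairing E U z x + pairing E U z y"
  using pair_add_left[of U x y z] pair_sym[of U z "x + y"] pair_sym[of U z x] pair_sym[of U z y]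
  by simp

lemma pair_smul_left: "\<lbrakk>opn X U; x \<in> sec E U; y \<in> sec E U; g \<in> sec X U\<rbrakk> \<Longrightarrow>
    pairing E U (smul E U g x) y = g * pairing E U x y" using ca_axioms[of U x y x g] by simp

lemma pair_smul_right: "\<lbrakk>opn X U; x \<in> sec E U; y \<in> sec E U; g \<in> sec X U\<rbrakk> \<Longrightarrow>
    pairing E U x (smul E U g y) = g * pairing E U x y"
  using pair_smul_left[of U y x g] pair_sym[of U x "smul E U g y"] pair_sym[of U x y] by simp

lemma pair_0_left [simp]: "opn X U \<Longrightarrow> y \<in> sec E U \<Longrightarrow> pairing E U 0 y = 0"
  using pair_add_left[of U 0 0 y] by simp

lemma pair_sum_left:
  assumes "opn X U" "\<And>i. i \<in> I \<Longrightarrow> s i \<in> sec E U" "y \<in> sec E U"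
  shows "pairing E U (sum s I) y = (\<Sum>i\<in>I. pairing E U (s i) y)"
  using assms by (induction I rule: infinite_finite_induct) (auto simp: pair_add_left)

lemma brk_add_left: "\<lbrakk>opn X U; x \<in> sec E U; y \<in> sec E U; z \<in> sec E U\<rbrakk> \<Longrightarrow>
    bracket E U (x + y) z = bracket E U x z + bracket E U y z"
  using ca_axioms[of U x y z "const X U 1"] by simp

lemma brk_add_right: "\<lbrakk>opn X U; x \<in> sec E U; y \<in> sec E U; z \<in> sec E U\<rbrakk> \<Longrightarrow>
    bracket E U x (y + z) = bracket E U x y + bracket E U x z"
  using ca_axioms[of U x y z "const X U 1"] by simp

lemma brk_smul_right: "\<lbrakk>opn X U; x \<in> sec E U; y \<in> sec E U; g \<in> sec X U\<rbrakk> \<Longrightarrow>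
    bracket E U x (smul E U g y) = smul E U g (bracket E U x y) + smul E U (anchor E U x U g) y"
  using ca_axioms[of U x y x g] by simp

lemma brk_self: "opn X U \<Longrightarrow> x \<in> sec E U \<Longrightarrow> bracket E U x x =
    smul E U (const X U (1 / 2)) (coanchor X E U (differential X U (pairing E U x x)))"
  using ca_axioms[of U x x x "const X U 1"] by simp

lemma anch_pair: "\<lbrakk>opn X U; x \<in> sec E U; y \<in> sec E U; z \<in> sec E U\<rbrakk> \<Longrightarrow>
    anchor E U x U (pairing E U y z) =
      pairing E U (bracket E U x y) z + pairing E U y (bracket E U x z)"
  using ca_axioms[of U x y z "const X U 1"] by simp

lemma jacobi: "\<lbrakk>opn X U; x \<in> sec E U; y \<in> sec E U; z \<in> sec E U\<rbrakk> \<Longrightarrow> bracket E U x (bracket E U y z) =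
      bracket E U (bracket E U x y) z + bracket E U y (bracket E U x z)"
  using ca_axioms[of U x y z "const X U 1"] by simp

lemma anch_add:
  "\<lbrakk>opn X U; x \<in> sec E U; y \<in> sec E U\<rbrakk> \<Longrightarrow> anchor E U (x + y) = anchor E U x + anchor E U y"
  using anchor_hom[of U] openin_subset[of "topo X" U] by blast

lemma anch_smul: "\<lbrakk>opn X U; x \<in> sec E U; g \<in> sec X U\<rbrakk> \<Longrightarrow>
    anchor E U (smul E U g x) = vsmul U g (anchor E U x)"
  using anchor_hom[of U] openin_subset[of "topo X" U] by blast

lemma anch_0 [simp]: "opn X U \<Longrightarrow> anchor E U 0 = 0" using anch_add[of U 0 0] by simp

lemma anch_uminus: "opn X U \<Longrightarrow> x \<in> sec E U \<Longrightarrow> anchor E U (- x) = - anchor E U x"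
  using anch_add[of U x "- x"] by (simp add: eq_neg_iff_add_eq_0 add.commute)

lemma anch_diff:
  "\<lbrakk>opn X U; x \<in> sec E U; y \<in> sec E U\<rbrakk> \<Longrightarrow> anchor E U (x - y) = anchor E U x - anchor E U y"
  using anch_add[of U x "- y"] by (simp add: anch_uminus)

lemma anch_sum:
  assumes "opn X U" "\<And>i. i \<in> I \<Longrightarrow> s i \<in> sec E U"
  shows "anchor E U (sum s I) = (\<Sum>i\<in>I. anchor E U (s i))"
  using assms by (induction I rule: infinite_finite_induct) (auto simp: anch_add)

lemma dualI:
  assumes "\<And>W v. \<lbrakk>opn X W; W \<subseteq> U; v \<in> sec E W\<rbrakk> \<Longrightarrow> \<omega> W v \<in> sec X W"
    and "\<And>W v w. \<lbrakk>opn X W; W \<subseteq> U; v \<in> sec E W; w \<in> sec E W\<rbrakk> \<Longrightarrow> \<omega> W (v + w) = \<omega> W v + \<omega> W w"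
    and "\<And>W a v. \<lbrakk>opn X W; W \<subseteq> U; a \<in> sec X W; v \<in> sec E W\<rbrakk> \<Longrightarrow> \<omega> W (smul E W a v) = a * \<omega> W v"
    and "\<And>W W' v. \<lbrakk>opn X W; W \<subseteq> U; opn X W'; W' \<subseteq> W; v \<in> sec E W\<rbrakk> \<Longrightarrow>
      \<omega> W' (res E W W' v) = res X W W' (\<omega> W v)"
    and "\<And>W v. \<not> (opn X W \<and> W \<subseteq> U \<and> v \<in> sec E W) \<Longrightarrow> \<omega> W v = 0"
  shows "\<omega> \<in> sec (dual X E) U"
  using assms unfolding dual_def hom_on_def null_outside_def structure_module_def by simp

lemma nondeg_eqI:
  assumes U: "opn X U" and e: "e \<in> sec E U" and e': "e' \<in> sec E U"
    and eq: "\<And>W t. \<lbrakk>opn X W; W \<subseteq> U; t \<in> sec E W\<rbrakk> \<Longrightarrow>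
      pairing E W (res E U W e) t = pairing E W (res E U W e') t"
  shows "e = e'"
proof -
  define \<alpha> where "\<alpha> W t = (if opn X W \<and> W \<subseteq> U \<and> t \<in> sec E W then pairing E W (res E U W e) t else 0)"
    for W t
  have "\<alpha> \<in> sec (dual X E) U"
  proof (rule dualI, goal_cases)
    case W: (4 W W' v)
    then show ?case using U e res_pair[of W W' "res E U W e" v] by (auto simp: \<alpha>_def)
  qed (auto simp: \<alpha>_def U e pair_add_right pair_smul_right)
  then have "\<exists>!e. e \<in> sec E U \<and>
        (\<forall>W. opn X W \<and> W \<subseteq> U \<longrightarrow> (\<forall>t\<in>sec E W. pairing E W (res E U W e) t = \<alpha> W t))"
    using nondeg U unfolding nondegenerate_def by simp
  moreover have "e \<in> sec E U \<and>
        (\<forall>W. opn X W \<and> W \<subseteq> U \<longrightarrow> (\<forall>t\<in>sec E W. pairing E W (res E U W e) t = \<alpha> W t))"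
    using e by (simp add: \<alpha>_def)
  moreover have "e' \<in> sec E U \<and>
        (\<forall>W. opn X W \<and> W \<subseteq> U \<longrightarrow> (\<forall>t\<in>sec E W. pairing E W (res E U W e') t = \<alpha> W t))"
    using e' eq by (simp add: \<alpha>_def)
  ultimately show ?thesis by (rule ex1_unique)
qed

lemma coanchor_ex1:
  assumes U: "opn X U" and \<omega>: "\<omega> \<in> forms U" shows "\<exists>!e. e \<in> sec E U \<and> (\<forall>W. opn X W \<and> W \<subseteq> U \<longrightarrow>
           (\<forall>t\<in>sec E W. pairing E W (res E U W e) t = \<omega> W (anchor E W t)))"
proof -
  define \<alpha> where "\<alpha> W t = (if opn X W \<and> W \<subseteq> U \<and> t \<in> sec E W then \<omega> W (anchor E W t) else 0)" for W t
  have "\<alpha> \<in> sec (dual X E) U"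
    by (rule dualI) (use \<omega> in \<open>auto simp: \<alpha>_def cot_add cot_smul cot_res anch_add anch_smul anch_res\<close>)
  then have "\<exists>!e. e \<in> sec E U \<and>
        (\<forall>W. opn X W \<and> W \<subseteq> U \<longrightarrow> (\<forall>t\<in>sec E W. pairing E W (res E U W e) t = \<alpha> W t))"
    using nondeg U unfolding nondegenerate_def by simp
  then show ?thesis by (simp add: \<alpha>_def cong: conj_cong ball_cong imp_cong)
qed

lemma coanchor_in [simp]:
  assumes "opn X U" "\<omega> \<in> forms U" shows "coanchor X E U \<omega> \<in> sec E U"
  using theI'[OF coanchor_ex1[OF assms]] unfolding coanchor_def by blast

lemma pair_coanchor_res:
  assumes "opn X U" "\<omega> \<in> forms U" "opn X W" "W \<subseteq> U" "t \<in> sec E W"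
  shows "pairing E W (res E U W (coanchor X E U \<omega>)) t = \<omega> W (anchor E W t)"
  using theI'[OF coanchor_ex1[OF assms(1,2)]] assms(3-5) unfolding coanchor_def by blast

lemma pair_coanchor:
  assumes "opn X U" "\<omega> \<in> forms U" "t \<in> sec E U"
  shows "pairing E U (coanchor X E U \<omega>) t = \<omega> U (anchor E U t)"
  using pair_coanchor_res[OF assms(1,2,1) subset_refl assms(3)] assms by simp

lemma coanchorI:
  assumes U: "opn X U" and \<omega>: "\<omega> \<in> forms U" and e: "e \<in> sec E U"
    and eq: "\<And>W t. \<lbrakk>opn X W; W \<subseteq> U; t \<in> sec E W\<rbrakk> \<Longrightarrow> pairing E W (res E U W e) t = \<omega> W (anchor E W t)"
  shows "coanchor X E U \<omega> = e"
  by (rule nondeg_eqI[OF U _ e]) (use U \<omega> eq in \<open>simp_all add: pair_coanchor_res\<close>)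

lemma coanchor_res:
  assumes U: "opn X U" "opn X V" "V \<subseteq> U" and \<omega>: "\<omega> \<in> forms U"
  shows "coanchor X E V (fres U V \<omega>) = res E U V (coanchor X E U \<omega>)"
proof (rule coanchorI, goal_cases)
  case W: (4 W t)
  then have "W \<subseteq> U" using U by blast
  then show ?case using U \<omega> W pair_coanchor_res[of U \<omega> W t] by simp
qed (use U \<omega> in auto)

lemma anch_coanchor [simp]:
  "opn X U \<Longrightarrow> \<omega> \<in> forms U \<Longrightarrow> anchor E U (coanchor X E U \<omega>) = 0" using exact_mid[of U] by blast

lemma anch_0_coanchor: "\<lbrakk>opn X U; e \<in> sec E U; anchor E U e = 0\<rbrakk> \<Longrightarrow> \<exists>\<omega>\<in>forms U. e = coanchor X E U \<omega>"
  using exact_mid[of U] by blast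

lemma anch_onto:
  assumes "opn X U" "v \<in> vfs U" "x \<in> U"
  shows "\<exists>V e. opn X V \<and> x \<in> V \<and> V \<subseteq> U \<and> e \<in> sec E V \<and> anchor E V e = vres U V v"
  using exact_onto[unfolded locally_onto_def, rule_format, OF assms] by blast

lemma brk_skew:
  assumes U: "opn X U" and x: "x \<in> sec E U" and y: "y \<in> sec E U" and z: "z \<in> sec E U"
  shows "pairing E U (bracket E U x y) z + pairing E U (bracket E U y x) z
    = anchor E U z U (pairing E U x y)"
proof -
  have self: "pairing E U (bracket E U w w) z = const X U (1/2) * anchor E U z U (pairing E U w w)"
    if "w \<in> sec E U" for w
    using that U z by (simp add: brk_self pair_smul_left pair_coanchor differential_app)
  have dbl: "anchor E U z U (pairing E U x y + pairing E U x y) =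
      anchor E U z U (pairing E U x y) + anchor E U z U (pairing E U x y)"
    using U x y z by (simp add: anch_vf_add)
  have "pairing E U (bracket E U (x + y) (x + y)) z =
      pairing E U (bracket E U x x) z + pairing E U (bracket E U y y) z
      + (pairing E U (bracket E U x y) z + pairing E U (bracket E U y x) z)"
    using U x y z by (simp add: brk_add_left brk_add_right pair_add_left add_ac)
  moreover have "anchor E U z U (pairing E U (x + y) (x + y)) =
      anchor E U z U (pairing E U x x) + anchor E U z U (pairing E U y y)
      + (anchor E U z U (pairing E U x y) + anchor E U z U (pairing E U x y))"
    using U x y z pair_sym[OF U x y] by (simp add: pair_add_left pair_add_right anch_vf_add add_ac)
  ultimately show ?thesis using self[of "x + y"] self[OF x] self[OF y] U x y z
      const_half[of U "anchor E U z U (pairing E U x y)"] by (simp add: distrib_left)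
qed

lemma anch_brk_smul:
  assumes U: "opn X U" and x: "x \<in> sec E U" and y: "y \<in> sec E U" and z: "z \<in> sec E U"
    and g: "g \<in> sec X U"
  shows "smul E U (anchor E U (bracket E U x y) U g
      - lie_bracket (anchor E U x) (anchor E U y) U g) z = 0"
proof -
  let ?b = "bracket E U" and ?m = "smul E U" and ?a = "\<lambda>x. anchor E U x U"
  have 1: "?b x (?b y (?m g z)) = ?m g (?b x (?b y z)) + ?m (?a x g) (?b y z)
      + (?m (?a y g) (?b x z) + ?m (?a x (?a y g)) z)"
    using assms by (simp add: brk_smul_right brk_add_right)
  have 2: "?b y (?b x (?m g z)) = ?m g (?b y (?b x z)) + ?m (?a y g) (?b x z)
      + (?m (?a x g) (?b y z) + ?m (?a y (?a x g)) z)"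
    using assms by (simp add: brk_smul_right brk_add_right)
  have 3: "?b (?b x y) (?m g z) = ?m g (?b (?b x y) z) + ?m (?a (?b x y) g) z"
    using assms by (simp add: brk_smul_right)
  have 4: "?m g (?b x (?b y z)) = ?m g (?b (?b x y) z) + ?m g (?b y (?b x z))"
    using assms by (simp add: jacobi[of U x y z] E.smul_add_right)
  have "?m (?a (?b x y) g) z - ?m (?a x (?a y g)) z + ?m (?a y (?a x g)) z = 0"
    using jacobi[of U x y "?m g z"] 1 2 3 4 assms by (simp add: algebra_simps)
  then show ?thesis using assms
    by (simp add: lie_bracket_app E.smul_diff_left eq_diff_eq diff_add_eq)
qed

text \<open>
  The difference of both sides kills every section of \<open>E\<close>, hence is zero where \<open>E\<close> has positive rank;
  where the rank is zero, both sides vanish.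
\<close>

lemma anch_brk:
  assumes U: "opn X U" and x: "x \<in> sec E U" and y: "y \<in> sec E U"
  shows "anchor E U (bracket E U x y) = lie_bracket (anchor E U x) (anchor E U y)"
proof (rule vf_eqI)
  fix W s assume W: "opn X W" "W \<subseteq> U" "s \<in> sec X W"
  show "anchor E U (bracket E U x y) W s = lie_bracket (anchor E U x) (anchor E U y) W s"
  proof (rule O.eqI_local[OF W(1)], goal_cases)
    case u: (3 u)
    then have "u \<in> pts X" using W openin_subset by blast
    from frame[OF this] obtain V0 n b where fr: "opn X V0 \<and> u \<in> V0 \<and> (\<forall>i<(n::nat). b i \<in> sec E V0) \<and>
        (\<forall>V. opn X V \<and> V \<subseteq> V0 \<longrightarrow> (\<forall>s\<in>sec E V. \<exists>!c. (\<forall>i<n. c i \<in> sec X V) \<and>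
          (\<forall>i\<ge>n. c i = 0) \<and> s = (\<Sum>i<n. smul E V (c i) (res E V0 V (b i)))))" by (elim exE)
    have V0: "opn X V0" "u \<in> V0" "\<forall>i<n. b i \<in> sec E V0" using fr by simp_all
    have fr1: "\<exists>!c. (\<forall>i<n. c i \<in> sec X V) \<and> (\<forall>i\<ge>n. c i = 0) \<and>
         s = (\<Sum>i<n. smul E V (c i) (res E V0 V (b i)))"
      if "opn X V" "V \<subseteq> V0" "s \<in> sec E V" for V s using fr that by simp
    let ?V = "V0 \<inter> W" and ?s = "res X W (V0 \<inter> W) s"
    let ?x = "res E U (V0 \<inter> W) x" and ?y = "res E U (V0 \<inter> W) y"
    have V: "opn X ?V" "?V \<subseteq> U" "?V \<subseteq> V0" "?V \<subseteq> W" using V0 W by auto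
    have s: "?s \<in> sec X ?V" using W V by simp
    have xy: "?x \<in> sec E ?V" "?y \<in> sec E ?V" using U V x y by simp_all
    let ?h = "anchor E ?V (bracket E ?V ?x ?y) ?V ?s
      - lie_bracket (anchor E ?V ?x) (anchor E ?V ?y) ?V ?s"
    have hV: "?h \<in> sec X ?V" using V xy s by simp
    have "?h = 0"
    proof (cases n)
      case 0
      have "t = 0" if "t \<in> sec E ?V" for t using ex1_implies_ex[OF fr1[OF V(1,3) that]] 0 by simp
      then have "?x = 0" "?y = 0" "bracket E ?V ?x ?y = 0" using xy V by auto
      then show ?thesis using V by (simp add: lie_bracket_app)
    next
      case (Suc m)
      let ?b = "\<lambda>i. res E V0 ?V (b i)"
      have b: "?b i \<in> sec E ?V" if "i < n" for i using that V0 V by simp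
      have z: "smul E ?V ?h (?b 0) = 0" by (rule anch_brk_smul) (use Suc V xy s b in auto)
      let ?c = "\<lambda>i::nat. if i = 0 then ?h else 0"
      have "(\<Sum>i<n. smul E ?V (?c i) (?b i)) = (\<Sum>i<n. 0)" by (rule sum.cong) (use b z V in auto)
      then have sc: "0 = (\<Sum>i<n. smul E ?V (?c i) (?b i))" by simp
      have s0: "0 = (\<Sum>i<n. smul E ?V 0 (?b i))" using V b by simp
      have "?c = (\<lambda>_. 0)"
      proof (rule ex1_unique[OF fr1[OF V(1,3) E.M.zero_in[OF V(1)]]], intro conjI)
        show "\<forall>i<n. ?c i \<in> sec X ?V" using hV V(1) by simp
        show "\<forall>i\<ge>n. ?c i = 0" using Suc by simp
      qed (use s0 V(1) in \<open>simp_all only: sc[symmetric]\<close>, use s0 V(1) in simp_all)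
      from fun_cong[OF this, of 0] show ?thesis by simp
    qed
    moreover have "anchor E ?V (bracket E ?V ?x ?y) ?V ?s = res X W ?V (anchor E U (bracket E U x y) W s)"
      using V W U x y by (simp add: brk_res anch_res anch_vf_res)
    moreover have "lie_bracket (anchor E ?V ?x) (anchor E ?V ?y) ?V ?s =
        res X W ?V (lie_bracket (anchor E U x) (anchor E U y) W s)"
    proof -
      have "lie_bracket (anchor E ?V ?x) (anchor E ?V ?y) =
          vres U ?V (lie_bracket (anchor E U x) (anchor E U y))"
        using V U x y by (simp add: anch_res res_lie_bracket)
      then show ?thesis
        using vf_res[OF lie_bracket_in[OF anch_in[OF U x] anch_in[OF U y]] W(1,2) V(1,4) W(3)] by simp
    qed
    ultimately have "res X W ?V (anchor E U (bracket E U x y) W s) =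
        res X W ?V (lie_bracket (anchor E U x) (anchor E U y) W s)" by simp
    then show ?case using V V0 u by blast
  qed (use W U x y in auto)
qed (use U x y in auto)

end

section \<open>Pullback to a closed subspace\<close>

lemma trace_subset [simp]: "W \<subseteq> U \<Longrightarrow> W \<inter> S \<subseteq> U" by blast

locale closed_emb = X: krs X + Y: krs Y
  for X :: "('x, 'r::comm_ring, 'k::field_char_0) ringed_space"
    and Y :: "('x, 's::comm_ring, 'k) ringed_space" +
  fixes \<rho> :: "'x set \<Rightarrow> 'r \<Rightarrow> 's"
  assumes emb: "closed_immersion X Y \<rho>"
begin

abbreviation tr where "tr U \<equiv> U \<inter> pts Y"

lemmas topo_Y = emb[unfolded closed_immersion_def, THEN conjunct2, THEN conjunct1]
lemmas emb_ring = emb[unfolded closed_immersion_def, THEN conjunct2, THEN conjunct2, THEN conjunct1,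
    rule_format]
lemmas emb_res = emb[unfolded closed_immersion_def, THEN conjunct2, THEN conjunct2, THEN conjunct2,
    THEN conjunct1, rule_format]
lemmas emb_lift = emb[unfolded closed_immersion_def, THEN conjunct2, THEN conjunct2, THEN conjunct2,
    THEN conjunct2, rule_format]

lemma opn_trace_iff: "opn Y V \<longleftrightarrow> (\<exists>U. opn X U \<and> V = tr U)"
  by (subst topo_Y) (simp add: openin_subtopology)

lemma opn_trace [simp]: "opn X U \<Longrightarrow> opn Y (tr U)" using opn_trace_iff by blast

lemma opn_nhd:
  assumes "opn Y V" "y \<in> V" "opn X N" "y \<in> N" shows "\<exists>U. opn X U \<and> y \<in> U \<and> U \<subseteq> N \<and> tr U \<subseteq> V"
proof -
  obtain U where "opn X U" "V = tr U" using assms opn_trace_iff by blast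
  then show ?thesis using assms by (intro exI[of _ "U \<inter> N"]) auto
qed

lemma pts_Y: "opn Y V \<Longrightarrow> y \<in> V \<Longrightarrow> y \<in> pts Y" using openin_subset by blast

lemma rho_in [simp]: "opn X U \<Longrightarrow> s \<in> sec X U \<Longrightarrow> \<rho> U s \<in> sec Y (tr U)" using emb_ring[of U] by blast

lemma rho_add: "\<lbrakk>opn X U; s \<in> sec X U; t \<in> sec X U\<rbrakk> \<Longrightarrow> \<rho> U (s + t) = \<rho> U s + \<rho> U t"
  using emb_ring[of U] by blast

lemma rho_mult: "\<lbrakk>opn X U; s \<in> sec X U; t \<in> sec X U\<rbrakk> \<Longrightarrow> \<rho> U (s * t) = \<rho> U s * \<rho> U t"
  using emb_ring[of U] by blast

lemma rho_const [simp]: "opn X U \<Longrightarrow> \<rho> U (const X U a) = const Y (tr U) a"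
  using emb_ring[of U] by blast

lemma rho_res: "\<lbrakk>opn X U; opn X V; V \<subseteq> U; s \<in> sec X U\<rbrakk> \<Longrightarrow>
    \<rho> V (res X U V s) = res Y (tr U) (tr V) (\<rho> U s)" using emb_res[of U V s] by blast

lemma rho_zero [simp]: "opn X U \<Longrightarrow> \<rho> U 0 = 0" using rho_add[of U 0 0] by simp

lemma rho_uminus: "opn X U \<Longrightarrow> s \<in> sec X U \<Longrightarrow> \<rho> U (- s) = - \<rho> U s"
  using rho_add[of U s "- s"] by (simp add: eq_neg_iff_add_eq_0 add.commute)

lemma rho_diff: "\<lbrakk>opn X U; s \<in> sec X U; t \<in> sec X U\<rbrakk> \<Longrightarrow> \<rho> U (s - t) = \<rho> U s - \<rho> U t"
  using rho_add[of U s "- t"] by (simp add: rho_uminus)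

lemma rho_sum:
  assumes "opn X U" "\<And>i. i \<in> I \<Longrightarrow> s i \<in> sec X U" shows "\<rho> U (sum s I) = (\<Sum>i\<in>I. \<rho> U (s i))"
  using assms by (induction I rule: infinite_finite_induct) (auto simp: rho_add)

lemma rho_lift:
  assumes "opn Y V" "g \<in> sec Y V" "y \<in> V" "opn X N" "y \<in> N"
  shows "\<exists>U s. opn X U \<and> y \<in> U \<and> U \<subseteq> N \<and> tr U \<subseteq> V \<and> s \<in> sec X U \<and> \<rho> U s = res Y V (tr U) g"
proof -
  obtain U s where U: "opn X U" "y \<in> U" "tr U \<subseteq> V" "s \<in> sec X U" "\<rho> U s = res Y V (tr U) g"
    using emb_lift[of V g y] assms by blast
  have "\<rho> (U \<inter> N) (res X U (U \<inter> N) s) = res Y V (U \<inter> N \<inter> pts Y) g"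
    using U assms by (subst rho_res) auto
  then show ?thesis using U assms by (intro exI[of _ "U \<inter> N"] exI[of _ "res X U (U \<inter> N) s"]) auto
qed

lemma Y_eqI:
  assumes V: "opn Y V" and s: "s \<in> sec Y V" and t: "t \<in> sec Y V"
    and loc: "\<And>y. y \<in> V \<Longrightarrow> \<exists>U. opn X U \<and> y \<in> U \<and> tr U \<subseteq> V \<and> res Y V (tr U) s = res Y V (tr U) t"
  shows "s = t"
proof (rule Y.O.eqI_local[OF V s t], goal_cases)
  case y: (1 y)
  then obtain U where "opn X U \<and> y \<in> U \<and> tr U \<subseteq> V \<and>
      res Y V (tr U) s = res Y V (tr U) t" using loc by blast
  then show ?case using y pts_Y[OF V] by (intro exI[of _ "tr U"]) auto
qed

lemma restricts_app: "\<lbrakk>vfield_restricts X Y \<rho> U v D; opn X W; W \<subseteq> U; g \<in> sec X W\<rbrakk> \<Longrightarrow>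
    \<rho> W (v W g) = D (tr W) (\<rho> W g)" unfolding vfield_restricts_def by simp

lemma vfield_Y_eqI:
  assumes V: "opn Y V" and D: "D \<in> Y.vfs V" "D' \<in> Y.vfs V"
    and loc: "\<And>y. y \<in> V \<Longrightarrow> \<exists>U. opn X U \<and> y \<in> U \<and> tr U \<subseteq> V \<and>
      (\<forall>W g. opn X W \<and> W \<subseteq> U \<and> g \<in> sec X W \<longrightarrow> D (tr W) (\<rho> W g) = D' (tr W) (\<rho> W g))"
  shows "D = D'"
proof (rule Y.vf_eqI[OF D], goal_cases)
  case W: (1 W s)
  show ?case
  proof (rule Y_eqI[OF W(1)], goal_cases)
    case y: (3 y)
    from loc[OF subsetD[OF W(2) y]] obtain U where U': "opn X U \<and> y \<in> U \<and> tr U \<subseteq> V \<and>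
      (\<forall>W g. opn X W \<and> W \<subseteq> U \<and> g \<in> sec X W \<longrightarrow> D (tr W) (\<rho> W g) = D' (tr W) (\<rho> W g))" by (elim exE)
    then have U: "opn X U" "y \<in> U" "tr U \<subseteq> V"
      "\<And>W g. \<lbrakk>opn X W; W \<subseteq> U; g \<in> sec X W\<rbrakk> \<Longrightarrow> D (tr W) (\<rho> W g) = D' (tr W) (\<rho> W g)" by simp_all
    obtain U' g where U': "opn X U'" "y \<in> U'" "U' \<subseteq> U" "tr U' \<subseteq> W" "g \<in> sec X U'"
        "\<rho> U' g = res Y W (tr U') s" using rho_lift[OF W(1,3) y U(1,2)] by blast
    have "res Y W (tr U') (D W s) = res Y W (tr U') (D' W s)"
      using U(4)[of U' g] U' W D by (simp add: Y.vf_res)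
    then show ?case using U' by blast
  qed (use W D in auto)
qed

end

locale pulled = closed_emb X Y \<rho> + C: exact_ca X E + P: kmod Y P
  for X :: "('x, 'r::comm_ring, 'k::field_char_0) ringed_space"
    and Y :: "('x, 's::comm_ring, 'k) ringed_space" and \<rho>
    and E :: "('x, 'r, 'e::ab_group_add) courant"
    and P :: "('x, 's, 'p::ab_group_add) msheaf" +
  fixes p :: "'x set \<Rightarrow> 'e \<Rightarrow> 'p"
  assumes pb: "is_pullback X Y \<rho> E P p"
begin

abbreviation dstar where "dstar U g \<equiv> coanchor X E U (differential X U g)"

lemmas pb_at = pb[unfolded is_pullback_def, THEN conjunct2, THEN conjunct1, rule_format]
lemmas pb_lift = pb[unfolded is_pullback_def, THEN conjunct2, THEN conjunct2, rule_format]

lemma p_in [simp]: "opn X U \<Longrightarrow> s \<in> sec E U \<Longrightarrow> p U s \<in> sec P (tr U)"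
  by (rule pb_at[THEN conjunct1, rule_format])

lemma p_add: "\<lbrakk>opn X U; s \<in> sec E U; t \<in> sec E U\<rbrakk> \<Longrightarrow> p U (s + t) = p U s + p U t"
  by (rule pb_at[THEN conjunct2, THEN conjunct1, rule_format])

lemma p_smul: "\<lbrakk>opn X U; a \<in> sec X U; s \<in> sec E U\<rbrakk> \<Longrightarrow>
    p U (smul E U a s) = smul P (tr U) (\<rho> U a) (p U s)"
  by (rule pb_at[THEN conjunct2, THEN conjunct2, THEN conjunct1, rule_format])

lemma p_res: "\<lbrakk>opn X U; opn X V; V \<subseteq> U; s \<in> sec E U\<rbrakk> \<Longrightarrow>
    p V (res E U V s) = res P (tr U) (tr V) (p U s)"
  by (rule pb_at[THEN conjunct2, THEN conjunct2, THEN conjunct2, THEN conjunct1, rule_format]) auto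

lemma p_vanish: "\<lbrakk>opn X U; s \<in> sec E U; p U s = 0; y \<in> tr U\<rbrakk> \<Longrightarrow>
    \<exists>V. opn X V \<and> y \<in> V \<and> V \<subseteq> U \<and> res E U V s \<in> vanishing_submodule X \<rho> E V"
  using pb_at[of U, THEN conjunct2, THEN conjunct2, THEN conjunct2, THEN conjunct2, rule_format, of s]
  by simp

lemma p_zero [simp]: "opn X U \<Longrightarrow> p U 0 = 0" using p_add[of U 0 0] by simp

lemma p_uminus: "opn X U \<Longrightarrow> s \<in> sec E U \<Longrightarrow> p U (- s) = - p U s"
  using p_add[of U s "- s"] by (simp add: eq_neg_iff_add_eq_0 add.commute)

lemma p_diff: "\<lbrakk>opn X U; s \<in> sec E U; t \<in> sec E U\<rbrakk> \<Longrightarrow> p U (s - t) = p U s - p U t"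
  using p_add[of U s "- t"] by (simp add: p_uminus)

lemma p_sum:
  assumes "opn X U" "\<And>i. i \<in> I \<Longrightarrow> s i \<in> sec E U" shows "p U (sum s I) = (\<Sum>i\<in>I. p U (s i))"
  using assms by (induction I rule: infinite_finite_induct) (auto simp: p_add)

lemma lift1:
  assumes "opn Y V" "\<sigma> \<in> sec P V" "y \<in> V" "opn X N" "y \<in> N"
  shows "\<exists>U e. opn X U \<and> y \<in> U \<and> U \<subseteq> N \<and> tr U \<subseteq> V \<and> e \<in> sec E U \<and> p U e = res P V (tr U) \<sigma>"
proof -
  obtain U s where U: "opn X U" "y \<in> U" "tr U \<subseteq> V" "s \<in> sec E U" "p U s = res P V (tr U) \<sigma>"
    using pb_lift[of V \<sigma> y] assms by blast
  have "p (U \<inter> N) (res E U (U \<inter> N) s) = res P V (U \<inter> N \<inter> pts Y) \<sigma>"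
    using U assms by (subst p_res) auto
  then show ?thesis using U assms by (intro exI[of _ "U \<inter> N"] exI[of _ "res E U (U \<inter> N) s"]) auto
qed

lemma lift_res:
  assumes "opn Y V" "\<sigma> \<in> sec P V" "opn X U" "tr U \<subseteq> V" "e \<in> sec E U"
    "p U e = res P V (tr U) \<sigma>" "opn X U'" "U' \<subseteq> U"
  shows "p U' (res E U U' e) = res P V (tr U') \<sigma>"
proof -
  have "tr U' \<subseteq> tr U" using assms by blast
  then show ?thesis using assms by (simp add: p_res)
qed

lemma lift2:
  assumes "opn Y V" "\<sigma> \<in> sec P V" "\<tau> \<in> sec P V" "y \<in> V" "opn X N" "y \<in> N"
  shows "\<exists>U e f. opn X U \<and> y \<in> U \<and> U \<subseteq> N \<and> tr U \<subseteq> V \<and> e \<in> sec E U \<and>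
    p U e = res P V (tr U) \<sigma> \<and> f \<in> sec E U \<and> p U f = res P V (tr U) \<tau>"
proof -
  obtain U e where U: "opn X U" "y \<in> U" "U \<subseteq> N" "tr U \<subseteq> V" "e \<in> sec E U"
      "p U e = res P V (tr U) \<sigma>" using lift1[of V \<sigma> y N] assms by blast
  obtain U' f where U': "opn X U'" "y \<in> U'" "U' \<subseteq> U" "tr U' \<subseteq> V" "f \<in> sec E U'"
      "p U' f = res P V (tr U') \<tau>" using lift1[of V \<tau> y U] assms U by blast
  show ?thesis using U U' lift_res[of V \<sigma> U e U'] assms
    by (intro exI[of _ U'] exI[of _ "res E U U' e"] exI[of _ f]) auto
qed

lemma lift3:
  assumes "opn Y V" "\<sigma> \<in> sec P V" "\<tau> \<in> sec P V" "\<upsilon> \<in> sec P V" "y \<in> V" "opn X N" "y \<in> N"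
  shows "\<exists>U e f g. opn X U \<and> y \<in> U \<and> U \<subseteq> N \<and> tr U \<subseteq> V \<and> e \<in> sec E U \<and>
    p U e = res P V (tr U) \<sigma> \<and> f \<in> sec E U \<and> p U f = res P V (tr U) \<tau> \<and>
    g \<in> sec E U \<and> p U g = res P V (tr U) \<upsilon>"
proof -
  obtain U e f where U: "opn X U" "y \<in> U" "U \<subseteq> N" "tr U \<subseteq> V" "e \<in> sec E U"
      "p U e = res P V (tr U) \<sigma>" "f \<in> sec E U" "p U f = res P V (tr U) \<tau>"
    using lift2[of V \<sigma> \<tau> y N] assms by blast
  obtain U' g where U': "opn X U'" "y \<in> U'" "U' \<subseteq> U" "tr U' \<subseteq> V" "g \<in> sec E U'"
      "p U' g = res P V (tr U') \<upsilon>" using lift1[of V \<upsilon> y U] assms U by blast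
  show ?thesis using U U' lift_res[of V \<sigma> U e U'] lift_res[of V \<tau> U f U'] assms
    by (intro exI[of _ U'] exI[of _ "res E U U' e"] exI[of _ "res E U U' f"] exI[of _ g]) auto
qed

subsection \<open>The pairing on the pullback\<close>

lemma rho_functional_0:
  assumes U: "opn X U" "e \<in> sec E U" "p U e = 0"
    and f_in: "\<And>W s. \<lbrakk>opn X W; W \<subseteq> U; s \<in> sec E W\<rbrakk> \<Longrightarrow> f W s \<in> sec X W"
    and f_add: "\<And>W s t. \<lbrakk>opn X W; W \<subseteq> U; s \<in> sec E W; t \<in> sec E W\<rbrakk> \<Longrightarrow> f W (s + t) = f W s + f W t"
    and f_smul: "\<And>W a s. \<lbrakk>opn X W; W \<subseteq> U; a \<in> sec X W; s \<in> sec E W\<rbrakk> \<Longrightarrow> f W (smul E W a s) = a * f W s"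
    and f_res: "\<And>W. opn X W \<Longrightarrow> W \<subseteq> U \<Longrightarrow> f W (res E U W e) = res X U W (f U e)"
  shows "\<rho> U (f U e) = 0"
proof (rule Y_eqI[of "tr U"], goal_cases)
  case (4 y)
  then obtain V where V: "opn X V" "y \<in> V" "V \<subseteq> U" "res E U V e \<in> vanishing_submodule X \<rho> E V"
    using p_vanish[OF U] by blast
  then obtain n a b where ab: "\<forall>i<(n::nat). a i \<in> sec X V \<and> \<rho> V (a i) = 0 \<and> b i \<in> sec E V"
      "res E U V e = (\<Sum>i<n. smul E V (a i) (b i))" unfolding vanishing_submodule_def by blast
  have f0: "f V 0 = 0" using f_add[of V 0 0] V by simp
  have fsum: "f V (\<Sum>i<m. smul E V (a i) (b i)) = (\<Sum>i<m. a i * f V (b i))" if "m \<le> n" for m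
    using that
  proof (induction m)
    case (Suc m)
    have "(\<Sum>i<m. smul E V (a i) (b i)) \<in> sec E V" using ab Suc.prems V by (intro C.E.M.sum_in) auto
    then show ?case using Suc ab V by (simp add: f_add f_smul)
  qed (simp add: f0)
  have fb: "f V (b i) \<in> sec X V" if "i < n" for i using ab that V f_in by simp
  have "\<rho> V (f V (res E U V e)) = (\<Sum>i<n. \<rho> V (a i * f V (b i)))"
    unfolding ab(2) fsum[OF le_refl] using ab V fb by (intro rho_sum) auto
  also have "\<dots> = (\<Sum>i<n. 0)" by (rule sum.cong[OF refl]) (use ab V fb in \<open>simp add: rho_mult\<close>)
  also have "\<dots> = 0" by simp
  finally have "res Y (tr U) (tr V) (\<rho> U (f U e)) = 0" using U V f_in f_res by (simp add: rho_res)
  moreover have "tr V \<subseteq> tr U" using V by blast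
  ultimately show ?case using U V by (intro exI[of _ V]) simp
qed (use U f_in in auto)

lemma rho_pair_0:
  assumes U: "opn X U" "e \<in> sec E U" "t \<in> sec E U" "p U e = 0" shows "\<rho> U (pairing E U e t) = 0"
proof -
  have "\<rho> U (pairing E U e (res E U U t)) = 0"
    by (rule rho_functional_0[where f = "\<lambda>W s. pairing E W s (res E U W t)"])
      (use U in \<open>auto simp: C.pair_add_left C.pair_smul_left C.res_pair\<close>)
  then show ?thesis using U by simp
qed

lemma rho_anch_0:
  assumes U: "opn X U" "e \<in> sec E U" "g \<in> sec X U" "p U e = 0" shows "\<rho> U (anchor E U e U g) = 0"
proof -
  have "\<rho> U (anchor E U e U (res X U U g)) = 0"
    by (rule rho_functional_0[where f = "\<lambda>W s. anchor E W s W (res X U W g)"])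
      (use U in \<open>auto simp: C.anch_add C.anch_smul C.anch_res C.anch_vf_res\<close>)
  then show ?thesis using U by simp
qed

lemma rho_pair_cong:
  assumes U: "opn X U" "e1 \<in> sec E U" "e2 \<in> sec E U" "f1 \<in> sec E U" "f2 \<in> sec E U"
    and "p U e1 = p U e2" "p U f1 = p U f2"
  shows "\<rho> U (pairing E U e1 f1) = \<rho> U (pairing E U e2 f2)"
proof -
  have a: "\<rho> U (pairing E U (e1 - e2) f1) = 0" by (rule rho_pair_0) (use assms in \<open>auto simp: p_diff\<close>)
  have b: "\<rho> U (pairing E U (f1 - f2) e2) = 0" by (rule rho_pair_0) (use assms in \<open>auto simp: p_diff\<close>)
  have "pairing E U e1 f1 = pairing E U (e1 - e2) f1 + pairing E U e2 f1"
    using C.pair_add_left[of U "e1 - e2" e2 f1] U by simp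
  moreover have "pairing E U e2 f1 = pairing E U (f1 - f2) e2 + pairing E U e2 f2"
    using C.pair_add_right[of U "f1 - f2" f2 e2] C.pair_sym[of U "f1 - f2" e2] U by simp
  ultimately show ?thesis using a b U by (simp add: rho_add)
qed

lemma rho_anch_cong:
  assumes U: "opn X U" "e1 \<in> sec E U" "e2 \<in> sec E U" "g \<in> sec X U" "p U e1 = p U e2"
  shows "\<rho> U (anchor E U e1 U g) = \<rho> U (anchor E U e2 U g)"
proof -
  have "\<rho> U (anchor E U (e1 - e2) U g) = 0" by (rule rho_anch_0) (use assms in \<open>auto simp: p_diff\<close>)
  then show ?thesis using U by (simp add: C.anch_diff rho_diff)
qed

abbreviation pp where "pp \<equiv> pull_pairing X Y \<rho> E P p"

lemma pp_ex1:
  assumes V: "opn Y V" and \<sigma>: "\<sigma> \<in> sec P V" and \<tau>: "\<tau> \<in> sec P V" shows "\<exists>!g. g \<in> sec Y V \<and>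
        (\<forall>U. opn X U \<and> tr U \<subseteq> V \<longrightarrow> (\<forall>e\<in>sec E U. \<forall>e'\<in>sec E U.
              p U e = res P V (tr U) \<sigma> \<and> p U e' = res P V (tr U) \<tau> \<longrightarrow>
              \<rho> U (pairing E U e e') = res Y V (tr U) g))"
proof -
  let ?R = "\<lambda>V' g. \<exists>U e e'. opn X U \<and> V' = tr U \<and> e \<in> sec E U \<and> e' \<in> sec E U \<and>
    p U e = res P V (tr U) \<sigma> \<and> p U e' = res P V (tr U) \<tau> \<and> g = \<rho> U (pairing E U e e')"
  have "\<exists>!g. g \<in> sec Y V \<and>
    (\<forall>V' g'. opn Y V' \<and> V' \<subseteq> V \<and> g' \<in> sec Y V' \<and> ?R V' g' \<longrightarrow> res Y V V' g = g')"
  proof (rule Y.O.glue_rel[OF V])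
    fix y assume y: "y \<in> V"
    then have "y \<in> pts X" using V opn_trace_iff openin_subset[of "topo X"] by blast
    then obtain U e f where U: "opn X U" "y \<in> U" "tr U \<subseteq> V" "e \<in> sec E U"
      "p U e = res P V (tr U) \<sigma>" "f \<in> sec E U" "p U f = res P V (tr U) \<tau>"
      using lift2[OF V \<sigma> \<tau> y, of "pts X"] by blast
    have "\<rho> U (pairing E U e f) \<in> sec Y (tr U)" using U by simp
    moreover have "?R (tr U) (\<rho> U (pairing E U e f))" using U by blast
    ultimately show "\<exists>V' g. opn Y V' \<and> y \<in> V' \<and> V' \<subseteq> V \<and> g \<in> sec Y V' \<and> ?R V' g"
      using U pts_Y[OF V y] opn_trace[OF U(1)] by blast
  next
    fix V1 g1 V2 g2
    assume V1: "V1 \<subseteq> V" "?R V1 g1" and V2: "V2 \<subseteq> V" "?R V2 g2"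
    obtain U1 e1 f1 where 1: "opn X U1" "V1 = tr U1" "e1 \<in> sec E U1" "f1 \<in> sec E U1"
      "p U1 e1 = res P V (tr U1) \<sigma>" "p U1 f1 = res P V (tr U1) \<tau>"
      "g1 = \<rho> U1 (pairing E U1 e1 f1)" using V1 by blast
    obtain U2 e2 f2 where 2: "opn X U2" "V2 = tr U2" "e2 \<in> sec E U2" "f2 \<in> sec E U2"
      "p U2 e2 = res P V (tr U2) \<sigma>" "p U2 f2 = res P V (tr U2) \<tau>"
      "g2 = \<rho> U2 (pairing E U2 e2 f2)" using V2 by blast
    let ?U = "U1 \<inter> U2"
    have eq: "V1 \<inter> V2 = tr ?U" using 1 2 by blast
    have "\<rho> ?U (pairing E ?U (res E U1 ?U e1) (res E U1 ?U f1)) =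
        \<rho> ?U (pairing E ?U (res E U2 ?U e2) (res E U2 ?U f2))"
    proof (rule rho_pair_cong)
      show "p ?U (res E U1 ?U e1) = p ?U (res E U2 ?U e2)"
        using lift_res[of V \<sigma> U1 e1 ?U] lift_res[of V \<sigma> U2 e2 ?U] V \<sigma> 1 2 V1 V2 by simp
      show "p ?U (res E U1 ?U f1) = p ?U (res E U2 ?U f2)"
        using lift_res[of V \<tau> U1 f1 ?U] lift_res[of V \<tau> U2 f2 ?U] V \<tau> 1 2 V1 V2 by simp
    qed (use 1 2 in auto)
    then show "res Y V1 (V1 \<inter> V2) g1 = res Y V2 (V1 \<inter> V2) g2"
      unfolding eq using 1 2 by (simp add: C.res_pair rho_res)
  qed
  from ex1_implies_ex[OF this] obtain g where g0: "g \<in> sec Y V \<and>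
      (\<forall>V' g'. opn Y V' \<and> V' \<subseteq> V \<and> g' \<in> sec Y V' \<and> ?R V' g' \<longrightarrow> res Y V V' g = g')" by (elim exE)
  have gin: "g \<in> sec Y V" using g0 by (rule conjunct1)
  have gR: "res Y V V' g = g'" if "opn Y V'" "V' \<subseteq> V" "g' \<in> sec Y V'" "?R V' g'" for V' g'
    by (rule g0[THEN conjunct2, rule_format, OF conjI[OF that(1) conjI[OF that(2) conjI[OF that(3,4)]]]])
  show ?thesis
  proof (rule ex1I)
    show "g \<in> sec Y V \<and> (\<forall>U. opn X U \<and> tr U \<subseteq> V \<longrightarrow> (\<forall>e\<in>sec E U. \<forall>e'\<in>sec E U.
              p U e = res P V (tr U) \<sigma> \<and> p U e' = res P V (tr U) \<tau> \<longrightarrow>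
              \<rho> U (pairing E U e e') = res Y V (tr U) g))"
    proof (intro conjI allI impI ballI, goal_cases)
      case (2 U e f)
      have "?R (tr U) (\<rho> U (pairing E U e f))" using 2 by blast
      from gR[OF _ _ _ this] show ?case using 2 by simp
    qed (rule gin)
  next
    fix h assume h: "h \<in> sec Y V \<and> (\<forall>U. opn X U \<and> tr U \<subseteq> V \<longrightarrow> (\<forall>e\<in>sec E U. \<forall>e'\<in>sec E U.
              p U e = res P V (tr U) \<sigma> \<and> p U e' = res P V (tr U) \<tau> \<longrightarrow>
              \<rho> U (pairing E U e e') = res Y V (tr U) h))"
    show "h = g"
    proof (rule Y_eqI[OF V], goal_cases)
      case y: (3 y)
      then have "y \<in> pts X" using V opn_trace_iff openin_subset[of "topo X"] by blast
      then obtain U e f where U: "opn X U" "y \<in> U" "tr U \<subseteq> V" "e \<in> sec E U"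
        "p U e = res P V (tr U) \<sigma>" "f \<in> sec E U" "p U f = res P V (tr U) \<tau>"
        using lift2[OF V \<sigma> \<tau> y, of "pts X"] by blast
      have "?R (tr U) (\<rho> U (pairing E U e f))" using U by blast
      from gR[OF _ _ _ this] have "res Y V (tr U) g = \<rho> U (pairing E U e f)" using U by simp
      then have "res Y V (tr U) h = res Y V (tr U) g" using h U by simp
      then show ?case using U by blast
    qed (use h gin in auto)
  qed
qed

lemmas pp_spec = theI'[OF pp_ex1, folded pull_pairing_def]

lemma pp_in [simp]:
  "\<lbrakk>opn Y V; \<sigma> \<in> sec P V; \<tau> \<in> sec P V\<rbrakk> \<Longrightarrow> pp V \<sigma> \<tau> \<in> sec Y V" using pp_spec[of V \<sigma> \<tau>] by blast

lemma pp_lift: "\<lbrakk>opn Y V; \<sigma> \<in> sec P V; \<tau> \<in> sec P V; opn X U; tr U \<subseteq> V;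
    e \<in> sec E U; f \<in> sec E U; p U e = res P V (tr U) \<sigma>; p U f = res P V (tr U) \<tau>\<rbrakk> \<Longrightarrow>
    res Y V (tr U) (pp V \<sigma> \<tau>) = \<rho> U (pairing E U e f)" using pp_spec[of V \<sigma> \<tau>] by simp

lemma pp_p: "\<lbrakk>opn X U; e \<in> sec E U; f \<in> sec E U\<rbrakk> \<Longrightarrow>
    pp (tr U) (p U e) (p U f) = \<rho> U (pairing E U e f)"
  using pp_lift[of "tr U" "p U e" "p U f" U e f] by simp

lemma pts_YX: "opn Y V \<Longrightarrow> y \<in> V \<Longrightarrow> y \<in> pts X" using opn_trace_iff openin_subset[of "topo X"] by blast

lemma pp_res:
  assumes V: "opn Y V" and \<sigma>: "\<sigma> \<in> sec P V" and \<tau>: "\<tau> \<in> sec P V" and W: "opn Y W" "W \<subseteq> V"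
  shows "res Y V W (pp V \<sigma> \<tau>) = pp W (res P V W \<sigma>) (res P V W \<tau>)"
proof (rule Y_eqI[OF W(1)], goal_cases)
  case y: (3 y)
  obtain U e f where U: "opn X U" "y \<in> U" "tr U \<subseteq> W" "e \<in> sec E U"
      "p U e = res P W (tr U) (res P V W \<sigma>)" "f \<in> sec E U"
      "p U f = res P W (tr U) (res P V W \<tau>)"
    using lift2[of W "res P V W \<sigma>" "res P V W \<tau>" y "pts X"] V \<sigma> \<tau> W y pts_YX[OF W(1) y] by auto
  have "res Y W (tr U) (pp W (res P V W \<sigma>) (res P V W \<tau>)) = \<rho> U (pairing E U e f)"
    by (rule pp_lift) (use U V \<sigma> \<tau> W in auto)
  moreover have "res Y V (tr U) (pp V \<sigma> \<tau>) = \<rho> U (pairing E U e f)"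
    by (rule pp_lift) (use U V \<sigma> \<tau> W in auto)
  ultimately show ?case using U V \<sigma> \<tau> W by (intro exI[of _ U]) simp
qed (use V W \<sigma> \<tau> in auto)

lemma pp_sym:
  assumes V: "opn Y V" and \<sigma>: "\<sigma> \<in> sec P V" and \<tau>: "\<tau> \<in> sec P V" shows "pp V \<sigma> \<tau> = pp V \<tau> \<sigma>"
proof (rule Y_eqI[OF V], goal_cases)
  case y: (3 y)
  obtain U e f where U: "opn X U" "y \<in> U" "tr U \<subseteq> V" "e \<in> sec E U"
      "p U e = res P V (tr U) \<sigma>" "f \<in> sec E U" "p U f = res P V (tr U) \<tau>"
    using lift2[OF V \<sigma> \<tau> y, of "pts X"] pts_YX[OF V y] by auto
  then show ?case using V \<sigma> \<tau> C.pair_sym[of U e f]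
    by (intro exI[of _ U]) (simp add: pp_lift[of V \<sigma> \<tau> U e f] pp_lift[of V \<tau> \<sigma> U f e])
qed (use V \<sigma> \<tau> in auto)

lemma pp_add_left:
  assumes V: "opn Y V" and \<sigma>: "\<sigma> \<in> sec P V" and \<sigma>': "\<sigma>' \<in> sec P V" and \<tau>: "\<tau> \<in> sec P V"
  shows "pp V (\<sigma> + \<sigma>') \<tau> = pp V \<sigma> \<tau> + pp V \<sigma>' \<tau>"
proof (rule Y_eqI[OF V], goal_cases)
  case y: (3 y)
  obtain U e e' f where U: "opn X U" "y \<in> U" "tr U \<subseteq> V" "e \<in> sec E U"
      "p U e = res P V (tr U) \<sigma>" "e' \<in> sec E U" "p U e' = res P V (tr U) \<sigma>'"
      "f \<in> sec E U" "p U f = res P V (tr U) \<tau>"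
    using lift3[OF V \<sigma> \<sigma>' \<tau> y, of "pts X"] pts_YX[OF V y] by auto
  have "p U (e + e') = res P V (tr U) (\<sigma> + \<sigma>')" using U V \<sigma> \<sigma>' by (simp add: p_add P.M.res_add)
  then have "res Y V (tr U) (pp V (\<sigma> + \<sigma>') \<tau>) = \<rho> U (pairing E U (e + e') f)"
    using U V \<sigma> \<sigma>' \<tau> by (intro pp_lift) auto
  also have "\<dots> = res Y V (tr U) (pp V \<sigma> \<tau> + pp V \<sigma>' \<tau>)"
    using U V \<sigma> \<sigma>' \<tau> pp_lift[of V \<sigma> \<tau> U e f] pp_lift[of V \<sigma>' \<tau> U e' f]
    by (simp add: C.pair_add_left rho_add Y.O.res_add)
  finally show ?case using U by blast
qed (use V \<sigma> \<sigma>' \<tau> in auto)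

lemma pp_smul_left:
  assumes V: "opn Y V" and \<sigma>: "\<sigma> \<in> sec P V" and \<tau>: "\<tau> \<in> sec P V" and a: "a \<in> sec Y V"
  shows "pp V (smul P V a \<sigma>) \<tau> = a * pp V \<sigma> \<tau>"
proof (rule Y_eqI[OF V], goal_cases)
  case y: (3 y)
  obtain N g where N: "opn X N" "y \<in> N" "tr N \<subseteq> V" "g \<in> sec X N"
      "\<rho> N g = res Y V (tr N) a" using rho_lift[OF V a y, of "pts X"] pts_YX[OF V y] by auto
  obtain U e f where U: "opn X U" "y \<in> U" "U \<subseteq> N" "tr U \<subseteq> V" "e \<in> sec E U"
      "p U e = res P V (tr U) \<sigma>" "f \<in> sec E U" "p U f = res P V (tr U) \<tau>"
    using lift2[OF V \<sigma> \<tau> y N(1,2)] by auto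
  let ?g = "res X N U g"
  have UN: "tr U \<subseteq> tr N" using U by blast
  have g: "?g \<in> sec X U" "\<rho> U ?g = res Y V (tr U) a" using U N V a by (simp_all add: rho_res)
  have "p U (smul E U ?g e) = res P V (tr U) (smul P V a \<sigma>)"
    using U V \<sigma> a g by (simp add: p_smul P.res_smul)
  then have "res Y V (tr U) (pp V (smul P V a \<sigma>) \<tau>) = \<rho> U (pairing E U (smul E U ?g e) f)"
    using U V \<sigma> \<tau> a g by (intro pp_lift) auto
  also have "\<dots> = res Y V (tr U) (a * pp V \<sigma> \<tau>)" using U V \<sigma> \<tau> a g pp_lift[of V \<sigma> \<tau> U e f]
    by (simp add: C.pair_smul_left rho_mult Y.res_mult)
  finally show ?case using U by blast
qed (use V \<sigma> \<tau> a in auto)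

lemma pp_add_right: "\<lbrakk>opn Y V; \<sigma> \<in> sec P V; \<tau> \<in> sec P V; \<tau>' \<in> sec P V\<rbrakk> \<Longrightarrow>
    pp V \<sigma> (\<tau> + \<tau>') = pp V \<sigma> \<tau> + pp V \<sigma> \<tau>'" using pp_add_left[of V \<tau> \<tau>' \<sigma>] pp_sym[of V \<sigma>] by simp

lemma pp_smul_right: "\<lbrakk>opn Y V; \<sigma> \<in> sec P V; \<tau> \<in> sec P V; a \<in> sec Y V\<rbrakk> \<Longrightarrow>
    pp V \<sigma> (smul P V a \<tau>) = a * pp V \<sigma> \<tau>"
  using pp_smul_left[of V \<tau> \<sigma> a] pp_sym[of V \<sigma> "smul P V a \<tau>"] pp_sym[of V \<sigma> \<tau>] by simp

lemma pp_zero_left [simp]: "opn Y V \<Longrightarrow> \<tau> \<in> sec P V \<Longrightarrow> pp V 0 \<tau> = 0"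
  using pp_add_left[of V 0 0 \<tau>] by simp

lemma pp_zero_right [simp]: "opn Y V \<Longrightarrow> \<tau> \<in> sec P V \<Longrightarrow> pp V \<tau> 0 = 0"
  using pp_add_right[of V \<tau> 0 0] by simp

lemma pp_uminus_left: "\<lbrakk>opn Y V; \<sigma> \<in> sec P V; \<tau> \<in> sec P V\<rbrakk> \<Longrightarrow> pp V (- \<sigma>) \<tau> = - pp V \<sigma> \<tau>"
  using pp_add_left[of V \<sigma> "- \<sigma>" \<tau>] by (simp add: eq_neg_iff_add_eq_0 add.commute)

lemma pp_diff_left: "\<lbrakk>opn Y V; \<sigma> \<in> sec P V; \<sigma>' \<in> sec P V; \<tau> \<in> sec P V\<rbrakk> \<Longrightarrow>
    pp V (\<sigma> - \<sigma>') \<tau> = pp V \<sigma> \<tau> - pp V \<sigma>' \<tau>"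
  using pp_add_left[of V \<sigma> "- \<sigma>'" \<tau>] by (simp add: pp_uminus_left)

lemma pp_sum_right:
  assumes "opn Y V" "\<sigma> \<in> sec P V" "\<And>i. i \<in> I \<Longrightarrow> \<tau> i \<in> sec P V"
  shows "pp V \<sigma> (sum \<tau> I) = (\<Sum>i\<in>I. pp V \<sigma> (\<tau> i))"
  using assms by (induction I rule: infinite_finite_induct) (auto simp: pp_add_right)

end

context pulled
begin

subsection \<open>Sections of the pullback whose anchor is tangent to the subspace\<close>

abbreviation anc where "anc \<equiv> anchored X Y \<rho> E P p"
abbreviation AP where "AP \<equiv> anchor_preimage X Y \<rho> E P p"
abbreviation pa where "pa \<equiv> pull_anchor X Y \<rho> E P p"
abbreviation CN where "CN \<equiv> conormal X Y \<rho> E P p"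

lemma anc_in: "anc V \<sigma> D \<Longrightarrow> D \<in> Y.vfs V" unfolding anchored_def by simp

lemma ancD:
  assumes "anc V \<sigma> D" "opn X U" "tr U \<subseteq> V" "e \<in> sec E U" "p U e = res P V (tr U) \<sigma>"
    "opn X W" "W \<subseteq> U" "g \<in> sec X W"
  shows "\<rho> W (anchor E U e W g) = D (tr W) (\<rho> W g)"
proof -
  have "vfield_restricts X Y \<rho> U (anchor E U e) (Y.vres V (tr U) D)"
    using assms unfolding anchored_def by simp
  moreover have "tr W \<subseteq> tr U" using assms by blast
  ultimately show ?thesis using assms(6-8) restricts_app by fastforce
qed

lemma ancI_local:
  assumes V: "opn Y V" and \<sigma>: "\<sigma> \<in> sec P V" and D: "D \<in> Y.vfs V"
    and loc: "\<And>y. y \<in> V \<Longrightarrow> \<exists>U e. opn X U \<and> y \<in> U \<and> tr U \<subseteq> V \<and> e \<in> sec E U \<and>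
      p U e = res P V (tr U) \<sigma> \<and>
      (\<forall>W g. opn X W \<and> W \<subseteq> U \<and> g \<in> sec X W \<longrightarrow> \<rho> W (anchor E U e W g) = D (tr W) (\<rho> W g))"
  shows "anc V \<sigma> D"
proof -
  have "\<rho> W (anchor E U e W g) = D (tr W) (\<rho> W g)"
    if U: "opn X U" "tr U \<subseteq> V" "e \<in> sec E U" "p U e = res P V (tr U) \<sigma>"
      and W: "opn X W" "W \<subseteq> U" "g \<in> sec X W" for U e W g
  proof (rule Y_eqI[of "tr W"], goal_cases)
    have WV: "tr W \<subseteq> V" using U W by blast
    show "D (tr W) (\<rho> W g) \<in> sec Y (tr W)" using D W WV by simp
    case y: (4 y)
    from loc[OF subsetD[OF WV y]] obtain U' e' where *: "opn X U' \<and> y \<in> U' \<and> tr U' \<subseteq> V \<and> e' \<in> sec E U' \<and>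
      p U' e' = res P V (tr U') \<sigma> \<and>
      (\<forall>W g. opn X W \<and> W \<subseteq> U' \<and> g \<in> sec X W \<longrightarrow> \<rho> W (anchor E U' e' W g) = D (tr W) (\<rho> W g))"
      by (elim exE)
    then have U': "opn X U'" "y \<in> U'" "tr U' \<subseteq> V" "e' \<in> sec E U'" "p U' e' = res P V (tr U') \<sigma>"
      and D': "\<And>W g. \<lbrakk>opn X W; W \<subseteq> U'; g \<in> sec X W\<rbrakk> \<Longrightarrow> \<rho> W (anchor E U' e' W g) = D (tr W) (\<rho> W g)"
      by simp_all
    let ?N = "W \<inter> U'"
    have N: "opn X ?N" "?N \<subseteq> W" "?N \<subseteq> U" "?N \<subseteq> U'" "tr ?N \<subseteq> tr W" using U' W by auto
    have "\<rho> ?N (anchor E ?N (res E U ?N e) ?N (res X W ?N g)) =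
        \<rho> ?N (anchor E ?N (res E U' ?N e') ?N (res X W ?N g))"
    proof (rule rho_anch_cong)
      show "p ?N (res E U ?N e) = p ?N (res E U' ?N e')"
        using lift_res[OF V \<sigma> U N(1,3)] lift_res[OF V \<sigma> U'(1,3,4,5) N(1,4)] by simp
    qed (use N U U' W in auto)
    moreover have "anchor E ?N (res E U ?N e) ?N (res X W ?N g) = res X W ?N (anchor E U e W g)"
      using N U W by (simp add: C.anch_res C.anch_vf_res)
    moreover have "anchor E ?N (res E U' ?N e') ?N (res X W ?N g) = anchor E U' e' ?N (res X W ?N g)"
      using N U' by (simp add: C.anch_res)
    ultimately have "res Y (tr W) (tr ?N) (\<rho> W (anchor E U e W g)) =
        D (tr ?N) (\<rho> ?N (res X W ?N g))"
      using D'[of ?N "res X W ?N g"] N W U rho_res[of W ?N "anchor E U e W g"] by simp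
    also have "\<dots> = res Y (tr W) (tr ?N) (D (tr W) (\<rho> W g))"
      using N W D WV by (simp add: rho_res Y.vf_res)
    finally show ?case using N y U' by (intro exI[of _ ?N]) simp
  qed (use U W in auto)
  moreover have "tr W \<subseteq> tr U" if "W \<subseteq> U" for W U using that by blast
  ultimately show ?thesis unfolding anchored_def vfield_restricts_def using D by simp
qed

lemma anc_unique:
  assumes V: "opn Y V" and \<sigma>: "\<sigma> \<in> sec P V" and D: "anc V \<sigma> D" "anc V \<sigma> D'" shows "D = D'"
proof (rule vfield_Y_eqI[OF V anc_in[OF D(1)] anc_in[OF D(2)]], goal_cases)
  case y: (1 y)
  obtain U e where U: "opn X U" "y \<in> U" "tr U \<subseteq> V" "e \<in> sec E U"
      "p U e = res P V (tr U) \<sigma>" using lift1[OF V \<sigma> y, of "pts X"] pts_YX[OF V y] by auto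
  then show ?case
    using ancD[OF D(1) U(1,3,4,5)] ancD[OF D(2) U(1,3,4,5)] by (intro exI[of _ U]) simp
qed

lemma pa_eq: "\<lbrakk>opn Y V; \<sigma> \<in> sec P V; anc V \<sigma> D\<rbrakk> \<Longrightarrow> pa V \<sigma> = D"
  unfolding pull_anchor_def using anc_unique by (intro the_equality) auto

lemma AP_in [simp]: "\<sigma> \<in> AP V \<Longrightarrow> \<sigma> \<in> sec P V" unfolding anchor_preimage_def by simp

lemma APD: "opn Y V \<Longrightarrow> \<sigma> \<in> AP V \<Longrightarrow> anc V \<sigma> (pa V \<sigma>)" unfolding anchor_preimage_def using pa_eq by auto

lemma API: "\<sigma> \<in> sec P V \<Longrightarrow> anc V \<sigma> D \<Longrightarrow> \<sigma> \<in> AP V" unfolding anchor_preimage_def by auto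

lemma pa_in [simp]: "opn Y V \<Longrightarrow> \<sigma> \<in> AP V \<Longrightarrow> pa V \<sigma> \<in> Y.vfs V" using APD anc_in by blast

lemma anc_p:
  assumes U: "opn X U" "e \<in> sec E U" and D: "D \<in> Y.vfs (tr U)"
    and "\<And>W g. \<lbrakk>opn X W; W \<subseteq> U; g \<in> sec X W\<rbrakk> \<Longrightarrow> \<rho> W (anchor E U e W g) = D (tr W) (\<rho> W g)"
  shows "anc (tr U) (p U e) D"
  by (rule ancI_local) (use assms in \<open>auto intro!: exI[of _ U] exI[of _ e]\<close>)

lemma anc_pD:
  assumes "anc (tr U) (p U e) D" "opn X U" "e \<in> sec E U" "opn X W" "W \<subseteq> U" "g \<in> sec X W"
  shows "\<rho> W (anchor E U e W g) = D (tr W) (\<rho> W g)" by (rule ancD[OF assms(1)]) (use assms in auto)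

lemma anc_zero: "opn Y V \<Longrightarrow> anc V 0 0"
proof (rule ancI_local, goal_cases)
  case V: (4 y)
  then obtain U where "opn X U" "y \<in> U" "tr U \<subseteq> V"
    using opn_nhd[OF V, of "pts X"] pts_YX[OF V] by auto
  then show ?case using V by (intro exI[of _ U] exI[of _ 0]) auto
qed auto

lemma anc_add:
  assumes V: "opn Y V" and \<sigma>: "\<sigma> \<in> sec P V" and \<tau>: "\<tau> \<in> sec P V" and D: "anc V \<sigma> D" "anc V \<tau> D'"
  shows "anc V (\<sigma> + \<tau>) (D + D')"
proof (rule ancI_local[OF V], goal_cases)
  case y: (3 y)
  obtain U e f where U: "opn X U" "y \<in> U" "tr U \<subseteq> V" "e \<in> sec E U"
      "p U e = res P V (tr U) \<sigma>" "f \<in> sec E U" "p U f = res P V (tr U) \<tau>"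
    using lift2[OF V \<sigma> \<tau> y, of "pts X"] pts_YX[OF V y] by auto
  have "\<rho> W (anchor E U (e + f) W g) = (D + D') (tr W) (\<rho> W g)"
    if "opn X W" "W \<subseteq> U" "g \<in> sec X W" for W g
    using U that ancD[OF D(1) U(1,3,4,5) that] ancD[OF D(2) U(1,3,6,7) that]
    by (simp add: C.anch_add rho_add)
  then show ?case
    using V U \<sigma> \<tau> by (intro exI[of _ U] exI[of _ "e + f"]) (simp add: p_add P.M.res_add)
qed (use V \<sigma> \<tau> anc_in[OF D(1)] anc_in[OF D(2)] in auto)

lemma anc_smul:
  assumes V: "opn Y V" and \<sigma>: "\<sigma> \<in> sec P V" and a: "a \<in> sec Y V" and D: "anc V \<sigma> D"
  shows "anc V (smul P V a \<sigma>) (Y.vsmul V a D)"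
proof (rule ancI_local[OF V], goal_cases)
  case y: (3 y)
  obtain N c where N: "opn X N" "y \<in> N" "tr N \<subseteq> V" "c \<in> sec X N"
      "\<rho> N c = res Y V (tr N) a" using rho_lift[OF V a y, of "pts X"] pts_YX[OF V y] by auto
  obtain U e where U: "opn X U" "y \<in> U" "U \<subseteq> N" "tr U \<subseteq> V" "e \<in> sec E U"
      "p U e = res P V (tr U) \<sigma>" using lift1[OF V \<sigma> y N(1,2)] by auto
  let ?c = "res X N U c"
  have c: "\<rho> W (res X N W c) = res Y V (tr W) a" if "opn X W" "W \<subseteq> U" for W
  proof -
    have "tr W \<subseteq> tr N" "W \<subseteq> N" using U that by auto
    then show ?thesis using N V a that by (simp add: rho_res)
  qed
  have "\<rho> W (anchor E U (smul E U ?c e) W g) = Y.vsmul V a D (tr W) (\<rho> W g)"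
    if "opn X W" "W \<subseteq> U" "g \<in> sec X W" for W g
  proof -
    have WN: "W \<subseteq> N" using U that by blast
    then show ?thesis using U N that ancD[OF D U(1,4,5,6) that] c[OF that(1,2)]
    by (simp add: C.anch_smul rho_mult)
  qed
  then show ?case
    using V U N \<sigma> a c[OF U(1)] by (intro exI[of _ U] exI[of _ "smul E U ?c e"]) (simp add: p_smul P.res_smul)
qed (use V \<sigma> a anc_in[OF D] in auto)

lemma anc_res:
  assumes V: "opn Y V" and \<sigma>: "\<sigma> \<in> sec P V" and D: "anc V \<sigma> D" and W: "opn Y W" "W \<subseteq> V"
  shows "anc W (res P V W \<sigma>) (Y.vres V W D)"
proof (rule ancI_local[OF W(1)], goal_cases)
  case y: (3 y)
  obtain U e where U: "opn X U" "y \<in> U" "tr U \<subseteq> W" "e \<in> sec E U"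
      "p U e = res P W (tr U) (res P V W \<sigma>)"
    using lift1[OF W(1) _ y, of _ "pts X"] pts_YX[OF W(1) y] V W \<sigma> P.M.res_in by (metis openin_topspace)
  have e: "p U e = res P V (tr U) \<sigma>" "tr U \<subseteq> V" using U V W \<sigma> by auto
  have sub: "tr W' \<subseteq> W" if "W' \<subseteq> U" for W' using U that by blast
  show ?case using U sub ancD[OF D U(1) e(2) U(4) e(1)] by (intro exI[of _ U] exI[of _ e]) simp
qed (use V W \<sigma> anc_in[OF D] in auto)

lemma AP_zero [simp]: "opn Y V \<Longrightarrow> 0 \<in> AP V" by (rule API[OF _ anc_zero]) simp_all

lemma AP_add [simp]: "\<lbrakk>opn Y V; \<sigma> \<in> AP V; \<tau> \<in> AP V\<rbrakk> \<Longrightarrow> \<sigma> + \<tau> \<in> AP V"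
  using API[OF _ anc_add[OF _ _ _ APD APD]] by simp

lemma AP_smul [simp]: "\<lbrakk>opn Y V; \<sigma> \<in> AP V; a \<in> sec Y V\<rbrakk> \<Longrightarrow> smul P V a \<sigma> \<in> AP V"
  using API[OF _ anc_smul[OF _ _ _ APD]] by simp

lemma AP_uminus [simp]: "opn Y V \<Longrightarrow> \<sigma> \<in> AP V \<Longrightarrow> - \<sigma> \<in> AP V"
  using AP_smul[of V \<sigma> "- const Y V 1"] by (simp add: P.smul_minus_left)

lemma AP_diff [simp]: "\<lbrakk>opn Y V; \<sigma> \<in> AP V; \<tau> \<in> AP V\<rbrakk> \<Longrightarrow> \<sigma> - \<tau> \<in> AP V"
  using AP_add[of V \<sigma> "- \<tau>"] by simp

lemma AP_res [simp]: "\<lbrakk>opn Y V; \<sigma> \<in> AP V; opn Y W; W \<subseteq> V\<rbrakk> \<Longrightarrow> res P V W \<sigma> \<in> AP W"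
  using API[OF _ anc_res[OF _ _ APD]] by simp

lemma pa_zero [simp]: "opn Y V \<Longrightarrow> pa V 0 = 0" by (rule pa_eq[OF _ _ anc_zero]) simp_all

lemma pa_add: "\<lbrakk>opn Y V; \<sigma> \<in> AP V; \<tau> \<in> AP V\<rbrakk> \<Longrightarrow> pa V (\<sigma> + \<tau>) = pa V \<sigma> + pa V \<tau>"
  using pa_eq[OF _ _ anc_add[OF _ _ _ APD APD]] by simp

lemma pa_smul: "\<lbrakk>opn Y V; \<sigma> \<in> AP V; a \<in> sec Y V\<rbrakk> \<Longrightarrow>
    pa V (smul P V a \<sigma>) = Y.vsmul V a (pa V \<sigma>)" using pa_eq[OF _ _ anc_smul[OF _ _ _ APD]] by simp

lemma pa_res: "\<lbrakk>opn Y V; \<sigma> \<in> AP V; opn Y W; W \<subseteq> V\<rbrakk> \<Longrightarrow>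
    pa W (res P V W \<sigma>) = Y.vres V W (pa V \<sigma>)" using pa_eq[OF _ _ anc_res[OF _ _ APD]] by simp

lemma pa_diff:
  assumes "opn Y V" "\<sigma> \<in> AP V" "\<tau> \<in> AP V" shows "pa V (\<sigma> - \<tau>) = pa V \<sigma> - pa V \<tau>"
  using pa_add[of V "\<sigma> - \<tau>" \<tau>] assms by simp

lemma pa_p:
  assumes "p U e \<in> AP (tr U)" "opn X U" "e \<in> sec E U" "opn X W" "W \<subseteq> U" "g \<in> sec X W"
  shows "\<rho> W (anchor E U e W g) = pa (tr U) (p U e) (tr W) (\<rho> W g)"
  by (rule anc_pD[OF APD]) (use assms in auto)

text \<open>
  A derivation of functions along \<open>Y\<close> is a vector field on \<open>Y\<close> as soon as it kills the ideal of
  \<open>Y\<close>, because functions on \<open>Y\<close> extend locally.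
\<close>

lemma AP_tangencyI:
  assumes V: "opn Y V" and \<sigma>: "\<sigma> \<in> sec P V"
    and tang: "\<And>U e g. \<lbrakk>opn X U; tr U \<subseteq> V; e \<in> sec E U; p U e = res P V (tr U) \<sigma>;
      g \<in> sec X U; \<rho> U g = 0\<rbrakk> \<Longrightarrow> \<rho> U (anchor E U e U g) = 0"
  shows "\<sigma> \<in> AP V"
proof -
  let ?A = "\<lambda>U e g. \<rho> U (anchor E U e U g)"
  let ?R = "\<lambda>W s V' r. \<exists>U e g. opn X U \<and> V' = tr U \<and> e \<in> sec E U \<and>
    p U e = res P V (tr U) \<sigma> \<and> g \<in> sec X U \<and> \<rho> U g = res Y W (tr U) s \<and>
    r = ?A U e g"
  let ?E = "\<lambda>W s r. \<forall>V' r'. opn Y V' \<and> V' \<subseteq> W \<and> r' \<in> sec Y V' \<and> ?R W s V' r' \<longrightarrow> res Y W V' r = r'"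
  have lft: "\<exists>U e g. opn X U \<and> y \<in> U \<and> tr U \<subseteq> W \<and> e \<in> sec E U \<and>
      p U e = res P V (tr U) \<sigma> \<and> g \<in> sec X U \<and> \<rho> U g = res Y W (tr U) s"
    if W: "opn Y W" "W \<subseteq> V" "s \<in> sec Y W" and y: "y \<in> W" for W s y
  proof -
    obtain N c where N: "opn X N" "y \<in> N" "tr N \<subseteq> W" "c \<in> sec X N"
        "\<rho> N c = res Y W (tr N) s" using rho_lift[OF W(1,3) y, of "pts X"] pts_YX[OF W(1) y] by auto
    obtain U e where U: "opn X U" "y \<in> U" "U \<subseteq> N" "tr U \<subseteq> V" "e \<in> sec E U"
        "p U e = res P V (tr U) \<sigma>" using lift1[OF V \<sigma> subsetD[OF W(2) y] N(1,2)] by auto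
    have UN: "tr U \<subseteq> tr N" "tr U \<subseteq> W" using U N by auto
    have "\<rho> U (res X N U c) = res Y W (tr U) s" using U N W by (simp add: rho_res)
    then show ?thesis using U N UN by (intro exI[of _ U] exI[of _ e] exI[of _ "res X N U c"]) simp
  qed
  have ex1: "\<exists>!r. r \<in> sec Y W \<and> ?E W s r" if W: "opn Y W" "W \<subseteq> V" "s \<in> sec Y W" for W s
  proof (rule Y.O.glue_rel[OF W(1)])
    fix y assume y: "y \<in> W"
    obtain U e g where U: "opn X U" "y \<in> U" "tr U \<subseteq> W" "e \<in> sec E U"
      "p U e = res P V (tr U) \<sigma>" "g \<in> sec X U" "\<rho> U g = res Y W (tr U) s" using lft[OF W y] by auto
    have "?A U e g \<in> sec Y (tr U)" using U by simp
    moreover have "?R W s (tr U) (?A U e g)" using U by blast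
    ultimately show "\<exists>V' r. opn Y V' \<and> y \<in> V' \<and> V' \<subseteq> W \<and> r \<in> sec Y V' \<and> ?R W s V' r"
      using U pts_Y[OF W(1) y] opn_trace[OF U(1)] by blast
  next
    fix V1 r1 V2 r2
    assume V1: "V1 \<subseteq> W" "?R W s V1 r1" and V2: "V2 \<subseteq> W" "?R W s V2 r2"
    obtain U1 e1 f1 where 1: "opn X U1" "V1 = tr U1" "e1 \<in> sec E U1"
      "p U1 e1 = res P V (tr U1) \<sigma>" "f1 \<in> sec X U1" "\<rho> U1 f1 = res Y W (tr U1) s"
      "r1 = ?A U1 e1 f1" using V1 by blast
    obtain U2 e2 f2 where 2: "opn X U2" "V2 = tr U2" "e2 \<in> sec E U2"
      "p U2 e2 = res P V (tr U2) \<sigma>" "f2 \<in> sec X U2" "\<rho> U2 f2 = res Y W (tr U2) s"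
      "r2 = ?A U2 e2 f2" using V2 by blast
    let ?U = "U1 \<inter> U2"
    let ?e1 = "res E U1 ?U e1" and ?e2 = "res E U2 ?U e2" and ?f1 = "res X U1 ?U f1"
      and ?f2 = "res X U2 ?U f2"
    have eq: "V1 \<inter> V2 = tr ?U" using 1 2 by blast
    have sub: "tr ?U \<subseteq> V" "tr ?U \<subseteq> tr U1" "tr ?U \<subseteq> tr U2"
      "tr U1 \<subseteq> V" "tr U2 \<subseteq> V" using V1 V2 1 2 W by auto
    have p1: "p ?U ?e1 = res P V (tr ?U) \<sigma>" and p2: "p ?U ?e2 = res P V (tr ?U) \<sigma>"
      using lift_res[of V \<sigma> U1 e1 ?U] lift_res[of V \<sigma> U2 e2 ?U] V \<sigma> 1 2 sub by simp_all
    have f: "\<rho> ?U (?f1 - ?f2) = 0" using 1 2 V1 V2 W by (simp add: rho_diff rho_res)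
    have "?A ?U ?e1 ?f1 = ?A ?U ?e2 ?f1" by (rule rho_anch_cong) (use 1 2 p1 p2 in auto)
    also have "\<dots> = ?A ?U ?e2 ?f2 + ?A ?U ?e2 (?f1 - ?f2)"
      using 1 2 C.anch_vf_add[of ?U ?e2 ?U ?f2 "?f1 - ?f2"] by (simp add: rho_add[symmetric])
    also have "?A ?U ?e2 (?f1 - ?f2) = 0" by (rule tang) (use 1 2 sub p2 f in auto)
    finally show "res Y V1 (V1 \<inter> V2) r1 = res Y V2 (V1 \<inter> V2) r2"
      unfolding eq using 1 2 by (simp add: C.anch_res C.anch_vf_res rho_res)
  qed
  define D where "D W s = (if opn Y W \<and> W \<subseteq> V \<and> s \<in> sec Y W then THE r. r \<in> sec Y W \<and>
    ?E W s r else 0)" for W s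
  have D0: "D W s \<in> sec Y W \<and> ?E W s (D W s)" if "opn Y W" "W \<subseteq> V" "s \<in> sec Y W" for W s
  proof -
    have eq: "D W s = (THE r. r \<in> sec Y W \<and> ?E W s r)" by (simp only: D_def that simp_thms if_True)
    show ?thesis unfolding eq by (rule theI'[OF ex1[OF that]])
  qed
  have D_in: "D W s \<in> sec Y W" if "opn Y W" "W \<subseteq> V" "s \<in> sec Y W" for W s
    using D0[OF that] by (rule conjunct1)
  have DD: "res Y W (tr U) (D W s) = ?A U e g"
    if W: "opn Y W" "W \<subseteq> V" "s \<in> sec Y W" and U: "opn X U" "tr U \<subseteq> W" "e \<in> sec E U"
      "p U e = res P V (tr U) \<sigma>" "g \<in> sec X U" "\<rho> U g = res Y W (tr U) s" for W s U e g
  proof -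
    have "?R W s (tr U) (?A U e g)" using U by blast
    from D0[OF W, THEN conjunct2, rule_format, OF conjI[OF _ conjI[OF _ conjI[OF _ this]]]]
    show ?thesis using U by simp
  qed
  have DT: "D \<in> Y.vfs V"
  proof (rule Y.tangentI, goal_cases)
    case (2 W s t)
    note W = 2(1,2) and s = 2(3) and t = 2(4)
    have "D W (s + t) = D W s + D W t \<and> D W (s * t) = D W s * t + s * D W t"
    proof (intro conjI; rule Y_eqI[OF W(1)])
      fix y assume y: "y \<in> W"
      obtain U1 e1 g1 where 1: "opn X U1" "y \<in> U1" "tr U1 \<subseteq> W" "e1 \<in> sec E U1"
        "p U1 e1 = res P V (tr U1) \<sigma>" "g1 \<in> sec X U1" "\<rho> U1 g1 = res Y W (tr U1) s"
        using lft[OF W s y] by auto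
      obtain U2 g2 where 2: "opn X U2" "y \<in> U2" "U2 \<subseteq> U1" "tr U2 \<subseteq> W"
        "g2 \<in> sec X U2" "\<rho> U2 g2 = res Y W (tr U2) t" using rho_lift[OF W(1) t y 1(1,2)] by auto
      let ?e = "res E U1 U2 e1" and ?g = "res X U1 U2 g1"
      have sub: "tr U2 \<subseteq> tr U1" "tr U1 \<subseteq> V" using 1 2 W by auto
      have e: "?e \<in> sec E U2" "p U2 ?e = res P V (tr U2) \<sigma>"
        using 1 2 lift_res[OF V \<sigma> 1(1) sub(2) 1(4,5) 2(1,3)] by simp_all
      have g: "?g \<in> sec X U2" "\<rho> U2 ?g = res Y W (tr U2) s" using 1 2 W s by (simp_all add: rho_res)
      have Ds: "res Y W (tr U2) (D W s) = ?A U2 ?e ?g" by (rule DD[OF W s 2(1,4) e g])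
      have Dt: "res Y W (tr U2) (D W t) = ?A U2 ?e g2" by (rule DD[OF W t 2(1,4) e 2(5,6)])
      have "res Y W (tr U2) (D W (s + t)) = ?A U2 ?e (?g + g2)"
        by (rule DD[OF W _ 2(1,4) e]) (use s t W 2 g in \<open>auto simp: rho_add Y.O.res_add\<close>)
      then have "res Y W (tr U2) (D W (s + t)) = res Y W (tr U2) (D W s + D W t)"
        using s t W 2 g e Ds Dt by (simp add: C.anch_vf_add rho_add Y.O.res_add D_in)
      then show "\<exists>U. opn X U \<and> y \<in> U \<and> tr U \<subseteq> W \<and>
           res Y W (tr U) (D W (s + t)) = res Y W (tr U) (D W s + D W t)" using 2 by blast
      have "res Y W (tr U2) (D W (s * t)) = ?A U2 ?e (?g * g2)"
        by (rule DD[OF W _ 2(1,4) e]) (use s t W 2 g in \<open>auto simp: rho_mult Y.res_mult\<close>)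
      also have "anchor E U2 ?e U2 (?g * g2) = anchor E U2 ?e U2 ?g * g2 + ?g * anchor E U2 ?e U2 g2"
        by (rule X.vf_mult[OF C.anch_in]) (use 2 e g in auto)
      finally have "res Y W (tr U2) (D W (s * t)) = res Y W (tr U2) (D W s * t + s * D W t)"
        using s t W 2 g e Ds Dt by (simp add: rho_mult rho_add Y.O.res_add Y.res_mult D_in)
      then show "\<exists>U. opn X U \<and> y \<in> U \<and> tr U \<subseteq> W \<and>
           res Y W (tr U) (D W (s * t)) = res Y W (tr U) (D W s * t + s * D W t)" using 2 by blast
    qed (use W s t D_in in auto)
    then show ?case "D W (s * t) = D W s * t + s * D W t" by simp_all
  next
    case W: (4 W a)
    show ?case
    proof (rule Y_eqI[OF W(1)], goal_cases)
      case y: (3 y)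
      obtain U e g where U: "opn X U" "y \<in> U" "tr U \<subseteq> W" "e \<in> sec E U"
        "p U e = res P V (tr U) \<sigma>" "g \<in> sec X U" "\<rho> U g = res Y W (tr U) (const Y W a)"
        using lft[OF W _ y, of "const Y W a"] W by auto
      have "res Y W (tr U) (D W (const Y W a)) = ?A U e (const X U a)"
        by (rule DD) (use U W in auto)
      also have "anchor E U e U (const X U a) = 0"
        by (rule X.vf_const[OF C.anch_in]) (use U in auto)
      finally show ?case using U W by (intro exI[of _ U]) simp
    qed (use W D_in in auto)
  next
    case (5 W W' s)
    note W = 5(1-4) and s = 5(5)
    have W'V: "W' \<subseteq> V" using W by blast
    have s': "res Y W W' s \<in> sec Y W'" using W s by simp
    show ?case
    proof (rule Y_eqI[OF W(3)], goal_cases)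
      case y: (3 y)
      obtain U e g where U: "opn X U" "y \<in> U" "tr U \<subseteq> W'" "e \<in> sec E U"
        "p U e = res P V (tr U) \<sigma>" "g \<in> sec X U" "\<rho> U g = res Y W' (tr U) (res Y W W' s)"
        using lft[OF W(3) W'V s' y] by auto
      have UW: "tr U \<subseteq> W" using U W by blast
      have "res Y W' (tr U) (D W' (res Y W W' s)) = ?A U e g"
        by (rule DD[OF W(3) W'V s' U(1,3,4,5,6,7)])
      moreover have "res Y W (tr U) (D W s) = ?A U e g"
        by (rule DD[OF W(1,2) s U(1) UW U(4,5,6)]) (use U W s in simp)
      ultimately show ?case using U W s D_in[OF W(1,2) s] by (intro exI[of _ U]) simp
    qed (use W W'V s s' D_in in auto)
  next
    case (6 W s)
    then show ?case unfolding D_def by (simp only: if_False)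
  qed (rule D_in)
  have "anc V \<sigma> D"
  proof (rule ancI_local[OF V \<sigma> DT], goal_cases)
    case y: (1 y)
    obtain U e where U: "opn X U" "y \<in> U" "tr U \<subseteq> V" "e \<in> sec E U"
        "p U e = res P V (tr U) \<sigma>" using lift1[OF V \<sigma> y, of "pts X"] pts_YX[OF V y] by auto
    have "\<rho> W (anchor E U e W g) = D (tr W) (\<rho> W g)" if W: "opn X W" "W \<subseteq> U" "g \<in> sec X W" for W g
    proof -
      have WV: "tr W \<subseteq> V" using U W by blast
      have "res Y (tr W) (tr W) (D (tr W) (\<rho> W g)) = \<rho> W (anchor E W (res E U W e) W g)"
        by (rule DD) (use U W WV lift_res[OF V \<sigma> U(1,3,4,5) W(1,2)] in auto)
      then show ?thesis using U W WV D_in by (simp add: C.anch_res)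
    qed
    then show ?case using U by (intro exI[of _ U] exI[of _ e]) simp
  qed
  then show ?thesis using API \<sigma> by blast
qed

lemma AP_local:
  assumes V: "opn Y V" and \<sigma>: "\<sigma> \<in> sec P V"
    and loc: "\<And>y. y \<in> V \<Longrightarrow> \<exists>W. opn Y W \<and> y \<in> W \<and> W \<subseteq> V \<and> res P V W \<sigma> \<in> AP W"
  shows "\<sigma> \<in> AP V"
proof (rule AP_tangencyI[OF V \<sigma>], goal_cases)
  case (1 U e g)
  note U = 1(1-4) and g = 1(5,6)
  show ?case
  proof (rule Y_eqI[of "tr U"], goal_cases)
    case y: (4 y)
    then obtain W where W: "opn Y W" "y \<in> W" "W \<subseteq> V" "res P V W \<sigma> \<in> AP W" using loc[of y] U by blast
    obtain N where N: "opn X N" "y \<in> N" "N \<subseteq> U" "tr N \<subseteq> W" using opn_nhd[OF W(1,2) U(1)] y by auto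
    have NU: "tr N \<subseteq> tr U" using N by blast
    have pe: "p N (res E U N e) = res P W (tr N) (res P V W \<sigma>)"
      using lift_res[OF V \<sigma> U N(1,3)] V \<sigma> W N by simp
    have "\<rho> N (anchor E N (res E U N e) N (res X U N g)) = pa W (res P V W \<sigma>) (tr N) (\<rho> N (res X U N g))"
      by (rule ancD[OF APD[OF W(1,4)] N(1,4) _ pe]) (use N U g in auto)
    also have "\<dots> = 0" using N U g pa_in[OF W(1,4)] by (simp add: rho_res)
    finally have "res Y (tr U) (tr N) (\<rho> U (anchor E U e U g)) = 0"
      using U N g by (simp add: C.anch_res C.anch_vf_res rho_res)
    then show ?case using N NU U by (intro exI[of _ N]) simp
  qed (use U g in auto)
qed

lemma anc_coanchor:
  "opn X U \<Longrightarrow> \<omega> \<in> X.forms U \<Longrightarrow> anc (tr U) (p U (coanchor X E U \<omega>)) 0" by (rule anc_p) auto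

lemma AP_coanchor [simp]: "opn X U \<Longrightarrow> \<omega> \<in> X.forms U \<Longrightarrow> p U (coanchor X E U \<omega>) \<in> AP (tr U)"
  by (rule API[OF _ anc_coanchor]) auto

lemma pa_coanchor [simp]: "opn X U \<Longrightarrow> \<omega> \<in> X.forms U \<Longrightarrow> pa (tr U) (p U (coanchor X E U \<omega>)) = 0"
  by (rule pa_eq[OF _ _ anc_coanchor]) auto

lemma form_restricts_app: "\<lbrakk>form_restricts X Y \<rho> U \<omega> \<eta>; opn X W; W \<subseteq> U; v \<in> X.vfs W;
    D \<in> Y.vfs (tr W); vfield_restricts X Y \<rho> W v D\<rbrakk> \<Longrightarrow> \<rho> W (\<omega> W v) = \<eta> (tr W) D"
  unfolding form_restricts_def by simp

lemma anc_restricts: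
  assumes "anc V \<tau> D" "opn X U" "tr U \<subseteq> V" "e \<in> sec E U" "p U e = res P V (tr U) \<tau>"
  shows "vfield_restricts X Y \<rho> U (anchor E U e) (Y.vres V (tr U) D)"
  using assms unfolding anchored_def by simp

lemma pp_coanchor:
  assumes U: "opn X U" and \<omega>: "\<omega> \<in> X.forms U" and V: "opn Y V" "tr U \<subseteq> V" and \<eta>: "\<eta> \<in> Y.forms V"
    and r: "form_restricts X Y \<rho> U \<omega> \<eta>" and \<tau>: "\<tau> \<in> AP (tr U)"
  shows "pp (tr U) (p U (coanchor X E U \<omega>)) \<tau> = \<eta> (tr U) (pa (tr U) \<tau>)"
proof (rule Y_eqI[of "tr U"], goal_cases)
  let ?V = "tr U" and ?\<sigma> = "p U (coanchor X E U \<omega>)"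
  case y: (4 y)
  then obtain N f where N: "opn X N" "y \<in> N" "N \<subseteq> U" "tr N \<subseteq> ?V" "f \<in> sec E N"
      "p N f = res P ?V (tr N) \<tau>" using lift1[of ?V \<tau> y U] U \<tau> by auto
  have "res Y ?V (tr N) (pp ?V ?\<sigma> \<tau>) = \<rho> N (pairing E N (res E U N (coanchor X E U \<omega>)) f)"
    by (rule pp_lift) (use U \<omega> \<tau> N in \<open>auto simp: p_res\<close>)
  also have "\<dots> = \<rho> N (\<omega> N (anchor E N f))" using U \<omega> N by (simp add: C.pair_coanchor_res)
  also have "\<dots> = \<eta> (tr N) (Y.vres ?V (tr N) (pa ?V \<tau>))"
  proof (rule form_restricts_app[OF r N(1,3)])
    show "vfield_restricts X Y \<rho> N (anchor E N f) (Y.vres ?V (tr N) (pa ?V \<tau>))"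
      by (rule anc_restricts[OF APD]) (use U \<tau> N in auto)
  qed (use N U \<tau> in auto)
  also have "\<dots> = res Y ?V (tr N) (\<eta> ?V (pa ?V \<tau>))" using U V \<eta> \<tau> N by (intro Y.cot_res) auto
  finally show ?case using N by blast
qed (use U V \<omega> \<eta> \<tau> in auto)

lemma CN_dg:
  assumes U: "opn X U" and g: "g \<in> sec X U" "\<rho> U g = 0" shows "p U (dstar U g) \<in> CN (tr U)"
proof -
  have "form_restricts X Y \<rho> U (differential X U g) 0" unfolding form_restricts_def
  proof (intro allI impI, elim conjE, goal_cases)
    case (1 W v D)
    note W = 1(1-4) and r = 1(5)
    have "tr W \<subseteq> tr U" using W by blast
    then have "\<rho> W (res X U W g) = 0" using U W g by (simp add: rho_res)
    then show ?case
      using restricts_app[OF r W(1), of "res X U W g"] U W g by (simp add: X.differential_app)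
  qed
  then show ?thesis using U g unfolding conormal_def
    by (auto intro!: exI[of _ U] bexI[of _ "differential X U g"])
qed

lemma perp_CN_AP:
  assumes V: "opn Y V" and \<sigma>: "\<sigma> \<in> sec P V"
    and perp: "\<And>W \<tau>. \<lbrakk>opn Y W; W \<subseteq> V; \<tau> \<in> CN W\<rbrakk> \<Longrightarrow> pp W (res P V W \<sigma>) \<tau> = 0"
  shows "\<sigma> \<in> AP V"
proof (rule AP_tangencyI[OF V \<sigma>], goal_cases)
  case (1 U e g)
  note U = 1(1-4) and g = 1(5,6)
  let ?dg = "dstar U g"
  have "pp (tr U) (res P V (tr U) \<sigma>) (p U ?dg) = 0" by (rule perp[OF _ _ CN_dg]) (use U g in auto)
  then have "\<rho> U (pairing E U e ?dg) = 0" using U g pp_p[of U e ?dg] by simp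
  then show ?case using U g C.pair_sym[of U e ?dg] by (simp add: C.pair_coanchor X.differential_app)
qed

end

section \<open>Local frames\<close>

text \<open>
  Functions \<open>f\<^sub>i\<close> and vector fields \<open>d\<^sub>i\<close> with \<open>v = \<Sum>\<^sub>i v(f\<^sub>i) d\<^sub>i\<close> for all vector fields \<open>v\<close>.
  The local existence of such a dual basis is the only geometric input: the rest is formal.
\<close>

definition frame_on ::
    "('x, 'r::comm_ring, 'k::field_char_0) ringed_space \<Rightarrow> 'x set \<Rightarrow> nat \<Rightarrow> (nat \<Rightarrow> 'r) \<Rightarrow>
     (nat \<Rightarrow> ('x, 'r) vfield) \<Rightarrow> bool" where
  "frame_on X U n f d \<longleftrightarrow> opn X U \<and> (\<forall>i<n. f i \<in> sec X U \<and> d i \<in> sec (tangent X) U) \<and>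
     (\<forall>W v s. opn X W \<and> W \<subseteq> U \<and> v \<in> sec (tangent X) W \<and> s \<in> sec X W \<longrightarrow>
        v W s = (\<Sum>i<n. v W (res X U W (f i)) * d i W s))"

definition locally_framed :: "('x, 'r::comm_ring, 'k::field_char_0) ringed_space \<Rightarrow> bool" where
  "locally_framed X \<longleftrightarrow> (\<forall>x\<in>pts X. \<exists>U n f d. x \<in> U \<and> frame_on X U n f d)"

lemma sum_fun2_app: "(\<Sum>i\<in>I. g i) W s = (\<Sum>i\<in>I. (g i :: 'a \<Rightarrow> 'b \<Rightarrow> 'c::comm_monoid_add) W s)"
  by (induction I rule: infinite_finite_induct) auto

lemma finite_nhd:
  assumes "x \<in> topspace T" and "\<And>i. i < n \<Longrightarrow> \<exists>V. openin T V \<and> x \<in> V \<and> R i V"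
    and "\<And>i V W. \<lbrakk>i < n; R i V; openin T V; openin T W; x \<in> W; W \<subseteq> V\<rbrakk> \<Longrightarrow> R i W"
  shows "\<exists>V. openin T V \<and> x \<in> V \<and> (\<forall>i<(n::nat). R i V)" using assms
proof (induction n)
  case 0
  then show ?case by (intro exI[of _ "topspace T"]) simp
next
  case (Suc n)
  obtain V where V: "openin T V" "x \<in> V" "\<forall>i<n. R i V" using Suc.IH Suc.prems less_SucI by metis
  obtain V' where V': "openin T V'" "x \<in> V'" "R n V'" using Suc.prems(2) by blast
  have int: "openin T (V \<inter> V')" "x \<in> V \<inter> V'" using V V' by auto
  have "R i (V \<inter> V')" if "i < Suc n" for i
  proof (cases "i = n")
    case True
    then show ?thesis using Suc.prems(3)[of n V' "V \<inter> V'"] V' int by simp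
  next
    case False
    then show ?thesis using Suc.prems(3)[of i V "V \<inter> V'"] V int that by simp
  qed
  then show ?case using int by blast
qed

context krs
begin

lemma frame_eq: "\<lbrakk>frame_on X U n f d; opn X W; W \<subseteq> U; v \<in> vfs W; s \<in> sec X W\<rbrakk> \<Longrightarrow>
    v W s = (\<Sum>i<n. v W (res X U W (f i)) * d i W s)" unfolding frame_on_def by simp

lemma frame_in:
  "frame_on X U n f d \<Longrightarrow> i < n \<Longrightarrow> f i \<in> sec X U" "frame_on X U n f d \<Longrightarrow> i < n \<Longrightarrow> d i \<in> vfs U"
  "frame_on X U n f d \<Longrightarrow> opn X U" unfolding frame_on_def by simp_all

lemma frame_res:
  assumes fr: "frame_on X U n f d" and V: "opn X V" "V \<subseteq> U"
  shows "frame_on X V n (\<lambda>i. res X U V (f i)) (\<lambda>i. vres U V (d i))" unfolding frame_on_def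
proof (intro conjI allI impI, goal_cases)
  case W: (4 W v s)
  then have "v W s = (\<Sum>i<n. v W (res X U W (f i)) * d i W s)"
    using V by (intro frame_eq[OF fr]) auto
  also have "\<dots> = (\<Sum>i<n. v W (res X V W (res X U V (f i))) * vres U V (d i) W s)"
    using W V frame_in[OF fr] by (intro sum.cong) auto
  finally show ?case .
qed (use V frame_in[OF fr] in auto)

lemma frame_at:
  assumes fr: "locally_framed X" and N: "opn X N" "x \<in> N"
  shows "\<exists>U n f d. x \<in> U \<and> U \<subseteq> N \<and> frame_on X U n f d"
proof -
  have "x \<in> pts X" using N openin_subset by blast
  then obtain U n f d where U: "x \<in> U" "frame_on X U n f d"
    using fr unfolding locally_framed_def by metis
  have "frame_on X (U \<inter> N) n (\<lambda>i. res X U (U \<inter> N) (f i)) (\<lambda>i. vres U (U \<inter> N) (d i))"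
    by (rule frame_res[OF U(2)]) (use N frame_in[OF U(2)] in auto)
  then show ?thesis using U N by blast
qed

lemma frame_vec:
  assumes fr: "frame_on X U n f d" and W: "opn X W" "W \<subseteq> U" and v: "v \<in> vfs W"
  shows "v = (\<Sum>i<n. vsmul W (v W (res X U W (f i))) (vres U W (d i)))"
proof (rule vf_eqI[OF v], goal_cases)
  show "(\<Sum>i<n. vsmul W (v W (res X U W (f i))) (vres U W (d i))) \<in> vfs W"
    using frame_in[OF fr] W v by (intro sum_vf_in) auto
  case W': (2 W' s)
  have "v W' s = vres W W' v W' s" by simp
  also have "\<dots> = (\<Sum>i<n. vres W W' v W' (res X U W' (f i)) * d i W' s)"
    by (rule frame_eq[OF fr]) (use W W' v in auto)
  also have "\<dots> = (\<Sum>i<n. vsmul W (v W (res X U W (f i))) (vres U W (d i))) W' s"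
    unfolding sum_fun2_app
  proof (rule sum.cong[OF refl], goal_cases)
    case (1 i)
    then have i: "f i \<in> sec X U" using frame_in[OF fr] by simp
    have "v W' (res X W W' (res X U W (f i))) = res X W W' (v W (res X U W (f i)))"
      by (rule vf_res[OF v W(1) subset_refl W'(1,2)]) (use W W' v i frame_in[OF fr] in auto)
    then show ?case using W W' i frame_in[OF fr] by simp
  qed
  finally show ?case .
qed

lemma frame_cot:
  assumes fr: "frame_on X U n f d" and \<eta>: "\<eta> \<in> forms V" and W: "opn X W" "W \<subseteq> U" "W \<subseteq> V"
    and v: "v \<in> vfs W"
  shows "\<eta> W v = (\<Sum>i<n. v W (res X U W (f i)) * \<eta> W (vres U W (d i)))"
proof -
  have *: "v W (res X U W (f i)) \<in> sec X W" "vres U W (d i) \<in> vfs W" if "i < n" for i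
    using frame_in[OF fr] W v that by auto
  have "\<eta> W v = \<eta> W (\<Sum>i<n. vsmul W (v W (res X U W (f i))) (vres U W (d i)))"
    using frame_vec[OF fr W(1,2) v] by simp
  also have "\<dots> = (\<Sum>i<n. \<eta> W (vsmul W (v W (res X U W (f i))) (vres U W (d i))))"
    using * W by (intro cot_sum[OF \<eta>]) auto
  also have "\<dots> = (\<Sum>i<n. v W (res X U W (f i)) * \<eta> W (vres U W (d i)))"
    using * W by (intro sum.cong refl cot_smul[OF \<eta>]) auto
  finally show ?thesis .
qed

end

section \<open>The induced Courant algebroid on the submanifold\<close>

locale restricted = pulled X Y \<rho> E P p for X :: "('x, 'r::comm_ring, 'k::field_char_0) ringed_space"
    and Y :: "('x, 's::comm_ring, 'k) ringed_space" and \<rho>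
    and E :: "('x, 'r, 'e::ab_group_add) courant"
    and P :: "('x, 's, 'p::ab_group_add) msheaf" and p +
  fixes Q :: "('x, 's, 'q::ab_group_add) courant" and q :: "'x set \<Rightarrow> 'p \<Rightarrow> 'q"
  assumes cpb: "is_courant_pullback X Y \<rho> E P p Q q" and framed_X: "locally_framed X"
    and framed_Y: "locally_framed Y"
begin

lemmas Q_data = cpb[unfolded is_courant_pullback_def, THEN conjunct1]
lemmas q_hom = cpb[unfolded is_courant_pullback_def, THEN conjunct2, THEN conjunct1,
    unfolded hom_on_def, rule_format]
lemmas q_onto = cpb[unfolded is_courant_pullback_def, THEN conjunct2, THEN conjunct2, THEN conjunct1,
    unfolded locally_onto_def, rule_format]
lemmas q_struct = cpb[unfolded is_courant_pullback_def, THEN conjunct2, THEN conjunct2, THEN conjunct2,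
    THEN conjunct1, rule_format]
lemmas q_brk = cpb[unfolded is_courant_pullback_def, THEN conjunct2, THEN conjunct2, THEN conjunct2,
    THEN conjunct2, rule_format]
lemmas Q_data_at = Q_data[unfolded courant_data_def, THEN conjunct2, rule_format]

sublocale Q: kmod Y Q by (rule kmod.intro, rule Y.krs_axioms, rule kmod_axioms.intro)
    (rule Q_data[unfolded courant_data_def, THEN conjunct1])

lemma opn_sub: "opn Y V \<Longrightarrow> V \<subseteq> pts Y" by (rule openin_subset)

lemma q_in [simp]: "opn Y V \<Longrightarrow> \<sigma> \<in> AP V \<Longrightarrow> q V \<sigma> \<in> sec Q V"
  using q_hom[of V, THEN conjunct1] opn_sub by simp

lemma q_add: "\<lbrakk>opn Y V; \<sigma> \<in> AP V; \<tau> \<in> AP V\<rbrakk> \<Longrightarrow> q V (\<sigma> + \<tau>) = q V \<sigma> + q V \<tau>"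
  using q_hom[of V, THEN conjunct2, THEN conjunct1] opn_sub by simp

lemma q_smul: "\<lbrakk>opn Y V; \<sigma> \<in> AP V; a \<in> sec Y V\<rbrakk> \<Longrightarrow> q V (smul P V a \<sigma>) = smul Q V a (q V \<sigma>)"
  using q_hom[of V, THEN conjunct2, THEN conjunct2, THEN conjunct1] opn_sub by simp

lemma q_res: "\<lbrakk>opn Y V; \<sigma> \<in> AP V; opn Y W; W \<subseteq> V\<rbrakk> \<Longrightarrow> q W (res P V W \<sigma>) = res Q V W (q V \<sigma>)"
  using q_hom[of V, THEN conjunct2, THEN conjunct2, THEN conjunct2] opn_sub by simp

lemma q_zero [simp]: "opn Y V \<Longrightarrow> q V 0 = 0" using q_add[of V 0 0] by simp

lemma q_uminus: "opn Y V \<Longrightarrow> \<sigma> \<in> AP V \<Longrightarrow> q V (- \<sigma>) = - q V \<sigma>"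
  using q_add[of V \<sigma> "- \<sigma>"] by (simp add: eq_neg_iff_add_eq_0 add.commute)

lemma q_diff: "\<lbrakk>opn Y V; \<sigma> \<in> AP V; \<tau> \<in> AP V\<rbrakk> \<Longrightarrow> q V (\<sigma> - \<tau>) = q V \<sigma> - q V \<tau>"
  using q_add[of V \<sigma> "- \<tau>"] by (simp add: q_uminus)

lemma CN_iff: "opn Y V \<Longrightarrow> \<sigma> \<in> CN V \<longleftrightarrow> \<sigma> \<in> AP V \<and> q V \<sigma> = 0" using q_struct[of V] by auto

lemma pair_q [simp]: "\<lbrakk>opn Y V; \<sigma> \<in> AP V; \<tau> \<in> AP V\<rbrakk> \<Longrightarrow> pairing Q V (q V \<sigma>) (q V \<tau>) = pp V \<sigma> \<tau>"
  using q_struct[of V] by simp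

lemma anch_q [simp]: "opn Y V \<Longrightarrow> \<sigma> \<in> AP V \<Longrightarrow> anchor Q V (q V \<sigma>) = pa V \<sigma>" using q_struct[of V] by auto

lemma brk_q: "\<lbrakk>opn X U; e \<in> sec E U; f \<in> sec E U; p U e \<in> AP (tr U); p U f \<in> AP (tr U)\<rbrakk> \<Longrightarrow>
    bracket Q (tr U) (q (tr U) (p U e)) (q (tr U) (p U f)) =
      q (tr U) (p U (bracket E U e f))" using q_brk[of U e f] by simp

lemma pairQ_in [simp]: "\<lbrakk>opn Y V; \<kappa> \<in> sec Q V; \<mu> \<in> sec Q V\<rbrakk> \<Longrightarrow> pairing Q V \<kappa> \<mu> \<in> sec Y V"
  using Q_data_at[of V \<kappa> \<mu>] by simp

lemma anchQ_in [simp]: "opn Y V \<Longrightarrow> \<kappa> \<in> sec Q V \<Longrightarrow> anchor Q V \<kappa> \<in> Y.vfs V"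
  using Q_data_at[of V \<kappa> \<kappa>] by simp

lemma brkQ_in [simp]: "\<lbrakk>opn Y V; \<kappa> \<in> sec Q V; \<mu> \<in> sec Q V\<rbrakk> \<Longrightarrow> bracket Q V \<kappa> \<mu> \<in> sec Q V"
  using Q_data_at[of V \<kappa> \<mu>] by simp

lemma pairQ_res: "\<lbrakk>opn Y V; \<kappa> \<in> sec Q V; \<mu> \<in> sec Q V; opn Y W; W \<subseteq> V\<rbrakk> \<Longrightarrow>
    pairing Q W (res Q V W \<kappa>) (res Q V W \<mu>) = res Y V W (pairing Q V \<kappa> \<mu>)"
  using Q_data_at[of V \<kappa> \<mu>] by simp

lemma anchQ_res: "\<lbrakk>opn Y V; \<kappa> \<in> sec Q V; opn Y W; W \<subseteq> V\<rbrakk> \<Longrightarrow>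
    anchor Q W (res Q V W \<kappa>) = Y.vres V W (anchor Q V \<kappa>)" using Q_data_at[of V \<kappa> \<kappa>] by simp

lemma brkQ_res: "\<lbrakk>opn Y V; \<kappa> \<in> sec Q V; \<mu> \<in> sec Q V; opn Y W; W \<subseteq> V\<rbrakk> \<Longrightarrow>
    bracket Q W (res Q V W \<kappa>) (res Q V W \<mu>) = res Q V W (bracket Q V \<kappa> \<mu>)"
  using Q_data_at[of V \<kappa> \<mu>] by simp

lemma q_lift:
  assumes "opn Y V" "\<kappa> \<in> sec Q V" "y \<in> V"
  shows "\<exists>W \<sigma>. opn Y W \<and> y \<in> W \<and> W \<subseteq> V \<and> \<sigma> \<in> AP W \<and> q W \<sigma> = res Q V W \<kappa>"
  using q_onto[of V \<kappa> y] assms by auto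

lemma q_lift2:
  assumes V: "opn Y V" "\<kappa> \<in> sec Q V" "\<mu> \<in> sec Q V" "y \<in> V"
  shows "\<exists>W \<sigma> \<tau>. opn Y W \<and> y \<in> W \<and> W \<subseteq> V \<and> \<sigma> \<in> AP W \<and> q W \<sigma> = res Q V W \<kappa> \<and>
    \<tau> \<in> AP W \<and> q W \<tau> = res Q V W \<mu>"
proof -
  obtain W \<sigma> where W: "opn Y W" "y \<in> W" "W \<subseteq> V" "\<sigma> \<in> AP W" "q W \<sigma> = res Q V W \<kappa>"
    using q_lift[OF V(1,2,4)] by auto
  obtain W' \<tau> where W': "opn Y W'" "y \<in> W'" "W' \<subseteq> W" "\<tau> \<in> AP W'" "q W' \<tau> = res Q W W' (res Q V W \<mu>)"
    using q_lift[of W "res Q V W \<mu>" y] V W by auto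
  show ?thesis using W W' V
    by (intro exI[of _ W'] exI[of _ "res P W W' \<sigma>"] exI[of _ \<tau>]) (auto simp: q_res)
qed

lemma anchQ_add:
  assumes V: "opn Y V" "\<kappa> \<in> sec Q V" "\<mu> \<in> sec Q V"
  shows "anchor Q V (\<kappa> + \<mu>) = anchor Q V \<kappa> + anchor Q V \<mu>"
proof (rule Y.vf_eqI_local[OF V(1)], goal_cases)
  case y: (3 y)
  obtain W \<sigma> \<tau> where W: "opn Y W" "y \<in> W" "W \<subseteq> V" "\<sigma> \<in> AP W" "q W \<sigma> = res Q V W \<kappa>"
      "\<tau> \<in> AP W" "q W \<tau> = res Q V W \<mu>" using q_lift2[OF V y] by auto
  have "Y.vres V W (anchor Q V (\<kappa> + \<mu>)) = anchor Q W (q W (\<sigma> + \<tau>))"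
    using W V by (simp only: anchQ_res[symmetric] Q.M.add_in Q.M.res_add q_add)
  also have "\<dots> = Y.vres V W (anchor Q V \<kappa> + anchor Q V \<mu>)"
    using W V anch_q[of W \<sigma>] anch_q[of W \<tau>] by (simp add: pa_add anchQ_res[symmetric] del: anch_q)
      (simp add: pa_add)
  finally show ?case using W by blast
qed (use V in auto)

lemma anchQ_smul:
  assumes V: "opn Y V" "\<kappa> \<in> sec Q V" "a \<in> sec Y V"
  shows "anchor Q V (smul Q V a \<kappa>) = Y.vsmul V a (anchor Q V \<kappa>)"
proof (rule Y.vf_eqI_local[OF V(1)], goal_cases)
  case y: (3 y)
  obtain W \<sigma> where W: "opn Y W" "y \<in> W" "W \<subseteq> V" "\<sigma> \<in> AP W" "q W \<sigma> = res Q V W \<kappa>"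
    using q_lift[OF V(1,2) y] by auto
  have pa: "pa W \<sigma> = Y.vres V W (anchor Q V \<kappa>)" using W V anch_q[of W \<sigma>] by (simp add: anchQ_res)
  have "Y.vres V W (anchor Q V (smul Q V a \<kappa>)) = anchor Q W (q W (smul P W (res Y V W a) \<sigma>))"
    using W V by (simp add: anchQ_res[symmetric] Q.res_smul q_smul del: anch_q)
  also have "\<dots> = Y.vres V W (Y.vsmul V a (anchor Q V \<kappa>))"
    using W V pa by (simp add: pa_smul Y.res_vf_smul)
  finally show ?case using W by blast
qed (use V in auto)

lemma pairQ_add_left:
  assumes V: "opn Y V" "\<kappa> \<in> sec Q V" "\<kappa>' \<in> sec Q V" "\<mu> \<in> sec Q V"
  shows "pairing Q V (\<kappa> + \<kappa>') \<mu> = pairing Q V \<kappa> \<mu> + pairing Q V \<kappa>' \<mu>"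
proof (rule Y.O.eqI_local[OF V(1)], goal_cases)
  case y: (3 y)
  obtain W0 \<sigma> \<tau> where W0: "opn Y W0" "y \<in> W0" "W0 \<subseteq> V" "\<sigma> \<in> AP W0" "q W0 \<sigma> = res Q V W0 \<kappa>"
      "\<tau> \<in> AP W0" "q W0 \<tau> = res Q V W0 \<mu>" using q_lift2[OF V(1,2,4) y] by auto
  obtain W \<sigma>' where W: "opn Y W" "y \<in> W" "W \<subseteq> W0" "\<sigma>' \<in> AP W" "q W \<sigma>' = res Q W0 W (res Q V W0 \<kappa>')"
    using q_lift[of W0 "res Q V W0 \<kappa>'" y] W0 V by auto
  have WV: "W \<subseteq> V" using W W0 by blast
  let ?\<sigma> = "res P W0 W \<sigma>" and ?\<tau> = "res P W0 W \<tau>"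
  have r: "res Q V W \<kappa> = q W ?\<sigma>" "res Q V W \<mu> = q W ?\<tau>" "res Q V W \<kappa>' = q W \<sigma>'"
    using W W0 V by (simp_all add: q_res)
  have "res Y V W (pairing Q V (\<kappa> + \<kappa>') \<mu>) = pairing Q W (q W (?\<sigma> + \<sigma>')) (q W ?\<tau>)"
    using W W0 V r by (simp add: pairQ_res[symmetric] Q.M.res_add q_add del: pair_q)
  also have "\<dots> = pp W ?\<sigma> ?\<tau> + pp W \<sigma>' ?\<tau>" using W W0 by (simp add: pp_add_left)
  also have "\<dots> = res Y V W (pairing Q V \<kappa> \<mu> + pairing Q V \<kappa>' \<mu>)" using W W0 V r
    by (simp add: Y.O.res_add pairQ_res[symmetric])
  finally show ?case using W WV by blast
qed (use V in auto)

lemma pairQ_smul_left: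
  assumes V: "opn Y V" "\<kappa> \<in> sec Q V" "\<mu> \<in> sec Q V" "a \<in> sec Y V"
  shows "pairing Q V (smul Q V a \<kappa>) \<mu> = a * pairing Q V \<kappa> \<mu>"
proof (rule Y.O.eqI_local[OF V(1)], goal_cases)
  case y: (3 y)
  obtain W \<sigma> \<tau> where W: "opn Y W" "y \<in> W" "W \<subseteq> V" "\<sigma> \<in> AP W" "q W \<sigma> = res Q V W \<kappa>"
      "\<tau> \<in> AP W" "q W \<tau> = res Q V W \<mu>" using q_lift2[OF V(1,2,3) y] by auto
  have r: "res Q V W \<kappa> = q W \<sigma>" "res Q V W \<mu> = q W \<tau>" using W by simp_all
  have "res Y V W (pairing Q V (smul Q V a \<kappa>) \<mu>) = pairing Q W (q W (smul P W (res Y V W a) \<sigma>)) (q W \<tau>)"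
    using W(1,3,4,6) V r by (simp add: pairQ_res[symmetric] Q.res_smul q_smul del: pair_q)
  also have "\<dots> = res Y V W a * pp W \<sigma> \<tau>" using W(1,3,4,6) V by (simp add: pp_smul_left)
  also have "\<dots> = res Y V W (a * pairing Q V \<kappa> \<mu>)"
    using W(1,3,4,6) V r by (simp add: Y.res_mult pairQ_res[symmetric])
  finally show ?case using W by blast
qed (use V in auto)

lemma pairQ_sym:
  assumes V: "opn Y V" "\<kappa> \<in> sec Q V" "\<mu> \<in> sec Q V" shows "pairing Q V \<kappa> \<mu> = pairing Q V \<mu> \<kappa>"
proof (rule Y.O.eqI_local[OF V(1)], goal_cases)
  case y: (3 y)
  obtain W \<sigma> \<tau> where W: "opn Y W" "y \<in> W" "W \<subseteq> V" "\<sigma> \<in> AP W" "q W \<sigma> = res Q V W \<kappa>"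
      "\<tau> \<in> AP W" "q W \<tau> = res Q V W \<mu>" using q_lift2[OF V y] by auto
  have r: "res Q V W \<kappa> = q W \<sigma>" "res Q V W \<mu> = q W \<tau>" using W by simp_all
  have "res Y V W (pairing Q V \<kappa> \<mu>) = res Y V W (pairing Q V \<mu> \<kappa>)"
    using W(1,3,4,6) V r pp_sym[of W \<sigma> \<tau>] by (simp add: pairQ_res[symmetric])
  then show ?case using W by blast
qed (use V in auto)

end

context restricted
begin

subsection \<open>Consequences of the existence of frames\<close>

lemma X_frame:
  assumes N: "opn X N" "x \<in> N"
  shows "\<exists>U n f e. x \<in> U \<and> U \<subseteq> N \<and> frame_on X U n f (\<lambda>i. anchor E U (e i)) \<and> (\<forall>i<n. e i \<in> sec E U)"
proof -
  obtain U0 n f d where U0: "x \<in> U0" "U0 \<subseteq> N" "frame_on X U0 n f d"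
    using X.frame_at[OF framed_X N] by auto
  note o0 = X.frame_in(3)[OF U0(3)] and f_in = X.frame_in(1)[OF U0(3)] and d_in = X.frame_in(2)[OF U0(3)]
  have "\<exists>V. opn X V \<and> x \<in> V \<and> (\<forall>i<n. \<exists>e. V \<subseteq> U0 \<and> e \<in> sec E V \<and> anchor E V e = X.vres U0 V (d i))"
  proof (rule finite_nhd, goal_cases)
    show "x \<in> pts X" using U0 o0 openin_subset by blast
    case i: (2 i)
    obtain V e where "opn X V" "x \<in> V" "V \<subseteq> U0" "e \<in> sec E V" "anchor E V e = X.vres U0 V (d i)"
      using C.anch_onto[OF o0 d_in[OF i] U0(1)] by auto
    then show ?case by blast
  next
    fix i V W assume V: "i < n" "opn X V" "opn X W" "x \<in> W" "W \<subseteq> V"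
      and e: "\<exists>e. V \<subseteq> U0 \<and> e \<in> sec E V \<and> anchor E V e = X.vres U0 V (d i)"
    then obtain e where "V \<subseteq> U0" "e \<in> sec E V" "anchor E V e = X.vres U0 V (d i)" by blast
    then show "\<exists>e. W \<subseteq> U0 \<and> e \<in> sec E W \<and> anchor E W e = X.vres U0 W (d i)"
      using V by (intro exI[of _ "res E V W e"]) (auto simp: C.anch_res)
  qed
  then obtain V where V: "opn X V" "x \<in> V"
    and ex: "\<forall>i<n. \<exists>e. V \<subseteq> U0 \<and> e \<in> sec E V \<and> anchor E V e = X.vres U0 V (d i)" by blast
  then obtain e where e: "\<And>i. i < n \<Longrightarrow> V \<subseteq> U0 \<and> e i \<in> sec E V \<and> anchor E V (e i) = X.vres U0 V (d i)"
    by metis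
  let ?V = "V \<inter> U0"
  have V': "opn X ?V" "?V \<subseteq> U0" "?V \<subseteq> V" using V o0 by auto
  have a: "anchor E ?V (res E V ?V (e i)) = X.vres U0 ?V (d i)" if "i < n" for i
    using e[OF that] V V' by (simp add: C.anch_res)
  have "frame_on X ?V n (\<lambda>i. res X U0 ?V (f i)) (\<lambda>i. anchor E ?V (res E V ?V (e i)))"
    using X.frame_res[OF U0(3) V'(1,2)] a unfolding frame_on_def by simp
  moreover have "\<forall>i<n. res E V ?V (e i) \<in> sec E ?V" using e V V' by simp
  ultimately show ?thesis using V U0
    by (intro exI[of _ ?V] exI[of _ n] exI[of _ "\<lambda>i. res X U0 ?V (f i)"]
        exI[of _ "\<lambda>i. res E V ?V (e i)"]) auto
qed

lemma anchor_0_local: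
  assumes V: "opn Y V" and \<sigma>: "\<sigma> \<in> AP V" "pa V \<sigma> = 0" and y: "y \<in> V"
  shows "\<exists>U \<omega>. opn X U \<and> y \<in> U \<and> tr U \<subseteq> V \<and> \<omega> \<in> X.forms U \<and>
    res P V (tr U) \<sigma> = p U (coanchor X E U \<omega>)"
proof -
  obtain U0 n f e where U0: "y \<in> U0" "U0 \<subseteq> pts X" and fr: "frame_on X U0 n f (\<lambda>i. anchor E U0 (e i))"
      and e: "\<forall>i<n. e i \<in> sec E U0" using X_frame[of "pts X" y] pts_YX[OF V y] by auto
  note o0 = X.frame_in(3)[OF fr] and f_in = X.frame_in(1)[OF fr]
  obtain U s where U: "opn X U" "y \<in> U" "U \<subseteq> U0" "tr U \<subseteq> V" "s \<in> sec E U" "p U s = res P V (tr U) \<sigma>"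
    using lift1[OF V AP_in[OF \<sigma>(1)] y o0 U0(1)] by auto
  define c where "c i = anchor E U s U (res X U0 U (f i))" for i
  define e' where "e' i = res E U0 U (e i)" for i
  have c: "c i \<in> sec X U" "\<rho> U (c i) = 0" and e': "e' i \<in> sec E U" if "i < n" for i
  proof -
    show "c i \<in> sec X U" "e' i \<in> sec E U" using that U o0 f_in e by (auto simp: c_def e'_def)
    show "\<rho> U (c i) = 0"
      using ancD[OF APD[OF V \<sigma>(1)] U(1,4,5,6) U(1) subset_refl, of "res X U0 U (f i)"] that U o0 f_in \<sigma>(2)
      by (simp add: c_def)
  qed
  let ?t = "s - (\<Sum>i<n. smul E U (c i) (e' i))"
  have sum_in: "(\<Sum>i<n. smul E U (c i) (e' i)) \<in> sec E U" using U c e' by (intro C.E.M.sum_in) auto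
  have "anchor E U (\<Sum>i<n. smul E U (c i) (e' i)) = (\<Sum>i<n. anchor E U (smul E U (c i) (e' i)))"
    by (rule C.anch_sum) (use U c e' in auto)
  also have "\<dots> = (\<Sum>i<n. X.vsmul U (c i) (anchor E U (e' i)))"
    by (rule sum.cong) (use U c e' in \<open>auto simp: C.anch_smul\<close>)
  finally have "anchor E U ?t = anchor E U s - (\<Sum>i<n. X.vsmul U (c i) (anchor E U (e' i)))"
    using U sum_in by (simp add: C.anch_diff)
  also have "\<dots> = 0" using X.frame_vec[OF fr U(1,3) C.anch_in[OF U(1,5)]] U o0 e
    by (simp add: c_def e'_def C.anch_res cong: sum.cong_simp)
  finally obtain \<omega> where \<omega>: "\<omega> \<in> X.forms U" "?t = coanchor X E U \<omega>"
    using C.anch_0_coanchor[OF U(1), of ?t] U sum_in by auto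
  have "p U (smul E U (c i) (e' i)) = 0" if "i < n" for i using U c e' that by (simp add: p_smul)
  then have "(\<Sum>i<n. p U (smul E U (c i) (e' i))) = 0" by simp
  moreover have "p U (\<Sum>i<n. smul E U (c i) (e' i)) = (\<Sum>i<n. p U (smul E U (c i) (e' i)))"
    by (rule p_sum) (use U c e' in auto)
  ultimately have "p U ?t = p U s" using U sum_in by (simp add: p_diff)
  then have "res P V (tr U) \<sigma> = p U (coanchor X E U \<omega>)" using \<omega> U by simp
  then show ?thesis using U \<omega> by blast
qed

lemma pp_anchor_0:
  assumes V: "opn Y V" and \<sigma>: "\<sigma> \<in> AP V" "pa V \<sigma> = 0" and \<tau>: "\<tau> \<in> AP V" "pa V \<tau> = 0"
  shows "pp V \<sigma> \<tau> = 0"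
proof (rule Y_eqI[OF V], goal_cases)
  case y: (3 y)
  obtain U1 \<omega>1 where U1: "opn X U1" "y \<in> U1" "tr U1 \<subseteq> V" "\<omega>1 \<in> X.forms U1"
    "res P V (tr U1) \<sigma> = p U1 (coanchor X E U1 \<omega>1)" using anchor_0_local[OF V \<sigma> y] by auto
  obtain U2 \<omega>2 where U2: "opn X U2" "y \<in> U2" "tr U2 \<subseteq> V" "\<omega>2 \<in> X.forms U2"
    "res P V (tr U2) \<tau> = p U2 (coanchor X E U2 \<omega>2)" using anchor_0_local[OF V \<tau> y] by auto
  let ?U = "U1 \<inter> U2"
  let ?e = "res E U1 ?U (coanchor X E U1 \<omega>1)" and ?f = "coanchor X E ?U (X.fres U2 ?U \<omega>2)"
  have U: "opn X ?U" "y \<in> ?U" "tr ?U \<subseteq> V" using U1 U2 by auto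
  have "res Y V (tr ?U) (pp V \<sigma> \<tau>) = \<rho> ?U (pairing E ?U ?e ?f)"
  proof (rule pp_lift)
    show "p ?U ?e = res P V (tr ?U) \<sigma>"
      using lift_res[OF V _ U1(1,3), of \<sigma> "coanchor X E U1 \<omega>1" ?U] \<sigma> U U1 by simp
    have "?f = res E U2 ?U (coanchor X E U2 \<omega>2)" using U U2 by (intro C.coanchor_res) auto
    then show "p ?U ?f = res P V (tr ?U) \<tau>"
      using lift_res[OF V _ U2(1,3), of \<tau> "coanchor X E U2 \<omega>2" ?U] \<tau> U U2 by simp
  qed (use V \<sigma> \<tau> U U1 U2 in auto)
  also have "pairing E ?U ?e ?f = 0" using U1 U2 by (simp add: C.pair_coanchor_res)
  finally show ?case using U V by (intro exI[of _ ?U]) simp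
qed (use V \<sigma> \<tau> in auto)

definition tangent_lifts :: bool where "tangent_lifts \<longleftrightarrow> (\<forall>V D y. opn Y V \<and> D \<in> Y.vfs V \<and> y \<in> V \<longrightarrow>
     (\<exists>W \<sigma>. opn Y W \<and> y \<in> W \<and> W \<subseteq> V \<and> \<sigma> \<in> AP W \<and> pa W \<sigma> = Y.vres V W D))"

lemma tangent_lift:
  assumes "tangent_lifts" "opn Y V" "D \<in> Y.vfs V" "y \<in> V" "opn X N" "y \<in> N"
  shows "\<exists>U e. opn X U \<and> y \<in> U \<and> U \<subseteq> N \<and> tr U \<subseteq> V \<and> e \<in> sec E U \<and> p U e \<in> AP (tr U) \<and>
    pa (tr U) (p U e) = Y.vres V (tr U) D"
proof -
  obtain W \<sigma> where W: "opn Y W" "y \<in> W" "W \<subseteq> V" "\<sigma> \<in> AP W" "pa W \<sigma> = Y.vres V W D"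
    using assms(1)[unfolded tangent_lifts_def, rule_format, OF conjI[OF assms(2) conjI[OF assms(3,4)]]]
    by auto
  obtain U e where "opn X U" "y \<in> U" "U \<subseteq> N" "tr U \<subseteq> W" "e \<in> sec E U" "p U e = res P W (tr U) \<sigma>"
    using lift1[OF W(1) AP_in[OF W(4)] W(2) assms(5,6)] by auto
  then show ?thesis using W by (intro exI[of _ U] exI[of _ e]) (auto simp: pa_res)
qed

lemma adapted_frame:
  assumes lifts: tangent_lifts and y: "y \<in> pts Y" and N: "opn X N" "y \<in> N"
  shows "\<exists>U n f e D. y \<in> U \<and> U \<subseteq> N \<and> frame_on X U n f (\<lambda>i. anchor E U (e i)) \<and> (\<forall>i<n. e i \<in> sec E U) \<and>
    frame_on Y (tr U) n (\<lambda>i. \<rho> U (f i)) D"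
proof -
  obtain V m g D where V: "y \<in> V" "frame_on Y V m g D"
    using framed_Y y unfolding locally_framed_def by metis
  note oV = Y.frame_in(3)[OF V(2)] and g_in = Y.frame_in(1)[OF V(2)] and D_in = Y.frame_in(2)[OF V(2)]
  have "\<exists>U. opn X U \<and> y \<in> U \<and> (\<forall>j<m. \<exists>h. tr U \<subseteq> V \<and> h \<in> sec X U \<and> \<rho> U h = res Y V (tr U) (g j))"
  proof (rule finite_nhd, goal_cases)
    show "y \<in> pts X" using pts_YX[OF oV V(1)] .
    case j: (2 j)
    obtain U h where "opn X U" "y \<in> U" "tr U \<subseteq> V" "h \<in> sec X U" "\<rho> U h = res Y V (tr U) (g j)"
      using rho_lift[OF oV g_in[OF j] V(1) N] by auto
    then show ?case by blast
  next
    fix j U W assume U: "opn X U" "opn X W" "y \<in> W" "W \<subseteq> U" and j: "j < m"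
      and h: "\<exists>h. tr U \<subseteq> V \<and> h \<in> sec X U \<and> \<rho> U h = res Y V (tr U) (g j)"
    then obtain h where h: "tr U \<subseteq> V" "h \<in> sec X U" "\<rho> U h = res Y V (tr U) (g j)" by blast
    have "tr W \<subseteq> tr U" "tr W \<subseteq> V" using U h by auto
    then show "\<exists>h. tr W \<subseteq> V \<and> h \<in> sec X W \<and> \<rho> W h = res Y V (tr W) (g j)"
      using U h oV g_in[OF j] by (intro exI[of _ "res X U W h"]) (simp add: rho_res)
  qed
  then obtain U1 where U1: "opn X U1" "y \<in> U1"
    and ex: "\<forall>j<m. \<exists>h. tr U1 \<subseteq> V \<and> h \<in> sec X U1 \<and> \<rho> U1 h = res Y V (tr U1) (g j)" by blast
  then obtain h where h: "\<And>j. j < m \<Longrightarrow> tr U1 \<subseteq> V \<and> h j \<in> sec X U1 \<and> \<rho> U1 (h j) = res Y V (tr U1) (g j)"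
    by metis
  obtain U2 where U2: "opn X U2" "y \<in> U2" "U2 \<subseteq> U1" "tr U2 \<subseteq> V" using opn_nhd[OF oV V(1) U1] by auto
  obtain U n f e where U: "y \<in> U" "U \<subseteq> U2 \<inter> N" and fr: "frame_on X U n f (\<lambda>i. anchor E U (e i))"
      and e: "\<forall>i<n. e i \<in> sec E U" using X_frame[of "U2 \<inter> N" y] U2 N by auto
  note oU = X.frame_in(3)[OF fr] and f_in = X.frame_in(1)[OF fr]
  have UV: "tr U \<subseteq> V" and UU: "U \<subseteq> U1" "U \<subseteq> U2" using U U2 by auto
  define k where "k i j = \<rho> U (anchor E U (e i) U (res X U1 U (h j)))" for i j
  have k: "k i j \<in> sec Y (tr U)" if "i < n" "j < m" for i j
    unfolding k_def using that e h[OF that(2)] U1 oU UU by simp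
  define D' where "D' i = (\<Sum>j<m. Y.vsmul (tr U) (k i j) (Y.vres V (tr U) (D j)))" for i
  have D': "D' i \<in> Y.vfs (tr U)" if "i < n" for i
    unfolding D'_def using k that D_in UV oU by (intro Y.sum_vf_in) auto
  have "frame_on Y (tr U) n (\<lambda>i. \<rho> U (f i)) D'" unfolding frame_on_def
  proof ((intro conjI allI impI; (elim conjE)?), goal_cases)
    case (4 W v s)
    note W = 4(1-3) and s = 4(4)
    have WV: "W \<subseteq> V" using W UV by blast
    let ?vf = "\<lambda>i. v W (res Y (tr U) W (\<rho> U (f i)))"
    have vg: "v W (res Y V W (g j)) = (\<Sum>i<n. ?vf i * res Y (tr U) W (k i j))" if j: "j < m" for j
    proof (rule Y_eqI[OF W(1)], goal_cases)
      case z: (3 z)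
      then have "z \<in> U" using W by blast
      then obtain N t where N: "opn X N" "z \<in> N" "N \<subseteq> U" "tr N \<subseteq> W" "t \<in> sec E N"
          "p N t \<in> AP (tr N)" "pa (tr N) (p N t) = Y.vres W (tr N) v"
        using tangent_lift[OF lifts W(1,3) z oU] by auto
      have NN: "N \<subseteq> U1" "tr N \<subseteq> tr U" "tr N \<subseteq> tr U1" "tr N \<subseteq> V" using N UU UV by auto
      note hj = h[OF j]
      have vt: "v (tr N) (\<rho> N r) = \<rho> N (anchor E N t N r)" if "r \<in> sec X N" for r
        using pa_p[OF N(6,1,5,1) subset_refl that] N by simp
      have "res Y W (tr N) (v W (res Y V W (g j))) = v (tr N) (\<rho> N (res X U1 N (h j)))"
        using N NN W WV oV g_in[OF j] U1 hj by (simp add: rho_res Y.vf_res[symmetric])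
      also have "\<dots> = \<rho> N (anchor E N t N (res X U1 N (h j)))" using N NN U1 hj by (intro vt) simp
      also have "anchor E N t N (res X U1 N (h j)) =
          (\<Sum>i<n. anchor E N t N (res X U N (f i)) * anchor E U (e i) N (res X U1 N (h j)))"
        by (rule X.frame_eq[OF fr]) (use N NN U1 hj in auto)
      also have "\<rho> N \<dots> = (\<Sum>i<n. \<rho> N (anchor E N t N (res X U N (f i)) * anchor E U (e i) N (res X U1 N (h j))))"
        using N NN U1 hj oU f_in e by (intro rho_sum) auto
      also have "\<dots> = (\<Sum>i<n. res Y W (tr N) (?vf i * res Y (tr U) W (k i j)))"
      proof (rule sum.cong[OF refl], goal_cases)
        case (1 i)
        then have i: "i < n" by simp
        have "\<rho> N (anchor E U (e i) N (res X U1 N (h j))) = res Y (tr U) (tr N) (k i j)"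
          using N UU U1 hj oU i e by (simp add: k_def rho_res[symmetric] C.anch_vf_res[symmetric])
        moreover have "\<rho> N (anchor E N t N (res X U N (f i))) = v (tr N) (res Y (tr U) (tr N) (\<rho> U (f i)))"
          using vt[of "res X U N (f i)"] N oU f_in[OF i] by (simp add: rho_res)
        moreover have "v (tr N) (res Y (tr U) (tr N) (\<rho> U (f i))) = res Y W (tr N) (?vf i)"
          using Y.vf_res[OF W(3,1) subset_refl opn_trace[OF N(1)] N(4), of "res Y (tr U) W (\<rho> U (f i))"] N W oU f_in[OF i] by simp
        ultimately show ?case
          using N NN W U1 hj oU f_in[OF i] e i j k by (simp add: rho_mult Y.res_mult)
      qed
      also have "\<dots> = res Y W (tr N) (\<Sum>i<n. ?vf i * res Y (tr U) W (k i j))"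
        using N W oU f_in j k by (intro Y.O.res_sum[symmetric]) auto
      finally show ?case using N by blast
    qed (use W WV oV g_in[OF j] oU f_in j k in \<open>auto intro!: Y.O.sum_in\<close>)
    have "v W s = (\<Sum>j<m. v W (res Y V W (g j)) * D j W s)"
      by (rule Y.frame_eq[OF V(2) W(1) WV W(3) s])
    also have "\<dots> = (\<Sum>j<m. \<Sum>i<n. ?vf i * (res Y (tr U) W (k i j) * D j W s))"
      by (rule sum.cong) (simp_all add: vg sum_distrib_right mult.assoc)
    also have "\<dots> = (\<Sum>i<n. ?vf i * D' i W s)"
      unfolding D'_def sum_fun2_app sum_distrib_left using W(2) by (subst sum.swap) simp
    finally show ?case .
  qed (use oU f_in D' in auto)
  then show ?thesis using U fr e
    by (intro exI[of _ U] exI[of _ n] exI[of _ f] exI[of _ e] exI[of _ D']) auto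
qed

lemma form_extends:
  assumes lifts: tangent_lifts and V: "opn Y V" and \<eta>: "\<eta> \<in> Y.forms V" and y: "y \<in> V"
  shows "\<exists>U \<omega>. opn X U \<and> y \<in> U \<and> tr U \<subseteq> V \<and> \<omega> \<in> X.forms U \<and> form_restricts X Y \<rho> U \<omega> \<eta>"
proof -
  have yX: "y \<in> pts X" using pts_YX[OF V y] .
  obtain U0 where U0: "opn X U0" "y \<in> U0" "tr U0 \<subseteq> V" using opn_nhd[OF V y _ yX] by auto
  obtain U n f e D where U: "y \<in> U" "U \<subseteq> U0" and fr: "frame_on X U n f (\<lambda>i. anchor E U (e i))"
      and e: "\<forall>i<n. e i \<in> sec E U" and frY: "frame_on Y (tr U) n (\<lambda>i. \<rho> U (f i)) D"
    using adapted_frame[OF lifts pts_Y[OF V y] U0(1,2)] by auto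
  note oU = X.frame_in(3)[OF fr] and f_in = X.frame_in(1)[OF fr] and D_in = Y.frame_in(2)[OF frY]
  have UV: "tr U \<subseteq> V" using U U0 by blast
  have hD: "\<eta> (tr U) (D i) \<in> sec Y (tr U)" if "i < n" for i using that D_in \<eta> oU UV by simp
  let ?H = "\<lambda>W i. res Y (tr U) (tr W) (\<eta> (tr U) (D i))"
  have "\<exists>W. opn X W \<and> y \<in> W \<and> (\<forall>i<n. \<exists>h. W \<subseteq> U \<and> h \<in> sec X W \<and> \<rho> W h = ?H W i)"
  proof (rule finite_nhd, goal_cases)
    case i: (2 i)
    obtain W h where "opn X W" "y \<in> W" "W \<subseteq> U" "h \<in> sec X W" "\<rho> W h = ?H W i"
      using rho_lift[OF opn_trace[OF oU] hD[OF i] _ oU U(1)] U pts_Y[OF V y] by auto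
    then show ?case by blast
  next
    fix i W W' assume W: "opn X W" "opn X W'" "y \<in> W'" "W' \<subseteq> W" and i: "i < n"
      and "\<exists>h. W \<subseteq> U \<and> h \<in> sec X W \<and> \<rho> W h = ?H W i"
    then obtain h where h: "W \<subseteq> U" "h \<in> sec X W" "\<rho> W h = ?H W i" by blast
    have "tr W' \<subseteq> tr W" "tr W \<subseteq> tr U" "W' \<subseteq> U" using W h by auto
    then show "\<exists>h. W' \<subseteq> U \<and> h \<in> sec X W' \<and> \<rho> W' h = ?H W' i"
      using W h oU hD[OF i] by (intro exI[of _ "res X W W' h"]) (simp add: rho_res)
  qed (rule yX)
  then obtain W0 where W0: "opn X W0" "y \<in> W0" and "\<forall>i<n. \<exists>h. W0 \<subseteq> U \<and> h \<in> sec X W0 \<and>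
      \<rho> W0 h = ?H W0 i" by blast
  then obtain h0 where h0: "\<And>i. i < n \<Longrightarrow> W0 \<subseteq> U \<and> h0 i \<in> sec X W0 \<and> \<rho> W0 (h0 i) = ?H W0 i" by metis
  define W where "W = W0 \<inter> U"
  define h where "h i = res X W0 W (h0 i)" for i
  have W: "opn X W" "y \<in> W" "W \<subseteq> U" "W \<subseteq> W0" "tr W \<subseteq> V" "tr W \<subseteq> tr U"
    using W0 U oU UV by (auto simp: W_def)
  have h: "h i \<in> sec X W" "\<rho> W (h i) = ?H W i" if i: "i < n" for i
  proof -
    have "tr W \<subseteq> tr W0" "tr W0 \<subseteq> tr U" using W h0[OF i] by auto
    then show "h i \<in> sec X W" "\<rho> W (h i) = ?H W i"
      unfolding h_def using W W0 h0[OF i] oU hD[OF i] by (simp_all add: rho_res)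
  qed
  define \<omega> where "\<omega> W' v = (if opn X W' \<and> W' \<subseteq> W \<and> v \<in> X.vfs W' then
    (\<Sum>i<n. res X W W' (h i) * v W' (res X U W' (f i))) else 0)" for W' v
  have \<omega>: "\<omega> \<in> X.forms W"
  proof (rule X.cotangentI, goal_cases)
    fix W' v assume W': "opn X W'" "W' \<subseteq> W" "v \<in> X.vfs W'"
    have sub: "W' \<subseteq> U" using W W' by blast
    have fi: "v W' (res X U W' (f i)) \<in> sec X W'" if "i < n" for i using W' that f_in oU sub by simp
    show "\<omega> W' v \<in> sec X W'" using W' W h(1) fi by (auto simp: \<omega>_def intro!: X.O.sum_in)
    fix w assume w: "w \<in> X.vfs W'"
    then show "\<omega> W' (v + w) = \<omega> W' v + \<omega> W' w"
      using W' by (simp add: \<omega>_def distrib_left sum.distrib)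
  next
    fix W' a v assume W': "opn X W'" "W' \<subseteq> W" "v \<in> X.vfs W'" "a \<in> sec X W'"
    then show "\<omega> W' (X.vsmul W' a v) = a * \<omega> W' v"
      by (simp add: \<omega>_def sum_distrib_left mult.left_commute)
  next
    case W': (4 W' W'' v)
    have sub: "W' \<subseteq> U" "W'' \<subseteq> U" "W'' \<subseteq> W" using W W' by auto
    have "res X W' W'' (\<Sum>i<n. res X W W' (h i) * v W' (res X U W' (f i))) =
        (\<Sum>i<n. res X W' W'' (res X W W' (h i) * v W' (res X U W' (f i))))"
      using W' W h(1) f_in oU sub by (intro X.O.res_sum) auto
    also have "\<dots> = (\<Sum>i<n. res X W W'' (h i) * v W'' (res X U W'' (f i)))"
      using W' W h(1) f_in oU sub by (intro sum.cong refl) (simp add: X.res_mult X.vf_res[symmetric])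
    finally show ?case using W' by (simp add: \<omega>_def)
  qed (auto simp: \<omega>_def)
  have "form_restricts X Y \<rho> W \<omega> \<eta>" unfolding form_restricts_def
  proof (intro allI impI, elim conjE, goal_cases)
    case (1 W' v D1)
    note W' = 1(1-3) and D1 = 1(4) and r = 1(5)
    have sub: "W' \<subseteq> U" "tr W' \<subseteq> tr U" "tr W' \<subseteq> V" "tr W' \<subseteq> tr W" using W W' by auto
    have "\<rho> W' (\<omega> W' v) = (\<Sum>i<n. \<rho> W' (res X W W' (h i) * v W' (res X U W' (f i))))"
      using W W' h(1) f_in oU sub by (simp add: \<omega>_def) (intro rho_sum, auto)
    also have "\<dots> = (\<Sum>i<n. D1 (tr W') (res Y (tr U) (tr W') (\<rho> U (f i))) *
        \<eta> (tr W') (Y.vres (tr U) (tr W') (D i)))"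
    proof (rule sum.cong[OF refl], goal_cases)
      case (1 i)
      then have i: "i < n" by simp
      have "\<rho> W' (res X W W' (h i)) = \<eta> (tr W') (Y.vres (tr U) (tr W') (D i))"
        using Y.cot_res[OF \<eta> _ UV _ sub(2), of "D i"] W W' oU h[OF i] D_in[OF i] hD[OF i]
        by (simp add: rho_res)
      moreover have "\<rho> W' (v W' (res X U W' (f i))) = D1 (tr W') (res Y (tr U) (tr W') (\<rho> U (f i)))"
        using restricts_app[OF r W'(1) subset_refl, of "res X U W' (f i)"] W' sub oU f_in[OF i]
        by (simp add: rho_res)
      ultimately show ?case using W W' oU h(1)[OF i] f_in[OF i] by (simp add: rho_mult mult.commute)
    qed
    also have "\<dots> = \<eta> (tr W') D1"
      by (rule Y.frame_cot[OF frY \<eta> _ sub(2,3) D1, symmetric]) (use W' in simp)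
    finally show ?case .
  qed
  then show ?thesis using W \<omega> by blast
qed

lemma anc_brk:
  assumes U: "opn X U" "e \<in> sec E U" "f \<in> sec E U" and e: "p U e \<in> AP (tr U)" and f: "p U f \<in> AP (tr U)"
  shows "anc (tr U) (p U (bracket E U e f)) (lie_bracket (pa (tr U) (p U e)) (pa (tr U) (p U f)))"
proof (rule anc_p, goal_cases)
  case W: (4 W g)
  then have "\<rho> W (anchor E U (bracket E U e f) W g) =
      \<rho> W (anchor E U e W (anchor E U f W g)) - \<rho> W (anchor E U f W (anchor E U e W g))"
    using U by (simp add: C.anch_brk X.lie_bracket_app rho_diff)
  also have "\<dots> = lie_bracket (pa (tr U) (p U e)) (pa (tr U) (p U f)) (tr W) (\<rho> W g)"
    using U W pa_p[OF e U(1,2) W(1,2)] pa_p[OF f U(1,3) W(1,2)] by (simp add: Y.lie_bracket_app)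
  finally show ?case .
qed (use assms in auto)

lemma AP_brk:
  assumes "opn X U" "e \<in> sec E U" "f \<in> sec E U" "p U e \<in> AP (tr U)" "p U f \<in> AP (tr U)"
  shows "p U (bracket E U e f) \<in> AP (tr U)" and "pa (tr U) (p U (bracket E U e f)) =
      lie_bracket (pa (tr U) (p U e)) (pa (tr U) (p U f))"
  using anc_brk[OF assms] API pa_eq assms by auto

end

section \<open>Trivializations\<close>

context krs
begin

lemma cot_eqI_local:
  assumes "opn X U" and v: "\<omega> \<in> forms U" and w: "\<omega>' \<in> forms U"
    and loc: "\<And>x. x \<in> U \<Longrightarrow> \<exists>V. opn X V \<and> x \<in> V \<and> V \<subseteq> U \<and> fres U V \<omega> = fres U V \<omega>'"
  shows "\<omega> = \<omega>'"
proof (rule cot_eqI[OF v w], goal_cases)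
  case W: (1 W D)
  show ?case
  proof (rule O.eqI_local[OF W(1)], goal_cases)
    case (3 x)
    then obtain V where V: "opn X V" "x \<in> V" "V \<subseteq> U" "fres U V \<omega> = fres U V \<omega>'" using loc W by blast
    have "\<omega> (W \<inter> V) (vres W (W \<inter> V) D) = \<omega>' (W \<inter> V) (vres W (W \<inter> V) D)"
      using fun_cong[OF fun_cong[OF V(4), of "W \<inter> V"], of "vres W (W \<inter> V) D"] by simp
    then have "res X W (W \<inter> V) (\<omega> W D) = res X W (W \<inter> V) (\<omega>' W D)"
      using W V v w by (simp add: cot_res)
    then show ?case using W V \<open>x \<in> W\<close> by (intro exI[of _ "W \<inter> V"]) auto
  qed (use W v w in auto)
qed

lemma std_isoI:
  fixes Q :: "('x, 'r, 'q::ab_group_add) courant"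
  assumes null: "\<And>V \<kappa>. \<not> (opn X V \<and> \<kappa> \<in> sec Q V) \<Longrightarrow> \<Phi> V \<kappa> = 0"
    and fst_in: "\<And>V \<kappa>. opn X V \<Longrightarrow> \<kappa> \<in> sec Q V \<Longrightarrow> fst (\<Phi> V \<kappa>) \<in> vfs V"
    and snd_in: "\<And>V \<kappa>. opn X V \<Longrightarrow> \<kappa> \<in> sec Q V \<Longrightarrow> snd (\<Phi> V \<kappa>) \<in> forms V"
    and anch: "\<And>V \<kappa>. opn X V \<Longrightarrow> \<kappa> \<in> sec Q V \<Longrightarrow> fst (\<Phi> V \<kappa>) = anchor Q V \<kappa>"
    and add: "\<And>V \<kappa> \<mu>. \<lbrakk>opn X V; \<kappa> \<in> sec Q V; \<mu> \<in> sec Q V\<rbrakk> \<Longrightarrow> \<Phi> V (\<kappa> + \<mu>) = \<Phi> V \<kappa> + \<Phi> V \<mu>"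
    and smul: "\<And>V \<kappa> a. \<lbrakk>opn X V; \<kappa> \<in> sec Q V; a \<in> sec X V\<rbrakk> \<Longrightarrow> \<Phi> V (smul Q V a \<kappa>) =
      (vsmul V a (fst (\<Phi> V \<kappa>)), smul (cotangent X) V a (snd (\<Phi> V \<kappa>)))"
    and res: "\<And>V \<kappa> W. \<lbrakk>opn X V; \<kappa> \<in> sec Q V; opn X W; W \<subseteq> V\<rbrakk> \<Longrightarrow> \<Phi> W (res Q V W \<kappa>) =
      (vres V W (fst (\<Phi> V \<kappa>)), fres V W (snd (\<Phi> V \<kappa>)))"
    and bij: "\<And>V. opn X V \<Longrightarrow> bij_betw (\<Phi> V) (sec Q V) (vfs V \<times> forms V)"
    and pair: "\<And>V \<kappa> \<mu>. \<lbrakk>opn X V; \<kappa> \<in> sec Q V; \<mu> \<in> sec Q V\<rbrakk> \<Longrightarrow>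
      snd (\<Phi> V \<kappa>) V (fst (\<Phi> V \<mu>)) + snd (\<Phi> V \<mu>) V (fst (\<Phi> V \<kappa>)) = pairing Q V \<kappa> \<mu>"
    and brk1: "\<And>V \<kappa> \<mu>. \<lbrakk>opn X V; \<kappa> \<in> sec Q V; \<mu> \<in> sec Q V\<rbrakk> \<Longrightarrow>
      fst (\<Phi> V (bracket Q V \<kappa> \<mu>)) = lie_bracket (fst (\<Phi> V \<kappa>)) (fst (\<Phi> V \<mu>))"
    and brk2: "\<And>V \<kappa> \<mu>. \<lbrakk>opn X V; \<kappa> \<in> sec Q V; \<mu> \<in> sec Q V\<rbrakk> \<Longrightarrow> snd (\<Phi> V (bracket Q V \<kappa> \<mu>)) =
      lie_derivative X V (fst (\<Phi> V \<kappa>)) (snd (\<Phi> V \<mu>)) - contract_d X V (fst (\<Phi> V \<mu>)) (snd (\<Phi> V \<kappa>))"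
  shows "courant_iso X Q (standard_courant X) \<Phi>"
proof -
  have "hom_on X (pts X) Q (standard_courant X) \<Phi>" unfolding hom_on_def standard_courant_def
    by (auto simp: case_prod_beta mem_Times_iff fst_in snd_in add smul res)
  moreover have "null_outside X (pts X) Q \<Phi>"
    unfolding null_outside_def using null openin_subset by blast
  moreover have "bij_betw (\<Phi> U) (sec Q U) (sec (standard_courant X) U)" if "opn X U" for U
    using bij[OF that] by (simp add: standard_courant_def)
  moreover have "pairing (standard_courant X) U (\<Phi> U x) (\<Phi> U y) = pairing Q U x y \<and>
         anchor (standard_courant X) U (\<Phi> U x) = anchor Q U x \<and>
         bracket (standard_courant X) U (\<Phi> U x) (\<Phi> U y) = \<Phi> U (bracket Q U x y)"
    if "opn X U" "x \<in> sec Q U" "y \<in> sec Q U" for U x y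
    using pair[OF that] anch[OF that(1,2)] brk1[OF that] brk2[OF that]
    by (simp add: standard_courant_def case_prod_beta prod_eq_iff)
  ultimately show ?thesis unfolding courant_iso_def by simp
qed

end

locale std_iso = krs X for X :: "('x, 'r::comm_ring, 'k::field_char_0) ringed_space" +
  fixes Q :: "('x, 'r, 'q::ab_group_add) courant" and \<Phi>
  assumes iso: "courant_iso X Q (standard_courant X) \<Phi>"
begin

lemmas iso_hom = iso[unfolded courant_iso_def hom_on_def, THEN conjunct1, rule_format]
lemmas iso_null = iso[unfolded courant_iso_def null_outside_def, THEN conjunct2, THEN conjunct1, rule_format]
lemmas iso_struct = iso[unfolded courant_iso_def, THEN conjunct2, THEN conjunct2, rule_format]

lemma \<Phi>_null: "\<not> (opn X V \<and> \<kappa> \<in> sec Q V) \<Longrightarrow> \<Phi> V \<kappa> = 0" using iso_null[of V \<kappa>] by blast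

lemma \<Phi>_hom_at: "opn X V \<Longrightarrow> opn X V \<and> V \<subseteq> pts X" using openin_subset by blast

lemma \<Phi>_in: "opn X V \<Longrightarrow> \<kappa> \<in> sec Q V \<Longrightarrow> fst (\<Phi> V \<kappa>) \<in> vfs V \<and> snd (\<Phi> V \<kappa>) \<in> forms V"
  using iso_hom[OF \<Phi>_hom_at, THEN conjunct1, of V] by (auto simp: standard_courant_def mem_Times_iff)

lemma \<Phi>_fst_in [simp]: "opn X V \<Longrightarrow> \<kappa> \<in> sec Q V \<Longrightarrow> fst (\<Phi> V \<kappa>) \<in> vfs V" using \<Phi>_in by blast

lemma \<Phi>_snd_in [simp]: "opn X V \<Longrightarrow> \<kappa> \<in> sec Q V \<Longrightarrow> snd (\<Phi> V \<kappa>) \<in> forms V" using \<Phi>_in by blast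

lemma \<Phi>_add: "\<lbrakk>opn X V; \<kappa> \<in> sec Q V; \<mu> \<in> sec Q V\<rbrakk> \<Longrightarrow> \<Phi> V (\<kappa> + \<mu>) = \<Phi> V \<kappa> + \<Phi> V \<mu>"
  by (rule iso_hom[OF \<Phi>_hom_at, THEN conjunct2, THEN conjunct1, rule_format])

lemma \<Phi>_smul: "\<lbrakk>opn X V; \<kappa> \<in> sec Q V; a \<in> sec X V\<rbrakk> \<Longrightarrow> \<Phi> V (smul Q V a \<kappa>) =
      (vsmul V a (fst (\<Phi> V \<kappa>)), smul (cotangent X) V a (snd (\<Phi> V \<kappa>)))"
  using iso_hom[OF \<Phi>_hom_at, THEN conjunct2, THEN conjunct2, THEN conjunct1, rule_format, of V a \<kappa>]
  by (simp add: standard_courant_def case_prod_beta)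

lemma \<Phi>_res: "\<lbrakk>opn X V; \<kappa> \<in> sec Q V; opn X W; W \<subseteq> V\<rbrakk> \<Longrightarrow> \<Phi> W (res Q V W \<kappa>) =
      (vres V W (fst (\<Phi> V \<kappa>)), fres V W (snd (\<Phi> V \<kappa>)))"
  using iso_hom[OF \<Phi>_hom_at, THEN conjunct2, THEN conjunct2, THEN conjunct2, rule_format, of V W \<kappa>]
  by (simp add: standard_courant_def case_prod_beta)

lemma \<Phi>_bij: "opn X V \<Longrightarrow> bij_betw (\<Phi> V) (sec Q V) (vfs V \<times> forms V)"
  using iso_struct[of V, THEN conjunct1] by (simp add: standard_courant_def)

lemma \<Phi>_inj: "\<lbrakk>opn X V; \<kappa> \<in> sec Q V; \<mu> \<in> sec Q V; \<Phi> V \<kappa> = \<Phi> V \<mu>\<rbrakk> \<Longrightarrow> \<kappa> = \<mu>"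
  using \<Phi>_bij[of V] unfolding bij_betw_def inj_on_def by blast

lemma \<Phi>_surj: "\<lbrakk>opn X V; D \<in> vfs V; \<eta> \<in> forms V\<rbrakk> \<Longrightarrow> \<exists>\<kappa>\<in>sec Q V. \<Phi> V \<kappa> = (D, \<eta>)"
  using \<Phi>_bij[of V] unfolding bij_betw_def image_iff by (metis (no_types, lifting) SigmaI imageE)

lemma \<Phi>_anch [simp]: "opn X V \<Longrightarrow> \<kappa> \<in> sec Q V \<Longrightarrow> fst (\<Phi> V \<kappa>) = anchor Q V \<kappa>"
  using iso_struct[of V, THEN conjunct2, rule_format, of \<kappa> \<kappa>]
  by (simp add: standard_courant_def case_prod_beta)

lemma \<Phi>_pair: "\<lbrakk>opn X V; \<kappa> \<in> sec Q V; \<mu> \<in> sec Q V\<rbrakk> \<Longrightarrow>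
    snd (\<Phi> V \<kappa>) V (fst (\<Phi> V \<mu>)) + snd (\<Phi> V \<mu>) V (fst (\<Phi> V \<kappa>)) = pairing Q V \<kappa> \<mu>"
  using iso_struct[of V, THEN conjunct2, rule_format, of \<kappa> \<mu>, THEN conjunct1]
  by (simp add: standard_courant_def case_prod_beta del: \<Phi>_anch)

lemma \<Phi>_brk: "\<lbrakk>opn X V; \<kappa> \<in> sec Q V; \<mu> \<in> sec Q V\<rbrakk> \<Longrightarrow> \<Phi> V (bracket Q V \<kappa> \<mu>) =
    (lie_bracket (fst (\<Phi> V \<kappa>)) (fst (\<Phi> V \<mu>)),
     lie_derivative X V (fst (\<Phi> V \<kappa>)) (snd (\<Phi> V \<mu>)) - contract_d X V (fst (\<Phi> V \<mu>)) (snd (\<Phi> V \<kappa>)))"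
  using iso_struct[of V, THEN conjunct2, rule_format, of \<kappa> \<mu>, THEN conjunct2, THEN conjunct2]
  by (simp add: standard_courant_def case_prod_beta del: \<Phi>_anch)

end

section \<open>From generalized tangent bundles to trivializations\<close>

locale gen_tangent = restricted X Y \<rho> E P p Q q for X Y \<rho> E P p Q q +
  fixes F
  assumes gtb: "F \<in> generalized_tangent_bundles X Y \<rho> E P p"
begin

lemmas gtb' = gtb[unfolded generalized_tangent_bundles_def mem_Collect_eq]
lemmas F_dirac = gtb'[THEN conjunct1, unfolded dirac_with_support_def]
lemmas F_module = F_dirac[THEN conjunct1, unfolded subbundle_def, THEN conjunct2, THEN conjunct1]
lemmas F_empty = F_dirac[THEN conjunct2, THEN conjunct1, rule_format]
lemmas F_lagr = F_dirac[THEN conjunct2, THEN conjunct2, THEN conjunct1, rule_format, THEN conjunct1]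
lemmas F_AP' = F_dirac[THEN conjunct2, THEN conjunct2, THEN conjunct1, rule_format, THEN conjunct2]
lemmas F_brk = F_dirac[THEN conjunct2, THEN conjunct2, THEN conjunct2, rule_format]
lemmas F_ker = gtb'[THEN conjunct2, THEN conjunct1, rule_format]
lemmas F_onto' = gtb'[THEN conjunct2, THEN conjunct2, unfolded locally_onto_def, rule_format]

lemma F_AP [simp]: "opn Y V \<Longrightarrow> \<sigma> \<in> F V \<Longrightarrow> \<sigma> \<in> AP V" using F_AP' by blast

lemma kmod_F: "kmod Y (P\<lparr>sec := F\<rparr>)"
  by (rule kmod.intro, rule Y.krs_axioms, rule kmod_axioms.intro, rule F_module)

lemma F_sheaf: "ab_sheaf (topo Y) (P\<lparr>sec := F\<rparr>)"
  by (rule ab_sheaf.intro) (rule F_module[unfolded module_sheaf_def, THEN conjunct1])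

lemma F_add [simp]: "\<lbrakk>opn Y V; \<sigma> \<in> F V; \<tau> \<in> F V\<rbrakk> \<Longrightarrow> \<sigma> + \<tau> \<in> F V"
  using ab_sheaf.add_in[OF F_sheaf, of V \<sigma> \<tau>] by simp

lemma F_diff [simp]: "\<lbrakk>opn Y V; \<sigma> \<in> F V; \<tau> \<in> F V\<rbrakk> \<Longrightarrow> \<sigma> - \<tau> \<in> F V"
  using ab_sheaf.diff_in[OF F_sheaf, of V \<sigma> \<tau>] by simp

lemma F_res [simp]: "\<lbrakk>opn Y V; \<sigma> \<in> F V; opn Y W; W \<subseteq> V\<rbrakk> \<Longrightarrow> res P V W \<sigma> \<in> F W"
  using ab_sheaf.res_in[OF F_sheaf, of V W \<sigma>] by simp

lemma F_smul [simp]: "\<lbrakk>opn Y V; \<sigma> \<in> F V; a \<in> sec Y V\<rbrakk> \<Longrightarrow> smul P V a \<sigma> \<in> F V"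
  using kmod.smul_in[OF kmod_F, of V a \<sigma>] by simp

lemma F_iso:
  assumes "opn Y V" "\<sigma> \<in> F V" "\<tau> \<in> F V" shows "pp V \<sigma> \<tau> = 0"
proof -
  have "\<forall>W. opn Y W \<and> W \<subseteq> V \<longrightarrow> (\<forall>\<tau>\<in>F W. pp W (res P V W \<sigma>) \<tau> = 0)"
    using F_lagr[OF assms(1)] assms(2) by blast
  then have "pp V (res P V V \<sigma>) \<tau> = 0" using assms by blast
  then show ?thesis using assms by simp
qed

lemma F_perpI:
  assumes "opn Y V" "\<sigma> \<in> sec P V" and "\<And>W \<tau>. \<lbrakk>opn Y W; W \<subseteq> V; \<tau> \<in> F W\<rbrakk> \<Longrightarrow> pp W (res P V W \<sigma>) \<tau> = 0"
  shows "\<sigma> \<in> F V" by (subst F_lagr[OF assms(1)]) (use assms in simp)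

lemma F_ker_CN: "\<lbrakk>opn Y V; \<sigma> \<in> F V; pa V \<sigma> = 0\<rbrakk> \<Longrightarrow> q V \<sigma> = 0"
  using F_ker[of V] CN_iff[of V \<sigma>] by blast

lemma F_onto:
  assumes "opn Y V" "D \<in> Y.vfs V" "y \<in> V"
  shows "\<exists>W \<tau>. opn Y W \<and> y \<in> W \<and> W \<subseteq> V \<and> \<tau> \<in> F W \<and> pa W \<tau> = Y.vres V W D"
  using F_onto'[OF assms] by blast

lemma F_onto2:
  assumes V: "opn Y V" "D \<in> Y.vfs V" "D' \<in> Y.vfs V" "y \<in> V"
  shows "\<exists>W \<tau> \<tau>'. opn Y W \<and> y \<in> W \<and> W \<subseteq> V \<and> \<tau> \<in> F W \<and> pa W \<tau> = Y.vres V W D \<and>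
    \<tau>' \<in> F W \<and> pa W \<tau>' = Y.vres V W D'"
proof -
  obtain W \<tau> where W: "opn Y W" "y \<in> W" "W \<subseteq> V" "\<tau> \<in> F W" "pa W \<tau> = Y.vres V W D"
    using F_onto[OF V(1,2,4)] by auto
  obtain W' \<tau>' where W': "opn Y W'" "y \<in> W'" "W' \<subseteq> W" "\<tau>' \<in> F W'"
      "pa W' \<tau>' = Y.vres W W' (Y.vres V W D')" using F_onto[of W "Y.vres V W D'" y] V W by auto
  show ?thesis using W W' V
    by (intro exI[of _ W'] exI[of _ "res P W W' \<tau>"] exI[of _ \<tau>']) (auto simp: pa_res)
qed

lemma F_lifts: tangent_lifts unfolding tangent_lifts_def
proof (intro allI impI, elim conjE, goal_cases)
  case V: (1 V D y)
  obtain W \<tau> where "opn Y W" "y \<in> W" "W \<subseteq> V" "\<tau> \<in> F W" "pa W \<tau> = Y.vres V W D"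
    using F_onto[OF V] by auto
  then show ?case by (intro exI[of _ W] exI[of _ \<tau>]) simp
qed

definition eta where "eta V \<kappa> W D = (if opn Y W \<and> W \<subseteq> V \<and> D \<in> Y.vfs W then
     THE r. r \<in> sec Y W \<and> (\<forall>V' r'. opn Y V' \<and> V' \<subseteq> W \<and> r' \<in> sec Y V' \<and>
       (\<exists>\<tau>. \<tau> \<in> F V' \<and> pa V' \<tau> = Y.vres W V' D \<and>
          r' = pairing Q V' (res Q V V' \<kappa>) (q V' \<tau>)) \<longrightarrow> res Y W V' r = r') else 0)"

lemma eta_spec:
  assumes V: "opn Y V" "\<kappa> \<in> sec Q V" and W: "opn Y W" "W \<subseteq> V" "D \<in> Y.vfs W"
  shows "eta V \<kappa> W D \<in> sec Y W \<and> (\<forall>V' r'. opn Y V' \<and> V' \<subseteq> W \<and> r' \<in> sec Y V' \<and>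
       (\<exists>\<tau>. \<tau> \<in> F V' \<and> pa V' \<tau> = Y.vres W V' D \<and>
          r' = pairing Q V' (res Q V V' \<kappa>) (q V' \<tau>)) \<longrightarrow> res Y W V' (eta V \<kappa> W D) = r')"
proof -
  let ?R = "\<lambda>V' r'. \<exists>\<tau>. \<tau> \<in> F V' \<and> pa V' \<tau> = Y.vres W V' D \<and>
          r' = pairing Q V' (res Q V V' \<kappa>) (q V' \<tau>)"
  have ex1: "\<exists>!r. r \<in> sec Y W \<and>
    (\<forall>V' r'. opn Y V' \<and> V' \<subseteq> W \<and> r' \<in> sec Y V' \<and> ?R V' r' \<longrightarrow> res Y W V' r = r')"
  proof (rule Y.O.glue_rel[OF W(1)])
    fix y assume y: "y \<in> W"
    obtain V' \<tau> where V': "opn Y V'" "y \<in> V'" "V' \<subseteq> W" "\<tau> \<in> F V'" "pa V' \<tau> = Y.vres W V' D"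
      using F_onto[OF W(1,3) y] by auto
    then have "V' \<subseteq> V" using W by blast
    then have "pairing Q V' (res Q V V' \<kappa>) (q V' \<tau>) \<in> sec Y V'" using V V' by simp
    then show "\<exists>V' r. opn Y V' \<and> y \<in> V' \<and> V' \<subseteq> W \<and> r \<in> sec Y V' \<and> ?R V' r"
      using V' by (intro exI[of _ V'] exI[of _ "pairing Q V' (res Q V V' \<kappa>) (q V' \<tau>)"]) auto
  next
    fix V1 r1 V2 r2
    assume 1: "opn Y V1" "V1 \<subseteq> W" "?R V1 r1" and 2: "opn Y V2" "V2 \<subseteq> W" "?R V2 r2"
    obtain \<tau>1 where \<tau>1: "\<tau>1 \<in> F V1" "pa V1 \<tau>1 = Y.vres W V1 D"
        "r1 = pairing Q V1 (res Q V V1 \<kappa>) (q V1 \<tau>1)" using 1 by blast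
    obtain \<tau>2 where \<tau>2: "\<tau>2 \<in> F V2" "pa V2 \<tau>2 = Y.vres W V2 D"
        "r2 = pairing Q V2 (res Q V V2 \<kappa>) (q V2 \<tau>2)" using 2 by blast
    let ?N = "V1 \<inter> V2"
    have N: "opn Y ?N" "?N \<subseteq> V1" "?N \<subseteq> V2" "V1 \<subseteq> V" "V2 \<subseteq> V" "?N \<subseteq> V" using 1 2 W by auto
    have "q ?N (res P V1 ?N \<tau>1 - res P V2 ?N \<tau>2) = 0"
      by (rule F_ker_CN) (use N 1 2 \<tau>1 \<tau>2 in \<open>auto simp: pa_diff pa_res\<close>)
    then have "q ?N (res P V1 ?N \<tau>1) = q ?N (res P V2 ?N \<tau>2)" using 1 2 \<tau>1 \<tau>2 by (simp add: q_diff)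
    then show "res Y V1 (V1 \<inter> V2) r1 = res Y V2 (V1 \<inter> V2) r2"
      using N V 1 2 \<tau>1 \<tau>2 by (simp add: pairQ_res[symmetric] q_res)
  qed
  have eq: "eta V \<kappa> W D = (THE r. r \<in> sec Y W \<and>
    (\<forall>V' r'. opn Y V' \<and> V' \<subseteq> W \<and> r' \<in> sec Y V' \<and> ?R V' r' \<longrightarrow> res Y W V' r = r'))"
    by (simp only: eta_def W simp_thms if_True)
  show ?thesis unfolding eq by (rule theI'[OF ex1])
qed

lemma eta_in [simp]: "\<lbrakk>opn Y V; \<kappa> \<in> sec Q V; opn Y W; W \<subseteq> V; D \<in> Y.vfs W\<rbrakk> \<Longrightarrow> eta V \<kappa> W D \<in> sec Y W"
  using eta_spec by blast

lemma eta_null: "\<not> (opn Y W \<and> W \<subseteq> V \<and> D \<in> Y.vfs W) \<Longrightarrow> eta V \<kappa> W D = 0"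
  by (simp only: eta_def if_False)

lemma eta_F:
  assumes V: "opn Y V" "\<kappa> \<in> sec Q V" and W: "opn Y W" "W \<subseteq> V" "D \<in> Y.vfs W"
    and V': "opn Y V'" "V' \<subseteq> W" "\<tau> \<in> F V'" "pa V' \<tau> = Y.vres W V' D"
  shows "res Y W V' (eta V \<kappa> W D) = pairing Q V' (res Q V V' \<kappa>) (q V' \<tau>)"
proof (rule eta_spec[OF V W, THEN conjunct2, rule_format])
  have "V' \<subseteq> V" using V' W by blast
  then show "opn Y V' \<and> V' \<subseteq> W \<and> pairing Q V' (res Q V V' \<kappa>) (q V' \<tau>) \<in> sec Y V' \<and>
    (\<exists>\<tau>'. \<tau>' \<in> F V' \<and> pa V' \<tau>' = Y.vres W V' D \<and>
       pairing Q V' (res Q V V' \<kappa>) (q V' \<tau>) = pairing Q V' (res Q V V' \<kappa>) (q V' \<tau>'))"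
    using V V' by auto
qed

lemma eta_pa:
  assumes "opn Y V" "\<kappa> \<in> sec Q V" "opn Y W" "W \<subseteq> V" "\<tau> \<in> F W"
  shows "eta V \<kappa> W (pa W \<tau>) = pairing Q W (res Q V W \<kappa>) (q W \<tau>)"
  using eta_F[OF assms(1-4) _ assms(3) subset_refl assms(5)] assms by simp

lemma eta_cot [simp]:
  assumes V: "opn Y V" "\<kappa> \<in> sec Q V" shows "eta V \<kappa> \<in> Y.forms V"
proof (rule Y.cotangentI, goal_cases)
  case (2 W D D')
  note W = 2(1,2) and D = 2(3,4)
  show ?case
  proof (rule Y.O.eqI_local[OF W(1)], goal_cases)
    case y: (3 y)
    obtain U \<tau> \<tau>' where U: "opn Y U" "y \<in> U" "U \<subseteq> W" "\<tau> \<in> F U" "pa U \<tau> = Y.vres W U D"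
        "\<tau>' \<in> F U" "pa U \<tau>' = Y.vres W U D'" using F_onto2[OF W(1) D y] by auto
    have UV: "U \<subseteq> V" using U W by blast
    have "res Y W U (eta V \<kappa> W (D + D')) = pairing Q U (res Q V U \<kappa>) (q U (\<tau> + \<tau>'))"
      by (rule eta_F[OF V W _ U(1,3)]) (use D U in \<open>auto simp: pa_add\<close>)
    also have "\<dots> = pairing Q U (res Q V U \<kappa>) (q U \<tau>) + pairing Q U (res Q V U \<kappa>) (q U \<tau>')"
      using U UV V pairQ_add_left[of U "q U \<tau>" "q U \<tau>'" "res Q V U \<kappa>"] pairQ_sym[of U "res Q V U \<kappa>"]
      by (simp add: q_add)
    also have "\<dots> = res Y W U (eta V \<kappa> W D + eta V \<kappa> W D')"
      using eta_F[OF V W D(1) U(1,3,4,5)] eta_F[OF V W D(2) U(1,3,6,7)] U V W D by (simp add: Y.O.res_add)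
    finally show ?case using U by blast
  qed (use V W D in auto)
next
  case (3 W a D)
  note W = 3(1,2) and a = 3(3) and D = 3(4)
  show ?case
  proof (rule Y.O.eqI_local[OF W(1)], goal_cases)
    case y: (3 y)
    obtain U \<tau> where U: "opn Y U" "y \<in> U" "U \<subseteq> W" "\<tau> \<in> F U" "pa U \<tau> = Y.vres W U D"
      using F_onto[OF W(1) D y] by auto
    have UV: "U \<subseteq> V" using U W by blast
    have "res Y W U (eta V \<kappa> W (Y.vsmul W a D)) =
        pairing Q U (res Q V U \<kappa>) (q U (smul P U (res Y W U a) \<tau>))"
      by (rule eta_F[OF V W _ U(1,3)]) (use D U W a in \<open>auto simp: pa_smul Y.res_vf_smul\<close>)
    also have "\<dots> = res Y W U a * pairing Q U (res Q V U \<kappa>) (q U \<tau>)"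
      using U V W a pairQ_smul_left[of U "q U \<tau>" "res Q V U \<kappa>" "res Y W U a"] pairQ_sym[of U "res Q V U \<kappa>"]
      by (simp add: q_smul)
    also have "\<dots> = res Y W U (a * eta V \<kappa> W D)"
      using eta_F[OF V W D U(1,3,4,5)] U V W D a by (simp add: Y.res_mult)
    finally show ?case using U by blast
  qed (use V W D a in auto)
next
  case (4 W W' D)
  note W = 4(1-4) and D = 4(5)
  show ?case
  proof (rule Y.O.eqI_local[OF W(3)], goal_cases)
    case y: (3 y)
    have D': "Y.vres W W' D \<in> Y.vfs W'" "W' \<subseteq> V" using D W by auto
    obtain U \<tau> where U: "opn Y U" "y \<in> U" "U \<subseteq> W'" "\<tau> \<in> F U"
        "pa U \<tau> = Y.vres W' U (Y.vres W W' D)" using F_onto[OF W(3) D'(1) y] by auto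
    have UW: "U \<subseteq> W" using U W by blast
    have "res Y W' U (eta V \<kappa> W' (Y.vres W W' D)) = res Y W U (eta V \<kappa> W D)"
      using eta_F[OF V W(3) D'(2,1) U(1,3,4,5)] eta_F[OF V W(1,2) D U(1) UW U(4)] U by simp
    then show ?case using U V W D by (intro exI[of _ U]) simp
  qed (use V W D in auto)
qed (use V in \<open>auto simp: eta_null\<close>)

lemma cot_eqI_F:
  assumes V: "opn Y V" and \<alpha>: "\<alpha> \<in> Y.forms V" and \<beta>: "\<beta> \<in> Y.forms V"
    and eq: "\<And>W \<tau>. \<lbrakk>opn Y W; W \<subseteq> V; \<tau> \<in> F W\<rbrakk> \<Longrightarrow> \<alpha> W (pa W \<tau>) = \<beta> W (pa W \<tau>)"
  shows "\<alpha> = \<beta>"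
proof (rule Y.cot_eqI[OF \<alpha> \<beta>], goal_cases)
  case (1 W D)
  note W = 1(1,2) and D = 1(3)
  show ?case
  proof (rule Y.O.eqI_local[OF W(1)], goal_cases)
    case y: (3 y)
    obtain U \<tau> where U: "opn Y U" "y \<in> U" "U \<subseteq> W" "\<tau> \<in> F U" "pa U \<tau> = Y.vres W U D"
      using F_onto[OF W(1) D y] by auto
    have UV: "U \<subseteq> V" using U W by blast
    have "\<alpha> U (Y.vres W U D) = \<beta> U (Y.vres W U D)" using eq[OF U(1) UV U(4)] U by simp
    then have "res Y W U (\<alpha> W D) = res Y W U (\<beta> W D)"
      using Y.cot_res[OF \<alpha> W U(1,3) D] Y.cot_res[OF \<beta> W U(1,3) D] by simp
    then show ?case using U by blast
  qed (use W D \<alpha> \<beta> in auto)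
qed

lemma eta_add:
  assumes V: "opn Y V" "\<kappa> \<in> sec Q V" "\<mu> \<in> sec Q V"
  shows "eta V (\<kappa> + \<mu>) = eta V \<kappa> + eta V \<mu>" by (rule cot_eqI_F[OF V(1)])
    (use V in \<open>auto simp: eta_pa Q.M.res_add pairQ_add_left\<close>)

lemma smul_cot_in: "\<lbrakk>opn Y V; \<alpha> \<in> Y.forms V; a \<in> sec Y V\<rbrakk> \<Longrightarrow>
    smul (cotangent Y) V a \<alpha> \<in> Y.forms V" by (rule Y.cotangentI)
    (auto simp: Y.cot_add Y.cot_smul Y.cot_res Y.cot_null Y.res_mult algebra_simps)

lemma eta_smul:
  assumes V: "opn Y V" "\<kappa> \<in> sec Q V" "a \<in> sec Y V"
  shows "eta V (smul Q V a \<kappa>) = smul (cotangent Y) V a (eta V \<kappa>)" by (rule cot_eqI_F[OF V(1)])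
    (use V in \<open>auto simp: eta_pa Q.res_smul pairQ_smul_left smul_cot_in\<close>)

lemma eta_res:
  assumes V: "opn Y V" "\<kappa> \<in> sec Q V" "opn Y W" "W \<subseteq> V"
  shows "eta W (res Q V W \<kappa>) = Y.fres V W (eta V \<kappa>)"
proof (rule cot_eqI_F[OF V(3)], goal_cases)
  case W': (3 W' \<tau>)
  have "W' \<subseteq> V" using W' V by blast
  then show ?case using V W' by (simp add: eta_pa)
qed (use V in auto)

definition triv where "triv V \<kappa> = (if opn Y V \<and> \<kappa> \<in> sec Q V then (anchor Q V \<kappa>, eta V \<kappa>) else 0)"

lemma triv_app: "opn Y V \<Longrightarrow> \<kappa> \<in> sec Q V \<Longrightarrow> triv V \<kappa> = (anchor Q V \<kappa>, eta V \<kappa>)" by (simp add: triv_def)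

lemma triv_ker:
  assumes V: "opn Y V" "\<kappa> \<in> sec Q V" and a: "anchor Q V \<kappa> = 0" and e: "eta V \<kappa> = 0" shows "\<kappa> = 0"
proof (rule Q.M.eqI_local[OF V(1,2)], goal_cases)
  case y: (2 y)
  obtain W \<sigma> where W: "opn Y W" "y \<in> W" "W \<subseteq> V" "\<sigma> \<in> AP W" "q W \<sigma> = res Q V W \<kappa>"
    using q_lift[OF V y] by auto
  have "\<sigma> \<in> F W"
  proof (rule F_perpI[OF W(1)], goal_cases)
    case W': (2 W' \<tau>)
    have W'V: "W' \<subseteq> V" using W' W by blast
    have "pp W' (res P W W' \<sigma>) \<tau> = pairing Q W' (q W' (res P W W' \<sigma>)) (q W' \<tau>)" using W W' by simp
    also have "q W' (res P W W' \<sigma>) = res Q V W' \<kappa>" using W W' V by (simp add: q_res)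
    also have "pairing Q W' (res Q V W' \<kappa>) (q W' \<tau>) = 0"
      using eta_pa[OF V W'(1) W'V W'(3)] e by simp
    finally show ?case .
  qed (use W in simp)
  moreover have "pa W \<sigma> = 0" using anch_q[OF W(1,4)] W V a by (simp add: anchQ_res)
  ultimately have "res Q V W \<kappa> = 0" using F_ker_CN[OF W(1)] W by simp
  then show ?case using W V by (intro exI[of _ W]) simp
qed (use V in simp)

lemma triv_inj:
  assumes V: "opn Y V" "\<kappa> \<in> sec Q V" "\<mu> \<in> sec Q V" and eq: "triv V \<kappa> = triv V \<mu>" shows "\<kappa> = \<mu>"
proof -
  have a: "anchor Q V (\<kappa> - \<mu>) + anchor Q V \<mu> = anchor Q V \<kappa>"
    using anchQ_add[of V "\<kappa> - \<mu>" \<mu>] V by simp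
  have e: "eta V (\<kappa> - \<mu>) + eta V \<mu> = eta V \<kappa>" using eta_add[of V "\<kappa> - \<mu>" \<mu>] V by simp
  have "\<kappa> - \<mu> = 0" by (rule triv_ker[OF V(1)]) (use V a e eq in \<open>auto simp: triv_app\<close>)
  then show ?thesis by simp
qed

lemma triv_surj_local:
  assumes V: "opn Y V" and D: "D \<in> Y.vfs V" and \<eta>: "\<eta> \<in> Y.forms V" and y: "y \<in> V"
  shows "\<exists>W \<kappa>. opn Y W \<and> y \<in> W \<and> W \<subseteq> V \<and> \<kappa> \<in> sec Q W \<and> triv W \<kappa> = (Y.vres V W D, Y.fres V W \<eta>)"
proof -
  obtain W0 \<tau> where W0: "opn Y W0" "y \<in> W0" "W0 \<subseteq> V" "\<tau> \<in> F W0" "pa W0 \<tau> = Y.vres V W0 D"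
    using F_onto[OF V D y] by auto
  obtain U \<omega> where U: "opn X U" "y \<in> U" "tr U \<subseteq> W0" "\<omega> \<in> X.forms U"
      "form_restricts X Y \<rho> U \<omega> (Y.fres V W0 \<eta>)"
    using form_extends[OF F_lifts W0(1) Y.res_cot_in[OF \<eta> W0(3)] W0(2)] by auto
  let ?W = "tr U"
  let ?c = "p U (coanchor X E U \<omega>)" and ?\<tau> = "res P W0 (tr U) \<tau>"
  have W: "opn Y ?W" "y \<in> ?W" "?W \<subseteq> V" using U W0 pts_Y[OF V y] by auto
  have c: "?c \<in> AP ?W" and \<tau>: "?\<tau> \<in> F ?W" using U W0 by auto
  let ?\<kappa> = "q ?W (?\<tau> + ?c)"
  have \<kappa>: "?\<kappa> \<in> sec Q ?W" using c \<tau> W by simp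
  have "anchor Q ?W ?\<kappa> = Y.vres V ?W D" using U W0 by (simp add: pa_add pa_res)
  moreover have "eta ?W ?\<kappa> = Y.fres V ?W \<eta>"
  proof (rule cot_eqI_F[OF W(1)])
    fix N \<tau>' assume N: "opn Y N" "N \<subseteq> ?W" "\<tau>' \<in> F N"
    have NN: "N \<subseteq> W0" "N \<subseteq> V" using N U W by auto
    obtain U' where U': "opn X U'" "N = tr U'" using N opn_trace_iff by blast
    let ?N = "U' \<inter> U"
    have N': "N = tr ?N" "opn X ?N" "?N \<subseteq> U" using U' U N by auto
    have cN: "res P ?W N ?c = p ?N (coanchor X E ?N (X.fres U ?N \<omega>))"
      using N' U by (simp add: C.coanchor_res p_res)
    have r: "form_restricts X Y \<rho> ?N (X.fres U ?N \<omega>) (Y.fres V W0 \<eta>)"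
      using U(5) N' unfolding form_restricts_def by auto
    have "eta ?W ?\<kappa> N (pa N \<tau>') = pairing Q N (q N (res P ?W N (?\<tau> + ?c))) (q N \<tau>')"
      using eta_pa[OF W(1) \<kappa> N] N W c \<tau> by (simp add: q_res)
    also have "\<dots> = pp N (res P ?W N ?\<tau>) \<tau>' + pp N (res P ?W N ?c) \<tau>'"
      using N W c \<tau> by (simp add: P.M.res_add pp_add_left)
    also have "pp N (res P ?W N ?\<tau>) \<tau>' = 0" using F_iso[OF N(1) _ N(3)] N W \<tau> by simp
    also have "pp N (res P ?W N ?c) \<tau>' = Y.fres V W0 \<eta> N (pa N \<tau>')"
      unfolding cN using pp_coanchor[OF N'(2) _ W0(1) _ _ r, of \<tau>'] U N N' NN W0 \<eta> by simp
    finally show "eta ?W ?\<kappa> N (pa N \<tau>') = Y.fres V ?W \<eta> N (pa N \<tau>')" using N NN by simp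
  qed (use W \<kappa> \<eta> in auto)
ultimately have "triv ?W ?\<kappa> = (Y.vres V ?W D, Y.fres V ?W \<eta>)" using W \<kappa> by (simp add: triv_app)
  then show ?thesis using W \<kappa> by blast
qed

lemma triv_surj:
  assumes V: "opn Y V" and D: "D \<in> Y.vfs V" and \<eta>: "\<eta> \<in> Y.forms V"
  shows "\<exists>\<kappa>\<in>sec Q V. triv V \<kappa> = (D, \<eta>)"
proof -
  let ?R = "\<lambda>W \<kappa>. triv W \<kappa> = (Y.vres V W D, Y.fres V W \<eta>)"
  have "\<exists>!\<kappa>. \<kappa> \<in> sec Q V \<and> (\<forall>W \<mu>. opn Y W \<and> W \<subseteq> V \<and> \<mu> \<in> sec Q W \<and> ?R W \<mu> \<longrightarrow> res Q V W \<kappa> = \<mu>)"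
  proof (rule Q.M.glue_rel[OF V], goal_cases)
    case (1 y)
    then show ?case by (rule triv_surj_local[OF V D \<eta>])
  next
    fix W1 \<kappa>1 W2 \<kappa>2
    assume 1: "opn Y W1" "W1 \<subseteq> V" "\<kappa>1 \<in> sec Q W1" "?R W1 \<kappa>1"
      and 2: "opn Y W2" "W2 \<subseteq> V" "\<kappa>2 \<in> sec Q W2" "?R W2 \<kappa>2"
    let ?N = "W1 \<inter> W2"
    have N: "opn Y ?N" using 1 2 by simp
    show "res Q W1 ?N \<kappa>1 = res Q W2 ?N \<kappa>2"
    proof (rule triv_inj[OF N])
      have "triv ?N (res Q W1 ?N \<kappa>1) = (Y.vres V ?N D, Y.fres V ?N \<eta>)"
        using 1 N by (simp add: triv_app anchQ_res eta_res) (auto simp: Y.res_cot_app fun_eq_iff)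
      moreover have "triv ?N (res Q W2 ?N \<kappa>2) = (Y.vres V ?N D, Y.fres V ?N \<eta>)"
        using 2 N by (simp add: triv_app anchQ_res eta_res) (auto simp: Y.res_cot_app fun_eq_iff)
      ultimately show "triv ?N (res Q W1 ?N \<kappa>1) = triv ?N (res Q W2 ?N \<kappa>2)" by simp
    qed (use 1 2 N in auto)
  qed
  from ex1_implies_ex[OF this] obtain \<kappa> where \<kappa>: "\<kappa> \<in> sec Q V"
    and r: "\<forall>W \<mu>. opn Y W \<and> W \<subseteq> V \<and> \<mu> \<in> sec Q W \<and> ?R W \<mu> \<longrightarrow> res Q V W \<kappa> = \<mu>" by (elim exE conjE)
  have loc: "\<exists>W. opn Y W \<and> y \<in> W \<and> W \<subseteq> V \<and> ?R W (res Q V W \<kappa>)" if y: "y \<in> V" for y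
  proof -
    obtain W \<mu> where W: "opn Y W" "y \<in> W" "W \<subseteq> V" "\<mu> \<in> sec Q W" "?R W \<mu>"
      using triv_surj_local[OF V D \<eta> y] by auto
    have "res Q V W \<kappa> = \<mu>" by (rule r[rule_format]) (intro conjI W)
    then show ?thesis using W by blast
  qed
  have "anchor Q V \<kappa> = D"
  proof (rule Y.vf_eqI_local[OF V _ D], goal_cases)
    case (2 y)
    then obtain W where W: "opn Y W" "y \<in> W" "W \<subseteq> V" "?R W (res Q V W \<kappa>)" using loc by blast
    then have "Y.vres V W (anchor Q V \<kappa>) = Y.vres V W D" using V \<kappa> by (simp add: triv_app anchQ_res)
    then show ?case using W by blast
  qed (use V \<kappa> in simp)
  moreover have "eta V \<kappa> = \<eta>"
  proof (rule Y.cot_eqI_local[OF V _ \<eta>], goal_cases)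
    case (2 y)
    then obtain W where W: "opn Y W" "y \<in> W" "W \<subseteq> V" "?R W (res Q V W \<kappa>)" using loc by blast
    then have "Y.fres V W (eta V \<kappa>) = Y.fres V W \<eta>" using V \<kappa> by (simp add: triv_app eta_res)
    then show ?case using W by blast
  qed (use V \<kappa> in simp)
  ultimately show ?thesis using V \<kappa> by (intro bexI[of _ \<kappa>]) (simp add: triv_app)
qed

end

context gen_tangent
begin

lemma local2:
  assumes V: "opn Y V" "\<kappa> \<in> sec Q V" "\<mu> \<in> sec Q V" "y \<in> V"
  shows "\<exists>W \<sigma> \<sigma>' \<tau> \<tau>'. opn Y W \<and> y \<in> W \<and> W \<subseteq> V \<and> \<sigma> \<in> AP W \<and> q W \<sigma> = res Q V W \<kappa> \<and>
    \<sigma>' \<in> AP W \<and> q W \<sigma>' = res Q V W \<mu> \<and> \<tau> \<in> F W \<and> pa W \<tau> = pa W \<sigma> \<and> \<tau>' \<in> F W \<and> pa W \<tau>' = pa W \<sigma>'"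
proof -
  obtain W0 \<sigma> \<sigma>' where W0: "opn Y W0" "y \<in> W0" "W0 \<subseteq> V" "\<sigma> \<in> AP W0" "q W0 \<sigma> = res Q V W0 \<kappa>"
      "\<sigma>' \<in> AP W0" "q W0 \<sigma>' = res Q V W0 \<mu>" using q_lift2[OF V] by auto
  obtain W \<tau> \<tau>' where W: "opn Y W" "y \<in> W" "W \<subseteq> W0" "\<tau> \<in> F W" "pa W \<tau> = Y.vres W0 W (pa W0 \<sigma>)"
      "\<tau>' \<in> F W" "pa W \<tau>' = Y.vres W0 W (pa W0 \<sigma>')"
    using F_onto2[OF W0(1) pa_in[OF W0(1,4)] pa_in[OF W0(1,6)] W0(2)] by auto
  show ?thesis using W W0 V
    by (intro exI[of _ W] exI[of _ "res P W0 W \<sigma>"] exI[of _ "res P W0 W \<sigma>'"] exI[of _ \<tau>] exI[of _ \<tau>'])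
      (auto simp: pa_res q_res)
qed

lemma pa_q_res:
  assumes V: "opn Y V" "\<kappa> \<in> sec Q V" "opn Y W" "W \<subseteq> V" "\<sigma> \<in> AP W" "q W \<sigma> = res Q V W \<kappa>"
  shows "pa W \<sigma> = Y.vres V W (anchor Q V \<kappa>)" using anch_q[OF V(3,5)] V by (simp add: anchQ_res)

lemma triv_pair:
  assumes V: "opn Y V" "\<kappa> \<in> sec Q V" "\<mu> \<in> sec Q V"
  shows "eta V \<kappa> V (anchor Q V \<mu>) + eta V \<mu> V (anchor Q V \<kappa>) = pairing Q V \<kappa> \<mu>"
proof (rule Y.O.eqI_local[OF V(1)], goal_cases)
  case y: (3 y)
  obtain W \<sigma> \<sigma>' \<tau> \<tau>' where W: "opn Y W" "y \<in> W" "W \<subseteq> V" and \<sigma>: "\<sigma> \<in> AP W" "q W \<sigma> = res Q V W \<kappa>"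
    and \<sigma>': "\<sigma>' \<in> AP W" "q W \<sigma>' = res Q V W \<mu>" and \<tau>: "\<tau> \<in> F W" "pa W \<tau> = pa W \<sigma>"
    and \<tau>': "\<tau>' \<in> F W" "pa W \<tau>' = pa W \<sigma>'" using local2[OF V y] by auto
  have a: "pa W \<tau> = Y.vres V W (anchor Q V \<kappa>)" "pa W \<tau>' = Y.vres V W (anchor Q V \<mu>)"
    using pa_q_res[OF V(1,2) W(1,3) \<sigma>] pa_q_res[OF V(1,3) W(1,3) \<sigma>'] \<tau> \<tau>' by simp_all
  have 1: "res Y V W (eta V \<kappa> V (anchor Q V \<mu>)) = pp W \<sigma> \<tau>'"
    using eta_F[OF V(1,2) V(1) subset_refl anchQ_in[OF V(1,3)] W(1,3) \<tau>'(1) a(2)]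
      pair_q[OF W(1) \<sigma>(1) F_AP[OF W(1) \<tau>'(1)]] \<sigma>(2) by simp
  have 2: "res Y V W (eta V \<mu> V (anchor Q V \<kappa>)) = pp W \<sigma>' \<tau>"
    using eta_F[OF V(1,3) V(1) subset_refl anchQ_in[OF V(1,2)] W(1,3) \<tau>(1) a(1)]
      pair_q[OF W(1) \<sigma>'(1) F_AP[OF W(1) \<tau>(1)]] \<sigma>'(2) by simp
  have 3: "res Y V W (pairing Q V \<kappa> \<mu>) = pp W \<sigma> \<sigma>'"
    using pair_q[OF W(1) \<sigma>(1) \<sigma>'(1)] \<sigma>(2) \<sigma>'(2) pairQ_res[OF V W(1,3)] by simp
  have in_P: "\<sigma> \<in> sec P W" "\<sigma>' \<in> sec P W" "\<tau> \<in> sec P W" "\<tau>' \<in> sec P W" using \<sigma> \<sigma>' \<tau> \<tau>' W by auto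
  have "pp W (\<sigma> - \<tau>) (\<sigma>' - \<tau>') = 0" by (rule pp_anchor_0) (use W \<sigma> \<sigma>' \<tau> \<tau>' in \<open>auto simp: pa_diff\<close>)
  moreover have "pp W (\<sigma> - \<tau>) \<sigma>' = pp W (\<sigma> - \<tau>) (\<sigma>' - \<tau>') + pp W (\<sigma> - \<tau>) \<tau>'"
    using pp_add_right[of W "\<sigma> - \<tau>" "\<sigma>' - \<tau>'" \<tau>'] W in_P by simp
  ultimately have "pp W \<sigma> \<sigma>' = pp W \<sigma> \<tau>' + pp W \<sigma>' \<tau>"
    using F_iso[OF W(1) \<tau>(1) \<tau>'(1)] pp_sym[OF W(1) in_P(2,3)] W in_P
    by (simp add: pp_diff_left algebra_simps)
  then show ?case using W V 1 2 3 by (intro exI[of _ W]) (simp add: Y.O.res_add)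
qed (use V in auto)

lemma rho_pair_F:
  assumes "opn X U" "f \<in> sec E U" "g \<in> sec E U" "p U f \<in> F (tr U)" "p U g \<in> F (tr U)"
  shows "\<rho> U (pairing E U f g) = 0"
  using F_iso[OF opn_trace assms(4,5)] pp_p[OF assms(1-3)] assms(1) by simp

lemma rho_anch_pair_F:
  assumes "opn X U" "e \<in> sec E U" "f \<in> sec E U" "g \<in> sec E U"
    "p U e \<in> AP (tr U)" "p U f \<in> F (tr U)" "p U g \<in> F (tr U)"
  shows "\<rho> U (anchor E U e U (pairing E U f g)) = 0"
  using pa_p[OF assms(5,1,2,1) subset_refl, of "pairing E U f g"] rho_pair_F[OF assms(1,3,4,6,7)]
    Y.vf_zero[OF pa_in[OF opn_trace assms(5)]] assms by simp

lemma rho_bracket_identity: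
  assumes U: "opn X U" and e: "e \<in> sec E U" "p U e \<in> AP (tr U)"
    and e': "e' \<in> sec E U" "p U e' \<in> AP (tr U)"
    and f: "f \<in> sec E U" "p U f \<in> F (tr U)" "pa (tr U) (p U f) = pa (tr U) (p U e)"
    and f': "f' \<in> sec E U" "p U f' \<in> F (tr U)" "pa (tr U) (p U f') = pa (tr U) (p U e')"
    and g: "g \<in> sec E U" "p U g \<in> F (tr U)"
  shows "\<rho> U (pairing E U (bracket E U e e') g) =
    \<rho> U (anchor E U e U (pairing E U e' g)) - \<rho> U (pairing E U e' (bracket E U f g)) -
    (\<rho> U (anchor E U e' U (pairing E U e g)) - \<rho> U (anchor E U g U (pairing E U e f')) -
     \<rho> U (pairing E U e (bracket E U f' g)))"
proof -
  let ?V = "tr U" and ?pr = "pairing E U" and ?b = "bracket E U" and ?a = "\<lambda>x. anchor E U x U"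
  let ?d = "e - f" and ?d' = "e' - f'"
  have V: "opn Y ?V" using U by simp
  have fA: "p U f \<in> AP ?V" "p U f' \<in> AP ?V" "p U g \<in> AP ?V" using f f' g V by auto
  have d: "?d \<in> sec E U" "p U ?d \<in> AP ?V" "pa ?V (p U ?d) = 0"
    and d': "?d' \<in> sec E U" "p U ?d' \<in> AP ?V" "pa ?V (p U ?d') = 0"
    using U e e' f f' by (auto simp: p_diff pa_diff)
  note b1 = AP_brk[OF U g(1) d(1) fA(3) d(2)]
  have gd: "pa ?V (p U (?b g ?d)) = 0"
    unfolding b1(2) d(3) using Y.vf_zero[OF pa_in[OF V fA(3)]] by (simp add: lie_bracket_def fun_eq_iff)
  have gf': "p U (?b g f') \<in> F ?V" using F_brk[OF U g(1) f'(1)] g f' by simp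
  have "?pr (?b e e') g = ?a e (?pr e' g) - ?pr e' (?b e g)"
    using C.anch_pair[OF U e(1) e'(1) g(1)] by simp
  then have 1: "\<rho> U (?pr (?b e e') g) = \<rho> U (?a e (?pr e' g)) - \<rho> U (?pr e' (?b e g))"
    using U e e' g by (simp add: rho_diff)
  have "?b e g = ?b f g + ?b ?d g" using C.brk_add_left[OF U f(1) d(1) g(1)] by simp
  then have 2: "\<rho> U (?pr e' (?b e g)) = \<rho> U (?pr e' (?b f g)) + \<rho> U (?pr e' (?b ?d g))"
    using U e' f d g by (simp add: C.pair_add_right rho_add)
  have "?pr e' (?b ?d g) + ?pr e' (?b g ?d) = ?a e' (?pr ?d g)"
    using C.brk_skew[OF U d(1) g(1) e'(1)] C.pair_sym[OF U e'(1)] U d g by simp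
  then have 3: "\<rho> U (?pr e' (?b ?d g)) + \<rho> U (?pr e' (?b g ?d)) = \<rho> U (?a e' (?pr ?d g))"
    using U e' d g by (simp add: rho_add[symmetric])
  have "?pr e g = ?pr ?d g + ?pr f g" using C.pair_add_left[OF U d(1) f(1) g(1)] by simp
  then have 4: "\<rho> U (?a e' (?pr e g)) = \<rho> U (?a e' (?pr ?d g))"
    using U e' d f g rho_anch_pair_F[OF U e'(1) f(1) g(1) e'(2) f(2) g(2)]
    by (simp add: C.anch_vf_add rho_add)
  have "?pr e' (?b g ?d) = ?pr ?d' (?b g ?d) + ?pr f' (?b g ?d)"
    using C.pair_add_left[OF U d'(1) f'(1), of "?b g ?d"] U g d by simp
  moreover have "\<rho> U (?pr ?d' (?b g ?d)) = 0"
    using pp_anchor_0[OF V d'(2,3) b1(1) gd] pp_p[OF U d'(1), of "?b g ?d"] U g d by simp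
  ultimately have 5: "\<rho> U (?pr e' (?b g ?d)) = \<rho> U (?pr f' (?b g ?d))"
    using U d' f' g d by (simp add: rho_add)
  have "?pr f' (?b g ?d) = ?a g (?pr f' ?d) - ?pr (?b g f') ?d"
    using C.anch_pair[OF U g(1) f'(1) d(1)] by simp
  then have 6: "\<rho> U (?pr f' (?b g ?d)) = \<rho> U (?a g (?pr f' ?d)) - \<rho> U (?pr (?b g f') ?d)"
    using U f' d g by (simp add: rho_diff)
  have "?pr e f' = ?pr f' ?d + ?pr f' f"
    using C.pair_add_right[OF U d(1) f(1) f'(1)] C.pair_sym[OF U e(1) f'(1)] by simp
  then have 7: "\<rho> U (?a g (?pr e f')) = \<rho> U (?a g (?pr f' ?d))"
    using U f' d f g rho_anch_pair_F[OF U g(1) f'(1) f(1) fA(3) f'(2) f(2)]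
    by (simp add: C.anch_vf_add rho_add)
  have "?pr (?b g f') e = ?pr (?b g f') ?d + ?pr (?b g f') f"
    using C.pair_add_right[OF U d(1) f(1), of "?b g f'"] U g f' by simp
  then have 8: "\<rho> U (?pr (?b g f') e) = \<rho> U (?pr (?b g f') ?d)"
    using U f' d f g rho_pair_F[OF U _ f(1) gf' f(2)] by (simp add: rho_add)
  have "?pr e (?b f' g) + ?pr (?b g f') e = ?a e (?pr f' g)"
    using C.brk_skew[OF U f'(1) g(1) e(1)] C.pair_sym[OF U e(1), of "?b f' g"] U f' g by simp
  then have "\<rho> U (?pr e (?b f' g)) + \<rho> U (?pr (?b g f') e) = \<rho> U (?a e (?pr f' g))"
    using U e f' g by (simp add: rho_add[symmetric])
  then have 9: "\<rho> U (?pr e (?b f' g)) + \<rho> U (?pr (?b g f') e) = 0"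
    using rho_anch_pair_F[OF U e(1) f'(1) g(1) e(2) f'(2) g(2)] by simp
  have h: "\<rho> U (?pr e' (?b ?d g)) = \<rho> U (?a e' (?pr ?d g)) - \<rho> U (?pr e' (?b g ?d))"
    unfolding 3[symmetric] by simp
  have n: "\<rho> U (?pr (?b g f') ?d) = - \<rho> U (?pr e (?b f' g))"
    unfolding 8[symmetric] using 9 by (simp add: eq_neg_iff_add_eq_0 add.commute)
  show ?thesis unfolding 1 2 h 4 5 6 7 n by (simp add: algebra_simps)
qed

lemma triv_brk1:
  assumes V: "opn Y V" "\<kappa> \<in> sec Q V" "\<mu> \<in> sec Q V"
  shows "anchor Q V (bracket Q V \<kappa> \<mu>) = lie_bracket (anchor Q V \<kappa>) (anchor Q V \<mu>)"
proof (rule Y.vf_eqI_local[OF V(1)], goal_cases)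
  case y: (3 y)
  obtain W \<sigma> \<sigma>' where W: "opn Y W" "y \<in> W" "W \<subseteq> V" and \<sigma>: "\<sigma> \<in> AP W" "q W \<sigma> = res Q V W \<kappa>"
    and \<sigma>': "\<sigma>' \<in> AP W" "q W \<sigma>' = res Q V W \<mu>" using q_lift2[OF V y] by auto
  obtain U e f where U: "opn X U" "y \<in> U" "tr U \<subseteq> W" "e \<in> sec E U" "p U e = res P W (tr U) \<sigma>"
      "f \<in> sec E U" "p U f = res P W (tr U) \<sigma>'"
    using lift2[OF W(1) AP_in[OF \<sigma>(1)] AP_in[OF \<sigma>'(1)] W(2), of "pts X"] pts_YX[OF W(1,2)] by auto
  let ?N = "tr U"
  have N: "opn Y ?N" "y \<in> ?N" "?N \<subseteq> V" using U W pts_Y[OF W(1,2)] by auto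
  have A: "p U e \<in> AP ?N" "p U f \<in> AP ?N"
    using AP_res[OF W(1) \<sigma>(1) N(1) U(3)] AP_res[OF W(1) \<sigma>'(1) N(1) U(3)] U(5,7) by simp_all
  have qe: "q ?N (p U e) = res Q V ?N \<kappa>" "q ?N (p U f) = res Q V ?N \<mu>"
    using q_res[OF W(1) \<sigma>(1) N(1) U(3)] q_res[OF W(1) \<sigma>'(1) N(1) U(3)] U(5,7) \<sigma>(2) \<sigma>'(2)
      Q.M.res_res[OF V(1) W(1) N(1) U(3) W(3)] V(2,3) by simp_all
  have "Y.vres V ?N (anchor Q V (bracket Q V \<kappa> \<mu>)) = pa ?N (p U (bracket E U e f))"
    using anch_q[OF N(1) AP_brk(1)[OF U(1,4,6) A]] brk_q[OF U(1,4,6) A] qe brkQ_res[OF V N(1,3)]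
      anchQ_res[OF V(1) brkQ_in[OF V] N(1,3)] by simp
  also have "\<dots> = lie_bracket (pa ?N (p U e)) (pa ?N (p U f))" by (rule AP_brk(2)[OF U(1,4,6) A])
  also have "\<dots> = Y.vres V ?N (lie_bracket (anchor Q V \<kappa>) (anchor Q V \<mu>))"
    using pa_q_res[OF V(1,2) N(1,3) A(1) qe(1)] pa_q_res[OF V(1,3) N(1,3) A(2) qe(2)] V N
    by (simp add: Y.res_lie_bracket)
  finally show ?case using N by blast
qed (use V in auto)

lemma triv_brk2:
  assumes V: "opn Y V" "\<kappa> \<in> sec Q V" "\<mu> \<in> sec Q V" shows "eta V (bracket Q V \<kappa> \<mu>) =
    lie_derivative Y V (anchor Q V \<kappa>) (eta V \<mu>) - contract_d Y V (anchor Q V \<mu>) (eta V \<kappa>)"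
proof (intro ext)
  fix W D2
  let ?D = "anchor Q V \<kappa>" and ?D' = "anchor Q V \<mu>"
  show "eta V (bracket Q V \<kappa> \<mu>) W D2 =
    (lie_derivative Y V ?D (eta V \<mu>) - contract_d Y V ?D' (eta V \<kappa>)) W D2"
  proof (cases "opn Y W \<and> W \<subseteq> V \<and> D2 \<in> Y.vfs W")
    case False
    then show ?thesis by (simp only: eta_null lie_derivative_def contract_d_def if_False minus_apply simp_thms diff_self)
  next
    case True
    then have W: "opn Y W" "W \<subseteq> V" and D2: "D2 \<in> Y.vfs W" by auto
    have DT: "?D \<in> Y.vfs V" "?D' \<in> Y.vfs V" using V by auto
    let ?h = "eta V" and ?r = "Y.vres V W"
    let ?T1 = "?D W (?h \<mu> W D2)" and ?T2 = "?h \<mu> W (lie_bracket (?r ?D) D2)"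
      and ?T3 = "?D' W (?h \<kappa> W D2)" and ?T4 = "D2 W (?h \<kappa> W (?r ?D'))"
      and ?T5 = "?h \<kappa> W (lie_bracket (?r ?D') D2)"
    let ?L = "?h (bracket Q V \<kappa> \<mu>) W D2" and ?R = "?T1 - ?T2 - (?T3 - ?T4 - ?T5)"
    have rD: "?r ?D \<in> Y.vfs W" "?r ?D' \<in> Y.vfs W" using DT W by simp_all
    have h_in: "?h x W D1 \<in> sec Y W" if "x \<in> sec Q V" "D1 \<in> Y.vfs W" for x D1 using V W that by simp
    have ins: "?T1 \<in> sec Y W" "?T3 \<in> sec Y W" "?T4 \<in> sec Y W" "?T2 \<in> sec Y W" "?T5 \<in> sec Y W"
      using Y.vf_in[OF DT(1) W h_in[OF V(3) D2]] Y.vf_in[OF DT(2) W h_in[OF V(2) D2]]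
        Y.vf_in[OF D2 W(1) subset_refl h_in[OF V(2) rD(2)]]
        h_in[OF V(3) Y.lie_bracket_in[OF rD(1) D2]] h_in[OF V(2) Y.lie_bracket_in[OF rD(2) D2]] by simp_all
    have rhs: "(lie_derivative Y V ?D (?h \<mu>) - contract_d Y V ?D' (?h \<kappa>)) W D2 = ?R"
      using True by (simp add: lie_derivative_def contract_d_def)
    have "?L = ?R"
    proof (rule Y.O.eqI_local[OF W(1)], goal_cases)
      case y: (3 y)
      obtain W1 \<sigma> \<sigma>' \<tau> \<tau>' where W1: "opn Y W1" "y \<in> W1" "W1 \<subseteq> V" and \<sigma>: "\<sigma> \<in> AP W1" "q W1 \<sigma> = res Q V W1 \<kappa>"
        and \<sigma>': "\<sigma>' \<in> AP W1" "q W1 \<sigma>' = res Q V W1 \<mu>" and \<tau>: "\<tau> \<in> F W1" "pa W1 \<tau> = pa W1 \<sigma>"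
        and \<tau>': "\<tau>' \<in> F W1" "pa W1 \<tau>' = pa W1 \<sigma>'" using local2[OF V subsetD[OF W(2) y]] by auto
      let ?W2 = "W \<inter> W1"
      obtain W3 \<upsilon> where W3: "opn Y W3" "y \<in> W3" "W3 \<subseteq> ?W2" "\<upsilon> \<in> F W3"
          "pa W3 \<upsilon> = Y.vres ?W2 W3 (Y.vres W ?W2 D2)"
        using F_onto[of ?W2 "Y.vres W ?W2 D2" y] W W1 D2 y by auto
      have W31: "W3 \<subseteq> W1" "W3 \<subseteq> W" "W3 \<subseteq> V" using W3 W1 by auto
      let ?s = "\<lambda>\<sigma>. res P W1 W3 \<sigma>"
      have sP: "?s \<sigma> \<in> sec P W3" "?s \<sigma>' \<in> sec P W3" "?s \<tau> \<in> sec P W3" "?s \<tau>' \<in> sec P W3" "\<upsilon> \<in> sec P W3"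
        using \<sigma> \<sigma>' \<tau> \<tau>' W1 W3 by auto
      obtain U1 e e' where U1: "opn X U1" "y \<in> U1" "tr U1 \<subseteq> W3"
          "e \<in> sec E U1" "p U1 e = res P W3 (tr U1) (?s \<sigma>)"
          "e' \<in> sec E U1" "p U1 e' = res P W3 (tr U1) (?s \<sigma>')"
        using lift2[OF W3(1) sP(1,2) W3(2), of "pts X"] pts_YX[OF W3(1,2)] by auto
      obtain U f f' g where U: "opn X U" "y \<in> U" "U \<subseteq> U1" "tr U \<subseteq> W3"
          "f \<in> sec E U" "p U f = res P W3 (tr U) (?s \<tau>)"
          "f' \<in> sec E U" "p U f' = res P W3 (tr U) (?s \<tau>')"
          "g \<in> sec E U" "p U g = res P W3 (tr U) \<upsilon>"
        using lift3[OF W3(1) sP(3,4,5) W3(2) U1(1,2)] by auto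
      let ?N = "tr U" and ?pr = "\<lambda>x y. \<rho> U (pairing E U x y)"
      let ?z = "res Y W ?N"
      let ?e = "res E U1 U e" and ?e' = "res E U1 U e'"
      have N: "opn Y ?N" "?N \<subseteq> W3" "?N \<subseteq> W1" "?N \<subseteq> W" "?N \<subseteq> V" "y \<in> ?N"
        using U W31 pts_Y[OF W(1) y] by auto
      have e: "?e \<in> sec E U" "p U ?e = res P W1 ?N \<sigma>"
        using U(1,3) U1(1,4) lift_res[OF W3(1) sP(1) U1(1,3,4,5) U(1,3)] \<sigma>(1) W1(1) W3(1) W31(1) N by simp_all
      have e': "?e' \<in> sec E U" "p U ?e' = res P W1 ?N \<sigma>'"
        using U(1,3) U1(1,6) lift_res[OF W3(1) sP(2) U1(1,3,6,7) U(1,3)] \<sigma>'(1) W1(1) W3(1) W31(1) N by simp_all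
      have f: "p U f = res P W1 ?N \<tau>" and f': "p U f' = res P W1 ?N \<tau>'"
        using U(6,8) \<tau>(1) \<tau>'(1) W1(1) W3(1) W31(1) N by simp_all
      have eA: "p U ?e \<in> AP ?N" "p U ?e' \<in> AP ?N"
        unfolding e(2) e'(2) using \<sigma>(1) \<sigma>'(1) W1(1) N by simp_all
      have F: "p U f \<in> F ?N" "p U f' \<in> F ?N" "p U g \<in> F ?N"
        unfolding f f' U(10) using \<tau>(1) \<tau>'(1) W1(1) W3(1,4) N by simp_all
      have FA: "p U f \<in> AP ?N" "p U f' \<in> AP ?N" "p U g \<in> AP ?N" using F N by auto
      have qe: "q ?N (p U ?e) = res Q V ?N \<kappa>" "q ?N (p U ?e') = res Q V ?N \<mu>"
        unfolding e(2) e'(2) using \<sigma> \<sigma>' W1(1,3) N V by (simp_all add: q_res)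
      have paf: "pa ?N (p U f) = pa ?N (p U ?e)" "pa ?N (p U f') = pa ?N (p U ?e')"
        unfolding e(2) e'(2) f f' using \<sigma>(1) \<sigma>'(1) \<tau> \<tau>' W1(1) N by (simp_all add: pa_res)
      have pae: "pa ?N (p U ?e) = Y.vres V ?N ?D" "pa ?N (p U ?e') = Y.vres V ?N ?D'"
        using pa_q_res[OF V(1,2) N(1,5) eA(1) qe(1)] pa_q_res[OF V(1,3) N(1,5) eA(2) qe(2)] by simp_all
      have pag: "pa ?N (p U g) = Y.vres W ?N D2" unfolding U(10) using W3 N by (simp add: pa_res)
      have eta_app: "eta V \<kappa>' ?N (pa ?N (p U h)) = ?pr x h"
        if "\<kappa>' \<in> sec Q V" "x \<in> sec E U" "p U x \<in> AP ?N" "q ?N (p U x) = res Q V ?N \<kappa>'" "h \<in> sec E U" "p U h \<in> F ?N"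
        for \<kappa>' x h
        using eta_pa[OF V(1) that(1) N(1,5) that(6)] pair_q[OF N(1) that(3) F_AP[OF N(1) that(6)]]
          pp_p[OF U(1) that(2,5)] that(4) by simp
      have bF: "p U (bracket E U h g) \<in> F ?N" if "h \<in> sec E U" "p U h \<in> F ?N" for h
        using F_brk[OF U(1) that(1) U(9)] that F by simp
      have rh: "?z (eta V \<kappa>' W D2) = eta V \<kappa>' ?N (pa ?N (p U g))" if "\<kappa>' \<in> sec Q V" for \<kappa>'
        using Y.cot_res[OF eta_cot[OF V(1) that] W N(1,4) D2] pag by simp
      have L: "?z ?L = ?pr (bracket E U ?e ?e') g" unfolding rh[OF brkQ_in[OF V]]
        by (rule eta_app) (use V U e e' eA F N AP_brk(1)[OF U(1) e(1) e'(1) eA] brk_q[OF U(1) e(1) e'(1) eA] qe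
            brkQ_res[OF V N(1,5)] in auto)
      have R1: "?z (D3 W (?h \<kappa>' W D2)) = \<rho> U (anchor E U x U (pairing E U x' g))"
        if x: "x \<in> sec E U" "p U x \<in> AP ?N" "pa ?N (p U x) = Y.vres V ?N D3" and D3: "D3 \<in> Y.vfs V"
          and x': "x' \<in> sec E U" "p U x' \<in> AP ?N" "q ?N (p U x') = res Q V ?N \<kappa>'" and \<kappa>': "\<kappa>' \<in> sec Q V"
        for x x' D3 \<kappa>'
      proof -
        have "?z (D3 W (?h \<kappa>' W D2)) = pa ?N (p U x) ?N (?z (?h \<kappa>' W D2))"
          using Y.vf_res[OF D3 W N(1,4), of "?h \<kappa>' W D2"] V W D2 x(3) \<kappa>' by simp
        also have "?z (?h \<kappa>' W D2) = ?pr x' g"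
          unfolding rh[OF \<kappa>'] by (rule eta_app) (use V U x' \<kappa>' F in auto)
        also have "pa ?N (p U x) ?N (?pr x' g) = \<rho> U (anchor E U x U (pairing E U x' g))"
          using pa_p[OF x(2) U(1) x(1) U(1) subset_refl, of "pairing E U x' g"] U x' by simp
        finally show ?thesis .
      qed
      note R2 = R1[OF e'(1) eA(2) pae(2) DT(2) e(1) eA(1) qe(1) V(2)]
      note R1 = R1[OF e(1) eA(1) pae(1) DT(1) e'(1) eA(2) qe(2) V(3)]
      have R3: "?z ?T4 = \<rho> U (anchor E U g U (pairing E U ?e f'))"
      proof -
        have "?z (?h \<kappa> W (?r ?D')) = ?h \<kappa> ?N (pa ?N (p U f'))"
          using Y.cot_res[OF eta_cot[OF V(1,2)] W N(1,4), of "?r ?D'"] DT W N paf pae by simp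
        also have "\<dots> = ?pr ?e f'" by (rule eta_app) (use V U e eA F qe in auto)
        finally have "D2 ?N (?z (?h \<kappa> W (?r ?D'))) = pa ?N (p U g) ?N (?pr ?e f')" using pag by simp
        then show ?thesis
          using pa_p[OF FA(3) U(1,9,1) subset_refl, of "pairing E U ?e f'"] U e V W Y.vf_res[OF D2 W(1) subset_refl N(1,4), of "?h \<kappa> W (?r ?D')"] by simp
      qed
      have R4: "?z (?h \<kappa>' W (lie_bracket (?r D1) D2)) = ?pr x (bracket E U h g)"
        if \<kappa>': "\<kappa>' \<in> sec Q V" and x: "x \<in> sec E U" "p U x \<in> AP ?N" "q ?N (p U x) = res Q V ?N \<kappa>'"
          and h: "h \<in> sec E U" "p U h \<in> F ?N" "pa ?N (p U h) = Y.vres V ?N D1" and D1: "D1 \<in> Y.vfs V"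
        for \<kappa>' x h D1
      proof -
        have "Y.vres W ?N (lie_bracket (?r D1) D2) = lie_bracket (pa ?N (p U h)) (pa ?N (p U g))"
          using Y.res_lie_bracket[of "?r D1" W D2 ?N] D1 D2 W N h pag by simp
        also have "\<dots> = pa ?N (p U (bracket E U h g))"
          using AP_brk(2)[OF U(1) h(1) U(9) F_AP[OF N(1) h(2)] FA(3)] by simp
        finally have "?z (?h \<kappa>' W (lie_bracket (?r D1) D2)) =
            eta V \<kappa>' ?N (pa ?N (p U (bracket E U h g)))"
          using Y.cot_res[OF eta_cot[OF V(1) \<kappa>'] W N(1,4), of "lie_bracket (?r D1) D2"] D1 D2 W by simp
        also have "\<dots> = ?pr x (bracket E U h g)" by (rule eta_app) (use \<kappa>' x h bF U in auto)
        finally show ?thesis .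
      qed
      note R5 = R4[OF V(3) e'(1) eA(2) qe(2) U(5) F(1) paf(1)[unfolded pae(1)] DT(1)]
      note R6 = R4[OF V(2) e(1) eA(1) qe(1) U(7) F(2) paf(2)[unfolded pae(2)] DT(2)]
      have "?z ?R = ?z ?T1 - ?z ?T2 - (?z ?T3 - ?z ?T4 - ?z ?T5)"
        using ins W(1) N by (simp add: Y.O.res_diff)
      also have "\<dots> = ?z ?L" unfolding L R1 R2 R3 R5 R6
        by (rule rho_bracket_identity[symmetric]) (use U e e' eA F paf in auto)
      finally show ?case using N by (intro exI[of _ ?N]) simp
    qed (use V W D2 ins in auto)
    then show ?thesis unfolding rhs .
  qed
qed

theorem triv_iso: "triv \<in> courant_trivializations Y Q"
  unfolding courant_trivializations_def mem_Collect_eq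
proof (rule Y.std_isoI, goal_cases)
  fix V \<kappa> \<mu> assume V: "opn Y V" and \<kappa>: "\<kappa> \<in> sec Q V" and \<mu>: "\<mu> \<in> sec Q V"
  show "triv V (\<kappa> + \<mu>) = triv V \<kappa> + triv V \<mu>" using V \<kappa> \<mu> by (simp add: triv_app anchQ_add eta_add)
  show "snd (triv V \<kappa>) V (fst (triv V \<mu>)) + snd (triv V \<mu>) V (fst (triv V \<kappa>)) = pairing Q V \<kappa> \<mu>"
    using V \<kappa> \<mu> by (simp add: triv_app triv_pair)
  show "fst (triv V (bracket Q V \<kappa> \<mu>)) = lie_bracket (fst (triv V \<kappa>)) (fst (triv V \<mu>))"
    using V \<kappa> \<mu> by (simp add: triv_app triv_brk1)
  show "snd (triv V (bracket Q V \<kappa> \<mu>)) = lie_derivative Y V (fst (triv V \<kappa>)) (snd (triv V \<mu>)) -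
      contract_d Y V (fst (triv V \<mu>)) (snd (triv V \<kappa>))"
    using V \<kappa> \<mu> by (simp add: triv_app triv_brk2)
next
  case V: (8 V)
  show ?case unfolding bij_betw_def
  proof (intro conjI subset_antisym)
    show "inj_on (triv V) (sec Q V)" using triv_inj[OF V] by (intro inj_onI)
    show "triv V ` sec Q V \<subseteq> Y.vfs V \<times> Y.forms V" using V by (auto simp: triv_app)
    show "Y.vfs V \<times> Y.forms V \<subseteq> triv V ` sec Q V"
    proof
      fix z assume "z \<in> Y.vfs V \<times> Y.forms V"
      then obtain D \<eta> where "z = (D, \<eta>)" "D \<in> Y.vfs V" "\<eta> \<in> Y.forms V" by auto
      moreover from this obtain \<kappa> where "\<kappa> \<in> sec Q V" "triv V \<kappa> = (D, \<eta>)"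
        using triv_surj[OF V] by blast
      ultimately show "z \<in> triv V ` sec Q V" by (metis imageI)
    qed
  qed
qed (auto simp: triv_app anchQ_smul eta_smul anchQ_res eta_res, simp_all add: triv_def)

theorem gtb_triv: "gtb_of_trivialization X Y \<rho> E P p q triv = F"
proof
  fix V
  show "gtb_of_trivialization X Y \<rho> E P p q triv V = F V"
  proof (cases "opn Y V")
    case False
    then show ?thesis using F_empty by (simp add: gtb_of_trivialization_def)
  next
    case V: True
    have iff: "\<sigma> \<in> F V \<longleftrightarrow> eta V (q V \<sigma>) = 0" if \<sigma>: "\<sigma> \<in> AP V" for \<sigma>
    proof
      assume F: "\<sigma> \<in> F V"
      show "eta V (q V \<sigma>) = 0"
      proof (rule cot_eqI_F[OF V], goal_cases)
        case W: (3 W \<tau>)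
        then have "eta V (q V \<sigma>) W (pa W \<tau>) = pp W (res P V W \<sigma>) \<tau>"
          using eta_pa[OF V q_in[OF V \<sigma>] W] \<sigma> V by (simp add: q_res[symmetric])
        also have "\<dots> = 0" using F_iso[OF W(1) _ W(3)] F V W by simp
        finally show ?case by simp
      qed (use V \<sigma> in auto)
    next
      assume 0: "eta V (q V \<sigma>) = 0"
      show "\<sigma> \<in> F V"
      proof (rule F_perpI[OF V AP_in[OF \<sigma>]], goal_cases)
        case W: (1 W \<tau>)
        then have "pp W (res P V W \<sigma>) \<tau> = eta V (q V \<sigma>) W (pa W \<tau>)"
          using eta_pa[OF V q_in[OF V \<sigma>] W] \<sigma> V by (simp add: q_res[symmetric])
        then show ?case using 0 by simp
      qed
    qed
    have "gtb_of_trivialization X Y \<rho> E P p q triv V = {\<sigma> \<in> AP V. eta V (q V \<sigma>) = 0}"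
      using V by (simp add: gtb_of_trivialization_def triv_app cong: conj_cong)
    also have "\<dots> = F V"
    proof (intro subset_antisym subsetI, goal_cases)
      case (2 \<sigma>)
      then show ?case using iff[of \<sigma>] F_AP[OF V] by simp
    qed (use iff in simp)
    finally show ?thesis .
  qed
qed

end

section \<open>From trivializations to generalized tangent bundles\<close>

lemma (in kmod) submodule_sheaf:
  assumes sub: "\<And>U. opn X U \<Longrightarrow> S U \<subseteq> sec M U" and zero: "\<And>U. opn X U \<Longrightarrow> 0 \<in> S U"
    and add: "\<And>U s t. \<lbrakk>opn X U; s \<in> S U; t \<in> S U\<rbrakk> \<Longrightarrow> s + t \<in> S U"
    and smul: "\<And>U a s. \<lbrakk>opn X U; a \<in> sec X U; s \<in> S U\<rbrakk> \<Longrightarrow> smul M U a s \<in> S U"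
    and res: "\<And>U V s. \<lbrakk>opn X U; opn X V; V \<subseteq> U; s \<in> S U\<rbrakk> \<Longrightarrow> res M U V s \<in> S V"
    and local: "\<And>U s. opn X U \<Longrightarrow> s \<in> sec M U \<Longrightarrow>
      (\<And>x. x \<in> U \<Longrightarrow> \<exists>V. opn X V \<and> x \<in> V \<and> V \<subseteq> U \<and> res M U V s \<in> S V) \<Longrightarrow> s \<in> S U"
  shows "module_sheaf X (M\<lparr>sec := S\<rparr>)"
proof -
  have in_M: "s \<in> sec M U" if "opn X U" "s \<in> S U" for U s using sub that by blast
  have uminus: "- s \<in> S U" if "opn X U" "s \<in> S U" for U s
    using smul[of U "- const X U 1" s] that in_M[OF that] by (simp add: smul_minus_left)
  have "sheaf_on (topo X) (M\<lparr>sec := S\<rparr>)" unfolding sheaf_on_def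
  proof (intro conjI allI impI ballI; (elim conjE)?)
    fix \<U> s t assume U: "\<forall>U\<in>\<U>. opn X U" and "s \<in> sec (M\<lparr>sec := S\<rparr>) (\<Union>\<U>)" "t \<in> sec (M\<lparr>sec := S\<rparr>) (\<Union>\<U>)"
      and eq: "\<forall>U\<in>\<U>. res (M\<lparr>sec := S\<rparr>) (\<Union>\<U>) U s = res (M\<lparr>sec := S\<rparr>) (\<Union>\<U>) U t"
    moreover have "opn X (\<Union>\<U>)" using U by blast
    ultimately have "s \<in> sec M (\<Union>\<U>)" "t \<in> sec M (\<Union>\<U>)" using in_M by simp_all
    then show "s = t" using M.sheaf_glue[of \<U>, THEN conjunct1, rule_format, of s t] U eq by simp
  next
    fix \<U> c assume U: "\<forall>U\<in>\<U>. opn X U" and c: "\<forall>U\<in>\<U>. c U \<in> sec (M\<lparr>sec := S\<rparr>) U"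
      and eq: "\<forall>U\<in>\<U>. \<forall>V\<in>\<U>. res (M\<lparr>sec := S\<rparr>) U (U \<inter> V) (c U) = res (M\<lparr>sec := S\<rparr>) V (U \<inter> V) (c V)"
    have o: "opn X (\<Union>\<U>)" using U by blast
    have cc: "(\<forall>U\<in>\<U>. c U \<in> sec M U) \<and> (\<forall>U\<in>\<U>. \<forall>V\<in>\<U>. res M U (U \<inter> V) (c U) = res M V (U \<inter> V) (c V))"
      using c eq U in_M by simp
    have "\<exists>s\<in>sec M (\<Union>\<U>). \<forall>U\<in>\<U>. res M (\<Union>\<U>) U s = c U"
      by (rule M.sheaf_glue[THEN conjunct2, THEN spec, THEN mp, OF _ cc]) (rule U[rule_format])
    then obtain s where s: "s \<in> sec M (\<Union>\<U>)" "\<forall>U\<in>\<U>. res M (\<Union>\<U>) U s = c U" by (elim bexE)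
    have "s \<in> S (\<Union>\<U>)"
    proof (rule local[OF o s(1)], goal_cases)
      case (1 x)
      then obtain V where "V \<in> \<U>" "x \<in> V" by blast
      then show ?case using U c s by (intro exI[of _ V]) auto
    qed
    then show "\<exists>s\<in>sec (M\<lparr>sec := S\<rparr>) (\<Union>\<U>). \<forall>U\<in>\<U>. res (M\<lparr>sec := S\<rparr>) (\<Union>\<U>) U s = c U"
      using s by (intro bexI[of _ s]) auto
  qed (use zero add uminus res in_M M.res_add in auto)
  moreover have "smul M U a s \<in> S U \<and> smul M U a (s + t) = smul M U a s + smul M U a t \<and>
      smul M U (a + b) s = smul M U a s + smul M U b s \<and>
      smul M U (a * b) s = smul M U a (smul M U b s) \<and> smul M U (const X U 1) s = s"
    if "opn X U" "a \<in> sec X U" "b \<in> sec X U" "s \<in> S U" "t \<in> S U" for U a b s t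
    using that smul in_M smul_add_right smul_add_left smul_mult by simp
  moreover have "res M U V (smul M U a s) = smul M V (res X U V a) (res M U V s)"
    if "opn X U" "opn X V" "V \<subseteq> U" "a \<in> sec X U" "s \<in> S U" for U V a s
    using that in_M res_smul by simp
  ultimately show ?thesis unfolding module_sheaf_def by simp
qed

lemma (in kmod) hom_sum:
  fixes n :: nat
  assumes V: "opn X V" and t: "\<And>i. i < n \<Longrightarrow> t i \<in> sec M V"
    and a: "\<And>i. i < n \<Longrightarrow> hom_on X V M (structure_module X) (a i)"
  shows "hom_on X V M M (\<lambda>W \<sigma>. \<Sum>i<n. smul M W (a i W \<sigma>) (res M V W (t i)))" using t a
proof (induction n)
  case 0
  show ?case by (simp add: hom_on_def)
next
  case (Suc n)
  then have IH: "hom_on X V M M (\<lambda>W \<sigma>. \<Sum>i<n. smul M W (a i W \<sigma>) (res M V W (t i)))"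
    and n: "t n \<in> sec M V" "hom_on X V M (structure_module X) (a n)" by simp_all
  have "hom_on X V M M (\<lambda>W \<sigma>. smul M W (a n W \<sigma>) (res M V W (t n)))"
    using n V by (auto simp: hom_on_def structure_module_def smul_add_left smul_mult res_smul)
  then show ?case using IH by (auto simp: hom_on_def smul_add_right M.res_add algebra_simps)
qed

lemma (in kmod) hom_correct:
  assumes A: "hom_on X V M M A" and B: "hom_on X V M M B"
  shows "hom_on X V M M (\<lambda>W \<sigma>. A W \<sigma> + B W (\<sigma> - A W \<sigma>))"
proof -
  have diff: "\<sigma> + \<sigma>' - (A W \<sigma> + A W \<sigma>') = (\<sigma> - A W \<sigma>) + (\<sigma>' - A W \<sigma>')" for W \<sigma> \<sigma>' by simp
  have smul: "smul M W a \<sigma> - smul M W a \<tau> = smul M W a (\<sigma> - \<tau>)"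
    if "opn X W" "a \<in> sec X W" "\<sigma> \<in> sec M W" "\<tau> \<in> sec M W" for W a \<sigma> \<tau>
    using smul_add_right[OF that(1,2), of "\<sigma> - \<tau>" \<tau>] that by simp
  show ?thesis using A B unfolding hom_on_def
    by (auto simp: diff smul smul_add_right M.res_add simp flip: M.res_diff)
qed

context restricted
begin

lemma pp_dg:
  assumes U: "opn X U" "f \<in> sec X U" and W: "opn Y W" "W \<subseteq> tr U" and \<tau>: "\<tau> \<in> AP W"
  shows "pp W \<tau> (res P (tr U) W (p U (dstar U f))) = pa W \<tau> W (res Y (tr U) W (\<rho> U f))"
proof (rule Y_eqI[OF W(1)], goal_cases)
  let ?g = "dstar U f"
  have rW: "res Y (tr U) W (\<rho> U f) \<in> sec Y W" using U W by simp
  case y: (3 y)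
  then have "y \<in> U" using W by blast
  then obtain N t where N: "opn X N" "y \<in> N" "N \<subseteq> U" "tr N \<subseteq> W" "t \<in> sec E N"
      "p N t = res P W (tr N) \<tau>" using lift1[OF W(1) AP_in[OF \<tau>] y U(1)] by auto
  have NU: "tr N \<subseteq> tr U" using N by blast
  have "res Y W (tr N) (pp W \<tau> (res P (tr U) W (p U ?g))) = \<rho> N (pairing E N t (res E U N ?g))"
    by (rule pp_lift) (use U W \<tau> N in \<open>auto simp: p_res\<close>)
  also have "pairing E N t (res E U N ?g) = anchor E N t N (res X U N f)"
    using C.pair_sym[of N t "res E U N ?g"] U N by (simp add: C.pair_coanchor_res X.differential_app)
  also have "\<rho> N \<dots> = pa W \<tau> (tr N) (\<rho> N (res X U N f))"
    by (rule ancD[OF APD[OF W(1) \<tau>] N(1,4,5,6,1)]) (use U N in auto)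
  also have "\<dots> = res Y W (tr N) (pa W \<tau> W (res Y (tr U) W (\<rho> U f)))"
    using Y.vf_res[OF pa_in[OF W(1) \<tau>] W(1) subset_refl opn_trace[OF N(1)] N(4) rW] U W N
    by (simp add: rho_res)
  finally show ?case using N by blast
qed (use U W \<tau> Y.vf_in[OF pa_in[OF W(1) \<tau>] W(1) subset_refl] in auto)

text \<open>Dualizing the frame of \<open>X\<close>: \<open>a\<^sup>*\<omega> = \<Sum>\<^sub>i \<omega>(a e\<^sub>i) a\<^sup>*df\<^sub>i\<close>.\<close>

lemma coanchor_frame:
  assumes fr: "frame_on X U n f (\<lambda>i. anchor E U (e i))" and e: "\<forall>i<n. e i \<in> sec E U"
    and N: "opn X N" "N \<subseteq> U" and \<omega>: "\<omega> \<in> X.forms N"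
  shows "coanchor X E N \<omega> = (\<Sum>i<n. smul E N (pairing E N (coanchor X E N \<omega>) (res E U N (e i)))
    (res E U N (dstar U (f i))))"
proof -
  note oU = X.frame_in(3)[OF fr] and f_in = X.frame_in(1)[OF fr]
  let ?c = "\<lambda>i. pairing E N (coanchor X E N \<omega>) (res E U N (e i))"
  let ?g = "\<lambda>i. res E U N (dstar U (f i))"
  have c: "?c i \<in> sec X N" "?g i \<in> sec E N" if "i < n" for i using that oU N e f_in \<omega> by simp_all
  show ?thesis
  proof (rule C.coanchorI[OF N(1) \<omega>])
    show "(\<Sum>i<n. smul E N (?c i) (?g i)) \<in> sec E N" using c N by (intro C.E.M.sum_in) auto
    fix W t assume W: "opn X W" "W \<subseteq> N" "t \<in> sec E W"
    have WU: "W \<subseteq> U" using W N by blast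
    have cW: "res X N W (?c i) = \<omega> W (X.vres U W (anchor E U (e i)))" if i: "i < n" for i
    proof -
      have "res X N W (?c i) = pairing E W (res E N W (coanchor X E N \<omega>)) (res E U W (e i))"
        using C.res_pair[OF N(1) W(1,2), of "coanchor X E N \<omega>" "res E U N (e i)"] i oU N W e \<omega> by simp
      also have "\<dots> = \<omega> W (anchor E W (res E U W (e i)))"
        using i oU N W WU e \<omega> by (intro C.pair_coanchor_res) auto
      finally show ?thesis using i oU W WU e by (simp add: C.anch_res)
    qed
    have gW: "pairing E W (res E U W (dstar U (f i))) t = anchor E W t W (res X U W (f i))"
      if i: "i < n" for i using i oU W WU f_in by (simp add: C.pair_coanchor_res X.differential_app)
    have "res E N W (\<Sum>i<n. smul E N (?c i) (?g i)) = (\<Sum>i<n. res E N W (smul E N (?c i) (?g i)))"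
      using c N W by (intro C.E.M.res_sum) auto
    also have "\<dots> = (\<Sum>i<n. smul E W (res X N W (?c i)) (res E U W (dstar U (f i))))"
      using c N W oU f_in by (intro sum.cong refl) (simp add: C.E.res_smul)
    finally have "pairing E W (res E N W (\<Sum>i<n. smul E N (?c i) (?g i))) t =
        (\<Sum>i<n. pairing E W (smul E W (res X N W (?c i)) (res E U W (dstar U (f i)))) t)"
      using c N W WU oU f_in by (simp only:) (intro C.pair_sum_left, auto)
    also have "\<dots> = (\<Sum>i<n. anchor E W t W (res X U W (f i)) * \<omega> W (X.vres U W (anchor E U (e i))))"
    proof (rule sum.cong[OF refl], goal_cases)
      case (1 i)
      then have i: "i < n" by simp
      have "res X N W (?c i) \<in> sec X W" using c(1)[OF i] N W by simp
      then show ?case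
        using W WU oU f_in[OF i] gW[OF i] unfolding cW[OF i] by (simp add: C.pair_smul_left mult.commute)
    qed
    also have "\<dots> = \<omega> W (anchor E W t)"
      by (rule X.frame_cot[OF fr \<omega> W(1) WU W(2), symmetric]) (use W in simp)
    finally show "pairing E W (res E N W (\<Sum>i<n. smul E N (?c i) (?g i))) t = \<omega> W (anchor E W t)" .
  qed
qed

lemma anchor_0_expansion:
  assumes fr: "frame_on X U n f (\<lambda>i. anchor E U (e i))" and e: "\<forall>i<n. e i \<in> sec E U"
    and W: "opn Y W" "W \<subseteq> tr U" and \<sigma>: "\<sigma> \<in> AP W" "pa W \<sigma> = 0"
  shows "\<sigma> = (\<Sum>i<n. smul P W (pp W \<sigma> (res P (tr U) W (p U (e i))))
    (res P (tr U) W (p U (dstar U (f i)))))"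
    (is "\<sigma> = ?S")
proof -
  note oU = X.frame_in(3)[OF fr] and f_in = X.frame_in(1)[OF fr]
  have t_in: "smul P W (pp W \<sigma> (res P (tr U) W (p U (e i))))
    (res P (tr U) W (p U (dstar U (f i)))) \<in> sec P W" if "i < n" for i
    using that oU W e f_in \<sigma> by simp
  show ?thesis
  proof (rule P.M.eqI_local[OF W(1) AP_in[OF \<sigma>(1)]], goal_cases)
    show "?S \<in> sec P W" using t_in W by (intro P.M.sum_in) auto
    case y: (2 y)
    obtain N0 \<omega>0 where N0: "opn X N0" "y \<in> N0" "tr N0 \<subseteq> W" "\<omega>0 \<in> X.forms N0"
        "res P W (tr N0) \<sigma> = p N0 (coanchor X E N0 \<omega>0)" using anchor_0_local[OF W(1) \<sigma> y] by auto
    define N where "N = N0 \<inter> U"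
    define \<omega> where "\<omega> = X.fres N0 N \<omega>0"
    let ?N = "tr N"
    have N: "opn X N" "y \<in> N" "N \<subseteq> U" "N \<subseteq> N0" "?N \<subseteq> W" "?N \<subseteq> tr N0" "y \<in> ?N" "opn Y ?N"
      using N0 oU W y by (auto simp: N_def)
    have \<omega>: "\<omega> \<in> X.forms N" using N0 N by (simp add: \<omega>_def)
    have \<sigma>N: "res P W ?N \<sigma> = p N (coanchor X E N \<omega>)"
    proof -
      have "p N (coanchor X E N \<omega>) = res P (tr N0) ?N (res P W (tr N0) \<sigma>)"
        using N0 N by (simp add: \<omega>_def C.coanchor_res p_res)
      also have "\<dots> = res P W ?N \<sigma>"
        by (rule P.M.res_res[OF W(1) opn_trace[OF N0(1)] N(8,6) N0(3) AP_in[OF \<sigma>(1)]])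
      finally show ?thesis by simp
    qed
    let ?c = "\<lambda>i. pairing E N (coanchor X E N \<omega>) (res E U N (e i))"
    let ?g = "\<lambda>i. res E U N (dstar U (f i))"
    have c: "?c i \<in> sec X N" "?g i \<in> sec E N" if "i < n" for i using that oU N e f_in \<omega> by simp_all
    have "res P W ?N \<sigma> = p N (\<Sum>i<n. smul E N (?c i) (?g i))"
      unfolding \<sigma>N using coanchor_frame[OF fr e N(1,3) \<omega>] by simp
    also have "\<dots> = (\<Sum>i<n. p N (smul E N (?c i) (?g i)))" using c N by (intro p_sum) auto
    also have "\<dots> = (\<Sum>i<n. res P W ?N (smul P W (pp W \<sigma> (res P (tr U) W (p U (e i))))
        (res P (tr U) W (p U (dstar U (f i))))))"
    proof (rule sum.cong[OF refl])
      fix i assume "i \<in> {..<n}"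
      then have i: "i < n" by simp
      have "res Y W ?N (pp W \<sigma> (res P (tr U) W (p U (e i)))) = \<rho> N (?c i)"
        by (rule pp_lift) (use i W \<sigma> oU e N \<omega> \<sigma>N in \<open>auto simp: p_res\<close>)
      then show "p N (smul E N (?c i) (?g i)) = res P W ?N (smul P W (pp W \<sigma> (res P (tr U) W (p U (e i))))
        (res P (tr U) W (p U (dstar U (f i)))))"
        using c[OF i] N W oU i e f_in \<sigma> by (simp add: p_smul p_res P.res_smul)
    qed
    also have "\<dots> = res P W ?N ?S" using t_in N W by (intro P.M.res_sum[symmetric]) auto
    finally show ?case using N by blast
  qed
qed

end

locale lagrangian = restricted X Y \<rho> E P p Q q
  for X Y \<rho> E and P :: "('x, 's::comm_ring, 'p::ab_group_add) msheaf" and p Q q +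
  fixes F
  assumes L_AP [simp]: "\<And>V \<sigma>. opn Y V \<Longrightarrow> \<sigma> \<in> F V \<Longrightarrow> \<sigma> \<in> AP V"
    and L_zero [simp]: "\<And>V. opn Y V \<Longrightarrow> 0 \<in> F V"
    and L_add [simp]: "\<And>V \<sigma> \<tau>. \<lbrakk>opn Y V; \<sigma> \<in> F V; \<tau> \<in> F V\<rbrakk> \<Longrightarrow> \<sigma> + \<tau> \<in> F V"
    and L_smul [simp]: "\<And>V a \<sigma>. \<lbrakk>opn Y V; a \<in> sec Y V; \<sigma> \<in> F V\<rbrakk> \<Longrightarrow> smul P V a \<sigma> \<in> F V"
    and L_res [simp]: "\<And>V W \<sigma>. \<lbrakk>opn Y V; opn Y W; W \<subseteq> V; \<sigma> \<in> F V\<rbrakk> \<Longrightarrow> res P V W \<sigma> \<in> F W"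
    and L_iso: "\<And>V \<sigma> \<tau>. \<lbrakk>opn Y V; \<sigma> \<in> F V; \<tau> \<in> F V\<rbrakk> \<Longrightarrow> pp V \<sigma> \<tau> = 0"
    and L_perp: "\<And>V \<sigma>. opn Y V \<Longrightarrow> \<sigma> \<in> sec P V \<Longrightarrow>
      (\<And>W \<tau>. \<lbrakk>opn Y W; W \<subseteq> V; \<tau> \<in> F W\<rbrakk> \<Longrightarrow> pp W (res P V W \<sigma>) \<tau> = 0) \<Longrightarrow> \<sigma> \<in> F V"
    and L_onto: "\<And>V D y. \<lbrakk>opn Y V; D \<in> Y.vfs V; y \<in> V\<rbrakk> \<Longrightarrow>
      \<exists>W \<tau>. opn Y W \<and> y \<in> W \<and> W \<subseteq> V \<and> \<tau> \<in> F W \<and> pa W \<tau> = Y.vres V W D"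
begin

lemma L_uminus [simp]: "opn Y V \<Longrightarrow> \<sigma> \<in> F V \<Longrightarrow> - \<sigma> \<in> F V"
  using L_smul[of V "- const Y V 1" \<sigma>] by (simp add: P.smul_minus_left)

lemma L_diff [simp]: "\<lbrakk>opn Y V; \<sigma> \<in> F V; \<tau> \<in> F V\<rbrakk> \<Longrightarrow> \<sigma> - \<tau> \<in> F V" using L_add[of V \<sigma> "- \<tau>"] by simp

lemma L_sum: "opn Y V \<Longrightarrow> (\<And>i. i \<in> I \<Longrightarrow> s i \<in> F V) \<Longrightarrow> sum s I \<in> F V"
  by (induction I rule: infinite_finite_induct) auto

lemma L_lifts: tangent_lifts unfolding tangent_lifts_def
proof (intro allI impI, elim conjE, goal_cases)
  case V: (1 V D y)
  obtain W \<tau> where "opn Y W" "y \<in> W" "W \<subseteq> V" "\<tau> \<in> F W" "pa W \<tau> = Y.vres V W D"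
    using L_onto[OF V] by auto
  then show ?case by (intro exI[of _ W] exI[of _ \<tau>]) simp
qed

lemma L_local:
  assumes V: "opn Y V" and \<sigma>: "\<sigma> \<in> sec P V"
    and loc: "\<And>y. y \<in> V \<Longrightarrow> \<exists>W. opn Y W \<and> y \<in> W \<and> W \<subseteq> V \<and> res P V W \<sigma> \<in> F W"
  shows "\<sigma> \<in> F V"
proof (rule L_perp[OF V \<sigma>], goal_cases)
  case (1 W \<tau>)
  note W = 1(1,2) and \<tau> = 1(3)
  show ?case
  proof (rule Y.O.eqI_local[OF W(1)], goal_cases)
    case y: (3 y)
    then obtain N where N: "opn Y N" "y \<in> N" "N \<subseteq> V" "res P V N \<sigma> \<in> F N" using loc W by blast
    let ?N = "N \<inter> W"
    have N': "opn Y ?N" "?N \<subseteq> W" "?N \<subseteq> N" "?N \<subseteq> V" using N W by auto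
    have "res P V ?N \<sigma> \<in> F ?N" using L_res[OF N(1) N'(1,3) N(4)] V N N' \<sigma> by simp
    then have "pp ?N (res P V ?N \<sigma>) (res P W ?N \<tau>) = 0" using L_iso N' W \<tau> by simp
    then have "res Y W ?N (pp W (res P V W \<sigma>) \<tau>) = 0" using V W N' \<sigma> \<tau> by (simp add: pp_res)
    then show ?case using N N' y W by (intro exI[of _ ?N]) simp
  qed (use V W \<sigma> \<tau> in auto)
qed

lemma pp_functional:
  "opn Y V \<Longrightarrow> u \<in> sec P V \<Longrightarrow> hom_on Y V P (structure_module Y) (\<lambda>W \<sigma>. pp W \<sigma> (res P V W u))"
  by (auto simp: hom_on_def structure_module_def pp_add_left pp_smul_left pp_res)

lemma pa_sum:
  assumes "opn Y V" "\<And>i. i \<in> I \<Longrightarrow> s i \<in> AP V"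
  shows "sum s I \<in> AP V \<and> pa V (sum s I) = (\<Sum>i\<in>I. pa V (s i))"
  using assms by (induction I rule: infinite_finite_induct) (auto simp: pa_add)

text \<open>
  The projection onto \<open>F\<close> is \<open>\<pi>\<^sub>1 + \<pi>\<^sub>2 (1 - \<pi>\<^sub>1)\<close>: here \<open>\<pi>\<^sub>1\<close> lifts the retraction of \<open>f\<^sup>*T\<^sub>X\<close> onto \<open>T\<^sub>Y\<close>
  given by an adapted frame, and \<open>\<pi>\<^sub>2\<close> is a projection onto the conormal bundle, dual to the
  complementary projection of \<open>f\<^sup>*T\<^sub>X\<close>.
\<close>

lemma frame_projection:
  assumes V: "opn Y V" and frY: "frame_on Y V n x D"
    and g: "\<And>i. i < n \<Longrightarrow> g i \<in> sec P V" and u: "\<And>i. i < n \<Longrightarrow> u i \<in> sec P V"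
    and \<tau>: "\<And>i. i < n \<Longrightarrow> \<tau> i \<in> F V" "\<And>i. i < n \<Longrightarrow> pa V (\<tau> i) = D i"
    and ppg: "\<And>W \<sigma> i. \<lbrakk>opn Y W; W \<subseteq> V; \<sigma> \<in> AP W; i < n\<rbrakk> \<Longrightarrow>
      pp W \<sigma> (res P V W (g i)) = pa W \<sigma> W (res Y V W (x i))"
    and exp: "\<And>W \<sigma>. \<lbrakk>opn Y W; W \<subseteq> V; \<sigma> \<in> AP W; pa W \<sigma> = 0\<rbrakk> \<Longrightarrow>
      \<sigma> = (\<Sum>i<n. smul P W (pp W \<sigma> (res P V W (u i))) (res P V W (g i)))"
  shows "\<exists>\<pi>. hom_on Y V P P \<pi> \<and>
    (\<forall>W. opn Y W \<and> W \<subseteq> V \<longrightarrow> \<pi> W ` sec P W = F W \<and> (\<forall>\<sigma>\<in>sec P W. \<pi> W (\<pi> W \<sigma>) = \<pi> W \<sigma>))"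
proof -
  note x = Y.frame_in(1)[OF frY] and D = Y.frame_in(2)[OF frY]
  define b where "b i W \<sigma> = pp W \<sigma> (res P V W (g i))" for i W \<sigma>
  define c where "c i W \<sigma> = pp W \<sigma> (res P V W (u i))" for i W \<sigma>
  define h where "h W i j = D i W (res Y V W (x j))" for W i j
  define k where "k i W \<sigma> = c i W \<sigma> - (\<Sum>j<n. h W i j * c j W \<sigma>)" for i W \<sigma>
  define S where "S a t W \<sigma> = (\<Sum>i<n. smul P W (a i W \<sigma>) (res P V W (t i)))"
    for a :: "nat \<Rightarrow> 'x set \<Rightarrow> 'p \<Rightarrow> 's" and t W \<sigma>
  have h: "h W i j \<in> sec Y W" if "opn Y W" "W \<subseteq> V" "i < n" "j < n" for W i j
    unfolding h_def by (rule Y.vf_in[OF D]) (use that x V in auto)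
  have h_res: "res Y W W' (h W i j) = h W' i j"
    if "opn Y W" "W \<subseteq> V" "opn Y W'" "W' \<subseteq> W" "i < n" "j < n" for W W' i j
    unfolding h_def using Y.vf_res[OF D[OF that(5)] that(1-4), of "res Y V W (x j)"] that x V by auto
  have b: "hom_on Y V P (structure_module Y) (b i)" if "i < n" for i
    unfolding b_def[abs_def] by (rule pp_functional[OF V g[OF that]])
  have c: "c i W \<sigma> \<in> sec Y W" "c i W (\<sigma> + \<sigma>') = c i W \<sigma> + c i W \<sigma>'" "a \<in> sec Y W \<Longrightarrow> c i W (smul P W a \<sigma>) = a * c i W \<sigma>"
    "opn Y W' \<Longrightarrow> W' \<subseteq> W \<Longrightarrow> res Y W W' (c i W \<sigma>) = c i W' (res P W W' \<sigma>)"
    if "i < n" "opn Y W" "W \<subseteq> V" "\<sigma> \<in> sec P W" "\<sigma>' \<in> sec P W" for i W W' \<sigma> \<sigma>' a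
    unfolding c_def using that V u by (simp_all add: pp_add_left pp_smul_left pp_res)
  have sum_in: "(\<Sum>j<n. h W i j * c j W \<sigma>) \<in> sec Y W" if "i < n" "opn Y W" "W \<subseteq> V" "\<sigma> \<in> sec P W" for i W \<sigma>
    by (rule Y.O.sum_in[OF that(2)]) (use that h c(1) in simp)
  have k: "hom_on Y V P (structure_module Y) (k i)" if i: "i < n" for i
  proof -
    have "k i W \<sigma> \<in> sec Y W" "a \<in> sec Y W \<Longrightarrow> k i W (smul P W a \<sigma>) = a * k i W \<sigma>"
      "opn Y W' \<Longrightarrow> W' \<subseteq> W \<Longrightarrow> k i W' (res P W W' \<sigma>) = res Y W W' (k i W \<sigma>)"
      if W: "opn Y W" "W \<subseteq> V" and \<sigma>: "\<sigma> \<in> sec P W" for W W' \<sigma> a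
    proof -
      note c = c[OF _ W \<sigma> \<sigma>]
      show "k i W \<sigma> \<in> sec Y W" using sum_in c(1) i W \<sigma> by (simp add: k_def)
      show "a \<in> sec Y W \<Longrightarrow> k i W (smul P W a \<sigma>) = a * k i W \<sigma>"
        using c(3) i by (simp add: k_def right_diff_distrib sum_distrib_left mult.left_commute)
      assume W': "opn Y W'" "W' \<subseteq> W"
      have "res Y W W' (\<Sum>j<n. h W i j * c j W \<sigma>) = (\<Sum>j<n. res Y W W' (h W i j * c j W \<sigma>))"
        by (rule Y.O.res_sum[OF W(1) W']) (use c(1) h[OF W i] W in simp)
      also have "\<dots> = (\<Sum>j<n. h W' i j * c j W' (res P W W' \<sigma>))"
        using c(1,4) h[OF W i] h_res[OF W W' i] W W' by (intro sum.cong refl) (simp add: Y.res_mult)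
      finally show "k i W' (res P W W' \<sigma>) = res Y W W' (k i W \<sigma>)"
        using c(1,4) sum_in[OF i W \<sigma>] i W W' by (simp add: k_def Y.O.res_diff)
    qed
    moreover have "k i W (\<sigma> + \<sigma>') = k i W \<sigma> + k i W \<sigma>'"
      if "opn Y W" "W \<subseteq> V" "\<sigma> \<in> sec P W" "\<sigma>' \<in> sec P W" for W \<sigma> \<sigma>'
      using c(2) i that by (simp add: k_def distrib_left sum.distrib)
    ultimately show ?thesis by (simp add: hom_on_def structure_module_def)
  qed
  have \<tau>P: "\<tau> i \<in> sec P V" if "i < n" for i using \<tau>(1)[OF that] V by simp
  have S: "hom_on Y V P P (S b \<tau>)" "hom_on Y V P P (S k g)"
    unfolding S_def[abs_def] by (intro P.hom_sum V \<tau>P b g k; assumption)+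
  have Skg: "S k g W \<sigma> \<in> sec P W"
    "opn Y W' \<Longrightarrow> W' \<subseteq> W \<Longrightarrow> S k g W' (res P W W' \<sigma>) = res P W W' (S k g W \<sigma>)"
    if "opn Y W" "W \<subseteq> V" "\<sigma> \<in> sec P W" for W W' \<sigma> using S(2) that by (simp_all add: hom_on_def)
  define \<pi> where "\<pi> W \<sigma> = S b \<tau> W \<sigma> + S k g W (\<sigma> - S b \<tau> W \<sigma>)" for W \<sigma>
  have hom: "hom_on Y V P P \<pi>" unfolding \<pi>_def[abs_def] by (rule P.hom_correct[OF S])
  have img1: "S b \<tau> W \<sigma> \<in> F W" if "opn Y W" "W \<subseteq> V" "\<sigma> \<in> sec P W" for W \<sigma>
    unfolding S_def b_def using that V g \<tau> by (intro L_sum L_smul) auto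
  have img2: "S k g W \<sigma> \<in> F W" if W: "opn Y W" "W \<subseteq> V" and \<sigma>: "\<sigma> \<in> sec P W" for W \<sigma>
  proof (rule L_perp[OF W(1)], goal_cases)
    show "S k g W \<sigma> \<in> sec P W" by (rule Skg(1)[OF W \<sigma>])
    case (2 W' \<upsilon>)
    note W' = 2(1,2) and \<upsilon> = 2(3)
    have W'V: "W' \<subseteq> V" using W W' by blast
    have \<upsilon>A: "\<upsilon> \<in> AP W'" using L_AP[OF W'(1) \<upsilon>] .
    let ?\<sigma> = "res P W W' \<sigma>"
    let ?d = "\<lambda>i. pa W' \<upsilon> W' (res Y V W' (x i))"
    have \<sigma>': "?\<sigma> \<in> sec P W'" using W W' \<sigma> by simp
    have kg: "k i W' ?\<sigma> \<in> sec Y W'" "res P V W' (g i) \<in> sec P W'" if "i < n" for i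
      using k[OF that] g[OF that] W' W'V V \<sigma>' by (auto simp: hom_on_def structure_module_def)
    have d: "?d j = (\<Sum>i<n. ?d i * h W' i j)" if "j < n" for j
      unfolding h_def by (rule Y.frame_eq[OF frY W'(1) W'V pa_in[OF W'(1) \<upsilon>A]]) (use x that V W' W'V in simp)
    have "pp W' (res P W W' (S k g W \<sigma>)) \<upsilon> = pp W' \<upsilon> (S k g W' ?\<sigma>)"
      using pp_sym[OF W'(1) AP_in[OF \<upsilon>A] Skg(1)[OF W'(1) W'V \<sigma>']] Skg(2)[OF W \<sigma> W'] by simp
    also have "\<dots> = (\<Sum>i<n. pp W' \<upsilon> (smul P W' (k i W' ?\<sigma>) (res P V W' (g i))))"
      unfolding S_def using kg W' \<upsilon>A by (intro pp_sum_right) auto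
    also have "\<dots> = (\<Sum>i<n. k i W' ?\<sigma> * ?d i)"
      using kg W' W'V \<upsilon>A by (intro sum.cong refl) (simp add: pp_smul_right ppg)
    also have "\<dots> = (\<Sum>i<n. c i W' ?\<sigma> * ?d i) - (\<Sum>i<n. \<Sum>j<n. c j W' ?\<sigma> * (?d i * h W' i j))"
      unfolding k_def left_diff_distrib sum_subtractf sum_distrib_right by (simp add: mult_ac)
    also have "\<dots> = 0" by (subst sum.swap) (simp add: d[symmetric] flip: sum_distrib_left)
    finally show ?case .
  qed
  have fixed: "\<pi> W \<sigma> = \<sigma>" if W: "opn Y W" "W \<subseteq> V" and \<sigma>: "\<sigma> \<in> F W" for W \<sigma>
  proof -
    have \<sigma>A: "\<sigma> \<in> AP W" using L_AP[OF W(1) \<sigma>] .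
    let ?s = "\<sigma> - S b \<tau> W \<sigma>"
    have T1: "S b \<tau> W \<sigma> \<in> F W" using img1[OF W AP_in[OF \<sigma>A]] .
    have s: "?s \<in> F W" using \<sigma> T1 W by simp
    have sA: "?s \<in> AP W" using L_AP[OF W(1) s] .
    have \<tau>W: "res P V W (\<tau> i) \<in> F W" "res P V W (\<tau> i) \<in> AP W" "pa W (res P V W (\<tau> i)) = Y.vres V W (D i)"
      "res P V W (g i) \<in> sec P W" if "i < n" for i
      using \<tau>[OF that] g[OF that] V W by (simp_all add: pa_res)
    have bi: "b i W \<sigma> = pa W \<sigma> W (res Y V W (x i))" "b i W \<sigma> \<in> sec Y W" if "i < n" for i
      unfolding b_def using ppg[OF W \<sigma>A that] pp_in[OF W(1) AP_in[OF \<sigma>A] \<tau>W(4)[OF that]] by simp_all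
    have "pa W (S b \<tau> W \<sigma>) = (\<Sum>i<n. pa W (smul P W (b i W \<sigma>) (res P V W (\<tau> i))))"
      unfolding S_def by (rule pa_sum[THEN conjunct2, OF W(1)]) (use \<tau>W bi W in simp)
    also have "\<dots> = (\<Sum>i<n. Y.vsmul W (pa W \<sigma> W (res Y V W (x i))) (Y.vres V W (D i)))"
      using \<tau>W bi(2) W by (intro sum.cong refl) (simp add: pa_smul bi(1)[symmetric])
    also have "\<dots> = pa W \<sigma>" by (rule Y.frame_vec[OF frY W pa_in[OF W(1) \<sigma>A], symmetric])
    finally have s0: "pa W ?s = 0" using W \<sigma>A L_AP[OF W(1) T1] by (simp add: pa_diff)
    have c_in: "c i W ?s \<in> sec Y W" if "i < n" for i by (rule c(1)[OF that W AP_in[OF sA] AP_in[OF sA]])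
    have s_exp: "?s = (\<Sum>i<n. smul P W (c i W ?s) (res P V W (g i)))"
      unfolding c_def by (rule exp[OF W sA s0])
    have "(\<Sum>j<n. h W i j * c j W ?s) = 0" if i: "i < n" for i
    proof -
      let ?t = "res P V W (\<tau> i)"
      have "0 = pp W ?t ?s" using L_iso[OF W(1) \<tau>W(1)[OF i] s] by simp
      also have "\<dots> = pp W ?t (\<Sum>j<n. smul P W (c j W ?s) (res P V W (g j)))"
        by (rule arg_cong[OF s_exp])
      also have "\<dots> = (\<Sum>j<n. pp W ?t (smul P W (c j W ?s) (res P V W (g j))))"
        using \<tau>W c_in i W by (intro pp_sum_right) auto
      also have "\<dots> = (\<Sum>j<n. h W i j * c j W ?s)"
        using \<tau>W c_in i W by (intro sum.cong refl) (simp add: pp_smul_right ppg h_def mult.commute)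
      finally show ?thesis by simp
    qed
    then have "S k g W ?s = (\<Sum>i<n. smul P W (c i W ?s) (res P V W (g i)))"
      unfolding S_def by (intro sum.cong refl) (simp add: k_def)
    then have "S k g W ?s = ?s" using s_exp by (rule trans[OF _ sym])
    then show ?thesis by (simp add: \<pi>_def)
  qed
  have "\<pi> W ` sec P W = F W \<and> (\<forall>\<sigma>\<in>sec P W. \<pi> W (\<pi> W \<sigma>) = \<pi> W \<sigma>)" if W: "opn Y W" "W \<subseteq> V" for W
  proof -
    have img: "\<pi> W \<sigma> \<in> F W" if \<sigma>: "\<sigma> \<in> sec P W" for \<sigma>
      unfolding \<pi>_def using img1[OF W \<sigma>] img2[OF W, of "\<sigma> - S b \<tau> W \<sigma>"] W \<sigma> by simp
    have "\<sigma> \<in> \<pi> W ` sec P W" if "\<sigma> \<in> F W" for \<sigma>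
      using fixed[OF W that] that W by (metis AP_in L_AP imageI)
    then show ?thesis using img fixed[OF W] by auto
  qed
  then show ?thesis using hom by blast
qed

lemma local_projection:
  assumes y: "y \<in> pts Y" shows "\<exists>V \<pi>. opn Y V \<and> y \<in> V \<and> hom_on Y V P P \<pi> \<and>
        (\<forall>W. opn Y W \<and> W \<subseteq> V \<longrightarrow> \<pi> W ` sec P W = F W \<and> (\<forall>\<sigma>\<in>sec P W. \<pi> W (\<pi> W \<sigma>) = \<pi> W \<sigma>))"
proof -
  have yX: "y \<in> pts X" using pts_YX[of "pts Y"] y by simp
  obtain U n f e D where U: "y \<in> U" and fr: "frame_on X U n f (\<lambda>i. anchor E U (e i))"
      and e: "\<forall>i<n. e i \<in> sec E U" and frY: "frame_on Y (tr U) n (\<lambda>i. \<rho> U (f i)) D"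
    using adapted_frame[OF L_lifts y _ yX] by auto
  note oU = X.frame_in(3)[OF fr] and f_in = X.frame_in(1)[OF fr] and D_in = Y.frame_in(2)[OF frY]
  let ?V = "tr U"
  have oV: "opn Y ?V" using oU by simp
  have "\<exists>V. opn Y V \<and> y \<in> V \<and> (\<forall>i<n. \<exists>\<tau>. V \<subseteq> ?V \<and> \<tau> \<in> F V \<and> pa V \<tau> = Y.vres ?V V (D i))"
  proof (rule finite_nhd[OF y], goal_cases)
    case i: (1 i)
    obtain W \<tau> where "opn Y W" "y \<in> W" "W \<subseteq> ?V" "\<tau> \<in> F W" "pa W \<tau> = Y.vres ?V W (D i)"
      using L_onto[OF oV D_in[OF i], of y] U y by auto
    then show ?case by blast
  next
    fix i V W assume V: "opn Y V" "opn Y W" "y \<in> W" "W \<subseteq> V"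
      and "\<exists>\<tau>. V \<subseteq> ?V \<and> \<tau> \<in> F V \<and> pa V \<tau> = Y.vres ?V V (D i)"
    then obtain \<tau> where "V \<subseteq> ?V" "\<tau> \<in> F V" "pa V \<tau> = Y.vres ?V V (D i)" by blast
    then show "\<exists>\<tau>. W \<subseteq> ?V \<and> \<tau> \<in> F W \<and> pa W \<tau> = Y.vres ?V W (D i)"
      using V by (intro exI[of _ "res P V W \<tau>"]) (auto simp: pa_res)
  qed
  then obtain V0 where V0: "opn Y V0" "y \<in> V0"
    and "\<forall>i<n. \<exists>\<tau>. V0 \<subseteq> ?V \<and> \<tau> \<in> F V0 \<and> pa V0 \<tau> = Y.vres ?V V0 (D i)" by blast
  then obtain \<tau>0 where \<tau>0: "\<And>i. i < n \<Longrightarrow> V0 \<subseteq> ?V \<and> \<tau>0 i \<in> F V0 \<and> pa V0 (\<tau>0 i) = Y.vres ?V V0 (D i)"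
    by metis
  define V where "V = V0 \<inter> ?V"
  have V: "opn Y V" "y \<in> V" "V \<subseteq> ?V" "V \<subseteq> V0" using V0 oV U y by (auto simp: V_def)
  have "\<exists>\<pi>. hom_on Y V P P \<pi> \<and>
    (\<forall>W. opn Y W \<and> W \<subseteq> V \<longrightarrow> \<pi> W ` sec P W = F W \<and> (\<forall>\<sigma>\<in>sec P W. \<pi> W (\<pi> W \<sigma>) = \<pi> W \<sigma>))"
  proof (rule frame_projection[OF V(1) Y.frame_res[OF frY V(1,3)],
        where g = "\<lambda>i. res P ?V V (p U (dstar U (f i)))"
          and u = "\<lambda>i. res P ?V V (p U (e i))" and \<tau> = "\<lambda>i. res P V0 V (\<tau>0 i)"])
    fix i assume i: "i < n"
    show "res P ?V V (p U (dstar U (f i))) \<in> sec P V" "res P ?V V (p U (e i)) \<in> sec P V"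
      using i oU V f_in e by simp_all
    show "res P V0 V (\<tau>0 i) \<in> F V" "pa V (res P V0 V (\<tau>0 i)) = Y.vres ?V V (D i)"
      using \<tau>0[OF i] V V0 by (simp_all add: pa_res)
  next
    fix W \<sigma> i assume W: "opn Y W" "W \<subseteq> V" and \<sigma>: "\<sigma> \<in> AP W"
    have WV: "W \<subseteq> ?V" using W V by blast
    show "pp W \<sigma> (res P V W (res P ?V V (p U (dstar U (f i))))) =
        pa W \<sigma> W (res Y V W (res Y ?V V (\<rho> U (f i))))" if "i < n"
      using pp_dg[OF oU f_in[OF that] W(1) WV \<sigma>] that W V oU f_in by simp
    assume 0: "pa W \<sigma> = 0"
    show "\<sigma> = (\<Sum>i<n. smul P W (pp W \<sigma> (res P V W (res P ?V V (p U (e i)))))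
        (res P V W (res P ?V V (p U (dstar U (f i))))))"
      by (rule trans[OF anchor_0_expansion[OF fr e W(1) WV \<sigma> 0] sum.cong[OF refl]])
        (use oU oV V W f_in e in simp)
  qed
  then obtain \<pi> where "hom_on Y V P P \<pi> \<and>
    (\<forall>W. opn Y W \<and> W \<subseteq> V \<longrightarrow> \<pi> W ` sec P W = F W \<and> (\<forall>\<sigma>\<in>sec P W. \<pi> W (\<pi> W \<sigma>) = \<pi> W \<sigma>))" by (rule exE)
  with V(1,2) show ?thesis by (intro exI[of _ V] exI[of _ \<pi>] conjI) (assumption | elim conjE)+
qed

lemma L_subbundle: "subbundle Y P F" unfolding subbundle_def
proof (intro conjI allI impI ballI)
  show "module_sheaf Y (P\<lparr>sec := F\<rparr>)" by (rule P.submodule_sheaf) (use L_local in auto)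
qed (use local_projection in auto)

end

section \<open>The action of closed two-forms\<close>

lemma is_torsor_transport:
  assumes tors: "is_torsor G S act" and bij: "bij_betw f S S'"
    and equi: "\<And>g s. g \<in> G \<Longrightarrow> s \<in> S \<Longrightarrow> f (act g s) = act' g (f s)"
  shows "is_torsor G S' act'"
proof -
  have G: "0 \<in> G" "\<And>g h. g \<in> G \<Longrightarrow> h \<in> G \<Longrightarrow> g + h \<in> G" "\<And>g. g \<in> G \<Longrightarrow> - g \<in> G"
    and act: "\<And>g s. g \<in> G \<Longrightarrow> s \<in> S \<Longrightarrow> act g s \<in> S" "\<And>s. s \<in> S \<Longrightarrow> act 0 s = s"
      "\<And>g h s. \<lbrakk>g \<in> G; h \<in> G; s \<in> S\<rbrakk> \<Longrightarrow> act (g + h) s = act g (act h s)"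
    and ex1: "\<And>s t. s \<in> S \<Longrightarrow> t \<in> S \<Longrightarrow> \<exists>!g. g \<in> G \<and> act g s = t"
    using tors unfolding is_torsor_def by simp_all
  have f: "\<exists>s\<in>S. s' = f s" if "s' \<in> S'" for s' using bij that unfolding bij_betw_def by auto
  have fS: "f s \<in> S'" if "s \<in> S" for s using bij that unfolding bij_betw_def by auto
  have inj: "s = t" if "s \<in> S" "t \<in> S" "f s = f t" for s t
    using bij that unfolding bij_betw_def inj_on_def by auto
  show ?thesis unfolding is_torsor_def
  proof (intro conjI ballI, goal_cases)
    fix g s' assume g: "g \<in> G" and "s' \<in> S'"
    then obtain s where s: "s \<in> S" "s' = f s" using f by blast
    show "act' g s' \<in> S'" using equi[OF g s(1)] act(1)[OF g s(1)] s fS by metis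
    fix h assume h: "h \<in> G"
    show "act' (g + h) s' = act' g (act' h s')"
      using equi[of "g + h" s] equi[of h s] equi[of g "act h s"] act g h s G by simp
  next
    case (5 s')
    then obtain s where s: "s \<in> S" "s' = f s" using f by blast
    show ?case using equi[OF G(1) s(1)] act(2)[OF s(1)] s by simp
  next
    case (7 s' t')
    then obtain s t where s: "s \<in> S" "s' = f s" and t: "t \<in> S" "t' = f t" using f by metis
    have "act' g s' = t' \<longleftrightarrow> act g s = t" if g: "g \<in> G" for g
      using equi[OF g s(1)] inj[OF act(1)[OF g s(1)] t(1)] s t by auto
    then show ?case using ex1[OF s(1) t(1)] by metis
  qed (use G in auto)
qed

context krs
begin

lemma tf_at:
  assumes "B \<in> two_forms X" "opn X U" "y \<in> vfs U" shows "B U y y = 0 \<and> (\<forall>z\<in>vfs U.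
              B U y z \<in> sec X U \<and>
              (\<forall>x\<in>vfs U. B U (x + y) z = B U x z + B U y z \<and> B U z (x + y) = B U z x + B U z y) \<and>
              (\<forall>a\<in>sec X U. B U (vsmul U a y) z = a * B U y z \<and> B U z (vsmul U a y) = a * B U z y) \<and>
              (\<forall>V. opn X V \<and> V \<subseteq> U \<longrightarrow> B V (vres U V y) (vres U V z) = res X U V (B U y z)))"
  by (rule assms(1)[unfolded two_forms_def mem_Collect_eq, THEN conjunct1, rule_format, OF assms(2,3)])

lemma tf_alt: "\<lbrakk>B \<in> two_forms X; opn X U; y \<in> vfs U\<rbrakk> \<Longrightarrow> B U y y = 0" using tf_at[of B U y] by simp

lemma tf_in [simp]: "\<lbrakk>B \<in> two_forms X; opn X U; y \<in> vfs U; z \<in> vfs U\<rbrakk> \<Longrightarrow>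
    B U y z \<in> sec X U" using tf_at[of B U y] by simp

lemma tf_add_left: "\<lbrakk>B \<in> two_forms X; opn X U; x \<in> vfs U; y \<in> vfs U;
    z \<in> vfs U\<rbrakk> \<Longrightarrow> B U (x + y) z = B U x z + B U y z" using tf_at[of B U y] by simp

lemma tf_add_right: "\<lbrakk>B \<in> two_forms X; opn X U; x \<in> vfs U; y \<in> vfs U;
    z \<in> vfs U\<rbrakk> \<Longrightarrow> B U z (x + y) = B U z x + B U z y" using tf_at[of B U y] by simp

lemma tf_smul_left: "\<lbrakk>B \<in> two_forms X; opn X U; y \<in> vfs U; z \<in> vfs U;
    a \<in> sec X U\<rbrakk> \<Longrightarrow> B U (vsmul U a y) z = a * B U y z" using tf_at[of B U y] by simp

lemma tf_smul_right: "\<lbrakk>B \<in> two_forms X; opn X U; y \<in> vfs U; z \<in> vfs U;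
    a \<in> sec X U\<rbrakk> \<Longrightarrow> B U z (vsmul U a y) = a * B U z y" using tf_at[of B U y] by simp

lemma tf_res: "\<lbrakk>B \<in> two_forms X; opn X U; y \<in> vfs U; z \<in> vfs U;
    opn X V; V \<subseteq> U\<rbrakk> \<Longrightarrow> B V (vres U V y) (vres U V z) = res X U V (B U y z)"
  using tf_at[of B U y] by simp

lemma tf_null: "B \<in> two_forms X \<Longrightarrow> \<not> (opn X U \<and> y \<in> vfs U \<and> z \<in> vfs U) \<Longrightarrow> B U y z = 0"
  unfolding two_forms_def by simp

lemma tf_zero_left [simp]: "B \<in> two_forms X \<Longrightarrow> B U 0 z = 0"
  using tf_add_left[of B U 0 0 z] tf_null[of B U 0 z] by (cases "opn X U \<and> z \<in> vfs U") auto

lemma tf_skew: "\<lbrakk>B \<in> two_forms X; opn X U; y \<in> vfs U; z \<in> vfs U\<rbrakk> \<Longrightarrow>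
    B U y z = - B U z y" using tf_alt[of B U "y + z"] tf_alt[of B U y] tf_alt[of B U z]
  by (simp add: tf_add_left tf_add_right eq_neg_iff_add_eq_0)

lemma two_formsI:
  assumes "\<And>U y. opn X U \<Longrightarrow> y \<in> vfs U \<Longrightarrow> B U y y = 0"
    and "\<And>U y z. \<lbrakk>opn X U; y \<in> vfs U; z \<in> vfs U\<rbrakk> \<Longrightarrow> B U y z \<in> sec X U"
    and add: "\<And>U x y z. \<lbrakk>opn X U; x \<in> vfs U; y \<in> vfs U; z \<in> vfs U\<rbrakk> \<Longrightarrow>
      B U (x + y) z = B U x z + B U y z"
    and "\<And>U x y z. \<lbrakk>opn X U; x \<in> vfs U; y \<in> vfs U; z \<in> vfs U\<rbrakk> \<Longrightarrow> B U z (x + y) = B U z x + B U z y"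
    and "\<And>U y z a. \<lbrakk>opn X U; y \<in> vfs U; z \<in> vfs U; a \<in> sec X U\<rbrakk> \<Longrightarrow> B U (vsmul U a y) z = a * B U y z"
    and "\<And>U y z a. \<lbrakk>opn X U; y \<in> vfs U; z \<in> vfs U; a \<in> sec X U\<rbrakk> \<Longrightarrow> B U z (vsmul U a y) = a * B U z y"
    and "\<And>U y z V. \<lbrakk>opn X U; y \<in> vfs U; z \<in> vfs U; opn X V; V \<subseteq> U\<rbrakk> \<Longrightarrow>
      B V (vres U V y) (vres U V z) = res X U V (B U y z)"
    and "\<And>U y z. \<not> (opn X U \<and> y \<in> vfs U \<and> z \<in> vfs U) \<Longrightarrow> B U y z = 0"
  shows "B \<in> two_forms X" unfolding two_forms_def mem_Collect_eq
  by (intro conjI allI impI ballI; (elim conjE)?) (use assms in simp_all)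

lemma closed_tf: "B \<in> closed_two_forms X \<Longrightarrow> B \<in> two_forms X" unfolding closed_two_forms_def by simp

lemma closed_eq:
  assumes "B \<in> closed_two_forms X" "opn X U" "x \<in> vfs U" "y \<in> vfs U" "z \<in> vfs U"
  shows "x U (B U y z) - y U (B U x z) + z U (B U x y)
          - B U (lie_bracket x y) z + B U (lie_bracket x z) y - B U (lie_bracket y z) x = 0"
  using assms unfolding closed_two_forms_def by simp

lemma closedI:
  assumes "B \<in> two_forms X" and "\<And>U x y z. \<lbrakk>opn X U; x \<in> vfs U; y \<in> vfs U; z \<in> vfs U\<rbrakk> \<Longrightarrow>
      x U (B U y z) - y U (B U x z) + z U (B U x y)
          - B U (lie_bracket x y) z + B U (lie_bracket x z) y - B U (lie_bracket y z) x = 0"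
  shows "B \<in> closed_two_forms X" using assms unfolding closed_two_forms_def by simp

lemma zero_closed: "0 \<in> closed_two_forms X" by (rule closedI, rule two_formsI) auto

lemma add_closed:
  assumes A: "A \<in> closed_two_forms X" and B: "B \<in> closed_two_forms X"
  shows "A + B \<in> closed_two_forms X"
proof (rule closedI, goal_cases)
  note tA = closed_tf[OF A] and tB = closed_tf[OF B]
  show "A + B \<in> two_forms X"
    by (rule two_formsI) (auto simp: tA tB tf_alt tf_add_left[OF tA] tf_add_left[OF tB] tf_add_right[OF tA]
      tf_add_right[OF tB] tf_smul_left[OF tA] tf_smul_left[OF tB] tf_smul_right[OF tA] tf_smul_right[OF tB]
      tf_res[OF tA] tf_res[OF tB] tf_null[OF tA] tf_null[OF tB] O.res_add algebra_simps)
  case (2 U x y z)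
  note U = 2(1) and xyz = 2(2-4)
  have ad: "v U ((A + B) U a b) = v U (A U a b) + v U (B U a b)"
    if "v \<in> vfs U" "a \<in> vfs U" "b \<in> vfs U" for v a b
    using vf_add[OF that(1) U subset_refl] tf_in[OF tA U that(2,3)] tf_in[OF tB U that(2,3)] by simp
  show ?case (is "?lhs = 0")
  proof -
    have "?lhs = (x U (A U y z) - y U (A U x z) + z U (A U x y)
          - A U (lie_bracket x y) z + A U (lie_bracket x z) y - A U (lie_bracket y z) x) +
        (x U (B U y z) - y U (B U x z) + z U (B U x y)
          - B U (lie_bracket x y) z + B U (lie_bracket x z) y - B U (lie_bracket y z) x)"
      unfolding ad[OF xyz] ad[OF xyz(2,1,3)] ad[OF xyz(3,1,2)] by simp
    then show ?thesis unfolding closed_eq[OF A U xyz] closed_eq[OF B U xyz] by simp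
  qed
qed

lemma uminus_closed:
  assumes B: "B \<in> closed_two_forms X" shows "- B \<in> closed_two_forms X"
proof (rule closedI, goal_cases)
  note tB = closed_tf[OF B]
  show "- B \<in> two_forms X"
    by (rule two_formsI) (auto simp: tB tf_alt tf_add_left[OF tB] tf_add_right[OF tB] tf_smul_left[OF tB]
      tf_smul_right[OF tB] tf_res[OF tB] tf_null[OF tB] O.res_uminus algebra_simps)
  case (2 U x y z)
  note U = 2(1) and xyz = 2(2-4)
  have um: "v U ((- B) U a b) = - v U (B U a b)" if "v \<in> vfs U" "a \<in> vfs U" "b \<in> vfs U" for v a b
    using vf_uminus[OF that(1) U subset_refl] tf_in[OF tB U that(2,3)] by simp
  show ?case (is "?lhs = 0")
  proof -
    have "?lhs = - (x U (B U y z) - y U (B U x z) + z U (B U x y)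
          - B U (lie_bracket x y) z + B U (lie_bracket x z) y - B U (lie_bracket y z) x)"
      unfolding um[OF xyz] um[OF xyz(2,1,3)] um[OF xyz(3,1,2)] by simp
    then show ?thesis unfolding closed_eq[OF B U xyz] by simp
  qed
qed

lemma contract_app [simp]: "W \<subseteq> V \<Longrightarrow> contract X B V x W z = B W (vres V W x) z"
  by (simp add: contract_def)

lemma contract_in [simp]:
  assumes B: "B \<in> two_forms X" and V: "opn X V" "x \<in> vfs V" shows "contract X B V x \<in> forms V"
proof (rule cotangentI, goal_cases)
  case W: (4 W W' z)
  then have "W' \<subseteq> V" by blast
  then show ?case using tf_res[OF B W(1) _ W(5,3,4), of "vres V W x"] W V by simp
next
  case (5 W z)
  then show ?case using tf_null[OF B] by (auto simp: contract_def)
qed (use B V in \<open>auto simp: tf_add_right tf_smul_right\<close>)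

lemma contract_zero [simp]: "B \<in> two_forms X \<Longrightarrow> contract X B V 0 = 0"
  by (intro ext) (simp add: contract_def)

lemma contract_add: "\<lbrakk>B \<in> two_forms X; x \<in> vfs V; y \<in> vfs V\<rbrakk> \<Longrightarrow>
    contract X B V (x + y) = contract X B V x + contract X B V y"
proof (intro ext, goal_cases)
  case (1 W z)
  note B = 1(1) and x = 1(2,3)
  show ?case using x tf_add_left[OF B, of W "vres V W x" "vres V W y" z] tf_null[OF B]
    by (cases "opn X W \<and> z \<in> vfs W") (auto simp: contract_def)
qed

lemma contract_smul: "\<lbrakk>B \<in> two_forms X; opn X V; x \<in> vfs V; a \<in> sec X V\<rbrakk> \<Longrightarrow>
    contract X B V (vsmul V a x) = smul (cotangent X) V a (contract X B V x)"
proof (intro ext, goal_cases)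
  case (1 W z)
  note B = 1(1) and x = 1(2-4)
  show ?case using x tf_smul_left[OF B, of W "vres V W x" z "res X V W a"] tf_null[OF B]
    by (cases "opn X W \<and> z \<in> vfs W") (auto simp: contract_def res_vf_smul)
qed

lemma contract_res: "V' \<subseteq> V \<Longrightarrow> contract X B V' (vres V V' x) = fres V V' (contract X B V x)"
  by (intro ext) (auto simp: contract_def res_cot_app)

lemma contract_form_add: "contract X (A + B) V x = contract X A V x + contract X B V x"
  by (intro ext) (simp add: contract_def)

lemma contract_form_zero: "contract X 0 V x = 0" by (intro ext) (simp add: contract_def)

lemma gauge_app:
  "gauge_action X B \<Phi> V \<kappa> = (fst (\<Phi> V \<kappa>), snd (\<Phi> V \<kappa>) + contract X B V (fst (\<Phi> V \<kappa>)))"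
  by (simp add: gauge_action_def case_prod_beta)

lemma lie_derivative_null: "\<not> (opn X W \<and> W \<subseteq> V \<and> z \<in> vfs W) \<Longrightarrow> lie_derivative X V x \<beta> W z = 0"
  by (simp only: lie_derivative_def if_False)

lemma contract_d_null: "\<not> (opn X W \<and> W \<subseteq> V \<and> z \<in> vfs W) \<Longrightarrow> contract_d X V y \<alpha> W z = 0"
  by (simp only: contract_d_def if_False)

lemma lie_derivative_app: "\<lbrakk>opn X W; W \<subseteq> V; z \<in> vfs W\<rbrakk> \<Longrightarrow>
    lie_derivative X V x \<beta> W z = x W (\<beta> W z) - \<beta> W (lie_bracket (vres V W x) z)"
  by (simp add: lie_derivative_def)

lemma contract_d_app: "\<lbrakk>opn X W; W \<subseteq> V; z \<in> vfs W\<rbrakk> \<Longrightarrow>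
    contract_d X V y \<alpha> W z = y W (\<alpha> W z) - z W (\<alpha> W (vres V W y))
      - \<alpha> W (lie_bracket (vres V W y) z)" by (simp add: contract_d_def)

lemma contract_bracket:
  assumes B: "B \<in> closed_two_forms X" and V: "opn X V" and x: "x \<in> vfs V" and y: "y \<in> vfs V"
    and \<alpha>: "\<alpha> \<in> forms V" and \<beta>: "\<beta> \<in> forms V"
  shows "lie_derivative X V x (\<beta> + contract X B V y) - contract_d X V y (\<alpha> + contract X B V x) =
    lie_derivative X V x \<beta> - contract_d X V y \<alpha> + contract X B V (lie_bracket x y)"
proof (intro ext)
  note tB = closed_tf[OF B]
  fix W z
  show "(lie_derivative X V x (\<beta> + contract X B V y) - contract_d X V y (\<alpha> + contract X B V x)) W z =
    (lie_derivative X V x \<beta> - contract_d X V y \<alpha> + contract X B V (lie_bracket x y)) W z"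
  proof (cases "opn X W \<and> W \<subseteq> V \<and> z \<in> vfs W")
    case False
    have "contract X B V (lie_bracket x y) W z = 0"
      by (rule cot_null[OF contract_in[OF tB V lie_bracket_in[OF x y]] False])
    then show ?thesis using lie_derivative_null[OF False] contract_d_null[OF False] by simp
  next
    case True
    then have W: "opn X W" "W \<subseteq> V" and z: "z \<in> vfs W" by auto
    let ?x = "vres V W x" and ?y = "vres V W y"
    have xy: "?x \<in> vfs W" "?y \<in> vfs W" using x y W by simp_all
    have 1: "x W (\<beta> W z + B W ?y z) = x W (\<beta> W z) + x W (B W ?y z)"
      by (rule vf_add[OF x W]) (use W z \<beta> tB xy in auto)
    have 2: "y W (\<alpha> W z + B W ?x z) = y W (\<alpha> W z) + y W (B W ?x z)"
      by (rule vf_add[OF y W]) (use W z \<alpha> tB xy in auto)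
    have 3: "z W (\<alpha> W ?y + B W ?x ?y) = z W (\<alpha> W ?y) + z W (B W ?x ?y)"
      by (rule vf_add[OF z W(1) subset_refl]) (use W z \<alpha> tB xy in auto)
    have lx: "lie_bracket ?x z \<in> vfs W" "lie_bracket ?y z \<in> vfs W" using xy z by simp_all
    have c: "x W (B W ?y z) - y W (B W ?x z) + z W (B W ?x ?y)
          - B W (lie_bracket ?x ?y) z - B W ?y (lie_bracket ?x z) + B W ?x (lie_bracket ?y z) = 0"
      using closed_eq[OF B W(1) xy z] tf_skew[OF tB W(1) lx(1) xy(2)] tf_skew[OF tB W(1) lx(2) xy(1)] by simp
    then have c': "B W (lie_bracket ?x ?y) z = x W (B W ?y z) - y W (B W ?x z) + z W (B W ?x ?y)
          - B W ?y (lie_bracket ?x z) + B W ?x (lie_bracket ?y z)" by (simp add: algebra_simps)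
    have r: "vres V W (lie_bracket x y) = lie_bracket ?x ?y" by (rule res_lie_bracket[OF x y W(2)])
    show ?thesis using W(2)
      by (simp add: lie_derivative_app[OF W z] contract_d_app[OF W z] r c' 1 2 3 algebra_simps)
  qed
qed

lemma gauge_iso:
  fixes Q :: "('x, 'r, 'q::ab_group_add) courant"
  assumes iso: "courant_iso X Q (standard_courant X) \<Phi>" and B: "B \<in> closed_two_forms X"
  shows "courant_iso X Q (standard_courant X) (gauge_action X B \<Phi>)"
proof -
  interpret \<Phi>: std_iso X Q \<Phi> by unfold_locales (rule iso)
  note tB = closed_tf[OF B]
  let ?c = "\<lambda>V x. contract X B V x"
  have anch_in: "anchor Q V \<kappa> \<in> vfs V" if "opn X V" "\<kappa> \<in> sec Q V" for V \<kappa>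
    using \<Phi>.\<Phi>_fst_in[OF that] \<Phi>.\<Phi>_anch[OF that] by simp
  show ?thesis
  proof (rule std_isoI, goal_cases)
    case (1 V \<kappa>)
    then show ?case using \<Phi>.\<Phi>_null[of V \<kappa>] tB by (simp add: gauge_app zero_prod_def)
  next
    fix V \<kappa> \<mu> assume V: "opn X V" and \<kappa>: "\<kappa> \<in> sec Q V" and \<mu>: "\<mu> \<in> sec Q V"
    note f = \<Phi>.\<Phi>_fst_in[OF V \<kappa>] \<Phi>.\<Phi>_fst_in[OF V \<mu>] and s = \<Phi>.\<Phi>_snd_in[OF V \<kappa>] \<Phi>.\<Phi>_snd_in[OF V \<mu>]
    show "gauge_action X B \<Phi> V (\<kappa> + \<mu>) = gauge_action X B \<Phi> V \<kappa> + gauge_action X B \<Phi> V \<mu>"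
      unfolding gauge_app \<Phi>.\<Phi>_add[OF V \<kappa> \<mu>] using contract_add[OF tB f] by (simp add: add_ac)
    have ck: "?c V (fst (\<Phi> V \<kappa>)) V (fst (\<Phi> V \<mu>)) = - ?c V (fst (\<Phi> V \<mu>)) V (fst (\<Phi> V \<kappa>))"
      using tf_skew[OF tB V f] f by (simp del: \<Phi>.\<Phi>_anch)
    show "snd (gauge_action X B \<Phi> V \<kappa>) V (fst (gauge_action X B \<Phi> V \<mu>)) +
        snd (gauge_action X B \<Phi> V \<mu>) V (fst (gauge_action X B \<Phi> V \<kappa>)) = pairing Q V \<kappa> \<mu>"
      unfolding gauge_app fst_conv snd_conv plus_fun_apply ck \<Phi>.\<Phi>_pair[OF V \<kappa> \<mu>, symmetric] by simp
    show "fst (gauge_action X B \<Phi> V (bracket Q V \<kappa> \<mu>)) =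
        lie_bracket (fst (gauge_action X B \<Phi> V \<kappa>)) (fst (gauge_action X B \<Phi> V \<mu>))"
      unfolding gauge_app \<Phi>.\<Phi>_brk[OF V \<kappa> \<mu>] by simp
    show "snd (gauge_action X B \<Phi> V (bracket Q V \<kappa> \<mu>)) =
        lie_derivative X V (fst (gauge_action X B \<Phi> V \<kappa>)) (snd (gauge_action X B \<Phi> V \<mu>)) -
        contract_d X V (fst (gauge_action X B \<Phi> V \<mu>)) (snd (gauge_action X B \<Phi> V \<kappa>))"
      unfolding gauge_app \<Phi>.\<Phi>_brk[OF V \<kappa> \<mu>] fst_conv snd_conv contract_bracket[OF B V f s] by simp
  next
    case (6 V \<kappa> a)
    note V = 6(1) and \<kappa> = 6(2) and a = 6(3)
    show ?case
      unfolding gauge_app \<Phi>.\<Phi>_smul[OF V \<kappa> a] fst_conv snd_conv contract_smul[OF tB V \<Phi>.\<Phi>_fst_in[OF V \<kappa>] a]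
      by (simp add: dual_def fun_eq_iff distrib_left)
  next
    case (7 V \<kappa> W)
    note V = 7(1) and \<kappa> = 7(2) and W = 7(3,4)
    show ?case unfolding gauge_app \<Phi>.\<Phi>_res[OF V \<kappa> W] fst_conv snd_conv contract_res[OF W(2)]
      by (simp add: dual_def fun_eq_iff)
  next
    case V: (8 V)
    show ?case unfolding bij_betw_def
    proof (intro conjI subset_antisym)
      show "inj_on (gauge_action X B \<Phi> V) (sec Q V)"
      proof (rule inj_onI)
        fix \<kappa> \<mu> assume k: "\<kappa> \<in> sec Q V" "\<mu> \<in> sec Q V" and "gauge_action X B \<Phi> V \<kappa> = gauge_action X B \<Phi> V \<mu>"
        then have "\<Phi> V \<kappa> = \<Phi> V \<mu>" unfolding gauge_app by (auto simp: prod_eq_iff simp del: \<Phi>.\<Phi>_anch)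
        then show "\<kappa> = \<mu>" by (rule \<Phi>.\<Phi>_inj[OF V k])
      qed
      show "gauge_action X B \<Phi> V ` sec Q V \<subseteq> vfs V \<times> forms V"
        using V tB by (auto simp: gauge_app simp del: \<Phi>.\<Phi>_anch)
      show "vfs V \<times> forms V \<subseteq> gauge_action X B \<Phi> V ` sec Q V"
      proof
        fix w assume "w \<in> vfs V \<times> forms V"
        then obtain D \<eta> where w: "w = (D, \<eta>)" "D \<in> vfs V" "\<eta> \<in> forms V" by auto
        then obtain \<kappa> where \<kappa>: "\<kappa> \<in> sec Q V" "\<Phi> V \<kappa> = (D, \<eta> - ?c V D)"
          using \<Phi>.\<Phi>_surj[OF V w(2), of "\<eta> - ?c V D"] V tB by auto
        then have "gauge_action X B \<Phi> V \<kappa> = w" by (simp add: gauge_app w)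
        then show "w \<in> gauge_action X B \<Phi> V ` sec Q V" using \<kappa>(1) by blast
      qed
    qed
  qed (use tB anch_in in \<open>simp_all add: gauge_app\<close>)
qed

text \<open>
  Two trivializations differ by an automorphism of the standard Courant algebroid; since it
  preserves anchor and pairing it has the form \<open>x + \<alpha> \<mapsto> x + \<alpha> + \<iota>\<^sub>x B\<close>.
\<close>

lemma gauge_transitive:
  fixes Q :: "('x, 'r, 'q::ab_group_add) courant"
  assumes data: "courant_data X Q" and iso: "courant_iso X Q (standard_courant X) \<Phi>"
    and iso': "courant_iso X Q (standard_courant X) \<Psi>"
  shows "\<exists>B\<in>closed_two_forms X. gauge_action X B \<Phi> = \<Psi>"
proof -
  interpret \<Phi>: std_iso X Q \<Phi> by unfold_locales (rule iso)
  interpret \<Psi>: std_iso X Q \<Psi> by unfold_locales (rule iso')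
  interpret Q: kmod X Q by unfold_locales (rule data[unfolded courant_data_def, THEN conjunct1])
  have brk_in: "bracket Q V \<kappa> \<mu> \<in> sec Q V" if "opn X V" "\<kappa> \<in> sec Q V" "\<mu> \<in> sec Q V" for V \<kappa> \<mu>
    using data[unfolded courant_data_def, THEN conjunct2, rule_format, OF that] by simp
  define k where "k V y = (SOME \<kappa>. \<kappa> \<in> sec Q V \<and> \<Phi> V \<kappa> = (y, 0))" for V y
  have k: "k V y \<in> sec Q V \<and> \<Phi> V (k V y) = (y, 0)" if y: "opn X V" "y \<in> vfs V" for V y
  proof -
    obtain \<kappa> where "\<kappa> \<in> sec Q V \<and> \<Phi> V \<kappa> = (y, 0)" using \<Phi>.\<Phi>_surj[OF y, of 0] y by auto
    then show ?thesis unfolding k_def by (rule someI)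
  qed
  have k_in: "k V y \<in> sec Q V" and \<Phi>k: "\<Phi> V (k V y) = (y, 0)" if "opn X V" "y \<in> vfs V" for V y
    using k[OF that] by simp_all
  have kI: "\<kappa> = k V y" if "opn X V" "y \<in> vfs V" "\<kappa> \<in> sec Q V" "\<Phi> V \<kappa> = (y, 0)" for V y \<kappa>
    by (rule \<Phi>.\<Phi>_inj[OF that(1,3) k_in[OF that(1,2)]]) (simp add: that \<Phi>k del: \<Phi>.\<Phi>_anch)
  have k_add: "k V (x + y) = k V x + k V y" if "opn X V" "x \<in> vfs V" "y \<in> vfs V" for V x y
    by (rule kI[symmetric]) (use that k_in \<Phi>k \<Phi>.\<Phi>_add in auto)
  have k_smul: "k V (vsmul V a x) = smul Q V a (k V x)"
    if "opn X V" "x \<in> vfs V" "a \<in> sec X V" for V x a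
  proof (rule kI[symmetric])
    show "\<Phi> V (smul Q V a (k V x)) = (vsmul V a x, 0)"
      unfolding \<Phi>.\<Phi>_smul[OF that(1) k_in[OF that(1,2)] that(3)] \<Phi>k[OF that(1,2)] by (auto simp: dual_def fun_eq_iff)
  qed (use that k_in in auto)
  have k_res: "k W (vres V W x) = res Q V W (k V x)"
    if "opn X V" "x \<in> vfs V" "opn X W" "W \<subseteq> V" for V W x
  proof (rule kI[symmetric])
    show "\<Phi> W (res Q V W (k V x)) = (vres V W x, 0)"
      unfolding \<Phi>.\<Phi>_res[OF that(1) k_in[OF that(1,2)] that(3,4)] \<Phi>k[OF that(1,2)] by simp
  qed (use that k_in in auto)
  have k_brk: "k V (lie_bracket x y) = bracket Q V (k V x) (k V y)"
    if "opn X V" "x \<in> vfs V" "y \<in> vfs V" for V x y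
  proof (rule kI[symmetric])
    have "lie_derivative X V x 0 - contract_d X V y 0 = 0"
    proof (intro ext)
      fix W z
      show "(lie_derivative X V x 0 - contract_d X V y 0) W z = 0 W z"
        using vf_zero[OF that(2), of W] vf_zero[OF that(3), of W] vf_zero[of z W W]
          lie_derivative_null[of W V z x 0] contract_d_null[of W V z y 0]
        by (cases "opn X W \<and> W \<subseteq> V \<and> z \<in> vfs W") (auto simp: lie_derivative_app contract_d_app)
    qed
    then show "\<Phi> V (bracket Q V (k V x) (k V y)) = (lie_bracket x y, 0)"
      unfolding \<Phi>.\<Phi>_brk[OF that(1) k_in[OF that(1,2)] k_in[OF that(1,3)]] \<Phi>k[OF that(1,2)] \<Phi>k[OF that(1,3)]
      by simp
  qed (use that k_in brk_in in auto)
  have anch_k: "anchor Q V (k V y) = y" if "opn X V" "y \<in> vfs V" for V y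
    using \<Phi>.\<Phi>_anch[OF that(1) k_in[OF that]] \<Phi>k[OF that] by simp
  have fst\<Psi>: "fst (\<Psi> V (k V y)) = y" if "opn X V" "y \<in> vfs V" for V y
    using \<Psi>.\<Phi>_anch[OF that(1) k_in[OF that]] anch_k[OF that] by simp
  define b where "b V y = snd (\<Psi> V (k V y))" for V y
  have b_in: "b V y \<in> forms V" if "opn X V" "y \<in> vfs V" for V y
    unfolding b_def using that k_in by simp
  have pair_k: "pairing Q V (k V y) (k V z) = 0" if "opn X V" "y \<in> vfs V" "z \<in> vfs V" for V y z
    using \<Phi>.\<Phi>_pair[OF that(1) k_in[OF that(1,2)] k_in[OF that(1,3)]] \<Phi>k[OF that(1,2)] \<Phi>k[OF that(1,3)] by simp
  have b_skew: "b V y V z + b V z V y = 0" if "opn X V" "y \<in> vfs V" "z \<in> vfs V" for V y z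
    using \<Psi>.\<Phi>_pair[OF that(1) k_in[OF that(1,2)] k_in[OF that(1,3)]] pair_k[OF that]
      fst\<Psi>[OF that(1,2)] fst\<Psi>[OF that(1,3)] by (simp add: b_def del: \<Psi>.\<Phi>_anch)
  have b_res: "b W (vres V W x) = fres V W (b V x)"
    if "opn X V" "x \<in> vfs V" "opn X W" "W \<subseteq> V" for V W x
    unfolding b_def k_res[OF that] using \<Psi>.\<Phi>_res[OF that(1) k_in[OF that(1,2)] that(3,4)] by simp
  define B where "B U y z = (if opn X U \<and> y \<in> vfs U \<and> z \<in> vfs U then b U y U z else 0)" for U y z
  have tB: "B \<in> two_forms X"
  proof (rule two_formsI, goal_cases)
    fix U y z assume U: "opn X U" and y: "y \<in> vfs U"
    show "B U y y = 0" using double_eq_0[OF U _ b_skew[OF U y y]] b_in[OF U y] by (simp add: B_def)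
    assume z: "z \<in> vfs U"
    show "B U y z \<in> sec X U" using U b_in[OF U y] by (simp add: B_def)
    fix a assume a: "a \<in> sec X U"
    have "b U (vsmul U a y) U z = a * b U y U z"
      unfolding b_def k_smul[OF U y a] \<Psi>.\<Phi>_smul[OF U k_in[OF U y] a] using U a by simp
    then show "B U (vsmul U a y) z = a * B U y z" using y a by (simp add: B_def)
    show "B U z (vsmul U a y) = a * B U z y"
      using y a cot_smul[OF b_in[OF U z] U subset_refl a y] by (simp add: B_def)
  next
    fix U x y z assume U: "opn X U" and x: "x \<in> vfs U" and y: "y \<in> vfs U" and z: "z \<in> vfs U"
    have "b U (x + y) U z = b U x U z + b U y U z"
      unfolding b_def k_add[OF U x y] \<Psi>.\<Phi>_add[OF U k_in[OF U x] k_in[OF U y]] by simp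
    then show "B U (x + y) z = B U x z + B U y z" using x y by (simp add: B_def)
    show "B U z (x + y) = B U z x + B U z y"
      using x y cot_add[OF b_in[OF U z] U subset_refl x y] by (simp add: B_def)
  next
    case (7 U y z V)
    note U = 7(1) and y = 7(2) and z = 7(3) and V = 7(4,5)
    show ?case
      using U y z V b_res[OF U y V] cot_res[OF b_in[OF U y] U subset_refl V z] by (simp add: B_def)
  qed (auto simp: B_def)
  have B: "B \<in> closed_two_forms X"
  proof (rule closedI[OF tB], goal_cases)
    case (1 U x y z)
    note U = 1(1) and x = 1(2) and y = 1(3) and z = 1(4)
    have "b U (lie_bracket x y) = lie_derivative X U x (b U y) - contract_d X U y (b U x)"
      unfolding b_def k_brk[OF U x y] using \<Psi>.\<Phi>_brk[OF U k_in[OF U x] k_in[OF U y]] fst\<Psi>[OF U x] fst\<Psi>[OF U y]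
      by (simp del: \<Psi>.\<Phi>_anch)
    then have "b U (lie_bracket x y) U z = x U (b U y U z) - b U y U (lie_bracket x z)
        - (y U (b U x U z) - z U (b U x U y) - b U x U (lie_bracket y z))"
      using U x y z by (simp add: lie_derivative_app contract_d_app)
    then have "B U (lie_bracket x y) z = x U (B U y z) - B U y (lie_bracket x z)
        - (y U (B U x z) - z U (B U x y) - B U x (lie_bracket y z))"
      using x y z by (simp add: B_def)
    then show ?case
      using tf_skew[OF tB U lie_bracket_in[OF x z] y] tf_skew[OF tB U lie_bracket_in[OF y z] x]
      by (simp add: algebra_simps)
  qed
  have "gauge_action X B \<Phi> = \<Psi>"
  proof (intro ext)
    fix V \<kappa>
    show "gauge_action X B \<Phi> V \<kappa> = \<Psi> V \<kappa>"
    proof (cases "opn X V \<and> \<kappa> \<in> sec Q V")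
      case False
      then show ?thesis using \<Phi>.\<Phi>_null[of V \<kappa>] \<Psi>.\<Phi>_null[of V \<kappa>] tB by (simp add: gauge_app zero_prod_def)
    next
      case True
      then have V: "opn X V" and \<kappa>: "\<kappa> \<in> sec Q V" by auto
      let ?x = "anchor Q V \<kappa>"
      have x: "?x \<in> vfs V" using \<Phi>.\<Phi>_fst_in[OF V \<kappa>] \<Phi>.\<Phi>_anch[OF V \<kappa>] by simp
      let ?a = "\<kappa> - k V ?x"
      have a: "?a \<in> sec Q V" using V \<kappa> k_in[OF V x] by simp
      have sum: "?a + k V ?x = \<kappa>" by simp
      have \<Phi>a: "\<Phi> V ?a = (0, snd (\<Phi> V \<kappa>))"
        using \<Phi>.\<Phi>_add[OF V a k_in[OF V x]] \<Phi>k[OF V x] \<Phi>.\<Phi>_anch[OF V \<kappa>] unfolding sum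
        by (simp add: prod_eq_iff del: \<Phi>.\<Phi>_anch)
      have anch_a: "anchor Q V ?a = 0" using \<Phi>.\<Phi>_anch[OF V a] \<Phi>a by simp
      have snd_a: "snd (\<Psi> V ?a) = snd (\<Phi> V ?a)"
      proof (rule cot_eqI[OF \<Psi>.\<Phi>_snd_in[OF V a] \<Phi>.\<Phi>_snd_in[OF V a]])
        fix W z assume W: "opn X W" "W \<subseteq> V" and z: "z \<in> vfs W"
        have ra: "res Q V W ?a \<in> sec Q W" using a V W by simp
        have "snd (\<Psi> V ?a) W z = pairing Q W (res Q V W ?a) (k W z)"
          using \<Psi>.\<Phi>_pair[OF W(1) ra k_in[OF W(1) z]] \<Psi>.\<Phi>_res[OF V a W] fst\<Psi>[OF W(1) z] anch_a \<Psi>.\<Phi>_anch[OF V a]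
            b_in[OF W(1) z] by (simp add: b_def[symmetric] del: \<Psi>.\<Phi>_anch)
        also have "\<dots> = snd (\<Phi> V ?a) W z"
          using \<Phi>.\<Phi>_pair[OF W(1) ra k_in[OF W(1) z]] \<Phi>.\<Phi>_res[OF V a W] \<Phi>k[OF W(1) z] by simp
        finally show "snd (\<Psi> V ?a) W z = snd (\<Phi> V ?a) W z" .
      qed
      have "b V ?x = contract X B V ?x"
      proof (rule cot_eqI[OF b_in[OF V x] contract_in[OF tB V x]], goal_cases)
        case (1 W z)
        note W = 1(1,2) and z = 1(3)
        then show ?case using b_res[OF V x W] x by (simp add: B_def)
      qed
      then have "snd (\<Psi> V \<kappa>) = snd (\<Phi> V \<kappa>) + contract X B V ?x"
        using \<Psi>.\<Phi>_add[OF V a k_in[OF V x]] snd_a \<Phi>a unfolding sum b_def by simp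
      then show ?thesis using \<Phi>.\<Phi>_anch[OF V \<kappa>] \<Psi>.\<Phi>_anch[OF V \<kappa>] by (simp add: gauge_app prod_eq_iff)
    qed
  qed
  then show ?thesis using B by blast
qed

lemma gauge_free:
  fixes Q :: "('x, 'r, 'q::ab_group_add) courant"
  assumes iso: "courant_iso X Q (standard_courant X) \<Phi>"
    and A: "A \<in> closed_two_forms X" and B: "B \<in> closed_two_forms X"
    and eq: "gauge_action X A \<Phi> = gauge_action X B \<Phi>"
  shows "A = B"
proof (intro ext)
  interpret \<Phi>: std_iso X Q \<Phi> by unfold_locales (rule iso)
  fix U y z
  show "A U y z = B U y z"
  proof (cases "opn X U \<and> y \<in> vfs U \<and> z \<in> vfs U")
    case False
    then show ?thesis using tf_null[OF closed_tf[OF A]] tf_null[OF closed_tf[OF B]] by simp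
  next
    case True
    then obtain \<kappa> where "\<Phi> U \<kappa> = (y, 0)" using \<Phi>.\<Phi>_surj[of U y 0] by auto
    then have "contract X A U y U z = contract X B U y U z"
      using fun_cong[OF fun_cong[OF eq, of U], of \<kappa>] by (simp add: gauge_app)
    then show ?thesis using True by simp
  qed
qed

theorem trivializations_torsor:
  fixes Q :: "('x, 'r, 'q::ab_group_add) courant"
  assumes data: "courant_data X Q"
  shows "is_torsor (closed_two_forms X) (courant_trivializations X Q) (gauge_action X)"
  unfolding is_torsor_def courant_trivializations_def mem_Collect_eq
proof ((intro conjI ballI; (unfold mem_Collect_eq)?), goal_cases)
  fix \<Phi> assume "courant_iso X Q (standard_courant X) \<Phi>"
  show "gauge_action X 0 \<Phi> = \<Phi>" by (intro ext) (simp add: gauge_app contract_form_zero)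
  fix A B
  show "gauge_action X (A + B) \<Phi> = gauge_action X A (gauge_action X B \<Phi>)"
    by (intro ext) (simp add: gauge_app contract_form_add add_ac)
next
  case iso: (7 \<Phi> \<Psi>)
  obtain B where B: "B \<in> closed_two_forms X" "gauge_action X B \<Phi> = \<Psi>"
    using gauge_transitive[OF data iso] by blast
  show ?case
  proof (rule ex1I)
    show "B \<in> closed_two_forms X \<and> gauge_action X B \<Phi> = \<Psi>" using B by simp
    fix A assume "A \<in> closed_two_forms X \<and> gauge_action X A \<Phi> = \<Psi>"
    then show "A = B" using gauge_free[OF iso(1) _ B(1), of A] B by simp
  qed
qed (use zero_closed add_closed uminus_closed gauge_iso in auto)

end

section \<open>The correspondence\<close>

lemma (in krs) res_cot_add:
  "fres U V (\<alpha> + \<beta>) = fres U V \<alpha> + fres U V \<beta>" by (intro ext) (simp add: res_cot_app)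

locale trivialized = restricted X Y \<rho> E P p Q q + \<Phi>: std_iso Y Q \<Phi> for X Y \<rho> E P p Q q \<Phi>
begin

abbreviation G where "G \<equiv> gtb_of_trivialization X Y \<rho> E P p q \<Phi>"

abbreviation form_part where "form_part V \<sigma> \<equiv> snd (\<Phi> V (q V \<sigma>))"

lemma G_iff: "opn Y V \<Longrightarrow> \<sigma> \<in> G V \<longleftrightarrow> \<sigma> \<in> AP V \<and> form_part V \<sigma> = 0"
  by (simp add: gtb_of_trivialization_def)

lemma fst_q [simp]: "opn Y V \<Longrightarrow> \<sigma> \<in> AP V \<Longrightarrow> fst (\<Phi> V (q V \<sigma>)) = pa V \<sigma>" by simp

lemma fp_in [simp]: "opn Y V \<Longrightarrow> \<sigma> \<in> AP V \<Longrightarrow> form_part V \<sigma> \<in> Y.forms V" by simp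

lemma fp_add: "\<lbrakk>opn Y V; \<sigma> \<in> AP V; \<tau> \<in> AP V\<rbrakk> \<Longrightarrow> form_part V (\<sigma> + \<tau>) = form_part V \<sigma> + form_part V \<tau>"
  by (simp add: q_add \<Phi>.\<Phi>_add)

lemma fp_diff:
  assumes "opn Y V" "\<sigma> \<in> AP V" "\<tau> \<in> AP V"
  shows "form_part V (\<sigma> - \<tau>) = form_part V \<sigma> - form_part V \<tau>"
  using fp_add[of V "\<sigma> - \<tau>" \<tau>] assms by simp

lemma fp_smul: "\<lbrakk>opn Y V; \<sigma> \<in> AP V; a \<in> sec Y V\<rbrakk> \<Longrightarrow>
    form_part V (smul P V a \<sigma>) = smul (cotangent Y) V a (form_part V \<sigma>)"
  by (simp add: q_smul \<Phi>.\<Phi>_smul)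

lemma fp_res: "\<lbrakk>opn Y V; \<sigma> \<in> AP V; opn Y W; W \<subseteq> V\<rbrakk> \<Longrightarrow>
    form_part W (res P V W \<sigma>) = Y.fres V W (form_part V \<sigma>)" by (simp add: q_res \<Phi>.\<Phi>_res)

lemma pp_fp: "\<lbrakk>opn Y V; \<sigma> \<in> AP V; \<tau> \<in> AP V\<rbrakk> \<Longrightarrow>
    pp V \<sigma> \<tau> = form_part V \<sigma> V (pa V \<tau>) + form_part V \<tau> V (pa V \<sigma>)"
  using \<Phi>.\<Phi>_pair[of V "q V \<sigma>" "q V \<tau>"] by simp

lemma lift_both:
  assumes V: "opn Y V" "D \<in> Y.vfs V" "\<eta> \<in> Y.forms V" "y \<in> V"
  shows "\<exists>W \<sigma>. opn Y W \<and> y \<in> W \<and> W \<subseteq> V \<and> \<sigma> \<in> AP W \<and> pa W \<sigma> = Y.vres V W D \<and>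
    form_part W \<sigma> = Y.fres V W \<eta>"
proof -
  obtain \<kappa> where \<kappa>: "\<kappa> \<in> sec Q V" "\<Phi> V \<kappa> = (D, \<eta>)" using \<Phi>.\<Phi>_surj[OF V(1-3)] by blast
  obtain W \<sigma> where W: "opn Y W" "y \<in> W" "W \<subseteq> V" "\<sigma> \<in> AP W" "q W \<sigma> = res Q V W \<kappa>"
    using q_lift[OF V(1) \<kappa>(1) V(4)] by auto
  have "\<Phi> W (q W \<sigma>) = (Y.vres V W D, Y.fres V W \<eta>)"
    unfolding W(5) using \<Phi>.\<Phi>_res[OF V(1) \<kappa>(1) W(1,3)] \<kappa>(2) by simp
  then show ?thesis using W fst_q[OF W(1,4)] by (intro exI[of _ W] exI[of _ \<sigma>]) simp
qed

lemma G_onto: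
  assumes V: "opn Y V" "D \<in> Y.vfs V" "y \<in> V"
  shows "\<exists>W \<tau>. opn Y W \<and> y \<in> W \<and> W \<subseteq> V \<and> \<tau> \<in> G W \<and> pa W \<tau> = Y.vres V W D"
proof -
  obtain W \<sigma> where "opn Y W" "y \<in> W" "W \<subseteq> V" "\<sigma> \<in> AP W" "pa W \<sigma> = Y.vres V W D"
      "form_part W \<sigma> = Y.fres V W 0" using lift_both[OF V(1,2) _ V(3), of 0] V by auto
  then show ?thesis by (intro exI[of _ W] exI[of _ \<sigma>]) (simp add: G_iff)
qed

lemma CN_G: "opn Y V \<Longrightarrow> \<sigma> \<in> CN V \<Longrightarrow> \<sigma> \<in> G V \<and> pa V \<sigma> = 0"
proof -
  assume V: "opn Y V" and "\<sigma> \<in> CN V"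
  then have \<sigma>: "\<sigma> \<in> AP V" "q V \<sigma> = 0" using CN_iff by simp_all
  have "\<Phi> V 0 = 0" using \<Phi>.\<Phi>_add[OF V, of 0 0] V by simp
  then show ?thesis using \<sigma> V fst_q[OF V \<sigma>(1)] by (simp add: G_iff del: fst_q)
qed

lemma G_ker: "\<lbrakk>opn Y V; \<sigma> \<in> G V; pa V \<sigma> = 0\<rbrakk> \<Longrightarrow> \<sigma> \<in> CN V"
proof -
  assume V: "opn Y V" and G: "\<sigma> \<in> G V" and a: "pa V \<sigma> = 0"
  have \<sigma>: "\<sigma> \<in> AP V" "form_part V \<sigma> = 0" using G V G_iff by simp_all
  have "\<Phi> V 0 = 0" using \<Phi>.\<Phi>_add[OF V, of 0 0] V by simp
  moreover have "\<Phi> V (q V \<sigma>) = 0" using \<sigma> a fst_q[OF V \<sigma>(1)] by (simp add: prod_eq_iff del: fst_q \<Phi>.\<Phi>_anch)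
  ultimately have "q V \<sigma> = 0" using \<Phi>.\<Phi>_inj[OF V, of "q V \<sigma>" 0] V \<sigma> by simp
  then show ?thesis using CN_iff[OF V] \<sigma> by simp
qed

lemma G_iso: "\<lbrakk>opn Y V; \<sigma> \<in> G V; \<tau> \<in> G V\<rbrakk> \<Longrightarrow> pp V \<sigma> \<tau> = 0" using pp_fp[of V \<sigma> \<tau>] by (simp add: G_iff)

lemma G_res: "\<lbrakk>opn Y V; opn Y W; W \<subseteq> V; \<sigma> \<in> G V\<rbrakk> \<Longrightarrow> res P V W \<sigma> \<in> G W"
  by (simp add: G_iff fp_res del: \<Phi>.\<Phi>_anch)

lemma G_perp:
  assumes V: "opn Y V" and \<sigma>: "\<sigma> \<in> sec P V"
    and perp: "\<And>W \<tau>. \<lbrakk>opn Y W; W \<subseteq> V; \<tau> \<in> G W\<rbrakk> \<Longrightarrow> pp W (res P V W \<sigma>) \<tau> = 0"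
  shows "\<sigma> \<in> G V"
proof -
  have \<sigma>A: "\<sigma> \<in> AP V" by (rule perp_CN_AP[OF V \<sigma>]) (use perp CN_G in blast)
  have "form_part V \<sigma> = 0"
  proof (rule Y.cot_eqI[OF fp_in[OF V \<sigma>A] Y.zero_cot_in[OF V]], goal_cases)
    case (1 W D)
    note W = 1(1,2) and D = 1(3)
    have in_W: "form_part V \<sigma> W D \<in> sec Y W" by (rule Y.cot_in[OF fp_in[OF V \<sigma>A] W D])
    have "form_part V \<sigma> W D = 0"
    proof (rule Y.O.eqI_local[OF W(1) in_W], goal_cases)
      case y: (2 y)
      obtain N \<tau> where N: "opn Y N" "y \<in> N" "N \<subseteq> W" "\<tau> \<in> G N" "pa N \<tau> = Y.vres W N D"
        using G_onto[OF W(1) D y] by auto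
      have NV: "N \<subseteq> V" and \<tau>: "\<tau> \<in> AP N" "form_part N \<tau> = 0" using N W G_iff[OF N(1)] by auto
      have "0 = pp N (res P V N \<sigma>) \<tau>" using perp[OF N(1) NV N(4)] by simp
      also have "\<dots> = form_part N (res P V N \<sigma>) N (pa N \<tau>)"
        using pp_fp[OF N(1) AP_res[OF V \<sigma>A N(1) NV] \<tau>(1)] \<tau>(2) by simp
      also have "\<dots> = form_part V \<sigma> N (pa N \<tau>)" using fp_res[OF V \<sigma>A N(1) NV] by simp
      also have "\<dots> = res Y W N (form_part V \<sigma> W D)"
        unfolding N(5) by (rule Y.cot_res[OF fp_in[OF V \<sigma>A] W N(1,3) D])
      finally show ?case using N W by (intro exI[of _ N]) simp
    qed (use W in simp)
    then show ?case by simp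
  qed
  then show ?thesis using V \<sigma>A G_iff by simp
qed

lemma G_lagrangian: "lagrangian X Y \<rho> E P p Q q G"
proof unfold_locales
  fix V a \<sigma> assume V: "opn Y V" and a: "a \<in> sec Y V" and \<sigma>: "\<sigma> \<in> G V"
  have "smul (cotangent Y) V a 0 = 0" by (simp add: dual_def fun_eq_iff)
  then show "smul P V a \<sigma> \<in> G V" using V a \<sigma> fp_smul[of V \<sigma> a] by (simp add: G_iff del: \<Phi>.\<Phi>_anch)
next
  fix V assume V: "opn Y V"
  have "0 \<in> CN V" using CN_iff[OF V] V by simp
  then show "0 \<in> G V" using CN_G[OF V] by simp
next
  fix V \<sigma> \<tau> assume "opn Y V" "\<sigma> \<in> G V" "\<tau> \<in> G V"
  then show "\<sigma> + \<tau> \<in> G V" using fp_add[of V \<sigma> \<tau>] by (simp add: G_iff del: \<Phi>.\<Phi>_anch)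
next
  fix V \<sigma> assume "opn Y V" "\<sigma> \<in> G V"
  then show "\<sigma> \<in> AP V" by (simp add: G_iff)
qed (fact G_res G_iso G_perp G_onto)+

lemma G_brk:
  assumes U: "opn X U" "e \<in> sec E U" "f \<in> sec E U" and e: "p U e \<in> G (tr U)" and f: "p U f \<in> G (tr U)"
  shows "p U (bracket E U e f) \<in> G (tr U)"
proof -
  let ?V = "tr U"
  have V: "opn Y ?V" using U by simp
  have A: "p U e \<in> AP ?V" "p U f \<in> AP ?V" and s: "form_part ?V (p U e) = 0" "form_part ?V (p U f) = 0"
    using e f G_iff[OF V] by simp_all
  have z: "lie_derivative Y ?V x 0 - contract_d Y ?V y 0 = 0"
    if "x \<in> Y.vfs ?V" "y \<in> Y.vfs ?V" for x y
  proof (intro ext)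
    fix W z
    show "(lie_derivative Y ?V x 0 - contract_d Y ?V y 0) W z = 0 W z"
      using Y.vf_zero[OF that(1), of W] Y.vf_zero[OF that(2), of W] Y.vf_zero[of z W W]
        Y.lie_derivative_null[of W ?V z x 0] Y.contract_d_null[of W ?V z y 0]
      by (cases "opn Y W \<and> W \<subseteq> ?V \<and> z \<in> Y.vfs W") (auto simp: Y.lie_derivative_app Y.contract_d_app)
  qed
  have "form_part ?V (p U (bracket E U e f)) = 0"
    unfolding brk_q[OF U A, symmetric] \<Phi>.\<Phi>_brk[OF V q_in[OF V A(1)] q_in[OF V A(2)]] snd_conv s
    by (rule z) (use V A in simp_all)
  then show ?thesis using AP_brk(1)[OF U A] G_iff[OF V] by simp
qed

theorem G_gtb: "G \<in> generalized_tangent_bundles X Y \<rho> E P p"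
proof -
  interpret L: lagrangian X Y \<rho> E P p Q q G by (rule G_lagrangian)
  have lagr: "G V = {\<sigma> \<in> sec P V. \<forall>W. opn Y W \<and> W \<subseteq> V \<longrightarrow> (\<forall>\<tau>\<in>G W. pp W (res P V W \<sigma>) \<tau> = 0)}"
    if V: "opn Y V" for V
  proof (intro subset_antisym subsetI, goal_cases)
    case \<sigma>: (1 \<sigma>)
    then show ?case using L.L_AP[OF V \<sigma>] G_iso G_res[OF V _ _ \<sigma>] by simp
  next
    case (2 \<sigma>)
    then show ?case by (intro G_perp[OF V]) simp_all
  qed
  have "dirac_with_support X Y \<rho> E P p G" unfolding dirac_with_support_def
  proof (intro conjI allI impI ballI; (elim conjE)?)
    show "subbundle Y P G" by (rule L.L_subbundle)
    show "G V = {}" if "\<not> opn Y V" for V using that by (simp add: gtb_of_trivialization_def)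
    show "G V \<subseteq> AP V" if "opn Y V" for V using L.L_AP[OF that] by (rule subsetI)
  qed (fact lagr G_brk)+
  moreover have "{\<sigma> \<in> G V. pa V \<sigma> = 0} = CN V" if V: "opn Y V" for V
    using CN_G[OF V] G_ker[OF V] by blast
  moreover have "locally_onto (topo Y) G (tangent Y) pa" unfolding locally_onto_def
  proof (intro allI impI ballI, goal_cases)
    case V: (1 V D y)
    obtain W \<tau> where "opn Y W" "y \<in> W" "W \<subseteq> V" "\<tau> \<in> G W" "pa W \<tau> = Y.vres V W D"
      using G_onto[OF V] by auto
    then show ?case by blast
  qed
  ultimately show ?thesis unfolding generalized_tangent_bundles_def by simp
qed

sublocale GT: gen_tangent X Y \<rho> E P p Q q G by unfold_locales (rule G_gtb)

theorem triv_G: "GT.triv = \<Phi>"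
proof (intro ext)
  fix V \<kappa>
  show "GT.triv V \<kappa> = \<Phi> V \<kappa>"
  proof (cases "opn Y V \<and> \<kappa> \<in> sec Q V")
    case False
    then show ?thesis using \<Phi>.\<Phi>_null[of V \<kappa>] by (auto simp: GT.triv_def)
  next
    case True
    then have V: "opn Y V" and \<kappa>: "\<kappa> \<in> sec Q V" by auto
    have "GT.eta V \<kappa> = snd (\<Phi> V \<kappa>)"
    proof (rule GT.cot_eqI_F[OF V], goal_cases)
      case (3 W \<tau>)
      note W = 3(1,2) and G = 3(3)
      have \<tau>: "\<tau> \<in> AP W" "form_part W \<tau> = 0" using G G_iff[OF W(1)] by simp_all
      have r: "res Q V W \<kappa> \<in> sec Q W" using V \<kappa> W by simp
      have "GT.eta V \<kappa> W (pa W \<tau>) = pairing Q W (res Q V W \<kappa>) (q W \<tau>)"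
        by (rule GT.eta_pa[OF V \<kappa> W G])
      also have "\<dots> = snd (\<Phi> W (res Q V W \<kappa>)) W (pa W \<tau>)"
        using \<Phi>.\<Phi>_pair[OF W(1) r q_in[OF W(1) \<tau>(1)]] \<tau> W(1) by simp
      also have "\<dots> = snd (\<Phi> V \<kappa>) W (pa W \<tau>)" using \<Phi>.\<Phi>_res[OF V \<kappa> W] by simp
      finally show ?case .
    qed (use V \<kappa> in auto)
    then show ?thesis using V \<kappa> by (simp add: GT.triv_app prod_eq_iff)
  qed
qed

lemma fp_coanchor:
  assumes U: "opn X U" and \<omega>: "\<omega> \<in> X.forms U" and \<eta>: "\<eta> \<in> Y.forms (tr U)"
    and r: "form_restricts X Y \<rho> U \<omega> \<eta>"
  shows "form_part (tr U) (p U (coanchor X E U \<omega>)) = \<eta>"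
proof (rule GT.cot_eqI_F[where V = "tr U"], goal_cases)
  let ?V = "tr U" and ?c = "p U (coanchor X E U \<omega>)"
  have V: "opn Y ?V" and c: "?c \<in> AP ?V" using U \<omega> by simp_all
  show "opn Y ?V" "form_part ?V ?c \<in> Y.forms ?V" using V fp_in[OF V c] by simp_all
  case (4 N \<tau>)
  note N = 4(1,2) and G = 4(3)
  have \<tau>: "\<tau> \<in> AP N" "form_part N \<tau> = 0" using G G_iff[OF N(1)] by simp_all
  obtain U' where U': "opn X U'" "N = tr U'" using N opn_trace_iff by blast
  let ?N = "U' \<inter> U"
  have N': "N = tr ?N" "opn X ?N" "?N \<subseteq> U" using U' U N by auto
  have cN: "res P ?V N ?c = p ?N (coanchor X E ?N (X.fres U ?N \<omega>))"
    using N' U \<omega> by (simp add: C.coanchor_res p_res)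
  have rN: "form_restricts X Y \<rho> ?N (X.fres U ?N \<omega>) \<eta>"
    using r N' unfolding form_restricts_def by auto
  have "form_part ?V ?c N (pa N \<tau>) = form_part N (res P ?V N ?c) N (pa N \<tau>)"
    using fp_res[OF V c N] by simp
  also have "\<dots> = pp N (res P ?V N ?c) \<tau>" using pp_fp[OF N(1) AP_res[OF V c N] \<tau>(1)] \<tau>(2) by simp
  also have "\<dots> = \<eta> N (pa N \<tau>)"
    unfolding cN using pp_coanchor[OF N'(2) _ V _ \<eta> rN, of \<tau>] N' \<omega> \<tau> by simp
  finally show ?case .
qed (rule \<eta>)

lemma form_restricts_res:
  "form_restricts X Y \<rho> U \<omega> \<eta> \<Longrightarrow> form_restricts X Y \<rho> U \<omega> (Y.fres V (tr U) \<eta>)"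
  unfolding form_restricts_def
proof (intro allI impI, goal_cases)
  case (1 W v D)
  note r = 1(1) and W = 1(2)
  have "tr W \<subseteq> tr U" using W by blast
  then show ?case using r W by simp
qed

theorem gtb_gauge:
  assumes B: "B \<in> closed_two_forms Y"
  shows "gtb_of_trivialization X Y \<rho> E P p q (gauge_action Y B \<Phi>) = shear X Y \<rho> E P p B G"
proof
  note tB = Y.closed_tf[OF B]
  fix V
  show "gtb_of_trivialization X Y \<rho> E P p q (gauge_action Y B \<Phi>) V = shear X Y \<rho> E P p B G V"
  proof (cases "opn Y V")
    case False
    then show ?thesis by (simp add: gtb_of_trivialization_def shear_def)
  next
    case V: True
    let ?S = "\<lambda>\<sigma> U \<tau> \<omega>. form_restricts X Y \<rho> U \<omega> (contract Y B (tr U) (pa (tr U) \<tau>)) \<and>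
             res P V (tr U) \<sigma> = \<tau> - p U (coanchor X E U \<omega>)"
    let ?L = "\<lambda>\<sigma>. \<forall>y\<in>V. \<exists>U. opn X U \<and> y \<in> U \<and> tr U \<subseteq> V \<and> (\<exists>\<tau>\<in>G (tr U). \<exists>\<omega>\<in>X.forms U. ?S \<sigma> U \<tau> \<omega>)"
      and ?T = "{\<sigma> \<in> AP V. form_part V \<sigma> + contract Y B V (pa V \<sigma>) = 0}"
    have lhs: "gtb_of_trivialization X Y \<rho> E P p q (gauge_action Y B \<Phi>) V = ?T"
    proof -
      have g: "snd (gauge_action Y B \<Phi> V (q V \<sigma>)) = form_part V \<sigma> + contract Y B V (pa V \<sigma>)"
        if "\<sigma> \<in> AP V" for \<sigma> unfolding Y.gauge_app snd_conv fst_q[OF V that] ..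
      show ?thesis unfolding gtb_of_trivialization_def if_P[OF V]
        by (intro Collect_cong conj_cong refl) (simp only: g)
    qed
    have rhs: "shear X Y \<rho> E P p B G V = {\<sigma> \<in> sec P V. ?L \<sigma>}" unfolding shear_def if_P[OF V] ..
    show ?thesis unfolding lhs rhs
    proof (intro subset_antisym subsetI)
      fix \<sigma> assume "\<sigma> \<in> ?T"
      then have \<sigma>: "\<sigma> \<in> AP V" and eq: "form_part V \<sigma> + contract Y B V (pa V \<sigma>) = 0" by auto
      let ?\<eta> = "contract Y B V (pa V \<sigma>)"
      have \<eta>: "?\<eta> \<in> Y.forms V" using tB V \<sigma> by simp
      have "\<exists>U. opn X U \<and> y \<in> U \<and> tr U \<subseteq> V \<and>
          (\<exists>\<tau>\<in>G (tr U). \<exists>\<omega>\<in>X.forms U. ?S \<sigma> U \<tau> \<omega>)" if y: "y \<in> V" for y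
      proof -
        obtain U \<omega> where U: "opn X U" "y \<in> U" "tr U \<subseteq> V" and \<omega>: "\<omega> \<in> X.forms U"
            and r: "form_restricts X Y \<rho> U \<omega> ?\<eta>" using form_extends[OF GT.F_lifts V \<eta> y] by auto
        let ?N = "tr U"
        let ?c = "p U (coanchor X E U \<omega>)"
        let ?\<tau> = "res P V ?N \<sigma> + ?c"
        have N: "opn Y ?N" using U by simp
        have A: "res P V ?N \<sigma> \<in> AP ?N" "?c \<in> AP ?N" using U V \<sigma> \<omega> by simp_all
        have c: "form_part ?N ?c = Y.fres V ?N ?\<eta>"
          by (rule fp_coanchor[OF U(1) \<omega> Y.res_cot_in[OF \<eta> U(3)] form_restricts_res[OF r]])
        have "form_part ?N ?\<tau> = Y.fres V ?N (form_part V \<sigma> + ?\<eta>)"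
          unfolding fp_add[OF N A] c fp_res[OF V \<sigma> N U(3)] by (rule Y.res_cot_add[symmetric])
        then have \<tau>: "?\<tau> \<in> G ?N" unfolding eq using G_iff[OF N] AP_add[OF N A] by simp
        have pa\<tau>: "pa ?N ?\<tau> = Y.vres V ?N (pa V \<sigma>)" using V U \<sigma> \<omega> by (simp add: pa_add pa_res)
        have "form_restricts X Y \<rho> U \<omega> (contract Y B ?N (pa ?N ?\<tau>))"
          unfolding pa\<tau> Y.contract_res[OF U(3)] by (rule form_restricts_res[OF r])
        then have "?S \<sigma> U ?\<tau> \<omega>" by simp
        then show ?thesis using U \<tau> \<omega> by blast
      qed
      then show "\<sigma> \<in> {\<sigma> \<in> sec P V. ?L \<sigma>}" using AP_in[OF \<sigma>] by (intro CollectI conjI ballI)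
    next
      fix \<sigma> assume m: "\<sigma> \<in> {\<sigma> \<in> sec P V. ?L \<sigma>}"
      have \<sigma>: "\<sigma> \<in> sec P V" and loc0: "?L \<sigma>"
        using m[unfolded mem_Collect_eq] by (rule conjunct1, rule conjunct2)
      have loc: "\<exists>N. opn Y N \<and> y \<in> N \<and> N \<subseteq> V \<and> res P V N \<sigma> \<in> AP N \<and>
          form_part N (res P V N \<sigma>) = - contract Y B N (pa N (res P V N \<sigma>))" if y: "y \<in> V" for y
      proof -
        from loc0[rule_format, OF y] obtain U \<tau> \<omega> where U: "opn X U" "y \<in> U" "tr U \<subseteq> V"
          and \<tau>G: "\<tau> \<in> G (tr U)" and \<omega>: "\<omega> \<in> X.forms U"
          and S1: "form_restricts X Y \<rho> U \<omega> (contract Y B (tr U) (pa (tr U) \<tau>))"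
          and S2: "res P V (tr U) \<sigma> = \<tau> - p U (coanchor X E U \<omega>)" by (elim exE conjE bexE)
        let ?N = "tr U"
        let ?c = "p U (coanchor X E U \<omega>)"
        have N: "opn Y ?N" "y \<in> ?N" using U pts_Y[OF V y] by auto
        have \<tau>: "\<tau> \<in> AP ?N" "form_part ?N \<tau> = 0" using \<tau>G G_iff[OF N(1)] by simp_all
        have c: "?c \<in> AP ?N" using U \<omega> by simp
        have e: "res P V ?N \<sigma> = \<tau> - ?c" by (rule S2)
        have pe: "pa ?N (res P V ?N \<sigma>) = pa ?N \<tau>"
          unfolding e using pa_diff[OF N(1) \<tau>(1) c] U \<omega> by simp
        have "form_part ?N ?c = contract Y B ?N (pa ?N \<tau>)"
          by (rule fp_coanchor[OF U(1) \<omega> _ S1]) (use tB N \<tau> in simp)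
        then have "form_part ?N (res P V ?N \<sigma>) = - contract Y B ?N (pa ?N (res P V ?N \<sigma>))"
          unfolding pe unfolding e fp_diff[OF N(1) \<tau>(1) c] \<tau>(2) by simp
        moreover have "res P V ?N \<sigma> \<in> AP ?N" unfolding e using N \<tau> c by simp
        ultimately show ?thesis using N U by blast
      qed
      have \<sigma>A: "\<sigma> \<in> AP V" by (rule AP_local[OF V \<sigma>]) (use loc in blast)
      have "form_part V \<sigma> + contract Y B V (pa V \<sigma>) = 0"
      proof (rule Y.cot_eqI_local[OF V], goal_cases)
        case y: (3 y)
        from loc[OF y] obtain N where N: "opn Y N" "y \<in> N" "N \<subseteq> V"
            and e: "form_part N (res P V N \<sigma>) = - contract Y B N (pa N (res P V N \<sigma>))" by (elim exE conjE)
        have "Y.fres V N (form_part V \<sigma> + contract Y B V (pa V \<sigma>)) =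
            Y.fres V N (form_part V \<sigma>) + Y.fres V N (contract Y B V (pa V \<sigma>))"
          by (rule Y.res_cot_add)
        also have "\<dots> = Y.fres V N 0"
          unfolding fp_res[OF V \<sigma>A N(1,3), symmetric] Y.contract_res[OF N(3), symmetric] e pa_res[OF V \<sigma>A N(1,3)]
          by simp
        finally show ?case using N by blast
      qed (use V \<sigma>A tB in auto)
      then show "\<sigma> \<in> ?T" using \<sigma>A by simp
    qed
  qed
qed

end

context restricted
begin

lemma trivialized: "\<Phi> \<in> courant_trivializations Y Q \<Longrightarrow> trivialized X Y \<rho> E P p Q q \<Phi>"
  by (intro trivialized.intro std_iso.intro std_iso_axioms.intro)
    (unfold_locales, simp add: courant_trivializations_def)

lemma gen_tangent: "F \<in> generalized_tangent_bundles X Y \<rho> E P p \<Longrightarrow> gen_tangent X Y \<rho> E P p Q q F"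
  by unfold_locales

theorem correspondence: "bij_betw (gtb_of_trivialization X Y \<rho> E P p q)
     (courant_trivializations Y Q) (generalized_tangent_bundles X Y \<rho> E P p)" unfolding bij_betw_def
proof (intro conjI inj_onI subset_antisym subsetI, goal_cases)
  case (1 \<Phi> \<Psi>)
  note \<Phi> = 1(1) and \<Psi> = 1(2) and eq = 1(3)
  show ?case using trivialized.triv_G[OF trivialized[OF \<Phi>]] trivialized.triv_G[OF trivialized[OF \<Psi>]]
    unfolding eq by simp
next
  case (2 F)
  then obtain \<Phi> where \<Phi>: "\<Phi> \<in> courant_trivializations Y Q" "F = gtb_of_trivialization X Y \<rho> E P p q \<Phi>"
    by (elim imageE)
  show ?case unfolding \<Phi>(2) by (rule trivialized.G_gtb[OF trivialized[OF \<Phi>(1)]])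
next
  case F: (3 F)
  show ?case by (subst gen_tangent.gtb_triv[OF gen_tangent[OF F], symmetric])
      (rule imageI[OF gen_tangent.triv_iso[OF gen_tangent[OF F]]])
qed

theorem equivariant: "B \<in> closed_two_forms Y \<Longrightarrow> \<Phi> \<in> courant_trivializations Y Q \<Longrightarrow>
    gtb_of_trivialization X Y \<rho> E P p q (gauge_action Y B \<Phi>) =
      shear X Y \<rho> E P p B (gtb_of_trivialization X Y \<rho> E P p q \<Phi>)"
  by (rule trivialized.gtb_gauge[OF trivialized])

theorem torsors: "is_torsor (closed_two_forms Y) (courant_trivializations Y Q) (gauge_action Y)"
  "is_torsor (closed_two_forms Y) (generalized_tangent_bundles X Y \<rho> E P p) (shear X Y \<rho> E P p)"
proof -
  show t: "is_torsor (closed_two_forms Y) (courant_trivializations Y Q) (gauge_action Y)"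
    by (rule Y.trivializations_torsor[OF Q_data])
  show "is_torsor (closed_two_forms Y) (generalized_tangent_bundles X Y \<rho> E P p) (shear X Y \<rho> E P p)"
    by (rule is_torsor_transport[OF t correspondence]) (rule equivariant)
qed

end

section \<open>Frames on manifolds with charts\<close>

definition coord_plane :: "nat \<Rightarrow> (nat \<Rightarrow> 'a::real_normed_field) set" where
  "coord_plane n = {x. \<forall>i\<ge>n. x i = 0}"

definition coord_box :: "nat \<Rightarrow> (nat \<Rightarrow> 'a::real_normed_field) \<Rightarrow> real \<Rightarrow> (nat \<Rightarrow> 'a) set" where
  "coord_box n c \<epsilon> = {x. (\<forall>i<n. dist (x i) (c i) < \<epsilon>) \<and> (\<forall>i\<ge>n. x i = 0)}"

lemma coord_space_eq: "coord_space n = top_of_set (coord_plane n)"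
  by (simp add: coord_space_def coord_plane_def euclidean_product_topology)

lemma continuous_map_coord_space: "W \<subseteq> coord_plane n \<Longrightarrow>
    continuous_map (subtopology (coord_space n) W) euclidean g \<longleftrightarrow> continuous_on W g"
  by (simp add: coord_space_eq subtopology_subtopology Int_absorb1)

lemma coord_box_subset: "coord_box n c \<epsilon> \<subseteq> coord_plane n"
  by (auto simp: coord_box_def coord_plane_def)

lemma openin_coord_box: "openin (coord_space n) (coord_box n c \<epsilon>)"
proof -
  have "open ((\<lambda>x::nat \<Rightarrow> 'a. x i) -` ball (c i) \<epsilon>)" for i
    by (rule open_vimage) (auto intro: continuous_on_product_coordinates)
  then have "open (\<Inter>i<n. (\<lambda>x::nat \<Rightarrow> 'a. x i) -` ball (c i) \<epsilon>)" by (intro open_INT) auto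
  moreover have "coord_box n c \<epsilon> = coord_plane n \<inter> (\<Inter>i<n. (\<lambda>x::nat \<Rightarrow> 'a. x i) -` ball (c i) \<epsilon>)"
    by (auto simp: coord_box_def coord_plane_def dist_commute)
  ultimately show ?thesis unfolding coord_space_eq openin_open by blast
qed

lemma coord_box_exists:
  assumes N: "openin (coord_space n) N" and c: "c \<in> N" shows "\<exists>\<epsilon>>0. coord_box n c \<epsilon> \<subseteq> N"
proof -
  obtain T where T: "open T" "N = coord_plane n \<inter> T"
    using N unfolding coord_space_eq openin_open by auto
  have "openin (product_topology (\<lambda>i. euclidean) UNIV) T"
    using T(1) by (simp add: euclidean_product_topology)
  then obtain S where S: "c \<in> (\<Pi>\<^sub>E i\<in>UNIV. S i)" "\<And>i. openin euclidean (S i)" "(\<Pi>\<^sub>E i\<in>UNIV. S i) \<subseteq> T"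
    using product_topology_open_contains_basis[of "\<lambda>i. euclidean" UNIV T c] c T by auto
  have "\<exists>e>0. ball (c i) e \<subseteq> S i" for i
    using S(1) S(2)[of i] by (auto simp: open_contains_ball PiE_iff)
  then obtain e where e: "\<And>i. e i > 0" "\<And>i. ball (c i) (e i) \<subseteq> S i" by metis
  define \<epsilon> where "\<epsilon> = Min (insert 1 (e ` {..<n}))"
  have \<epsilon>: "\<epsilon> > 0" "\<And>i. i < n \<Longrightarrow> \<epsilon> \<le> e i" using e(1) by (auto simp: \<epsilon>_def)
  have cE: "c i = 0" if "i \<ge> n" for i using c T that by (auto simp: coord_plane_def)
  have "coord_box n c \<epsilon> \<subseteq> N"
  proof
    fix x assume x: "x \<in> coord_box n c \<epsilon>"
    have "x i \<in> S i" for i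
    proof (cases "i < n")
      case True
      then have "x i \<in> ball (c i) (e i)" using x \<epsilon>(2)[of i] by (auto simp: coord_box_def dist_commute)
      then show ?thesis using e(2) by blast
    next
      case False
      then have "x i = c i" using x cE by (auto simp: coord_box_def)
      then show ?thesis using S(1) by (auto simp: PiE_iff)
    qed
    then have "x \<in> T" using S(3) by (auto simp: PiE_iff)
    then show "x \<in> N" using x T coord_box_subset by blast
  qed
  then show ?thesis using \<epsilon>(1) by blast
qed

lemma smooth_funE:
  assumes "smooth_fun n W f" "W \<subseteq> coord_plane n"
  obtains g where "\<And>x. x \<in> W \<Longrightarrow> g [] x = f x" "\<And>I. set I \<subseteq> {..<n} \<Longrightarrow> continuous_on W (g I)"
    "\<And>I i x. \<lbrakk>set I \<subseteq> {..<n}; i < n; x \<in> W\<rbrakk> \<Longrightarrow>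
       ((\<lambda>t. g I (x(i := t))) has_field_derivative g (i # I) x) (at (x i))"
proof -
  obtain g where "\<forall>x\<in>W. g [] x = f x" "\<forall>I. set I \<subseteq> {..<n} \<longrightarrow>
      continuous_map (subtopology (coord_space n) W) euclidean (g I) \<and>
      (\<forall>i<n. \<forall>x\<in>W. ((\<lambda>t. g I (x(i := t))) has_field_derivative g (i # I) x) (at (x i)))"
    using assms(1) unfolding smooth_fun_def by (elim exE conjE)
  then show ?thesis by (intro that[of g]) (simp_all add: continuous_map_coord_space[OF assms(2)])
qed

lemma smooth_funI:
  assumes "W \<subseteq> coord_plane n" "\<And>x. x \<in> W \<Longrightarrow> g [] x = f x" "\<And>I. set I \<subseteq> {..<n} \<Longrightarrow> continuous_on W (g I)"
    "\<And>I i x. \<lbrakk>set I \<subseteq> {..<n}; i < n; x \<in> W\<rbrakk> \<Longrightarrow>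
       ((\<lambda>t. g I (x(i := t))) has_field_derivative g (i # I) x) (at (x i))"
  shows "smooth_fun n W f"
  using assms unfolding smooth_fun_def by (intro exI[of _ g]) (auto simp: continuous_map_coord_space)

lemma smooth_fun_subset:
  assumes "smooth_fun n W f" "V \<subseteq> W" "W \<subseteq> coord_plane n" shows "smooth_fun n V f"
proof -
  obtain g where g: "\<And>x. x \<in> W \<Longrightarrow> g [] x = f x" "\<And>I. set I \<subseteq> {..<n} \<Longrightarrow> continuous_on W (g I)"
    "\<And>I i x. \<lbrakk>set I \<subseteq> {..<n}; i < n; x \<in> W\<rbrakk> \<Longrightarrow>
       ((\<lambda>t. g I (x(i := t))) has_field_derivative g (i # I) x) (at (x i))"
    using smooth_funE[OF assms(1,3)] by metis
  show ?thesis
    by (rule smooth_funI[of _ _ g]) (use assms g continuous_on_subset[OF g(2) assms(2)] in auto)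
qed

lemma smooth_fun_cong:
  assumes "smooth_fun n W f" "\<And>x. x \<in> W \<Longrightarrow> f x = f' x" shows "smooth_fun n W f'"
  using assms unfolding smooth_fun_def by auto

text \<open>
  The segment from \<open>(c\<^sub>0,\<dots>,c\<^sub>k,x\<^sub>k\<^sub>+\<^sub>1,\<dots>)\<close> to \<open>(c\<^sub>0,\<dots>,c\<^sub>k\<^sub>-\<^sub>1,x\<^sub>k,\<dots>)\<close>: moving one coordinate at a
  time reduces Hadamard's lemma to calculus in one variable.
\<close>

definition seg :: "(nat \<Rightarrow> 'a::real_normed_field) \<Rightarrow> nat \<Rightarrow> real \<Rightarrow> (nat \<Rightarrow> 'a) \<Rightarrow> nat \<Rightarrow> 'a" where
  "seg c k t x = (\<lambda>i. if i < k then c i else if i = k then c k + of_real t * (x k - c k) else x i)"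

lemma seg_in_box:
  assumes "x \<in> coord_box n c \<epsilon>" "t \<in> {0..1}" "k < n" "\<epsilon> > 0" shows "seg c k t x \<in> coord_box n c \<epsilon>"
proof -
  have xk: "norm (x k - c k) < \<epsilon>" using assms by (auto simp: coord_box_def dist_norm)
  have "norm (of_real t * (x k - c k)) \<le> 1 * norm (x k - c k)"
    unfolding norm_mult using assms by (intro mult_right_mono) auto
  then have "dist (c k + of_real t * (x k - c k)) (c k) < \<epsilon>" using xk by (simp add: dist_norm)
  then show ?thesis using assms by (auto simp: coord_box_def seg_def)
qed

lemma continuous_on_seg:
  "continuous_on (S \<times> {0..1}) (\<lambda>(x, t). seg c k t x :: nat \<Rightarrow> 'a::{real_normed_field,euclidean_space})"
  unfolding split_beta
proof (rule continuous_on_coordinatewise_then_product)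
  fix i
  have coord: "continuous_on (S \<times> {0..1}) (\<lambda>z::(nat \<Rightarrow> 'a) \<times> real. fst z i)" for i
    by (rule continuous_on_compose2[OF continuous_on_product_coordinates continuous_on_fst[OF continuous_on_id]]) auto
  consider "i < k" | "i = k" | "i > k" by linarith
  then show "continuous_on (S \<times> {0..1}) (\<lambda>z. seg c k (snd z) (fst z) i)"
  proof cases
    case 2
    then show ?thesis using coord[of k] by (auto simp: seg_def intro!: continuous_intros)
  qed (auto simp: seg_def coord)
qed

theorem hadamard:
  fixes f :: "(nat \<Rightarrow> 'a::{real_normed_field,euclidean_space}) \<Rightarrow> 'a"
    and n :: nat and c :: "nat \<Rightarrow> 'a" and \<epsilon> :: real
  defines "B \<equiv> coord_box n c \<epsilon>"
  assumes f: "smooth_fun n B f" and \<epsilon>: "\<epsilon> > 0" and c: "\<And>i. i \<ge> n \<Longrightarrow> c i = 0"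
  shows "\<exists>q. (\<forall>k<n. smooth_fun n B (q k) \<and>
        ((\<lambda>t. f (c(k := t))) has_field_derivative q k c) (at (c k))) \<and>
      (\<forall>x\<in>B. f x = f c + (\<Sum>k<n. (x k - c k) * q k x))"
proof -
  have BE: "B \<subseteq> coord_plane n" unfolding B_def by (rule coord_box_subset)
  obtain g where g0: "\<And>x. x \<in> B \<Longrightarrow> g [] x = f x" and gc: "\<And>I. set I \<subseteq> {..<n} \<Longrightarrow> continuous_on B (g I)"
    and gd: "\<And>I i x. \<lbrakk>set I \<subseteq> {..<n}; i < n; x \<in> B\<rbrakk> \<Longrightarrow>
       ((\<lambda>t. g I (x(i := t))) has_field_derivative g (i # I) x) (at (x i))"
    using smooth_funE[OF f BE] by metis
  have cB: "c \<in> B" using \<epsilon> c by (auto simp: B_def coord_box_def)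
  have segB: "seg c k t x \<in> B" if "x \<in> B" "t \<in> {0..1}" "k < n" for k t x
    using that seg_in_box \<epsilon> unfolding B_def by blast
  have updB: "x(j := s) \<in> B" if "x \<in> B" "j < n" "s \<in> ball (c j) \<epsilon>" for x j s
    using that by (auto simp: B_def coord_box_def dist_commute)
  define h where "h k I x t = (of_real t ^ count_list I k :: 'a) * g (I @ [k]) (seg c k t x)" for k I x t
  define Q where "Q k I x = (if \<exists>i\<in>set I. i < k then 0 else integral {0..1} (h k I x))" for k I x
  have h_cont: "continuous_on (B \<times> {0..1}) (\<lambda>(x, t). h k I x t)" if k: "k < n" and I: "set I \<subseteq> {..<n}" for k I
  proof -
    have "continuous_on (B \<times> {0..1}) (\<lambda>z. g (I @ [k]) ((\<lambda>(x, t). seg c k t x) z))"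
      by (rule continuous_on_compose2[OF gc continuous_on_seg]) (use k I segB in auto)
    then show ?thesis unfolding h_def split_beta by (intro continuous_intros) auto
  qed
  have h_cont1: "continuous_on {0..1} (h k I x)" if "k < n" "set I \<subseteq> {..<n}" "x \<in> B" for k I x
  proof -
    have "continuous_on {0..1} (\<lambda>t::real. (x, t))" by (intro continuous_on_Pair continuous_on_const continuous_on_id)
    from continuous_on_compose2[OF h_cont[OF that(1,2)] this] show ?thesis using that(3) by auto
  qed
  have Q_cont: "continuous_on B (Q k I)" if "k < n" "set I \<subseteq> {..<n}" for k I
    using integral_continuous_on_param[of B 0 1 "h k I"] h_cont[OF that]
    by (cases "\<exists>i\<in>set I. i < k") (simp_all add: Q_def[abs_def])
  have Q_der: "((\<lambda>s. Q k I (x(j := s))) has_field_derivative Q k (j # I) x) (at (x j))"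
    if k: "k < n" and I: "set I \<subseteq> {..<n}" and j: "j < n" and x: "x \<in> B" for k I j x
  proof (cases "\<exists>i\<in>set I. i < k")
    case True
    then show ?thesis by (simp add: Q_def)
  next
    case I0: False
    show ?thesis
    proof (cases "j < k")
      case True
      have sg: "seg c k t (x(j := s)) = seg c k t x" for t s using True by (auto simp: seg_def fun_eq_iff)
      have "h k I (x(j := s)) = h k I x" for s by (rule ext) (simp only: h_def sg)
      then show ?thesis using I0 True by (simp add: Q_def)
    next
      case jk: False
      have xj: "x j \<in> ball (c j) \<epsilon>" using x j by (auto simp: B_def coord_box_def dist_commute)
      have der: "((\<lambda>s. h k I (x(j := s)) t) has_field_derivative h k (j # I) (x(j := s)) t) (at s within ball (c j) \<epsilon>)"
        if s: "s \<in> ball (c j) \<epsilon>" and t: "t \<in> {0..1}" for s t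
      proof -
        let ?y = "seg c k t (x(j := s))"
        have y: "?y \<in> B" by (rule segB[OF updB[OF x j s] t k])
        have Ik: "set (I @ [k]) \<subseteq> {..<n}" using I k by auto
        have d: "((\<lambda>u. g (I @ [k]) (?y(j := u))) has_field_derivative g (j # I @ [k]) ?y) (at (?y j))"
          by (rule gd[OF Ik j y])
        show ?thesis
        proof (cases "j = k")
          case True
          have e: "seg c k t (x(j := u)) = ?y(j := c k + of_real t * (u - c k))" for u
            using True by (auto simp: seg_def fun_eq_iff)
          have yj: "?y j = c k + of_real t * (s - c k)" using True by (simp add: seg_def)
          have l: "((\<lambda>u. c k + of_real t * (u - c k)) has_field_derivative of_real t) (at s)"
            by (auto intro!: derivative_eq_intros)
          have "((\<lambda>u. g (I @ [k]) (?y(j := c k + of_real t * (u - c k)))) has_field_derivative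
              g (j # I @ [k]) ?y * of_real t) (at s)" using DERIV_chain2[OF d[unfolded yj] l] .
          then have "((\<lambda>u. g (I @ [k]) (seg c k t (x(j := u)))) has_field_derivative
              g (j # I @ [k]) ?y * of_real t) (at s)" unfolding e[symmetric] .
          then have d': "((\<lambda>u. of_real t ^ count_list I k * g (I @ [k]) (seg c k t (x(j := u)))) has_field_derivative
              of_real t ^ count_list I k * (g (j # I @ [k]) ?y * of_real t)) (at s)"
            by (rule DERIV_cmult)
          have hd: "h k (j # I) (x(j := s)) t = of_real t ^ count_list I k * (g (j # I @ [k]) ?y * of_real t)"
            unfolding h_def True by (simp only: count_list.simps if_True power_add power_one_right append_Cons mult_ac refl)
          show ?thesis unfolding hd unfolding h_def by (rule has_field_derivative_at_within[OF d'])
        next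
          case False
          have e: "seg c k t (x(j := u)) = ?y(j := u)" for u
            using False jk by (auto simp: seg_def fun_eq_iff)
          have yj: "?y j = s" using False jk by (simp add: seg_def)
          have "((\<lambda>u. g (I @ [k]) (seg c k t (x(j := u)))) has_field_derivative g (j # I @ [k]) ?y) (at s)"
            using d[unfolded yj] unfolding e[symmetric] .
          then have d': "((\<lambda>u. of_real t ^ count_list I k * g (I @ [k]) (seg c k t (x(j := u)))) has_field_derivative
              of_real t ^ count_list I k * g (j # I @ [k]) ?y) (at s)" by (rule DERIV_cmult)
          have hd: "h k (j # I) (x(j := s)) t = of_real t ^ count_list I k * g (j # I @ [k]) ?y"
            unfolding h_def using False by (simp only: count_list.simps if_False append_Cons refl)
          show ?thesis unfolding hd unfolding h_def by (rule has_field_derivative_at_within[OF d'])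
        qed
      qed
      have jI: "set (j # I) \<subseteq> {..<n}" using j I by simp
      have "continuous_on (ball (c j) \<epsilon> \<times> {0..1}) (\<lambda>z. (\<lambda>(x, t). h k (j # I) x t) (x(j := fst z), snd z))"
      proof (rule continuous_on_compose2[OF h_cont[OF k jI]])
        have "continuous_on (ball (c j) \<epsilon> \<times> {0..1}) (\<lambda>z::'a \<times> real. x(j := fst z))"
        proof (rule continuous_on_coordinatewise_then_product)
          fix i show "continuous_on (ball (c j) \<epsilon> \<times> {0..1}) (\<lambda>z::'a \<times> real. (x(j := fst z)) i)"
            by (cases "i = j") (auto intro!: continuous_intros)
        qed
        then show "continuous_on (ball (c j) \<epsilon> \<times> {0..1}) (\<lambda>z::'a \<times> real. (x(j := fst z), snd z))"
          by (rule continuous_on_Pair[OF _ continuous_on_snd[OF continuous_on_id]])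
      qed (use updB[OF x j] in auto)
      then have cont: "continuous_on (ball (c j) \<epsilon> \<times> cbox 0 1) (\<lambda>(s, t). h k (j # I) (x(j := s)) t)"
        by (simp add: split_beta)
      have "((\<lambda>s. integral (cbox 0 1) (h k I (x(j := s)))) has_field_derivative
          integral (cbox 0 1) (h k (j # I) (x(j := x j)))) (at (x j) within ball (c j) \<epsilon>)"
        by (rule leibniz_rule_field_derivative[where f = "\<lambda>s t. h k I (x(j := s)) t"
              and fx = "\<lambda>s t. h k (j # I) (x(j := s)) t"])
          (use der cont xj h_cont1[OF k I updB[OF x j]] in \<open>auto intro: integrable_continuous_real\<close>)
      then have "((\<lambda>s. integral {0..1} (h k I (x(j := s)))) has_field_derivative
          integral {0..1} (h k (j # I) x)) (at (x j))" using at_within_open[OF xj open_ball] by simp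
      then show ?thesis using jk by (simp add: Q_def)
    qed
  qed
  define q where "q k = Q k []" for k
  have q_smooth: "smooth_fun n B (q k)" if "k < n" for k
    by (rule smooth_funI[OF BE, of "Q k"]) (use that Q_cont Q_der in \<open>auto simp: q_def\<close>)
  have qc: "q k c = g [k] c" for k
  proof -
    have "seg c k t c = c" for t by (auto simp: seg_def)
    then have "h k [] c = (\<lambda>t. g [k] c)" by (intro ext) (simp add: h_def)
    then show ?thesis by (simp add: q_def Q_def)
  qed
  have line: "eventually (\<lambda>t. x(k := t) \<in> B) (nhds (x k))" if "x \<in> B" "k < n" for x k
  proof -
    have "x k \<in> ball (c k) \<epsilon>" using that by (auto simp: B_def coord_box_def dist_commute)
    then have "eventually (\<lambda>t. t \<in> ball (c k) \<epsilon>) (nhds (x k))" by (intro eventually_nhds_in_open) auto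
    then show ?thesis by eventually_elim (use updB[OF that] in blast)
  qed
  have f_der: "((\<lambda>t. f (x(k := t))) has_field_derivative g [k] x) (at (x k))" if x: "x \<in> B" and k: "k < n" for x k
  proof -
    have "eventually (\<lambda>t. f (x(k := t)) = g [] (x(k := t))) (nhds (x k))"
      using line[OF x k] by eventually_elim (simp add: g0)
    then show ?thesis using DERIV_cong_ev[OF refl _ refl] gd[of "[]" k x] x k by fastforce
  qed
  have step: "f (seg c k 1 x) - f (seg c k 0 x) = (x k - c k) * q k x" if x: "x \<in> B" and k: "k < n" for x k
  proof -
    let ?l = "\<lambda>t. c k + of_real t * (x k - c k)"
    have "((\<lambda>t. f (seg c k t x)) has_vector_derivative (x k - c k) * g [k] (seg c k t x)) (at t within {0..1})"
      if t: "t \<in> {0..1}" for t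
    proof -
      let ?y = "seg c k t x"
      have yk: "?y k = ?l t" by (simp add: seg_def)
      have e: "(\<lambda>t. f (seg c k t x)) = (\<lambda>u. f (?y(k := u))) \<circ> ?l"
        unfolding comp_def by (intro ext arg_cong[where f = f]) (simp add: seg_def)
      have l: "(?l has_vector_derivative (x k - c k)) (at t)"
        by (auto intro!: derivative_eq_intros simp: has_vector_derivative_def scaleR_conv_of_real)
      have "((\<lambda>u. f (?y(k := u))) has_field_derivative g [k] ?y) (at (?l t))"
        using f_der[OF segB[OF x t k] k] yk by simp
      from field_vector_diff_chain_at[OF l this] show ?thesis
        unfolding e by (rule has_vector_derivative_at_within)
    qed
    then have "((\<lambda>t. (x k - c k) * g [k] (seg c k t x)) has_integral (f (seg c k 1 x) - f (seg c k 0 x))) {0..1}"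
      by (intro fundamental_theorem_of_calculus) auto
    then have "integral {0..1} (\<lambda>t. (x k - c k) * g [k] (seg c k t x)) = f (seg c k 1 x) - f (seg c k 0 x)"
      by (rule integral_unique)
    then have "(x k - c k) * integral {0..1} (\<lambda>t. g [k] (seg c k t x)) = f (seg c k 1 x) - f (seg c k 0 x)"
      by simp
    moreover have "h k [] x = (\<lambda>t. g [k] (seg c k t x))" by (rule ext) (simp add: h_def)
    ultimately show ?thesis by (simp add: q_def Q_def)
  qed
  have "f x = f c + (\<Sum>k<n. (x k - c k) * q k x)" if x: "x \<in> B" for x
  proof -
    define y where "y k = (\<lambda>i. if i < k then c i else x i)" for k
    have s: "seg c k 1 x = y k" "seg c k 0 x = y (Suc k)" for k
      by (auto simp: seg_def y_def fun_eq_iff less_Suc_eq)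
    have "(\<Sum>k<n. (x k - c k) * q k x) = (\<Sum>k<n. f (y k) - f (y (Suc k)))"
      using step[OF x] by (intro sum.cong) (auto simp: s)
    also have "\<dots> = f (y 0) - f (y n)" by (rule sum_lessThan_telescope')
    also have "y 0 = x" by (simp add: y_def)
    also have "y n = c" using x c by (auto simp: y_def fun_eq_iff B_def coord_box_def)
    finally show ?thesis by simp
  qed
  then show ?thesis using q_smooth f_der[OF cB] by (intro exI[of _ q]) (simp add: qc)
qed

lemma line_eventually:
  assumes "openin (coord_space n) N" "x \<in> N" "k < n"
  shows "eventually (\<lambda>t. x(k := t) \<in> N) (nhds (x k))"
proof -
  obtain \<epsilon> where \<epsilon>: "\<epsilon> > 0" "coord_box n x \<epsilon> \<subseteq> N" using coord_box_exists[OF assms(1,2)] by auto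
  have "x \<in> coord_plane n" using openin_subset[OF assms(1)] assms(2) by (auto simp: coord_space_eq)
  then have "x(k := t) \<in> N" if "t \<in> ball (x k) \<epsilon>" for t
    using that \<epsilon> assms(3) by (auto simp: coord_box_def coord_plane_def dist_commute)
  moreover have "eventually (\<lambda>t. t \<in> ball (x k) \<epsilon>) (nhds (x k))"
    using \<epsilon>(1) by (intro eventually_nhds_in_open) auto
  ultimately show ?thesis by (auto elim: eventually_mono)
qed

definition pd :: "nat \<Rightarrow> ((nat \<Rightarrow> 'a::real_normed_field) \<Rightarrow> 'a) \<Rightarrow> (nat \<Rightarrow> 'a) \<Rightarrow> 'a" where
  "pd i f x = deriv (\<lambda>t. f (x(i := t))) (x i)"

lemma smooth_fun_pd:
  assumes f: "smooth_fun n N f" and N: "openin (coord_space n) N" and i: "i < n"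
  shows "smooth_fun n N (pd i f)"
    and "x \<in> N \<Longrightarrow> ((\<lambda>t. f (x(i := t))) has_field_derivative pd i f x) (at (x i))"
proof -
  have NE: "N \<subseteq> coord_plane n" using openin_subset[OF N] by (simp add: coord_space_eq)
  obtain g where g0: "\<And>x. x \<in> N \<Longrightarrow> g [] x = f x" and gc: "\<And>I. set I \<subseteq> {..<n} \<Longrightarrow> continuous_on N (g I)"
    and gd: "\<And>I i x. \<lbrakk>set I \<subseteq> {..<n}; i < n; x \<in> N\<rbrakk> \<Longrightarrow>
       ((\<lambda>t. g I (x(i := t))) has_field_derivative g (i # I) x) (at (x i))"
    using smooth_funE[OF f NE] by metis
  have d: "((\<lambda>t. f (x(i := t))) has_field_derivative g [i] x) (at (x i))" if x: "x \<in> N" for x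
  proof -
    have "eventually (\<lambda>t. f (x(i := t)) = g [] (x(i := t))) (nhds (x i))"
      using line_eventually[OF N x i] by eventually_elim (simp add: g0)
    then show ?thesis using DERIV_cong_ev[OF refl _ refl] gd[of "[]" i x] x i by fastforce
  qed
  then have pd: "pd i f x = g [i] x" if "x \<in> N" for x
    using that by (simp add: pd_def DERIV_imp_deriv)
  show "smooth_fun n N (pd i f)"
  proof (rule smooth_funI[OF NE, of "\<lambda>I. g (I @ [i])"], goal_cases)
    case (3 I j x)
    then show ?case using gd[of "I @ [i]" j x] i by simp
  qed (use pd gc i in auto)
  show "((\<lambda>t. f (x(i := t))) has_field_derivative pd i f x) (at (x i))" if "x \<in> N"
    using d[OF that] pd[OF that] by simp
qed

lemma pd_eqI: "((\<lambda>t. f (x(i := t))) has_field_derivative D) (at (x i)) \<Longrightarrow> pd i f x = D"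
  by (simp add: pd_def DERIV_imp_deriv)

lemma smooth_fun_coord:
  assumes "N \<subseteq> coord_plane n" shows "smooth_fun n N (\<lambda>x. x k)"
proof (rule smooth_funI[OF assms, of "\<lambda>I x. case I of [] \<Rightarrow> x k | [j] \<Rightarrow> if j = k then 1 else 0 | _ \<Rightarrow> 0"])
  fix I :: "nat list"
  show "continuous_on N (\<lambda>x. case I of [] \<Rightarrow> x k | [j] \<Rightarrow> if j = k then 1 else 0 | _ \<Rightarrow> 0)"
  proof (cases I)
    case Nil
    then show ?thesis by (simp add: continuous_on_subset[OF continuous_on_product_coordinates])
  next
    case (Cons j J)
    then show ?thesis by (cases J) simp_all
  qed
  fix i and x :: "nat \<Rightarrow> 'a"
  show "((\<lambda>t. case I of [] \<Rightarrow> (x(i := t)) k | [j] \<Rightarrow> if j = k then 1 else 0 | _ \<Rightarrow> 0) has_field_derivative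
      (case i # I of [] \<Rightarrow> x k | [j] \<Rightarrow> if j = k then 1 else 0 | _ \<Rightarrow> 0)) (at (x i))"
    by (auto split: list.split)
qed simp

locale chart = krs X for X :: "('x, 'r::comm_ring, 'k::field_char_0) ringed_space" +
  fixes \<phi> :: "'k \<Rightarrow> 'a::{real_normed_field,euclidean_space}" and U :: "'x set" and n :: nat and W h \<theta>
  assumes phi: "field_iso \<phi>" and U: "opn X U" and W: "openin (coord_space n) W"
    and h: "homeomorphic_map (subtopology (topo X) U) (subtopology (coord_space n) W) h"
    and chart: "\<And>V. opn X V \<Longrightarrow> V \<subseteq> U \<Longrightarrow>
           bij_betw (\<theta> V) (sec X V) {f. smooth_fun n (h ` V) f \<and> (\<forall>p. p \<notin> h ` V \<longrightarrow> f p = 0)} \<and>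
           (\<forall>s\<in>sec X V. \<forall>t\<in>sec X V. \<forall>p\<in>h ` V.
              \<theta> V (s + t) p = \<theta> V s p + \<theta> V t p \<and> \<theta> V (s * t) p = \<theta> V s p * \<theta> V t p) \<and>
           (\<forall>a. \<forall>p\<in>h ` V. \<theta> V (const X V a) p = \<phi> a) \<and>
           (\<forall>V'. opn X V' \<and> V' \<subseteq> V \<longrightarrow> (\<forall>s\<in>sec X V. \<forall>p\<in>h ` V'. \<theta> V' (res X V V' s) p = \<theta> V s p))"
begin

lemma image_open: "opn X V \<Longrightarrow> V \<subseteq> U \<Longrightarrow> openin (coord_space n) (h ` V)"
  using homeomorphic_imp_open_map[OF h] U W unfolding open_map_def
  by (metis openin_open_subtopology)

lemma preimage_open: "openin (coord_space n) N \<Longrightarrow> opn X {x \<in> U. h x \<in> N}"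
proof -
  assume N: "openin (coord_space n) N"
  have "openin (subtopology (coord_space n) W) (N \<inter> W)" using N by (rule openin_subtopology_Int)
  then have "openin (subtopology (topo X) U) {x \<in> topspace (subtopology (topo X) U). h x \<in> N \<inter> W}"
    by (rule openin_continuous_map_preimage[OF homeomorphic_imp_continuous_map[OF h]])
  moreover have "h x \<in> W" if "x \<in> U" for x
    using homeomorphic_imp_surjective_map[OF h] that openin_subset[OF U] by auto
  then have "{x \<in> topspace (subtopology (topo X) U). h x \<in> N \<inter> W} = {x \<in> U. h x \<in> N}"
    using openin_subset[OF U] by auto
  ultimately show ?thesis using U by (simp add: openin_open_subtopology)
qed

lemma th_zero: "\<lbrakk>opn X V; V \<subseteq> U; s \<in> sec X V; p \<notin> h ` V\<rbrakk> \<Longrightarrow> \<theta> V s p = 0"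
  using bij_betwE[OF chart[THEN conjunct1]] by auto

lemma th_smooth: "\<lbrakk>opn X V; V \<subseteq> U; s \<in> sec X V\<rbrakk> \<Longrightarrow> smooth_fun n (h ` V) (\<theta> V s)"
  using bij_betwE[OF chart[THEN conjunct1]] by auto

lemma th_eqI:
  assumes V: "opn X V" "V \<subseteq> U" and st: "s \<in> sec X V" "t \<in> sec X V"
    and eq: "\<And>p. p \<in> h ` V \<Longrightarrow> \<theta> V s p = \<theta> V t p"
  shows "s = t"
proof -
  have "\<theta> V s = \<theta> V t" using eq th_zero[OF V] st by (metis ext)
  then show ?thesis using bij_betw_imp_inj_on[OF chart[OF V, THEN conjunct1]] st by (auto dest: inj_onD)
qed

lemma th_ex:
  assumes V: "opn X V" "V \<subseteq> U" and f: "smooth_fun n (h ` V) f"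
  shows "\<exists>s\<in>sec X V. \<forall>p\<in>h ` V. \<theta> V s p = f p"
proof -
  let ?f = "\<lambda>p. if p \<in> h ` V then f p else 0"
  have "?f \<in> {f. smooth_fun n (h ` V) f \<and> (\<forall>p. p \<notin> h ` V \<longrightarrow> f p = 0)}"
    using smooth_fun_cong[OF f, of ?f] by auto
  then have "?f \<in> \<theta> V ` sec X V" unfolding bij_betw_imp_surj_on[OF chart[OF V, THEN conjunct1]] .
  then obtain s where s: "?f = \<theta> V s" "s \<in> sec X V" by (rule imageE)
  show ?thesis by (rule bexI[OF _ s(2)]) (simp flip: s(1))
qed

context
  fixes V assumes V: "opn X V" "V \<subseteq> U"
begin

lemma th_add: "\<lbrakk>s \<in> sec X V; t \<in> sec X V; p \<in> h ` V\<rbrakk> \<Longrightarrow> \<theta> V (s + t) p = \<theta> V s p + \<theta> V t p"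
  and th_mult: "\<lbrakk>s \<in> sec X V; t \<in> sec X V; p \<in> h ` V\<rbrakk> \<Longrightarrow> \<theta> V (s * t) p = \<theta> V s p * \<theta> V t p"
  and th_const: "p \<in> h ` V \<Longrightarrow> \<theta> V (const X V a) p = \<phi> a"
  and th_res: "\<lbrakk>opn X V'; V' \<subseteq> V; s \<in> sec X V; p \<in> h ` V'\<rbrakk> \<Longrightarrow> \<theta> V' (res X V V' s) p = \<theta> V s p"
  using chart[OF V] by auto

lemma th_0: "p \<in> h ` V \<Longrightarrow> \<theta> V 0 p = 0" using th_add[of 0 0 p] V by simp

lemma th_diff: "\<lbrakk>s \<in> sec X V; t \<in> sec X V; p \<in> h ` V\<rbrakk> \<Longrightarrow> \<theta> V (s - t) p = \<theta> V s p - \<theta> V t p"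
  using th_add[of "s - t" t p] V by simp

lemma th_sum:
  "(\<And>i. i < m \<Longrightarrow> s i \<in> sec X V) \<Longrightarrow> p \<in> h ` V \<Longrightarrow> \<theta> V (\<Sum>i<m. s i) p = (\<Sum>i<(m::nat). \<theta> V (s i) p)"
proof (induction m)
  case (Suc m)
  have "sum s {..<m} \<in> sec X V" using Suc.prems V by (intro O.sum_in) auto
  then show ?case using th_add[of "sum s {..<m}" "s m" p] Suc by simp
qed (simp add: th_0)

end

definition partial :: "nat \<Rightarrow> ('x, 'r) vfield" where
  "partial i V s = (if opn X V \<and> V \<subseteq> U \<and> s \<in> sec X V
     then SOME t. t \<in> sec X V \<and> (\<forall>p\<in>h ` V. \<theta> V t p = pd i (\<theta> V s) p) else 0)"

lemma partial:
  assumes V: "opn X V" "V \<subseteq> U" and s: "s \<in> sec X V" and i: "i < n" shows "partial i V s \<in> sec X V"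
    and "p \<in> h ` V \<Longrightarrow> \<theta> V (partial i V s) p = pd i (\<theta> V s) p"
    and "p \<in> h ` V \<Longrightarrow> ((\<lambda>t. \<theta> V s (p(i := t))) has_field_derivative pd i (\<theta> V s) p) (at (p i))"
proof -
  note sm = smooth_fun_pd[OF th_smooth[OF V s] image_open[OF V] i]
  have "\<exists>t. t \<in> sec X V \<and> (\<forall>p\<in>h ` V. \<theta> V t p = pd i (\<theta> V s) p)" using th_ex[OF V sm(1)] by blast
  from someI_ex[OF this] have "partial i V s \<in> sec X V \<and> (\<forall>p\<in>h ` V. \<theta> V (partial i V s) p = pd i (\<theta> V s) p)"
    using V s by (simp add: partial_def)
  then show "partial i V s \<in> sec X V" "p \<in> h ` V \<Longrightarrow> \<theta> V (partial i V s) p = pd i (\<theta> V s) p" by auto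
  show "p \<in> h ` V \<Longrightarrow> ((\<lambda>t. \<theta> V s (p(i := t))) has_field_derivative pd i (\<theta> V s) p) (at (p i))"
    by (rule sm(2))
qed

lemma th_ev:
  assumes V: "opn X V" "V \<subseteq> U" and p: "p \<in> h ` V" and i: "i < n" and eq: "\<And>y. y \<in> h ` V \<Longrightarrow> f y = g y"
    and D: "((\<lambda>t. g (p(i := t))) has_field_derivative D) (at (p i))"
  shows "pd i f p = D"
proof (rule pd_eqI)
  have "eventually (\<lambda>t. f (p(i := t)) = g (p(i := t))) (nhds (p i))"
    using line_eventually[OF image_open[OF V] p i] by eventually_elim (simp add: eq)
  then show "((\<lambda>t. f (p(i := t))) has_field_derivative D) (at (p i))"
    using DERIV_cong_ev[OF refl _ refl] D by fastforce
qed

lemma partial_in: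
  assumes i: "i < n" shows "partial i \<in> vfs U"
proof (rule tangentI, goal_cases)
  fix V s assume V: "opn X V" "V \<subseteq> U" and s: "s \<in> sec X V"
  note ps = partial[OF V s i]
  show "partial i V s \<in> sec X V" by (rule ps)
  fix t assume t: "t \<in> sec X V"
  note pt = partial[OF V t i]
  show "partial i V (s + t) = partial i V s + partial i V t"
  proof (rule th_eqI[OF V], goal_cases)
    case p: (3 p)
    have "pd i (\<theta> V (s + t)) p = pd i (\<theta> V s) p + pd i (\<theta> V t) p"
      by (rule th_ev[OF V p i th_add[OF V s t] DERIV_add[OF ps(3)[OF p] pt(3)[OF p]]])
    then show ?case using partial[OF V _ i] th_add[OF V] V s t p by simp
  qed (use partial(1)[OF V _ i] V s t in auto)
  show "partial i V (s * t) = partial i V s * t + s * partial i V t"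
  proof (rule th_eqI[OF V], goal_cases)
    case p: (3 p)
    have "pd i (\<theta> V (s * t)) p = pd i (\<theta> V s) p * \<theta> V t p + pd i (\<theta> V t) p * \<theta> V s p"
      using th_ev[OF V p i th_mult[OF V s t] DERIV_mult[OF ps(3)[OF p] pt(3)[OF p]]] by simp
    then show ?case using partial[OF V _ i] th_add[OF V] th_mult[OF V] V s t p by simp
  qed (use partial(1)[OF V _ i] V s t in auto)
next
  case V: (4 V a)
  note pc = partial[OF V const_in[OF V(1)] i]
  show ?case
  proof (rule th_eqI[OF V], goal_cases)
    case p: (3 p)
    have "pd i (\<theta> V (const X V a)) p = 0" by (rule th_ev[OF V p i th_const[OF V] DERIV_const])
    then show ?case using pc p th_0[OF V p] by simp
  qed (use pc V in auto)
next
  case (5 V V' s)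
  note V = 5(1-4) and s = 5(5)
  have V': "opn X V'" "V' \<subseteq> U" using V by auto
  have r: "res X V V' s \<in> sec X V'" using V s by simp
  show ?case
  proof (rule th_eqI[OF V'], goal_cases)
    case p: (3 p)
    then have p': "p \<in> h ` V" using V by auto
    have "pd i (\<theta> V' (res X V V' s)) p = pd i (\<theta> V s) p"
      by (rule th_ev[OF V' p i th_res[OF V(1,2) V'(1) V(4) s] partial(3)[OF V(1,2) s i p']])
    then show ?case
      using partial[OF V' r i] partial[OF V(1,2) s i] p p' th_res[OF V(1,2) V'(1) V(4)] by simp
  qed (use partial(1)[OF V' r i] partial(1)[OF V(1,2) s i] V in auto)
next
  case (6 V s)
  then show ?case unfolding partial_def by (rule if_not_P)
qed

lemma frame: "\<exists>f. frame_on X U n f partial"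
proof -
  have NE: "h ` V \<subseteq> coord_plane n" if "opn X V" "V \<subseteq> U" for V
    using openin_subset[OF image_open[OF that]] by (simp add: coord_space_eq)
  have "\<exists>s\<in>sec X U. \<forall>p\<in>h ` U. \<theta> U s p = p i" for i
    by (rule th_ex[OF U subset_refl smooth_fun_coord[OF NE[OF U subset_refl]]])
  then have "\<forall>i. \<exists>s. s \<in> sec X U \<and> (\<forall>p\<in>h ` U. \<theta> U s p = p i)" unfolding Bex_def by simp
  from choice[OF this] obtain x where x0: "\<forall>i. x i \<in> sec X U \<and> (\<forall>p\<in>h ` U. \<theta> U (x i) p = p i)"
    by (rule exE)
  note x = x0[THEN spec, THEN conjunct1] x0[THEN spec, THEN conjunct2, THEN bspec]
  have eq: "\<theta> V (v V s) c = (\<Sum>i<n. \<theta> V (v V (res X U V (x i))) c * \<theta> V (partial i V s) c)"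
    if V: "opn X V" "V \<subseteq> U" and v: "v \<in> vfs V" and s: "s \<in> sec X V" and c: "c \<in> h ` V" for V v s c
  proof -
    obtain \<epsilon> where \<epsilon>: "\<epsilon> > 0" "coord_box n c \<epsilon> \<subseteq> h ` V" using coord_box_exists[OF image_open[OF V] c] by auto
    have c0: "c i = 0" if "i \<ge> n" for i using NE[OF V] c that by (auto simp: coord_plane_def)
    have cB: "c \<in> coord_box n c \<epsilon>" using \<epsilon>(1) c0 by (simp add: coord_box_def)
    define N where "N = {x \<in> U. h x \<in> coord_box n c \<epsilon>} \<inter> V"
    have N: "opn X N" "N \<subseteq> U" "N \<subseteq> V" using preimage_open[OF openin_coord_box] V by (auto simp: N_def)
    have hN: "h ` N = coord_box n c \<epsilon>" using \<epsilon>(2) V(2) by (auto simp: N_def)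
    have cN: "c \<in> h ` N" using cB hN by simp
    have sm: "smooth_fun n (coord_box n c \<epsilon>) (\<theta> V s)"
      by (rule smooth_fun_subset[OF th_smooth[OF V s] \<epsilon>(2) NE[OF V]])
    obtain Q where Q0: "(\<forall>k<n. smooth_fun n (coord_box n c \<epsilon>) (Q k) \<and>
        ((\<lambda>t. \<theta> V s (c(k := t))) has_field_derivative Q k c) (at (c k))) \<and>
      (\<forall>p\<in>coord_box n c \<epsilon>. \<theta> V s p = \<theta> V s c + (\<Sum>k<n. (p k - c k) * Q k p))"
      using hadamard[OF sm \<epsilon>(1) c0] by (rule exE)
    note Q = Q0[THEN conjunct1, rule_format, THEN conjunct1] Q0[THEN conjunct1, rule_format, THEN conjunct2]
      Q0[THEN conjunct2, rule_format]
    have "\<exists>u\<in>sec X N. \<forall>p\<in>h ` N. \<theta> N u p = Q k p" if "k < n" for k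
      using th_ex[OF N(1,2), of "Q k"] Q(1)[OF that] unfolding hN .
    then have "\<forall>k\<in>{..<n}. \<exists>u. u \<in> sec X N \<and> (\<forall>p\<in>h ` N. \<theta> N u p = Q k p)" unfolding Bex_def by simp
    from bchoice[OF this] obtain u where u0: "\<forall>k\<in>{..<n}. u k \<in> sec X N \<and> (\<forall>p\<in>h ` N. \<theta> N (u k) p = Q k p)"
      by (rule exE)
    note u = u0[THEN bspec, THEN conjunct1, OF lessThan_iff[THEN iffD2]]
      u0[THEN bspec, THEN conjunct2, THEN bspec, OF lessThan_iff[THEN iffD2]]
    have "surj \<phi>" using phi by (simp add: field_iso_def bij_def)
    note inv = surj_f_inv_f[OF this]
    define a b where "a = inv_into UNIV \<phi> (\<theta> V s c)" and "b = (\<lambda>k. inv_into UNIV \<phi> (c k))"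
    have ab: "\<phi> a = \<theta> V s c" "\<phi> (b k) = c k" for k unfolding a_def b_def by (rule inv)+
    define y where "y k = res X U N (x k) - const X N (b k)" for k
    have xN: "res X U N (x k) \<in> sec X N" for k using x(1) N U by simp
    have y: "y k \<in> sec X N" for k using xN N by (simp add: y_def)
    have yp: "\<theta> N (y k) p = p k - c k" if p: "p \<in> h ` N" for k p
    proof -
      have pU: "p \<in> h ` U" using p N(2) by auto
      show ?thesis
        unfolding y_def th_diff[OF N(1,2) xN const_in[OF N(1)] p] th_const[OF N(1,2) p] ab(2)
          th_res[OF U subset_refl N(1,2) x(1) p] x(2)[OF pU] by (rule refl)
    qed
    have yu: "y k * u k \<in> sec X N" if "k < n" for k using that N y u(1) by simp
    have yus: "(\<Sum>k<n. y k * u k) \<in> sec X N" by (rule O.sum_in[OF N(1)]) (use yu in simp)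
    have sN: "res X V N s = const X N a + (\<Sum>k<n. y k * u k)"
    proof (rule th_eqI[OF N(1,2)], goal_cases)
      case p: (3 p)
      have "\<theta> N (res X V N s) p = \<theta> V s p" by (rule th_res[OF V N(1,3) s p])
      also have "\<dots> = \<phi> a + (\<Sum>k<n. (p k - c k) * Q k p)" unfolding ab(1) by (rule Q(3)) (use p hN in simp)
      also have "(\<Sum>k<n. (p k - c k) * Q k p) = (\<Sum>k<n. \<theta> N (y k * u k) p)"
        by (intro sum.cong refl) (simp add: th_mult[OF N(1,2) y u(1) p] yp[OF p] u(2)[OF _ p])
      also have "\<dots> = \<theta> N (\<Sum>k<n. y k * u k) p" by (rule th_sum[OF N(1,2) yu p, symmetric])
      also have "\<phi> a = \<theta> N (const X N a) p" by (rule th_const[OF N(1,2) p, symmetric])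
      also have "\<theta> N (const X N a) p + \<theta> N (\<Sum>k<n. y k * u k) p = \<theta> N (const X N a + (\<Sum>k<n. y k * u k)) p"
        by (rule th_add[OF N(1,2) _ _ p, symmetric]) (use yus N in auto)
      finally show ?case .
    qed (use N V s yus in auto)
    have vx: "v N (y k) = v N (res X U N (x k))" for k
      using vf_diff[OF v N(1,3) xN const_in[OF N(1)]] vf_const[OF v N(1,3)] by (simp add: y_def)
    have vN: "v N t \<in> sec X N" if "t \<in> sec X N" for t by (rule vf_in[OF v N(1,3) that])
    have "v N (\<Sum>k<n. y k * u k) = (\<Sum>k<n. v N (y k * u k))"
      by (rule vf_sum[OF v N(1,3)]) (use y u N in auto)
    also have "\<dots> = (\<Sum>k<n. v N (y k) * u k + y k * v N (u k))"
      by (intro sum.cong refl vf_mult[OF v N(1,3)]) (use y u in auto)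
    finally have "v N (res X V N s) = (\<Sum>k<n. v N (y k) * u k + y k * v N (u k))"
      unfolding sN using vf_add[OF v N(1,3) const_in[OF N(1)] yus, of a] vf_const[OF v N(1,3)]
      by simp
    moreover have "\<theta> V (v V s) c = \<theta> N (res X V N (v V s)) c"
      by (rule th_res[OF V N(1,3) vf_in[OF v V(1) subset_refl s] cN, symmetric])
    moreover have "res X V N (v V s) = v N (res X V N s)"
      by (rule vf_res[OF v V(1) subset_refl N(1,3) s, symmetric])
    ultimately have "\<theta> V (v V s) c = (\<Sum>k<n. \<theta> N (v N (y k)) c * Q k c)"
      using N y u vN cN yp[OF cN] by (simp add: th_add[OF N(1,2)] th_sum[OF N(1,2)] th_mult[OF N(1,2)])
    also have "\<dots> = (\<Sum>i<n. \<theta> V (v V (res X U V (x i))) c * \<theta> V (partial i V s) c)"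
    proof (rule sum.cong[OF refl], goal_cases)
      case (1 k)
      then have k: "k < n" by simp
      have xV: "res X U V (x k) \<in> sec X V" using x(1) U V by simp
      have "\<theta> V (partial k V s) c = Q k c" using partial(2)[OF V s k c] pd_eqI[where f = "\<theta> V s", OF Q(2)[OF k]] by simp
      moreover have "v N (y k) = res X V N (v V (res X U V (x k)))"
        unfolding vx using vf_res[OF v V(1) subset_refl N(1,3) xV] x(1) U V N by simp
      then have "\<theta> N (v N (y k)) c = \<theta> V (v V (res X U V (x k))) c"
        using th_res[OF V N(1,3) vf_in[OF v V(1) subset_refl xV] cN] by simp
      ultimately show ?case by simp
    qed
    finally show ?thesis .
  qed
  have "frame_on X U n x partial" unfolding frame_on_def
  proof (intro conjI allI impI, goal_cases)
    case (4 V v s)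
    then have V: "opn X V" "V \<subseteq> U" and v: "v \<in> vfs V" and s: "s \<in> sec X V" by auto
    have vx: "v V (res X U V (x i)) \<in> sec X V" for i
      using vf_in[OF v V(1) subset_refl] x(1) U V by simp
    show ?case
    proof (rule th_eqI[OF V vf_in[OF v V(1) subset_refl s]], goal_cases)
      have m: "v V (res X U V (x i)) * partial i V s \<in> sec X V" if "i < n" for i
        using vx partial(1)[OF V s that] V by simp
      show "(\<Sum>i<n. v V (res X U V (x i)) * partial i V s) \<in> sec X V"
        by (rule O.sum_in[OF V(1)]) (use m in simp)
      case c: (2 c)
      have sm: "\<theta> V (\<Sum>i<n. v V (res X U V (x i)) * partial i V s) c =
          (\<Sum>i<n. \<theta> V (v V (res X U V (x i)) * partial i V s) c)" by (rule th_sum[OF V _ c]) (rule m)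
      show ?case unfolding eq[OF V v s c] sm
        by (intro sum.cong refl) (simp add: th_mult[OF V vx partial(1)[OF V s] c])
    qed
  qed (use U x partial_in in auto)
  then show ?thesis by blast
qed

end

theorem chart_manifold_framed:
  fixes \<phi> :: "'k::field_char_0 \<Rightarrow> 'a::{real_normed_field,euclidean_space}"
    and X :: "('x, 'r::comm_ring, 'k) ringed_space"
  assumes "field_iso \<phi>" "chart_manifold \<phi> X" shows "locally_framed X" unfolding locally_framed_def
proof
  fix x assume x: "x \<in> pts X"
  obtain U n W h \<theta> where c: "opn X U" "x \<in> U" "openin (coord_space n) W"
        "homeomorphic_map (subtopology (topo X) U) (subtopology (coord_space n) W) h"
        "\<forall>V. opn X V \<and> V \<subseteq> U \<longrightarrow>
           bij_betw (\<theta> V) (sec X V) {f. smooth_fun n (h ` V) f \<and> (\<forall>p. p \<notin> h ` V \<longrightarrow> f p = (0::'a))} \<and>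
           (\<forall>s\<in>sec X V. \<forall>t\<in>sec X V. \<forall>p\<in>h ` V.
              \<theta> V (s + t) p = \<theta> V s p + \<theta> V t p \<and> \<theta> V (s * t) p = \<theta> V s p * \<theta> V t p) \<and>
           (\<forall>a. \<forall>p\<in>h ` V. \<theta> V (const X V a) p = \<phi> a) \<and>
           (\<forall>V'. opn X V' \<and> V' \<subseteq> V \<longrightarrow> (\<forall>s\<in>sec X V. \<forall>p\<in>h ` V'. \<theta> V' (res X V V' s) p = \<theta> V s p))"
    using assms(2)[unfolded chart_manifold_def, THEN conjunct2, THEN conjunct2, THEN conjunct2, THEN bspec, OF x]
    by (elim exE conjE) (rule that)
  interpret chart X \<phi> U n W h \<theta>
  proof
    show "k_ringed_space X" using assms(2) unfolding chart_manifold_def by (rule conjunct1)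
  qed (fact assms(1) c(1,3,4) c(5)[rule_format, OF conjI])+
  show "\<exists>U n f d. x \<in> U \<and> frame_on X U n f d" using frame c(2) by blast
qed

section \<open>Frames on smooth varieties\<close>

lemma poly_mapping_induct_single:
  fixes p :: "'a \<Rightarrow>\<^sub>0 'b::comm_monoid_add"
  assumes "\<And>m a. m \<in> Poly_Mapping.keys p \<Longrightarrow> P (Poly_Mapping.single m a)" and "P 0"
    and "\<And>p q. P p \<Longrightarrow> P q \<Longrightarrow> P (p + q)"
  shows "P p"
proof -
  have "p = (\<Sum>m\<in>Poly_Mapping.keys p. Poly_Mapping.single m (Poly_Mapping.lookup p m))"
  proof (rule poly_mapping_eqI)
    fix m
    show "Poly_Mapping.lookup p m =
      Poly_Mapping.lookup (\<Sum>m\<in>Poly_Mapping.keys p. Poly_Mapping.single m (Poly_Mapping.lookup p m)) m"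
      by (simp add: lookup_sum lookup_single when_def in_keys_iff)
  qed
  moreover have "P (\<Sum>m\<in>M. Poly_Mapping.single m (Poly_Mapping.lookup p m))"
    if "finite M" "M \<subseteq> Poly_Mapping.keys p" for M using that by (induction M) (use assms in auto)
  ultimately show ?thesis using finite_keys subset_refl by metis
qed

lemma mpoly_pderiv_single: "mpoly_pderiv i (Poly_Mapping.single m a) =
    Poly_Mapping.single (m - Poly_Mapping.single i 1) (of_nat (Poly_Mapping.lookup m i) * a)"
  by (cases "a = 0") (simp_all add: mpoly_pderiv_def)

lemma mpoly_pderiv_0 [simp]: "mpoly_pderiv i 0 = 0" by (simp add: mpoly_pderiv_def)

lemma mpoly_pderiv_add: "mpoly_pderiv i (p + q) = mpoly_pderiv i p + mpoly_pderiv i q"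
  unfolding mpoly_pderiv_def
  by (rule setsum_keys_plus_distrib[where f = "\<lambda>m a. Poly_Mapping.single (m - Poly_Mapping.single i 1)
      (of_nat (Poly_Mapping.lookup m i) * a)"]) (simp_all add: distrib_left single_add)

lemma mpoly_pderiv_mult: "mpoly_pderiv i (p * q) = mpoly_pderiv i p * q + p * mpoly_pderiv i q"
proof (induction p rule: poly_mapping_induct_single)
  fix m :: "nat \<Rightarrow>\<^sub>0 nat" and a :: 'a
  show "mpoly_pderiv i (Poly_Mapping.single m a * q) =
    mpoly_pderiv i (Poly_Mapping.single m a) * q + Poly_Mapping.single m a * mpoly_pderiv i q"
  proof (induction q rule: poly_mapping_induct_single)
    fix m' :: "nat \<Rightarrow>\<^sub>0 nat" and b :: 'a
    let ?e = "Poly_Mapping.single i (1::nat)"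
    have e: "k - ?e + l = k + l - ?e" if "Poly_Mapping.lookup k i \<noteq> 0" for k l :: "nat \<Rightarrow>\<^sub>0 nat"
      using that by (intro poly_mapping_eqI) (auto simp: lookup_add lookup_minus lookup_single when_def)
    have e1: "Poly_Mapping.single (m - ?e + m') (of_nat (Poly_Mapping.lookup m i) * a * b) =
        Poly_Mapping.single (m + m' - ?e) (of_nat (Poly_Mapping.lookup m i) * a * b)"
      using e[of m m'] by (cases "Poly_Mapping.lookup m i = 0") simp_all
    have e2: "Poly_Mapping.single (m + (m' - ?e)) (a * (of_nat (Poly_Mapping.lookup m' i) * b)) =
        Poly_Mapping.single (m + m' - ?e) (of_nat (Poly_Mapping.lookup m' i) * a * b)"
      using e[of m' m] by (cases "Poly_Mapping.lookup m' i = 0") (simp_all add: add.commute mult_ac)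
    show "mpoly_pderiv i (Poly_Mapping.single m a * Poly_Mapping.single m' b) =
        mpoly_pderiv i (Poly_Mapping.single m a) * Poly_Mapping.single m' b +
        Poly_Mapping.single m a * mpoly_pderiv i (Poly_Mapping.single m' b)"
      unfolding mult_single mpoly_pderiv_single lookup_add e1 e2 by (simp add: algebra_simps flip: single_add)
  qed (simp_all add: mpoly_pderiv_add algebra_simps)
qed (simp_all add: mpoly_pderiv_add algebra_simps)

lemma mpoly_induct [consumes 1]:
  fixes p :: "'k::field_char_0 mpoly"
  assumes p: "p \<in> mpolys n" and const: "\<And>a. P (Poly_Mapping.single 0 a)"
    and add: "\<And>p q. P p \<Longrightarrow> P q \<Longrightarrow> P (p + q)"
    and var: "\<And>p i. i < n \<Longrightarrow> P p \<Longrightarrow> P (p * Poly_Mapping.single (Poly_Mapping.single i 1) 1)"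
  shows "P p"
proof (rule poly_mapping_induct_single)
  fix m and a :: 'k assume "m \<in> Poly_Mapping.keys p"
  then have "Poly_Mapping.keys m \<subseteq> {..<n}" using p by (auto simp: mpolys_def)
  then show "P (Poly_Mapping.single m a)"
  proof (induction "\<Sum>i<n. Poly_Mapping.lookup m i" arbitrary: m)
    case 0
    then have "m = 0" by (intro poly_mapping_eqI) (auto simp: in_keys_iff subset_iff)
    then show ?case using const by simp
  next
    case (Suc d)
    then obtain i where i: "i < n" "Poly_Mapping.lookup m i \<noteq> 0"
      by (metis lessThan_iff nat.distinct(1) sum.neutral)
    let ?e = "Poly_Mapping.single i (1::nat)"
    have m: "m = (m - ?e) + ?e"
      using i(2) by (intro poly_mapping_eqI) (auto simp: lookup_add lookup_minus lookup_single when_def)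
    have "Suc d = (\<Sum>j<n. Poly_Mapping.lookup (m - ?e) j + (if j = i then 1 else 0))"
      unfolding Suc.hyps(2) by (subst m) (simp add: lookup_add lookup_single when_def eq_commute del: One_nat_def)
    also have "\<dots> = Suc (\<Sum>j<n. Poly_Mapping.lookup (m - ?e) j)" using i by (simp add: sum.distrib)
    finally have "d = (\<Sum>j<n. Poly_Mapping.lookup (m - ?e) j)" by simp
    moreover have "Poly_Mapping.keys (m - ?e) \<subseteq> {..<n}"
      using Suc.prems by (auto simp: in_keys_iff lookup_minus subset_iff)
    ultimately have "P (Poly_Mapping.single (m - ?e) a)" by (rule Suc.hyps(1))
    from var[OF i(1) this] show ?case using m by (simp add: mult_single)
  qed
qed (use const[of 0] add in auto)

lemma section_ring_simps: "\<one>\<^bsub>section_ring X U\<^esub> = const X U 1" "s \<otimes>\<^bsub>section_ring X U\<^esub> t = s * t"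
  by (simp_all add: section_ring_def)

context krs
begin

lemma cring_section_ring:
  assumes U: "opn X U" shows "cring (section_ring X U)"
proof (rule cringI)
  show "abelian_group (section_ring X U)"
  proof (rule abelian_groupI, goal_cases)
    case (6 s)
    then show ?case using U by (intro bexI[of _ "- s"]) (auto simp: section_ring_def)
  qed (use U in \<open>auto simp: section_ring_def algebra_simps\<close>)
  show "comm_monoid (section_ring X U)"
    by (rule comm_monoidI) (use U in \<open>auto simp: section_ring_def mult.assoc intro: mult.commute\<close>)
qed (auto simp: section_ring_def algebra_simps)

end

locale sections = krs X for X :: "('x, 'r::comm_ring, 'k::field_char_0) ringed_space" +
  fixes U :: "'x set" and n :: nat and y :: "nat \<Rightarrow> 'r"
  assumes U: "opn X U" and y: "\<And>i. i < n \<Longrightarrow> y i \<in> sec X U"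
begin

interpretation R: cring "section_ring X U"
  rewrites "carrier (section_ring X U) = sec X U" and "monoid.mult (section_ring X U) = (*)"
    and "monoid.one (section_ring X U) = const X U 1"
  by (rule cring_section_ring[OF U]) (simp_all add: section_ring_def)

definition monom_eval :: "(nat \<Rightarrow>\<^sub>0 nat) \<Rightarrow> 'r" where "monom_eval m = finprod (section_ring X U)
          (\<lambda>i. y i [^]\<^bsub>section_ring X U\<^esub> Poly_Mapping.lookup m i) {..<n}"

abbreviation ev where "ev \<equiv> mpoly_eval X U n y"

lemma ev_eq: "ev p = (\<Sum>m\<in>Poly_Mapping.keys p. const X U (Poly_Mapping.lookup p m) * monom_eval m)"
  by (simp add: mpoly_eval_def monom_eval_def)

lemma monom_eval_in: "monom_eval m \<in> sec X U"
  unfolding monom_eval_def by (rule R.finprod_closed) (use y in auto)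

lemma monom_eval_0: "monom_eval 0 = const X U 1"
  unfolding monom_eval_def by (rule R.finprod_one_eqI) (simp add: section_ring_simps)

lemma monom_eval_add: "monom_eval (m + m') = monom_eval m * monom_eval m'"
proof -
  have "monom_eval (m + m') = finprod (section_ring X U)
          (\<lambda>i. (y i [^]\<^bsub>section_ring X U\<^esub> Poly_Mapping.lookup m i) *
            (y i [^]\<^bsub>section_ring X U\<^esub> Poly_Mapping.lookup m' i)) {..<n}" unfolding monom_eval_def
    by (rule R.finprod_cong') (use y U in \<open>auto simp: lookup_add R.nat_pow_mult\<close>)
  also have "\<dots> = monom_eval m * monom_eval m'"
    unfolding monom_eval_def by (rule R.finprod_multf) (use y in auto)
  finally show ?thesis .
qed

lemma monom_eval_var:
  assumes i: "i < n" shows "monom_eval (Poly_Mapping.single i 1) = y i"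
proof -
  have "monom_eval (Poly_Mapping.single i 1) =
      finprod (section_ring X U) (\<lambda>j. if i = j then y j else const X U 1) {..<n}"
    unfolding monom_eval_def
    by (rule R.finprod_cong') (use y U in \<open>auto simp: lookup_single when_def section_ring_simps\<close>)
  also have "\<dots> = y i" by (rule R.finprod_singleton) (use i y in auto)
  finally show ?thesis .
qed

lemma ev_single: "ev (Poly_Mapping.single m a) = const X U a * monom_eval m"
  by (cases "a = 0") (simp_all add: ev_eq U)

lemma ev_0 [simp]: "ev 0 = 0" by (simp add: ev_eq)

lemma ev_add: "ev (p + q) = ev p + ev q" unfolding ev_eq
  by (rule setsum_keys_plus_distrib[where f = "\<lambda>m a. const X U a * monom_eval m"])
    (simp_all add: U const_add distrib_right)

lemma ev_in: "ev p \<in> sec X U" unfolding ev_eq by (rule O.sum_in[OF U]) (simp add: U monom_eval_in)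

lemma ev_mult: "ev (p * q) = ev p * ev q"
proof (induction p rule: poly_mapping_induct_single)
  fix m a
  show "ev (Poly_Mapping.single m a * q) = ev (Poly_Mapping.single m a) * ev q"
    by (induction q rule: poly_mapping_induct_single)
      (simp_all add: mult_single ev_single monom_eval_add const_mult[OF U] ev_add algebra_simps)
qed (simp_all add: ev_add distrib_right)

lemma ev_const: "ev (Poly_Mapping.single 0 a) = const X U a"
proof -
  have "const X U a * const X U 1 = const X U a" by (simp flip: const_mult[OF U])
  then show ?thesis by (simp add: ev_single monom_eval_0)
qed

lemma ev_var: "i < n \<Longrightarrow> ev (Poly_Mapping.single (Poly_Mapping.single i 1) 1) = y i"
  by (simp add: ev_single monom_eval_var U y del: One_nat_def)

lemma ev_diff: "ev (p - q) = ev p - ev q" using ev_add[of "p - q" q] by simp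

lemma ev_sum: "ev (\<Sum>i\<in>I. p i) = (\<Sum>i\<in>I. ev (p i))"
  by (induction I rule: infinite_finite_induct) (simp_all add: ev_add)

text \<open>The chain rule, for derivations with values in the sections over a smaller open set.\<close>

lemma ev_derivation:
  assumes V: "opn X V" "V \<subseteq> U" and D_add: "\<And>a b. a \<in> sec X U \<Longrightarrow> b \<in> sec X U \<Longrightarrow> D (a + b) = D a + D b"
    and D_mult: "\<And>a b. a \<in> sec X U \<Longrightarrow> b \<in> sec X U \<Longrightarrow> D (a * b) = D a * res X U V b + res X U V a * D b"
    and D_const: "\<And>k. D (const X U k) = 0"
    and D_in: "\<And>a. a \<in> sec X U \<Longrightarrow> D a \<in> sec X V"
    and p: "p \<in> mpolys n"
  shows "D (ev p) = (\<Sum>l<n. res X U V (ev (mpoly_pderiv l p)) * D (y l))" using p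
proof (induction p rule: mpoly_induct)
  fix k show "D (ev (Poly_Mapping.single 0 k)) =
      (\<Sum>l<n. res X U V (ev (mpoly_pderiv l (Poly_Mapping.single 0 k))) * D (y l))"
    by (simp add: ev_const D_const mpoly_pderiv_single U V)
next
  fix p q
  assume "D (ev p) = (\<Sum>l<n. res X U V (ev (mpoly_pderiv l p)) * D (y l))"
    "D (ev q) = (\<Sum>l<n. res X U V (ev (mpoly_pderiv l q)) * D (y l))"
  then show "D (ev (p + q)) = (\<Sum>l<n. res X U V (ev (mpoly_pderiv l (p + q))) * D (y l))"
    by (simp add: mpoly_pderiv_add ev_add D_add ev_in O.res_add U V distrib_right sum.distrib)
next
  fix p i assume i: "i < n" and IH: "D (ev p) = (\<Sum>l<n. res X U V (ev (mpoly_pderiv l p)) * D (y l))"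
  let ?x = "Poly_Mapping.single (Poly_Mapping.single i 1) (1::'k)"
  have x: "mpoly_pderiv l ?x = (if l = i then 1 else 0)" for l
    by (simp add: mpoly_pderiv_single lookup_single when_def single_one del: One_nat_def)
  have "ev (1 :: 'k mpoly) = const X U 1" using ev_const[of 1] by simp
  then have r: "res X U V (ev (mpoly_pderiv l (p * ?x))) * D (y l) =
      res X U V (ev (mpoly_pderiv l p)) * D (y l) * res X U V (y i) +
      (if l = i then res X U V (ev p) * D (y i) else 0)" if "l < n" for l using i V U y ev_in
    by (simp add: mpoly_pderiv_mult x ev_add ev_mult ev_var O.res_add res_mult algebra_simps del: One_nat_def)
  have "(\<Sum>l<n. res X U V (ev (mpoly_pderiv l (p * ?x))) * D (y l)) =
      (\<Sum>l<n. res X U V (ev (mpoly_pderiv l p)) * D (y l) * res X U V (y i) +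
        (if l = i then res X U V (ev p) * D (y i) else 0))" by (intro sum.cong refl r) simp
  also have "\<dots> = D (ev p) * res X U V (y i) + res X U V (ev p) * D (y i)"
    using i by (simp add: sum.distrib IH sum_distrib_right)
  also have "\<dots> = D (ev (p * ?x))" using i by (simp add: ev_mult ev_var D_mult ev_in y del: One_nat_def)
  finally show "D (ev (p * ?x)) = (\<Sum>l<n. res X U V (ev (mpoly_pderiv l (p * ?x))) * D (y l))" ..
qed

end

context krs
begin

lemma unit_locus_open: assumes U: "opn X U" shows "opn X (unit_locus X U s)"
proof (subst openin_subopen, intro ballI)
  fix x assume "x \<in> unit_locus X U s"
  then obtain V t where V: "opn X V" "x \<in> V" "V \<subseteq> U" "t \<in> sec X V" "res X U V s * t = const X V 1"
    unfolding unit_locus_def by auto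
  then have "V \<subseteq> unit_locus X U s" unfolding unit_locus_def by blast
  then show "\<exists>V. opn X V \<and> x \<in> V \<and> V \<subseteq> unit_locus X U s" using V by blast
qed

lemma unit_cancel:
  assumes "opn X N" "s * e = const X N 1" "z \<in> sec X N" "s * z = 0" shows "z = 0"
proof -
  have "z = const X N 1 * z" using assms by simp
  also have "\<dots> = e * (s * z)" by (simp add: mult_ac flip: assms(2))
  finally show ?thesis using assms(4) by simp
qed

lemma unit_locus_cancel:
  assumes U: "opn X U" and s: "s \<in> sec X U" and z: "z \<in> sec X (unit_locus X U s)"
    and sz: "res X U (unit_locus X U s) s * z = 0"
  shows "z = 0"
proof (rule O.eqI_local)
  let ?D = "unit_locus X U s"
  note D = unit_locus_open[OF U, of s]
  have DU: "?D \<subseteq> U" unfolding unit_locus_def by auto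
  fix x assume x: "x \<in> ?D"
  then obtain V t where V: "opn X V" "x \<in> V" "V \<subseteq> U" "t \<in> sec X V" "res X U V s * t = const X V 1"
    unfolding unit_locus_def by auto
  let ?N = "V \<inter> ?D"
  have N: "opn X ?N" using V(1) D by simp
  have zN: "res X ?D ?N z \<in> sec X ?N" using z N D by simp
  have "res X V ?N (res X U V s * t) = res X V ?N (const X V 1)" using V(5) by simp
  then have u: "res X U ?N s * res X V ?N t = const X ?N 1"
    using V(1,3,4) N U s by (simp add: res_mult)
  have "res X ?D ?N (res X U ?D s * z) = res X U ?N s * res X ?D ?N z"
    using N D U DU s z by (simp add: res_mult)
  then have "res X U ?N s * res X ?D ?N z = 0" using sz N D by simp
  then have "res X ?D ?N z = 0" by (rule unit_cancel[OF N u zN])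
  then show "\<exists>V. opn X V \<and> x \<in> V \<and> V \<subseteq> ?D \<and> res X ?D V z = res X ?D V 0"
    using N D V(2) x by (intro exI[of _ ?N]) simp
qed (use unit_locus_open[OF U] z in auto)

lemma funpow_mult_in: "\<lbrakk>opn X N; s \<in> sec X N; z \<in> sec X N\<rbrakk> \<Longrightarrow> ((*) s ^^ m) z \<in> sec X N"
  by (induction m) simp_all

lemma res_funpow_mult:
  assumes "opn X N" "opn X M" "M \<subseteq> N" "s \<in> sec X N" "z \<in> sec X N"
  shows "res X N M (((*) s ^^ m) z) = ((*) (res X N M s) ^^ m) (res X N M z)"
  using assms by (induction m) (simp_all add: res_mult funpow_mult_in)

lemma affine_basis:
  "\<lbrakk>affine_open X U; opn X V; V \<subseteq> U; x \<in> V\<rbrakk> \<Longrightarrow> \<exists>s\<in>sec X U. x \<in> unit_locus X U s \<and> unit_locus X U s \<subseteq> V"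
  unfolding affine_open_def by simp

lemma affine_frac: "\<lbrakk>affine_open X U; s \<in> sec X U; t \<in> sec X (unit_locus X U s)\<rbrakk> \<Longrightarrow>
    \<exists>m. \<exists>b\<in>sec X U. ((*) (res X U (unit_locus X U s) s) ^^ m) t = res X U (unit_locus X U s) b"
  unfolding affine_open_def by simp

lemma affine_null: "\<lbrakk>affine_open X U; s \<in> sec X U; b \<in> sec X U; res X U (unit_locus X U s) b = 0\<rbrakk> \<Longrightarrow>
    \<exists>m. ((*) s ^^ m) b = 0" unfolding affine_open_def by simp

lemma affine_fraction:
  assumes aff: "affine_open X U" and V: "opn X V" "V \<subseteq> U" and t: "t \<in> sec X V" and x: "x \<in> V"
  shows "\<exists>N s b e. opn X N \<and> x \<in> N \<and> N \<subseteq> V \<and> s \<in> sec X U \<and> b \<in> sec X U \<and> e \<in> sec X N \<and>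
    res X U N s * e = const X N 1 \<and> res X U N s * res X V N t = res X U N b"
proof -
  have U: "opn X U" using aff by (simp add: affine_open_def)
  obtain s where s: "s \<in> sec X U" "x \<in> unit_locus X U s" "unit_locus X U s \<subseteq> V"
    using affine_basis[OF aff V x] by (elim bexE conjE)
  let ?D = "unit_locus X U s"
  note D = unit_locus_open[OF U, of s]
  have DU: "?D \<subseteq> U" using s(3) V by auto
  have "res X V ?D t \<in> sec X ?D" using t V D s by simp
  from affine_frac[OF aff s(1) this]
  obtain m b where b: "b \<in> sec X U" "((*) (res X U ?D s) ^^ m) (res X V ?D t) = res X U ?D b"
    by (elim exE bexE)
  obtain V' e where V': "opn X V'" "x \<in> V'" "V' \<subseteq> U" "e \<in> sec X V'" "res X U V' s * e = const X V' 1"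
    using s(2) unfolding unit_locus_def by auto
  let ?N = "V' \<inter> ?D"
  have N: "opn X ?N" "x \<in> ?N" "?N \<subseteq> V" "?N \<subseteq> U" using V' D s by auto
  have "res X V' ?N (res X U V' s * e) = res X V' ?N (const X V' 1)" using V'(5) by simp
  then have u: "res X U ?N s * res X V' ?N e = const X ?N 1"
    using V'(1,3,4) N U s(1) by (simp add: res_mult)
  have pow: "\<exists>s'\<in>sec X U. \<exists>e'\<in>sec X ?N. res X U ?N s' * e' = const X ?N 1 \<and>
      (\<forall>z\<in>sec X ?N. res X U ?N s' * z = ((*) (res X U ?N s) ^^ m) z)"
  proof (induction m)
    case 0
    have "const X ?N 1 * const X ?N 1 = const X ?N 1" using N by simp
    then show ?case using U N by (intro bexI[of _ "const X U 1"] bexI[of _ "const X ?N 1"]) auto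
  next
    case (Suc m)
    then obtain s' e' where s': "s' \<in> sec X U" "e' \<in> sec X ?N" "res X U ?N s' * e' = const X ?N 1"
      "\<And>z. z \<in> sec X ?N \<Longrightarrow> res X U ?N s' * z = ((*) (res X U ?N s) ^^ m) z" by blast
    have eN: "res X V' ?N e \<in> sec X ?N" using V' N by simp
    have "res X U ?N (s * s') * (res X V' ?N e * e') = (res X U ?N s * res X V' ?N e) * (res X U ?N s' * e')"
      using U N(1,4) s(1) s'(1) by (simp add: res_mult mult_ac)
    then have "res X U ?N (s * s') * (res X V' ?N e * e') = const X ?N 1"
      unfolding u s'(3) using N(1) by simp
    moreover have "res X U ?N (s * s') * z = ((*) (res X U ?N s) ^^ Suc m) z" if "z \<in> sec X ?N" for z
      using U N(1,4) s(1) s'(1) s'(4)[OF that] by (simp add: res_mult mult.assoc)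
    moreover have "s * s' \<in> sec X U" "res X V' ?N e * e' \<in> sec X ?N" using s s' eN U N by simp_all
    ultimately show ?case by blast
  qed
  then obtain s' e' where s': "s' \<in> sec X U" "e' \<in> sec X ?N" "res X U ?N s' * e' = const X ?N 1"
      "\<And>z. z \<in> sec X ?N \<Longrightarrow> res X U ?N s' * z = ((*) (res X U ?N s) ^^ m) z" by blast
  have "res X U ?N s' * res X V ?N t = ((*) (res X U ?N s) ^^ m) (res X V ?N t)"
    using s'(4) t V N by simp
  also have "\<dots> = res X ?D ?N (((*) (res X U ?D s) ^^ m) (res X V ?D t))"
    using res_funpow_mult[OF D N(1) Int_lower2, of "res X U ?D s" "res X V ?D t" m] U V s t D N by simp
  also have "\<dots> = res X U ?N b" unfolding b(2) using U D DU N b by simp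
  finally show ?thesis using N s' b(1) by blast
qed

end

lemma fraction_compat:
  fixes s :: "'a::comm_ring"
  assumes "s * t = b" "s' * t = b'" "s * r + t * ds = db" "s' * db + b * ds' = s * db' + b' * ds"
  shows "s * (s' * r + t * ds' - db') = 0"
proof -
  have "s * (s' * r) + s' * t * ds = s' * (s * r + t * ds)" by (simp add: algebra_simps)
  then have "s * (s' * r) = s' * db - b' * ds" unfolding assms(2,3) by (simp add: eq_diff_eq)
  moreover have "s * (t * ds') = b * ds'" unfolding assms(1)[symmetric] by (simp add: mult_ac)
  moreover have "s * (s' * r + t * ds' - db') = s * (s' * r) + s * (t * ds') - s * db'"
    by (simp add: algebra_simps)
  ultimately have "s * (s' * r + t * ds' - db') = (s' * db + b * ds') - (s * db' + b' * ds)" by simp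
  then show ?thesis unfolding assms(4) by simp
qed

lemma fraction_add_mult:
  fixes s :: "'a::comm_ring"
  assumes "s * t = b" "s' * t' = b'" "s * r + t * ds = db" "s' * r' + t' * ds' = db'"
  shows "s * s' * (t + t') = s' * b + s * b'"
    and "s * s' * (r + r') + (t + t') * (ds * s' + s * ds') = (ds' * b + s' * db) + (ds * b' + s * db')"
    and "s * s' * (t * t') = b * b'"
    and "s * s' * (r * t' + t * r') + t * t' * (ds * s' + s * ds') = db * b' + b * db'"
  unfolding assms[symmetric] by (simp_all add: algebra_simps)

locale affine_derivation = krs X for X :: "('x, 'r::comm_ring, 'k::field_char_0) ringed_space" +
  fixes U :: "'x set" and \<delta> :: "'r \<Rightarrow> 'r"
  assumes aff: "affine_open X U" and der_in: "\<And>a. a \<in> sec X U \<Longrightarrow> \<delta> a \<in> sec X U"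
    and der_add: "\<And>a b. a \<in> sec X U \<Longrightarrow> b \<in> sec X U \<Longrightarrow> \<delta> (a + b) = \<delta> a + \<delta> b"
    and der_mult: "\<And>a b. a \<in> sec X U \<Longrightarrow> b \<in> sec X U \<Longrightarrow> \<delta> (a * b) = \<delta> a * b + a * \<delta> b"
    and der_const: "\<And>k. \<delta> (const X U k) = 0"
begin

lemma U: "opn X U" using aff by (simp add: affine_open_def)

lemma der_0: "\<delta> 0 = 0" using der_add[of 0 0] U by simp

lemma der_diff: "a \<in> sec X U \<Longrightarrow> b \<in> sec X U \<Longrightarrow> \<delta> (a - b) = \<delta> a - \<delta> b"
  using der_add[of "a - b" b] U by (simp add: algebra_simps)

lemma der_local:
  assumes N: "opn X N" "N \<subseteq> U" and a: "a \<in> sec X U" "res X U N a = 0" shows "res X U N (\<delta> a) = 0"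
proof (rule O.eqI_local[OF N(1)], goal_cases)
  case x: (3 x)
  obtain s where s: "s \<in> sec X U" "x \<in> unit_locus X U s" "unit_locus X U s \<subseteq> N"
    using affine_basis[OF aff N x] by (elim bexE conjE)
  let ?D = "unit_locus X U s"
  have D: "opn X ?D" "?D \<subseteq> U" using unit_locus_open[OF U] s N by auto
  have aD: "res X U ?D a = 0" using O.res_res[OF U N(1) D(1) s(3) N(2) a(1)] a(2) N D s by simp
  from affine_null[OF aff s(1) a(1) this] obtain m where "((*) s ^^ m) a = 0" by (elim exE)
  then have "res X U ?D (\<delta> a) = 0" using a(1) aD
  proof (induction m arbitrary: a)
    case 0
    then show ?case by (simp add: der_0)
  next
    case (Suc m)
    have "((*) s ^^ m) (s * a) = 0" using Suc.prems(1) by (simp add: funpow_swap1)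
    moreover have "res X U ?D (s * a) = 0" using Suc.prems s U D by (simp add: res_mult)
    ultimately have "res X U ?D (\<delta> (s * a)) = 0" using Suc.IH Suc.prems s U by simp
    then have 0: "res X U ?D s * res X U ?D (\<delta> a) = 0"
      using Suc.prems(2,3) s U D der_in by (simp add: der_mult res_mult O.res_add)
    have "res X U ?D (\<delta> a) \<in> sec X ?D" by (rule O.res_in[OF U D der_in[OF Suc.prems(2)]])
    from unit_locus_cancel[OF U s(1) this 0] show ?case .
  qed
  then show ?case using D s N U a der_in by (intro exI[of _ ?D]) simp
qed (use N U a der_in in auto)

definition quot :: "'x set \<Rightarrow> 'r \<Rightarrow> 'r \<Rightarrow> 'r \<Rightarrow> bool" where
  "quot N t s b \<longleftrightarrow> s \<in> sec X U \<and> b \<in> sec X U \<and> res X U N s * t = res X U N b"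

definition der_eq :: "'x set \<Rightarrow> 'r \<Rightarrow> 'r \<Rightarrow> 'r \<Rightarrow> 'r \<Rightarrow> bool" where
  "der_eq N t r s b \<longleftrightarrow> res X U N s * r + t * res X U N (\<delta> s) = res X U N (\<delta> b)"

definition is_unit :: "'x set \<Rightarrow> 'r \<Rightarrow> bool" where
  "is_unit N s \<longleftrightarrow> (\<exists>e\<in>sec X N. res X U N s * e = const X N 1)"

definition is_der :: "'x set \<Rightarrow> 'r \<Rightarrow> 'r \<Rightarrow> bool" where
  "is_der V t r \<longleftrightarrow> (\<forall>M s b. opn X M \<and> M \<subseteq> V \<and> quot M (res X V M t) s b \<longrightarrow>
     der_eq M (res X V M t) (res X V M r) s b)"

lemma quot_res:
  assumes "opn X N" "N \<subseteq> U" "opn X M" "M \<subseteq> N" "t \<in> sec X N" "quot N t s b"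
  shows "quot M (res X N M t) s b"
proof -
  have s: "s \<in> sec X U" "b \<in> sec X U" "res X U N s * t = res X U N b"
    using assms(6) by (auto simp: quot_def)
  have "res X N M (res X U N s * t) = res X N M (res X U N b)" using s(3) by simp
  then show ?thesis using s(1,2) assms(1-5) U by (simp add: quot_def res_mult)
qed

lemma is_unit_res:
  assumes "opn X N" "N \<subseteq> U" "opn X M" "M \<subseteq> N" "s \<in> sec X U" "is_unit N s" shows "is_unit M s"
proof -
  obtain e where e: "e \<in> sec X N" "res X U N s * e = const X N 1" using assms(6) by (auto simp: is_unit_def)
  have "res X N M (res X U N s * e) = res X N M (const X N 1)" using e(2) by simp
  then have "res X U M s * res X N M e = const X M 1" using e(1) assms(1-5) U by (simp add: res_mult)
  then show ?thesis unfolding is_unit_def using e(1) assms by (intro bexI[of _ "res X N M e"]) simp_all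
qed

lemma is_unitD: "\<lbrakk>is_unit N s; opn X N; z \<in> sec X N; res X U N s * z = 0\<rbrakk> \<Longrightarrow> z = 0"
  unfolding is_unit_def using unit_cancel by blast

lemma fraction:
  assumes "opn X V" "V \<subseteq> U" "t \<in> sec X V" "x \<in> V"
  obtains N s b where "opn X N" "x \<in> N" "N \<subseteq> V" "is_unit N s" "quot N (res X V N t) s b"
proof -
  obtain N s b e where "opn X N \<and> x \<in> N \<and> N \<subseteq> V \<and> s \<in> sec X U \<and> b \<in> sec X U \<and> e \<in> sec X N \<and>
    res X U N s * e = const X N 1 \<and> res X U N s * res X V N t = res X U N b"
    using affine_fraction[OF aff assms] by (elim exE)
  then show ?thesis by (intro that[of N s b]) (auto simp: is_unit_def quot_def)
qed

lemma is_der_res: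
  assumes "opn X V" "V \<subseteq> U" "opn X N" "N \<subseteq> V" "t \<in> sec X V" "r \<in> sec X V" "is_der V t r"
  shows "is_der N (res X V N t) (res X V N r)" unfolding is_der_def
proof (intro allI impI, goal_cases)
  case M: (1 M s b)
  moreover have "res X N M (res X V N t) = res X V M t" "res X N M (res X V N r) = res X V M r"
    using M assms(1-6) by simp_all
  moreover have "M \<subseteq> V" using M assms(4) by blast
  ultimately show ?case using assms(7)[unfolded is_der_def, rule_format, of M s b] by simp
qed

lemma der_eq_transfer:
  assumes N: "opn X N" "N \<subseteq> U" and t: "t \<in> sec X N" and r: "r \<in> sec X N"
    and s: "is_unit N s" "quot N t s b" "der_eq N t r s b" and s': "quot N t s' b'"
  shows "der_eq N t r s' b'"
proof -
  have in_U: "s \<in> sec X U" "b \<in> sec X U" "s' \<in> sec X U" "b' \<in> sec X U"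
    and q: "res X U N s * t = res X U N b" "res X U N s' * t = res X U N b'"
    using s(2) s' by (auto simp: quot_def)
  have "res X U N (s' * b - s * b') = res X U N s' * (res X U N s * t) - res X U N s * (res X U N s' * t)"
    unfolding q using in_U N U by (simp add: res_mult O.res_diff)
  also have "\<dots> = 0" by (simp add: mult_ac)
  finally have "res X U N (\<delta> (s' * b - s * b')) = 0" by (intro der_local[OF N]) (use in_U U in auto)
  then have "res X U N s' * res X U N (\<delta> b) + res X U N b * res X U N (\<delta> s') =
      res X U N s * res X U N (\<delta> b') + res X U N b' * res X U N (\<delta> s)"
    using in_U N U der_in by (simp add: der_diff der_mult res_mult O.res_diff O.res_add algebra_simps)
  note 0 = fraction_compat[OF q s(3)[unfolded der_eq_def] this]
  have "res X U N s' * r + t * res X U N (\<delta> s') - res X U N (\<delta> b') \<in> sec X N"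
    using in_U N U t r der_in by simp
  from is_unitD[OF s(1) N(1) this 0]
  have "res X U N s' * r + t * res X U N (\<delta> s') - res X U N (\<delta> b') = 0" .
  then show ?thesis by (simp add: der_eq_def)
qed

lemma is_derI:
  assumes V: "opn X V" "V \<subseteq> U" and t: "t \<in> sec X V" and r: "r \<in> sec X V"
    and loc: "\<And>x. x \<in> V \<Longrightarrow> \<exists>N s b. opn X N \<and> x \<in> N \<and> N \<subseteq> V \<and> is_unit N s \<and> quot N (res X V N t) s b \<and>
      der_eq N (res X V N t) (res X V N r) s b"
  shows "is_der V t r" unfolding is_der_def
proof (intro allI impI, goal_cases)
  case M: (1 M s b)
  then have MU: "opn X M" "M \<subseteq> U" "M \<subseteq> V" and q: "quot M (res X V M t) s b" using V by auto
  then have sb: "s \<in> sec X U" "b \<in> sec X U" by (auto simp: quot_def)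
  show ?case unfolding der_eq_def
  proof (rule O.eqI_local[OF MU(1)], goal_cases)
    case x: (3 x)
    then obtain N s' b' where N: "opn X N" "x \<in> N" "N \<subseteq> V" and s': "is_unit N s'"
      "quot N (res X V N t) s' b'" "der_eq N (res X V N t) (res X V N r) s' b'"
      using loc[OF subsetD[OF MU(3) x]] by (elim exE conjE)
    let ?L = "M \<inter> N"
    have L: "opn X ?L" "?L \<subseteq> U" "?L \<subseteq> V" "?L \<subseteq> M" "?L \<subseteq> N" "N \<subseteq> U" using N MU V by auto
    have s'U: "s' \<in> sec X U" "b' \<in> sec X U" using s'(2) by (auto simp: quot_def)
    have "res X N ?L (res X U N s' * res X V N r + res X V N t * res X U N (\<delta> s')) = res X N ?L (res X U N (\<delta> b'))"
      using s'(3) by (simp add: der_eq_def)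
    then have d: "der_eq ?L (res X V ?L t) (res X V ?L r) s' b'"
      using L N U V s'U t r der_in by (simp add: der_eq_def res_mult O.res_add)
    have q': "quot ?L (res X V ?L t) s' b'"
      using quot_res[OF N(1) L(6) L(1) L(5) _ s'(2)] t V N L by simp
    have q0: "quot ?L (res X V ?L t) s b" using quot_res[OF MU(1,2) L(1) L(4) _ q] t V MU L by simp
    have "der_eq ?L (res X V ?L t) (res X V ?L r) s b"
      by (rule der_eq_transfer[OF L(1,2) _ _ is_unit_res[OF N(1) L(6) L(1) L(5) s'U(1) s'(1)] q' d q0])
        (use t r V L in auto)
    then have "res X M ?L (res X U M s * res X V M r + res X V M t * res X U M (\<delta> s)) =
        res X M ?L (res X U M (\<delta> b))"
      using L MU U V sb t r der_in by (simp add: der_eq_def res_mult O.res_add)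
    then show ?case using L x N by (intro exI[of _ ?L]) simp
  qed (use MU V U sb t r der_in in auto)
qed

lemma is_der_unique:
  assumes V: "opn X V" "V \<subseteq> U" and t: "t \<in> sec X V" and r: "r \<in> sec X V" "r' \<in> sec X V"
    and d: "is_der V t r" "is_der V t r'"
  shows "r = r'"
proof (rule O.eqI_local[OF V(1) r], goal_cases)
  case x: (1 x)
  obtain N s b where N: "opn X N" "x \<in> N" "N \<subseteq> V" and s: "is_unit N s" "quot N (res X V N t) s b"
    by (rule fraction[OF V t x])
  have sU: "s \<in> sec X U" using s(2) by (simp add: quot_def)
  have e: "der_eq N (res X V N t) (res X V N r) s b" "der_eq N (res X V N t) (res X V N r') s b"
    using d[unfolded is_der_def, rule_format, of N s b] N s by simp_all
  have "res X U N s * res X V N r + res X V N t * res X U N (\<delta> s) =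
      res X U N s * res X V N r' + res X V N t * res X U N (\<delta> s)"
    using e unfolding der_eq_def by (rule trans[OF _ sym])
  then have 0: "res X U N s * (res X V N r - res X V N r') = 0" by (simp add: right_diff_distrib)
  have "res X V N r - res X V N r' \<in> sec X N" using V N r by simp
  from is_unitD[OF s(1) N(1) this 0] have "res X V N r - res X V N r' = 0" .
  then show ?case using N by auto
qed

lemma is_der_exists:
  assumes V: "opn X V" "V \<subseteq> U" and t: "t \<in> sec X V" shows "\<exists>r\<in>sec X V. is_der V t r"
proof -
  have loc: "\<exists>N r. opn X N \<and> x \<in> N \<and> N \<subseteq> V \<and> r \<in> sec X N \<and> is_der N (res X V N t) r" if x: "x \<in> V" for x
  proof -
    obtain N s b where N: "opn X N" "x \<in> N" "N \<subseteq> V" and s: "is_unit N s" "quot N (res X V N t) s b"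
      by (rule fraction[OF V t x])
    have NU: "N \<subseteq> U" using N V by auto
    have sU: "s \<in> sec X U" "b \<in> sec X U" using s(2) by (auto simp: quot_def)
    obtain e where e: "e \<in> sec X N" "res X U N s * e = const X N 1" using s(1) by (auto simp: is_unit_def)
    let ?w = "res X U N (\<delta> b) - res X V N t * res X U N (\<delta> s)"
    have w: "?w \<in> sec X N" using N U V sU t der_in by simp
    have "res X U N s * (e * ?w) = ?w" using w N e by (simp flip: mult.assoc)
    then have "der_eq N (res X V N t) (e * ?w) s b" by (simp add: der_eq_def)
    then have d: "opn X N \<and> y \<in> N \<and> N \<subseteq> N \<and> is_unit N s \<and> quot N (res X N N (res X V N t)) s b \<and>
        der_eq N (res X N N (res X V N t)) (res X N N (e * ?w)) s b" if "y \<in> N" for y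
      using that N V(1) t e(1) w s by simp
    have ew: "e * ?w \<in> sec X N" "res X V N t \<in> sec X N" using N V(1) t e(1) w by simp_all
    have "is_der N (res X V N t) (e * ?w)" by (rule is_derI[OF N(1) NU ew(2,1)]) (intro exI, rule d)
    then show ?thesis using N e w by (intro exI[of _ N] exI[of _ "e * ?w"]) simp
  qed
  have "\<exists>!r. r \<in> sec X V \<and>
    (\<forall>N r'. opn X N \<and> N \<subseteq> V \<and> r' \<in> sec X N \<and> is_der N (res X V N t) r' \<longrightarrow> res X V N r = r')"
  proof (rule O.glue_rel[OF V(1) loc], goal_cases)
    case N: (2 N r N' r')
    let ?L = "N \<inter> N'"
    have L: "opn X ?L" "?L \<subseteq> U" "?L \<subseteq> N" "?L \<subseteq> N'" "N \<subseteq> U" "N' \<subseteq> U" "?L \<subseteq> V" using N V by auto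
    have tN: "res X V N t \<in> sec X N" "res X V N' t \<in> sec X N'" using N V t by simp_all
    have "is_der ?L (res X V ?L t) (res X N ?L r)"
      using is_der_res[OF N(1) L(5) L(1,3) tN(1) N(3,4)] N V t by simp
    moreover have "is_der ?L (res X V ?L t) (res X N' ?L r')"
      using is_der_res[OF N(5) L(6) L(1,4) tN(2) N(7,8)] N V t by simp
    ultimately show ?case by (rule is_der_unique[OF L(1,2), rotated 3]) (use N L V t in auto)
  qed
  from ex1_implies_ex[OF this] obtain r where r0: "r \<in> sec X V \<and>
    (\<forall>N r'. opn X N \<and> N \<subseteq> V \<and> r' \<in> sec X N \<and> is_der N (res X V N t) r' \<longrightarrow> res X V N r = r')"
    by (rule exE)
  note r = r0[THEN conjunct1] r0[THEN conjunct2, rule_format, OF conjI[OF _ conjI[OF _ conjI]]]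
  have "is_der V t r"
  proof (rule is_derI[OF V t r(1)], goal_cases)
    case x: (1 x)
    obtain N r' where N: "opn X N" "x \<in> N" "N \<subseteq> V" "r' \<in> sec X N" "is_der N (res X V N t) r'"
      using loc[OF x] by (elim exE conjE)
    have tN: "res X V N t \<in> sec X N" using N V t by simp
    obtain M s b where M: "opn X M" "x \<in> M" "M \<subseteq> N" and s: "is_unit M s" "quot M (res X N M (res X V N t)) s b"
      by (rule fraction[OF N(1) subset_trans[OF N(3) V(2)] tN N(2)])
    have "der_eq M (res X N M (res X V N t)) (res X N M r') s b"
      using N(5)[unfolded is_der_def, rule_format, of M s b] M s by simp
    moreover have "r' = res X V N r" using r(2)[OF N(1,3,4,5)] by (rule sym)
    ultimately show ?case using M N V t r s by (intro exI[of _ M] exI[of _ s] exI[of _ b]) simp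
  qed
  then show ?thesis by (rule bexI[OF _ r(1)])
qed

definition ext :: "('x, 'r) vfield" where
  "ext V t = (if opn X V \<and> V \<subseteq> U \<and> t \<in> sec X V then SOME r. r \<in> sec X V \<and> is_der V t r else 0)"

lemma ext:
  assumes "opn X V" "V \<subseteq> U" "t \<in> sec X V"
  shows ext_sec: "ext V t \<in> sec X V" and ext_is_der: "is_der V t (ext V t)"
proof -
  have "\<exists>r. r \<in> sec X V \<and> is_der V t r" using is_der_exists[OF assms] by blast
  from someI_ex[OF this] show "ext V t \<in> sec X V" "is_der V t (ext V t)"
    unfolding ext_def if_P[OF conjI[OF assms(1) conjI[OF assms(2,3)]]] by simp_all
qed

lemma ext_eqI:
  assumes V: "opn X V" "V \<subseteq> U" and t: "t \<in> sec X V" and r: "r \<in> sec X V" and d: "is_der V t r"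
  shows "ext V t = r" by (rule is_der_unique[OF V t ext_sec[OF V t] r ext_is_der[OF V t] d])

lemma ext_der_eq:
  assumes "opn X V" "V \<subseteq> U" "t \<in> sec X V" "opn X N" "N \<subseteq> V" "quot N (res X V N t) s b"
  shows "der_eq N (res X V N t) (res X V N (ext V t)) s b"
  using ext_is_der[OF assms(1-3)] assms(4-6) unfolding is_der_def by simp

lemma fraction2:
  assumes V: "opn X V" "V \<subseteq> U" and t: "t \<in> sec X V" "t' \<in> sec X V" and x: "x \<in> V"
  obtains N s b s' b' where "opn X N" "x \<in> N" "N \<subseteq> V" "N \<subseteq> U" "is_unit N (s * s')"
    "quot N (res X V N t) s b" "quot N (res X V N t') s' b'"
    "s \<in> sec X U" "b \<in> sec X U" "s' \<in> sec X U" "b' \<in> sec X U"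
proof -
  obtain N s b where N: "opn X N" "x \<in> N" "N \<subseteq> V" and s: "is_unit N s" "quot N (res X V N t) s b"
    by (rule fraction[OF V t(1) x])
  have NU: "N \<subseteq> U" using N V by auto
  have t'N: "res X V N t' \<in> sec X N" using N V t by simp
  obtain M s' b' where M: "opn X M" "x \<in> M" "M \<subseteq> N" and s': "is_unit M s'"
    "quot M (res X N M (res X V N t')) s' b'" by (rule fraction[OF N(1) NU t'N N(2)])
  have MU: "M \<subseteq> U" "M \<subseteq> V" using M NU N by auto
  have in_U: "s \<in> sec X U" "b \<in> sec X U" "s' \<in> sec X U" "b' \<in> sec X U" using s(2) s'(2) by (auto simp: quot_def)
  obtain e e' where e: "e \<in> sec X M" "res X U M s * e = const X M 1" "e' \<in> sec X M" "res X U M s' * e' = const X M 1"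
    using is_unit_res[OF N(1) NU M(1,3) in_U(1) s(1)] s'(1) by (auto simp: is_unit_def)
  have "res X U M (s * s') * (e * e') = (res X U M s * e) * (res X U M s' * e')"
    using M MU U in_U by (simp add: res_mult mult_ac)
  then have "is_unit M (s * s')" unfolding e(2,4) is_unit_def using e M by (intro bexI[of _ "e * e'"]) simp_all
  moreover have "quot M (res X V M t) s b" using quot_res[OF N(1) NU M(1,3) _ s(2)] V N M t by simp
  moreover have "quot M (res X V M t') s' b'" using s'(2) V N M t by simp
  ultimately show ?thesis using M MU in_U by (intro that[of M s s' b b'])
qed

lemma quot_add_mult:
  assumes N: "opn X N" "N \<subseteq> U" and t: "t \<in> sec X N" "t' \<in> sec X N" "r \<in> sec X N" "r' \<in> sec X N"
    and q: "quot N t s b" "quot N t' s' b'" and d: "der_eq N t r s b" "der_eq N t' r' s' b'"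
  shows "quot N (t + t') (s * s') (s' * b + s * b')"
    and "der_eq N (t + t') (r + r') (s * s') (s' * b + s * b')"
    and "quot N (t * t') (s * s') (b * b')"
    and "der_eq N (t * t') (r * t' + t * r') (s * s') (b * b')"
proof -
  have in_U: "s \<in> sec X U" "b \<in> sec X U" "s' \<in> sec X U" "b' \<in> sec X U" using q by (auto simp: quot_def)
  note frac = fraction_add_mult[OF q[unfolded quot_def, THEN conjunct2, THEN conjunct2] d[unfolded der_eq_def]]
  have push: "res X U N (s * s') = res X U N s * res X U N s'"
    "res X U N (b * b') = res X U N b * res X U N b'"
    "res X U N (s' * b + s * b') = res X U N s' * res X U N b + res X U N s * res X U N b'"
    "res X U N (\<delta> (s * s')) = res X U N (\<delta> s) * res X U N s' + res X U N s * res X U N (\<delta> s')"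
    "res X U N (\<delta> (b * b')) = res X U N (\<delta> b) * res X U N b' + res X U N b * res X U N (\<delta> b')"
    "res X U N (\<delta> (s' * b + s * b')) =
      (res X U N (\<delta> s') * res X U N b + res X U N s' * res X U N (\<delta> b)) +
      (res X U N (\<delta> s) * res X U N b' + res X U N s * res X U N (\<delta> b'))"
    using in_U N U der_in by (simp_all add: der_add der_mult res_mult O.res_add)
  show "quot N (t + t') (s * s') (s' * b + s * b')" "quot N (t * t') (s * s') (b * b')"
    unfolding quot_def push using in_U U frac(1,3) by simp_all
  show "der_eq N (t + t') (r + r') (s * s') (s' * b + s * b')"
    "der_eq N (t * t') (r * t' + t * r') (s * s') (b * b')"
    unfolding der_eq_def push by (rule frac)+
qed

lemma ext_in: "ext \<in> vfs U"
proof (rule tangentI, goal_cases)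
  fix V t assume V: "opn X V" "V \<subseteq> U" and t: "t \<in> sec X V"
  show "ext V t \<in> sec X V" by (rule ext_sec[OF V t])
  fix t' assume t': "t' \<in> sec X V"
  note r = ext_sec[OF V t] ext_sec[OF V t']
  show "ext V (t + t') = ext V t + ext V t'"
  proof (rule ext_eqI[OF V _ _ is_derI[OF V]], goal_cases)
    case (5 x)
    then obtain N s b s' b' where N: "opn X N" "x \<in> N" "N \<subseteq> V" "N \<subseteq> U" "is_unit N (s * s')"
      and q: "quot N (res X V N t) s b" "quot N (res X V N t') s' b'"
      and in_U: "s \<in> sec X U" "b \<in> sec X U" "s' \<in> sec X U" "b' \<in> sec X U"
      by (rule fraction2[OF V t t'])
    note d = ext_der_eq[OF V t N(1,3) q(1)] ext_der_eq[OF V t' N(1,3) q(2)]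
    have in_N: "res X V N t \<in> sec X N" "res X V N t' \<in> sec X N"
      "res X V N (ext V t) \<in> sec X N" "res X V N (ext V t') \<in> sec X N" using V N t t' r by simp_all
    have push: "res X V N (t + t') = res X V N t + res X V N t'"
      "res X V N (ext V t + ext V t') = res X V N (ext V t) + res X V N (ext V t')"
      using V N t t' r by (simp_all add: O.res_add)
    have "opn X N \<and> x \<in> N \<and> N \<subseteq> V \<and> is_unit N (s * s') \<and> quot N (res X V N (t + t')) (s * s') (s' * b + s * b') \<and>
      der_eq N (res X V N (t + t')) (res X V N (ext V t + ext V t')) (s * s') (s' * b + s * b')"
      unfolding push using quot_add_mult(1,2)[OF N(1,4) in_N q d] N by simp
    then show ?case by (intro exI)
  qed (use V t t' r in auto)
  show "ext V (t * t') = ext V t * t' + t * ext V t'"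
  proof (rule ext_eqI[OF V _ _ is_derI[OF V]], goal_cases)
    case (5 x)
    then obtain N s b s' b' where N: "opn X N" "x \<in> N" "N \<subseteq> V" "N \<subseteq> U" "is_unit N (s * s')"
      and q: "quot N (res X V N t) s b" "quot N (res X V N t') s' b'"
      and in_U: "s \<in> sec X U" "b \<in> sec X U" "s' \<in> sec X U" "b' \<in> sec X U"
      by (rule fraction2[OF V t t'])
    note d = ext_der_eq[OF V t N(1,3) q(1)] ext_der_eq[OF V t' N(1,3) q(2)]
    have in_N: "res X V N t \<in> sec X N" "res X V N t' \<in> sec X N"
      "res X V N (ext V t) \<in> sec X N" "res X V N (ext V t') \<in> sec X N" using V N t t' r by simp_all
    have push: "res X V N (t * t') = res X V N t * res X V N t'"
      "res X V N (ext V t * t' + t * ext V t') =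
        res X V N (ext V t) * res X V N t' + res X V N t * res X V N (ext V t')"
      using V N t t' r by (simp_all add: O.res_add res_mult)
    have "opn X N \<and> x \<in> N \<and> N \<subseteq> V \<and> is_unit N (s * s') \<and> quot N (res X V N (t * t')) (s * s') (b * b') \<and>
      der_eq N (res X V N (t * t')) (res X V N (ext V t * t' + t * ext V t')) (s * s') (b * b')"
      unfolding push using quot_add_mult(3,4)[OF N(1,4) in_N q d] N by simp
    then show ?case by (intro exI)
  qed (use V t t' r in auto)
next
  case V: (4 V k)
  have one: "const X V 1 * const X V 1 = const X V 1" using V by simp
  have "is_unit V (const X U 1)" using V U one unfolding is_unit_def by (intro bexI[of _ "const X V 1"]) simp_all
  moreover have "quot V (res X V V (const X V k)) (const X U 1) (const X U k)" using V U by (simp add: quot_def)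
  moreover have "der_eq V (res X V V (const X V k)) (res X V V 0) (const X U 1) (const X U k)"
    using V U by (simp add: der_eq_def der_const)
  ultimately show ?case
    using V by (intro ext_eqI[OF V _ _ is_derI[OF V]] exI[of _ V] exI[of _ "const X U 1"] exI[of _ "const X U k"]) auto
next
  case (5 V N t)
  note V = 5(1-4) and t = 5(5)
  then have "N \<subseteq> U" by auto
  then show ?case using V t ext_sec[OF V(1,2) t] by (intro ext_eqI is_der_res ext_is_der) auto
next
  case (6 V s)
  then show ?case unfolding ext_def by (rule if_not_P)
qed

end

text \<open>The partial derivatives form a frame because of the chain rule for sections over \<open>U\<close>.\<close>

lemma (in krs) affine_frame:
  assumes aff: "affine_open X U" and y: "\<And>i. i < n \<Longrightarrow> y i \<in> sec X U"
    and D: "\<And>i. i < n \<Longrightarrow> affine_derivation X U (D i)"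
    and chain: "\<And>N v b. \<lbrakk>opn X N; N \<subseteq> U; v \<in> vfs N; b \<in> sec X U\<rbrakk> \<Longrightarrow>
      v N (res X U N b) = (\<Sum>i<n. v N (res X U N (y i)) * res X U N (D i b))"
  shows "frame_on X U n y (\<lambda>i. affine_derivation.ext X U (D i))" unfolding frame_on_def
proof (intro conjI allI impI)
  have U: "opn X U" using aff by (simp add: affine_open_def)
  show "opn X U" by (rule U)
  fix V v t
  let ?ext = "\<lambda>i. affine_derivation.ext X U (D i)"
  assume "opn X V \<and> V \<subseteq> U \<and> v \<in> vfs V \<and> t \<in> sec X V"
  then have V: "opn X V" "V \<subseteq> U" and v: "v \<in> vfs V" and t: "t \<in> sec X V" by auto
  have yV: "res X U V (y i) \<in> sec X V" if "i < n" for i using y[OF that] U V by simp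
  have vy: "v V (res X U V (y i)) \<in> sec X V" if "i < n" for i
    by (rule vf_in[OF v V(1) subset_refl yV[OF that]])
  have ext: "?ext i V t \<in> sec X V" if "i < n" for i
    by (rule affine_derivation.ext_sec[OF D[OF that] V t])
  have vyext: "v V (res X U V (y i)) * ?ext i V t \<in> sec X V" if "i < n" for i
    using vy[OF that] ext[OF that] V by simp
  have sum_in: "(\<Sum>i<n. v V (res X U V (y i)) * ?ext i V t) \<in> sec X V"
    by (rule O.sum_in[OF V(1)]) (use vyext in simp)
  show "v V t = (\<Sum>i<n. v V (res X U V (y i)) * ?ext i V t)"
  proof (rule O.eqI_local[OF V(1) vf_in[OF v V(1) subset_refl t] sum_in], goal_cases)
    case x: (1 x)
    obtain N s b e where *: "opn X N \<and> x \<in> N \<and> N \<subseteq> V \<and> s \<in> sec X U \<and> b \<in> sec X U \<and> e \<in> sec X N \<and>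
      res X U N s * e = const X N 1 \<and> res X U N s * res X V N t = res X U N b"
      using affine_fraction[OF aff V t x] by (elim exE)
    then have N: "opn X N" "N \<subseteq> V" and s: "s \<in> sec X U" "b \<in> sec X U" "e \<in> sec X N"
        "res X U N s * e = const X N 1" and q: "res X U N s * res X V N t = res X U N b" by auto
    have NU: "N \<subseteq> U" using N V by auto
    let ?S = "res X U N s" and ?T = "res X V N t" and ?v = "vres V N v"
    have vN: "?v \<in> vfs N" using v N by simp
    have ST: "?S \<in> sec X N" "?T \<in> sec X N" using s t N V U by simp_all
    define w where "w i = ?v N (res X U N (y i))" for i
    define E where "E i = res X V N (?ext i V t)" for i
    have E: "?S * E i = res X U N (D i b) - ?T * res X U N (D i s)" if "i < n" for i
    proof -
      interpret D: affine_derivation X U "D i" by (rule D[OF that])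
      have "D.quot N ?T s b" using q s by (simp add: D.quot_def)
      from D.ext_der_eq[OF V t N this] show ?thesis
        unfolding D.der_eq_def E_def by (simp add: eq_diff_eq)
    qed
    have "?v N (res X U N b) = ?v N ?S * ?T + ?S * ?v N ?T"
      unfolding q[symmetric] by (rule vf_mult[OF vN N(1) subset_refl ST])
    then have "?S * ?v N ?T = ?v N (res X U N b) - ?v N ?S * ?T" by simp
    also have "\<dots> = (\<Sum>i<n. w i * res X U N (D i b)) - (\<Sum>i<n. w i * res X U N (D i s)) * ?T"
      unfolding w_def chain[OF N(1) NU vN s(1)] chain[OF N(1) NU vN s(2)] ..
    also have "\<dots> = (\<Sum>i<n. w i * (?S * E i))"
    proof -
      have "w i * (?S * E i) = w i * res X U N (D i b) - w i * res X U N (D i s) * ?T" if "i < n" for i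
        unfolding E[OF that] by (simp add: right_diff_distrib mult_ac)
      then show ?thesis by (simp add: sum_subtractf sum_distrib_right)
    qed
    also have "\<dots> = ?S * (\<Sum>i<n. w i * E i)" by (simp add: sum_distrib_left mult_ac)
    finally have *: "?S * (?v N ?T - (\<Sum>i<n. w i * E i)) = 0" by (simp add: right_diff_distrib)
    have w_in: "w i \<in> sec X N" if "i < n" for i
      unfolding w_def using y[OF that] U N NU by (intro vf_in[OF vN N(1) subset_refl]) simp
    have E_in: "E i \<in> sec X N" if "i < n" for i unfolding E_def using ext[OF that] V N by simp
    have "(\<Sum>i<n. w i * E i) \<in> sec X N" by (rule O.sum_in[OF N(1)]) (use w_in E_in N in simp)
    then have "?v N ?T - (\<Sum>i<n. w i * E i) \<in> sec X N"
      using vf_in[OF vN N(1) subset_refl ST(2)] N by simp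
    from unit_cancel[OF N(1) s(4) this *] have eq: "?v N ?T = (\<Sum>i<n. w i * E i)" by simp
    have w_res: "res X V N (v V (res X U V (y i))) = w i" if "i < n" for i
      unfolding w_def using vf_res[OF v V(1) subset_refl N yV[OF that]] y[OF that] U V N by simp
    have "res X V N (\<Sum>i<n. v V (res X U V (y i)) * ?ext i V t) =
        (\<Sum>i<n. res X V N (v V (res X U V (y i)) * ?ext i V t))"
      by (rule O.res_sum[OF V(1) N]) (use vyext in simp)
    also have "\<dots> = (\<Sum>i<n. w i * E i)"
    proof (rule sum.cong[OF refl], goal_cases)
      case (1 i)
      then have i: "i < n" by simp
      show ?case using res_mult[OF V(1) N vy[OF i] ext[OF i]] unfolding w_res[OF i] E_def .
    qed
    also have "\<dots> = res X V N (v V t)"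
      unfolding eq[symmetric] using vf_res[OF v V(1) subset_refl N t] by simp
    finally show ?case using * \<open>opn X N \<and> x \<in> N \<and> _\<close> by (intro exI[of _ N]) simp
  qed
qed (simp_all add: y affine_derivation.ext_in[OF D])

lemma mpolys_closed: "p \<in> mpolys n \<Longrightarrow> q \<in> mpolys n \<Longrightarrow> p + q \<in> mpolys n"
  "p \<in> mpolys n \<Longrightarrow> q \<in> mpolys n \<Longrightarrow> p - q \<in> mpolys n"
  "p \<in> mpolys n \<Longrightarrow> q \<in> mpolys n \<Longrightarrow> p * q \<in> mpolys n"
  "Poly_Mapping.single 0 a \<in> mpolys n"
proof -
  assume p: "p \<in> mpolys n" and q: "q \<in> mpolys n"
  show "p + q \<in> mpolys n" using p q Poly_Mapping.keys_add[of p q] unfolding mpolys_def by blast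
  show "p - q \<in> mpolys n" using p q Poly_Mapping.keys_diff[of p q] unfolding mpolys_def by blast
  show "p * q \<in> mpolys n" unfolding mpolys_def
  proof (intro CollectI ballI, goal_cases)
    case (1 m)
    then obtain k l where m: "m = k + l" "k \<in> Poly_Mapping.keys p" "l \<in> Poly_Mapping.keys q"
      using keys_mult[of p q] by auto
    then have "Poly_Mapping.keys k \<subseteq> {..<n}" "Poly_Mapping.keys l \<subseteq> {..<n}"
      using p q by (auto simp: mpolys_def)
    then show ?case unfolding m(1) using Poly_Mapping.keys_add[of k l] by blast
  qed
qed (simp add: mpolys_def)

text \<open>
  A standard smooth affine open set.  The partial derivatives with respect to the last \<open>n - c\<close>
  coordinates extend to derivations by solving for the first \<open>c\<close> components with the inverse
  Jacobian; those with respect to the first \<open>c\<close> coordinates become zero.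
\<close>

locale std_smooth = sections X U n y
  for X :: "('x, 'r::comm_ring, 'k::field_char_0) ringed_space" and U n y +
  fixes c :: nat and f :: "nat \<Rightarrow> 'k mpoly"
  assumes aff: "affine_open X U" and c: "c \<le> n" and f: "\<And>j. j < c \<Longrightarrow> f j \<in> mpolys n"
    and gen: "mpoly_eval X U n y ` mpolys n = sec X U"
    and rel: "\<And>p. p \<in> mpolys n \<Longrightarrow> mpoly_eval X U n y p = 0 \<longleftrightarrow>
           (\<exists>g. (\<forall>j<c. g j \<in> mpolys n) \<and> p = (\<Sum>j<c. g j * f j))"
    and unit: "mpoly_eval X U n y
          (\<Sum>\<pi> | \<pi> permutes {..<c}. of_int (sign \<pi>) * (\<Prod>j<c. mpoly_pderiv (\<pi> j) (f j)))
          \<in> Units (section_ring X U)"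
begin

lemma ev_f: "j < c \<Longrightarrow> ev (f j) = 0"
proof -
  assume j: "j < c"
  have "(\<Sum>i<c. (if i = j then 1 else 0) * f i) = (\<Sum>i<c. if i = j then f i else 0)"
    by (intro sum.cong) auto
  also have "\<dots> = f j" using j by simp
  finally have "\<exists>g. (\<forall>i<c. g i \<in> mpolys n) \<and> f j = (\<Sum>i<c. g i * f i)"
    using mpolys_closed(4)[of "0::'k" n] mpolys_closed(4)[of "1::'k" n]
    by (intro exI[of _ "\<lambda>i. if i = j then 1 else 0"]) simp
  then show ?thesis using rel[OF f[OF j]] by simp
qed

definition der :: "(nat \<Rightarrow> 'r) \<Rightarrow> 'k mpoly \<Rightarrow> 'r" where "der a p = (\<Sum>l<n. ev (mpoly_pderiv l p) * a l)"

lemma der_add: "der a (p + q) = der a p + der a q"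
  by (simp add: der_def mpoly_pderiv_add ev_add distrib_right sum.distrib)

lemma der_mult: "der a (p * q) = der a p * ev q + ev p * der a q"
proof -
  have "ev (mpoly_pderiv l (p * q)) * a l =
      ev (mpoly_pderiv l p) * a l * ev q + ev p * (ev (mpoly_pderiv l q) * a l)" for l
    by (simp add: mpoly_pderiv_mult ev_add ev_mult algebra_simps)
  then show ?thesis by (simp only: der_def sum.distrib sum_distrib_left sum_distrib_right)
qed

lemma der_sum: "der a (\<Sum>j\<in>J. p j) = (\<Sum>j\<in>J. der a (p j))"
  by (induction J rule: infinite_finite_induct) (simp_all add: der_add, simp_all add: der_def)

lemma der_const: "der a (Poly_Mapping.single 0 k) = 0" by (simp add: der_def mpoly_pderiv_single)

lemma derivation_exists:
  assumes a: "\<And>l. l < n \<Longrightarrow> a l \<in> sec X U" and key: "\<And>j. j < c \<Longrightarrow> der a (f j) = 0"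
  shows "\<exists>D. affine_derivation X U D \<and> (\<forall>p\<in>mpolys n. D (ev p) = der a p)"
proof -
  have der_0: "der a p = 0" if p: "p \<in> mpolys n" "ev p = 0" for p
  proof -
    obtain g where "p = (\<Sum>j<c. g j * f j)" using rel[OF p(1)] p(2) by blast
    then show ?thesis by (simp add: der_sum der_mult ev_f key)
  qed
  define D where "D b = der a (SOME p. p \<in> mpolys n \<and> ev p = b)" for b
  have D: "D (ev p) = der a p" if p: "p \<in> mpolys n" for p
  proof -
    let ?q = "SOME q. q \<in> mpolys n \<and> ev q = ev p"
    have q: "?q \<in> mpolys n \<and> ev ?q = ev p" by (rule someI[of _ p]) (use p in simp)
    have "der a (p - ?q) = 0"
      by (rule der_0[OF mpolys_closed(2)[OF p q[THEN conjunct1]]]) (use q in \<open>simp add: ev_diff\<close>)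
    then have "der a p = der a ?q" using der_add[of a "p - ?q" ?q] by simp
    then show ?thesis by (simp add: D_def)
  qed
  have rep: "\<exists>p\<in>mpolys n. b = ev p" if "b \<in> sec X U" for b using that gen by blast
  have "affine_derivation X U D"
  proof
    fix b b' assume b: "b \<in> sec X U"
    then obtain p where p: "p \<in> mpolys n" "b = ev p" using rep by blast
    show "D b \<in> sec X U" unfolding p(2) D[OF p(1)] der_def
      by (rule O.sum_in[OF U]) (use a ev_in U in simp)
    assume "b' \<in> sec X U"
    then obtain p' where p': "p' \<in> mpolys n" "b' = ev p'" using rep by blast
    show "D (b + b') = D b + D b'"
      using D[OF mpolys_closed(1)[OF p(1) p'(1)]] D[OF p(1)] D[OF p'(1)] by (simp add: p p' ev_add der_add)
    show "D (b * b') = D b * b' + b * D b'"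
      using D[OF mpolys_closed(3)[OF p(1) p'(1)]] D[OF p(1)] D[OF p'(1)] by (simp add: p p' ev_mult der_mult)
  next
    fix k show "D (const X U k) = 0" using D[OF mpolys_closed(4)] by (simp add: ev_const der_const)
  qed (rule aff)
  then show ?thesis using D by blast
qed

definition jac :: "'k mpoly mat" where "jac = mat c c (\<lambda>(j, l). mpoly_pderiv l (f j))"

lemma jac_inverse: "\<exists>B. (\<forall>l j. B l j \<in> sec X U) \<and> (\<forall>j<c. \<forall>j'<c.
      (\<Sum>l<c. ev (mpoly_pderiv l (f j)) * B l j') = (if j = j' then const X U 1 else 0))"
proof -
  have jac: "jac \<in> carrier_mat c c" by (simp add: jac_def)
  have "Determinant.det jac =
      (\<Sum>\<pi> | \<pi> permutes {..<c}. of_int (sign \<pi>) * (\<Prod>j<c. mpoly_pderiv (\<pi> j) (f j)))"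
    unfolding Determinant.det_def'[OF jac] lessThan_atLeast0[symmetric]
    by (intro sum.cong refl arg_cong2[where f = "(*)"] prod.cong)
      (auto simp: jac_def permutes_in_image[where S = "{..<c}", simplified])
  then obtain \<epsilon> where \<epsilon>: "\<epsilon> \<in> sec X U" "ev (Determinant.det jac) * \<epsilon> = const X U 1"
    using unit by (auto simp: Units_def section_ring_def)
  define B where "B l j = \<epsilon> * ev (adj_mat jac $$ (l, j))" for l j
  have "(\<Sum>l<c. ev (mpoly_pderiv l (f j)) * B l j') = (if j = j' then const X U 1 else 0)"
    if j: "j < c" "j' < c" for j j'
  proof -
    have "(\<Sum>l<c. mpoly_pderiv l (f j) * adj_mat jac $$ (l, j')) = (jac * adj_mat jac) $$ (j, j')"
      using j adj_mat(1)[OF jac] by (simp add: scalar_prod_def lessThan_atLeast0 jac_def)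
    also have "\<dots> = (if j = j' then Determinant.det jac else 0)"
      unfolding adj_mat(2)[OF jac] using j by simp
    finally have "(\<Sum>l<c. ev (mpoly_pderiv l (f j)) * ev (adj_mat jac $$ (l, j'))) =
        ev (if j = j' then Determinant.det jac else 0)" by (simp flip: ev_mult ev_sum)
    then have "\<epsilon> * (\<Sum>l<c. ev (mpoly_pderiv l (f j)) * ev (adj_mat jac $$ (l, j'))) =
        (if j = j' then const X U 1 else 0)" using \<epsilon>(2) by (simp add: mult.commute)
    then show ?thesis by (simp add: B_def sum_distrib_left mult_ac)
  qed
  then show ?thesis using \<epsilon>(1) ev_in U by (intro exI[of _ B]) (simp add: B_def)
qed

theorem frame: "\<exists>d. frame_on X U n y d"
proof -
  obtain B where B0: "(\<forall>l j. B l j \<in> sec X U) \<and> (\<forall>j<c. \<forall>j'<c.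
      (\<Sum>l<c. ev (mpoly_pderiv l (f j)) * B l j') = (if j = j' then const X U 1 else 0))"
    using jac_inverse by (rule exE)
  note B = B0[THEN conjunct1, rule_format] and inv = B0[THEN conjunct2, rule_format]
  define G where "G i l = (\<Sum>j<c. B l j * ev (mpoly_pderiv i (f j)))" for i l
  define a where "a i l = (if l = i then const X U 1 else 0) - (if l < c then G i l else 0)" for i l
  have G: "G i l \<in> sec X U" for i l unfolding G_def by (rule O.sum_in[OF U]) (use B ev_in U in simp)
  have a: "a i l \<in> sec X U" for i l using G U by (simp add: a_def)
  have restrict: "(\<Sum>l<n. if l < c then h l else 0) = (\<Sum>l<c. h l)" for h :: "nat \<Rightarrow> 'r"
    using c by (intro sum.mono_neutral_cong_right) auto
  have key: "der (a i) (f j) = 0" if i: "i < n" and j: "j < c" for i j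
  proof -
    have "der (a i) (f j) = (\<Sum>l<n. if l = i then ev (mpoly_pderiv l (f j)) * const X U 1 else 0) -
        (\<Sum>l<n. if l < c then ev (mpoly_pderiv l (f j)) * G i l else 0)"
      unfolding der_def a_def sum_subtractf[symmetric]
      by (intro sum.cong refl) (simp add: right_diff_distrib)
    also have "(\<Sum>l<n. if l = i then ev (mpoly_pderiv l (f j)) * const X U 1 else 0) = ev (mpoly_pderiv i (f j))"
      using i ev_in U by (simp add: mult.commute[of _ "const X U 1"])
    also have "(\<Sum>l<n. if l < c then ev (mpoly_pderiv l (f j)) * G i l else 0) =
        (\<Sum>l<c. \<Sum>j'<c. ev (mpoly_pderiv l (f j)) * B l j' * ev (mpoly_pderiv i (f j')))"
      unfolding restrict G_def by (simp add: sum_distrib_left mult_ac)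
    also have "\<dots> = (\<Sum>j'<c. (\<Sum>l<c. ev (mpoly_pderiv l (f j)) * B l j') * ev (mpoly_pderiv i (f j')))"
      by (subst sum.swap) (simp add: sum_distrib_right)
    also have "\<dots> = (\<Sum>j'<c. if j' = j then ev (mpoly_pderiv i (f j')) else 0)"
      using j ev_in U by (intro sum.cong refl) (simp add: inv)
    also have "\<dots> = ev (mpoly_pderiv i (f j))" using j by simp
    finally show ?thesis by simp
  qed
  have "\<forall>i\<in>{..<n}. \<exists>D. affine_derivation X U D \<and> (\<forall>p\<in>mpolys n. D (ev p) = der (a i) p)"
    by (intro ballI derivation_exists a key) simp_all
  from bchoice[OF this] obtain D where D0: "\<forall>i\<in>{..<n}. affine_derivation X U (D i) \<and>
      (\<forall>p\<in>mpolys n. D i (ev p) = der (a i) p)" by (rule exE)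
  have D: "affine_derivation X U (D i)" "p \<in> mpolys n \<Longrightarrow> D i (ev p) = der (a i) p" if "i < n" for i p
    using bspec[OF D0, of i] that by simp_all
  have chain: "v N (res X U N b) = (\<Sum>i<n. v N (res X U N (y i)) * res X U N (D i b))"
    if N: "opn X N" "N \<subseteq> U" and v: "v \<in> vfs N" and b: "b \<in> sec X U" for N v b
  proof -
    let ?r = "res X U N"
    define w where "w i = v N (?r (y i))" for i
    have w_in: "w i \<in> sec X N" if "i < n" for i
      unfolding w_def using y[OF that] U N by (intro vf_in[OF v N(1) subset_refl]) simp
    have vev: "v N (?r (ev p)) = (\<Sum>l<n. ?r (ev (mpoly_pderiv l p)) * w l)" if p: "p \<in> mpolys n" for p
      unfolding w_def
    proof (rule ev_derivation[where D = "\<lambda>a. v N (?r a)", OF N _ _ _ _ p])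
      fix a b assume ab: "a \<in> sec X U" "b \<in> sec X U"
      have rab: "?r a \<in> sec X N" "?r b \<in> sec X N" using ab N U by simp_all
      show "v N (?r a) \<in> sec X N" by (rule vf_in[OF v N(1) subset_refl rab(1)])
      show "v N (?r (a + b)) = v N (?r a) + v N (?r b)"
        using vf_add[OF v N(1) subset_refl rab] ab N U by (simp add: O.res_add)
      show "v N (?r (a * b)) = v N (?r a) * ?r b + ?r a * v N (?r b)"
        using vf_mult[OF v N(1) subset_refl rab] ab N U by (simp add: res_mult)
    next
      fix k show "v N (?r (const X U k)) = 0" using vf_const[OF v N(1) subset_refl] N U by simp
    qed
    have rel0: "(\<Sum>l<n. ?r (ev (mpoly_pderiv l (f j))) * w l) = 0" if "j < c" for j
      using vev[OF f[OF that]] ev_f[OF that] N U v by simp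
    have wa: "(\<Sum>i<n. w i * ?r (a i l)) = w l" if l: "l < n" for l
    proof -
      have rG: "?r (G i l) = (\<Sum>j<c. ?r (B l j) * ?r (ev (mpoly_pderiv i (f j))))" for i
        unfolding G_def using B ev_in U N by (subst O.res_sum) (simp_all add: res_mult)
      have "(\<Sum>i<n. w i * ?r (G i l)) = (\<Sum>j<c. ?r (B l j) * (\<Sum>i<n. ?r (ev (mpoly_pderiv i (f j))) * w i))"
        unfolding rG sum_distrib_left by (subst sum.swap) (simp add: mult_ac)
      also have "\<dots> = 0" by (simp add: rel0)
      finally have 0: "(\<Sum>i<n. w i * ?r (G i l)) = 0" .
      have "w i * ?r (a i l) = (if i = l then w i else 0) - (if l < c then w i * ?r (G i l) else 0)" if "i < n" for i
        using w_in[OF that] G U N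
        by (auto simp: a_def O.res_diff O.res_uminus right_diff_distrib mult.commute[of _ "const X N 1"])
      then have "(\<Sum>i<n. w i * ?r (a i l)) =
          (\<Sum>i<n. (if i = l then w i else 0) - (if l < c then w i * ?r (G i l) else 0))"
        by (intro sum.cong) auto
      also have "\<dots> = w l - (if l < c then \<Sum>i<n. w i * ?r (G i l) else 0)"
        using l by (simp add: sum_subtractf)
      finally show ?thesis unfolding 0 by simp
    qed
    obtain p where p: "p \<in> mpolys n" "b = ev p" using gen b by blast
    have "(\<Sum>i<n. w i * ?r (D i b)) = (\<Sum>i<n. w i * (\<Sum>l<n. ?r (ev (mpoly_pderiv l p)) * ?r (a i l)))"
    proof (intro sum.cong refl arg_cong2[where f = "(*)"], goal_cases)
      case (1 i)
      then have "D i b = (\<Sum>l<n. ev (mpoly_pderiv l p) * a i l)" using D(2)[OF _ p(1), of i] by (simp add: p(2) der_def)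
      then show ?case using a ev_in U N by (simp add: O.res_sum res_mult)
    qed
    also have "\<dots> = (\<Sum>l<n. ?r (ev (mpoly_pderiv l p)) * (\<Sum>i<n. w i * ?r (a i l)))"
      unfolding sum_distrib_left by (subst sum.swap) (simp add: mult_ac)
    also have "\<dots> = v N (?r b)" unfolding p(2) vev[OF p(1)] by (simp add: wa)
    finally show ?thesis by (simp add: w_def)
  qed
  show ?thesis by (rule exI, rule affine_frame[where D = D, OF aff]) (fact y D(1) chain)+
qed

end

theorem smooth_variety_framed:
  fixes X :: "('x, 'r::comm_ring, 'k::field_char_0) ringed_space"
  assumes "smooth_variety X" shows "locally_framed X" unfolding locally_framed_def
proof
  have krs: "k_ringed_space X" using assms unfolding smooth_variety_def by (rule conjunct1)
  fix x assume x: "x \<in> pts X"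
  obtain U where A: "affine_open X U" "x \<in> U" "standard_smooth X U"
    using assms[unfolded smooth_variety_def, THEN conjunct2, THEN conjunct2, THEN conjunct1, THEN bspec, OF x]
    by (elim exE conjE)
  obtain n c and y :: "nat \<Rightarrow> 'r" and f :: "nat \<Rightarrow> 'k mpoly" where std:
        "c \<le> n" "\<forall>i<n. y i \<in> sec X U" "\<forall>j<c. f j \<in> mpolys n"
        "mpoly_eval X U n y ` mpolys n = sec X U"
        "\<forall>p\<in>mpolys n. mpoly_eval X U n y p = 0 \<longleftrightarrow>
           (\<exists>g. (\<forall>j<c. g j \<in> mpolys n) \<and> p = (\<Sum>j<c. g j * f j))"
        "mpoly_eval X U n y
          (\<Sum>\<pi> | \<pi> permutes {..<c}. of_int (sign \<pi>) * (\<Prod>j<c. mpoly_pderiv (\<pi> j) (f j)))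
          \<in> Units (section_ring X U)" using A(3) unfolding standard_smooth_def by (elim exE conjE)
  interpret std_smooth X U n y c f
  proof
    show "opn X U" using A(1) by (simp add: affine_open_def)
  qed (use krs A(1) std in \<open>simp_all\<close>)
  show "\<exists>U n f d. x \<in> U \<and> frame_on X U n f d" using frame A(2) by blast
qed

theorem corollary6p6:
  fixes X :: "('x, 'r::comm_ring, 'k::field_char_0) ringed_space"
    and Y :: "('x, 's::comm_ring, 'k) ringed_space"
    and \<rho> :: "'x set \<Rightarrow> 'r \<Rightarrow> 's"
    and E :: "('x, 'r, 'e::ab_group_add) courant"
    and P :: "('x, 's, 'p::ab_group_add) msheaf"
    and p :: "'x set \<Rightarrow> 'e \<Rightarrow> 'p"
    and Q :: "('x, 's, 'q::ab_group_add) courant"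
    and q :: "'x set \<Rightarrow> 'p \<Rightarrow> 'q"
  assumes "manifold X" and "closed_submanifold X Y \<rho>" and "exact_courant X E"
    and "is_pullback X Y \<rho> E P p"
    and "is_courant_pullback X Y \<rho> E P p Q q"
  shows "bij_betw (gtb_of_trivialization X Y \<rho> E P p q)
           (courant_trivializations Y Q) (generalized_tangent_bundles X Y \<rho> E P p) \<and>
         is_torsor (closed_two_forms Y) (courant_trivializations Y Q) (gauge_action Y) \<and>
         is_torsor (closed_two_forms Y) (generalized_tangent_bundles X Y \<rho> E P p)
           (shear X Y \<rho> E P p) \<and>
         (\<forall>B\<in>closed_two_forms Y. \<forall>\<Phi>\<in>courant_trivializations Y Q.
            gtb_of_trivialization X Y \<rho> E P p q (gauge_action Y B \<Phi>) =
              shear X Y \<rho> E P p B (gtb_of_trivialization X Y \<rho> E P p q \<Phi>))"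
proof -
  note sub = assms(2)[unfolded closed_submanifold_def]
  have "k_ringed_space X \<and> k_ringed_space Y \<and> locally_framed X \<and> locally_framed Y"
    using sub[THEN conjunct2]
  proof (elim disjE exE conjE)
    fix \<phi> :: "'k \<Rightarrow> real" assume m: "field_iso \<phi>" "chart_manifold \<phi> X" "chart_manifold \<phi> Y"
    then show ?thesis
      using chart_manifold_framed[OF m(1,2)] chart_manifold_framed[OF m(1,3)] by (simp add: chart_manifold_def)
  next
    fix \<phi> :: "'k \<Rightarrow> complex" assume m: "field_iso \<phi>" "chart_manifold \<phi> X" "chart_manifold \<phi> Y"
    then show ?thesis
      using chart_manifold_framed[OF m(1,2)] chart_manifold_framed[OF m(1,3)] by (simp add: chart_manifold_def)
  next
    assume m: "smooth_variety X" "smooth_variety Y"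
    then show ?thesis
      using smooth_variety_framed[OF m(1)] smooth_variety_framed[OF m(2)] by (simp add: smooth_variety_def)
  qed
  then interpret restricted X Y \<rho> E P p Q q
    using sub[THEN conjunct1] assms(3-5) assms(4)[unfolded is_pullback_def, THEN conjunct1]
    by unfold_locales simp_all
  show ?thesis using correspondence torsors equivariant by simp
qed

end
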